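(* Assume that: (i) $\mathcal{M}\neq\emptyset$; (ii) $U$ satisfies the Inada conditions $\lim_{x\to 0+}U'(x)=\infty$ and $\lim_{x\to\infty}U'(x)=0$; (iii) $|f|\le X'_T$ for some non-negative wealth process $X'$; (iv) for every non-zero $q\in\mathbb{R}^n$ the random variable $qf$ is not replicable; (v) $\tilde{w}(y)<\infty$ for all $y>0$. Let $(x,q)\in\{u>-\infty\}$ be non-zero and belong to the boundary of the set $\{u>-\infty\}\subseteq\mathbb{R}^{n+1}$, and let $p_0\in\mathcal{P}(x,q;U)$. Then there exists an arbitrage price $p\in\mathbb{R}^n\setminus\mathcal{P}$ such that $[p_0,p)\subseteq\mathcal{P}(x,q;U)$, where $[p_0,p)$ denotes the segment from $p_0$ to $p$, excluding $p$.
   Context: Market. Fix $T\in(0,\infty)$ and a filtered probability space $(\Omega,\mathcal{F},(\mathcal{F}_t)_{t\in[0,T]},P)$ satisfying the usual conditions. The market consists of a savings account with zero interest rate and $d$ stocks whose price $S=(S^i)_{i=1}^d$ is a locally bounded semimartingale. A wealth process is a process $X_t=x+\int_0^t H_u\,dS_u$, $t\in[0,T]$, with $x\in\mathbb{R}$ and $H$ predictable and $S$-integrable. $\mathcal{X}(x)$ is the set of non-negative wealth processes with initial value $x\ge 0$. $\mathcal{M}$ is the set of equivalent local martingale measures for $S$. A process $X\in\mathcal{X}(x)$ is maximal if its terminal value cannot be dominated by that of any other process in $\mathcal{X}(x)$. A wealth process $X$ is acceptable if $X=X'-X''$ with $X'$ a non-negative wealth process and $X''$ a maximal wealth process; it is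 workable if both $X$ and $-X$ are acceptable. A random variable $g$ is replicable if $g=X_T$ for some workable $X$. Claims and utility. $f=(f_j)_{j=1}^n$ is the ($\mathbb{R}^n$-valued, $\mathcal{F}_T$-measurable) payoff of $n$ contingent claims and $|f|$ is its Euclidean norm; $vw$ denotes the dot product of vectors. $U:(0,\infty)\to\mathbb{R}$ is strictly concave, strictly increasing and continuously differentiable, extended to $\mathbb{R}$ by $U(0)=\lim_{x\to0+}U(x)$ and $U(x)=-\infty$ for $x<0$. For $(x,q)\in\mathbb{R}\times\mathbb{R}^n$, $$\mathcal{X}(x,q)=\{X:\ X\text{ acceptable},\ X_0=x,\ X_T+qf\ge0\},$$ $$u(x,q)=\sup\{\mathbb{E}[U(X_T+qf)]:\ X\text{ acceptable},\ X_0=x\},$$ where $\mathbb{E}[U(X_T+qf)]:=-\infty$ whenever the expectation of the negative part of $U(X_T+qf)$ is infinite (irrespective of the positive part). Dual value function. $V(y)=\sup_{x\in\mathbb{R}}(U(x)-xy)$; $\mathcal{Y}(y)$ is the set of processes $Y\ge0$ with $Y_0=y$ such that $XY$ is a supermartingale for all $X\in\mathcal{X}(1)$; $\tilde{w}(y)=\inf_{Y\in\mathcal{Y}(y)}\mathbb{E}[V(Y_T)]$. Prices. The set of arbitrage-free prices is $$\mathcal{P}=\{p\in\mathbb{R}^n:\ q\in\mathbb{R}^n,\ X\in\mathcal{X}(-pq,q)\ \text{imply}\ X_T=-qf\}.$$ For $(x,q)$ with $u(x,q)\in\mathbb{R}$, the set of marginal (utility-based) prices at $(x,q)$ relative to $U$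 is $$\mathcal{P}(x,q;U)=\{p\in\mathbb{R}^n:\ u(x-q'p,q+q')\le u(x,q)\ \text{for all }q'\in\mathbb{R}^n\}.$$ *)

theory Defs
  imports "HOL-Probability.Probability"
begin

text \<open>Conventions.  A process is a function of time and scenario; only its values at times in
  \<open>{0..T}\<close> and at points of \<open>space P\<close> matter.  Path properties and identities between processes
  are required outside a null set.  A filtration is a family \<open>F\<close> of which only the members
  \<open>F t\<close> with \<open>0 \<le> t \<le> T\<close> matter.\<close>

type_synonym ('a, 'b) process = "real \<Rightarrow> 'a \<Rightarrow> 'b"


section \<open>Filtrations, martingales and semimartingales\<close>

text \<open>The library's filtrations and stopping times are indexed by a whole type.\<close>

definition clamp_filtration :: "real \<Rightarrow> (real \<Rightarrow> 'a measure) \<Rightarrow> real \<Rightarrow> 'a measure" where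
  "clamp_filtration T F t = F (max 0 (min t T))"

definition usual_conditions :: "'a measure \<Rightarrow> (real \<Rightarrow> 'a measure) \<Rightarrow> real \<Rightarrow> bool" where
  "usual_conditions P F T \<longleftrightarrow>
     filtration (space P) (clamp_filtration T F) \<and>
     (\<forall>t\<in>{0..T}. subalgebra P (F t)) \<and>
     complete_measure P \<and> null_sets P \<subseteq> sets (F 0) \<and>
     (\<forall>t\<in>{0..<T}. sets (F t) = (\<Inter>s\<in>{t<..T}. sets (F s)))"

definition adapted :: "(real \<Rightarrow> 'a measure) \<Rightarrow> real \<Rightarrow> ('a, 'b::topological_space) process \<Rightarrow> bool" where
  "adapted F T X \<longleftrightarrow> (\<forall>t\<in>{0..T}. X t \<in> borel_measurable (F t))"

definition cadlag_on :: "real \<Rightarrow> (real \<Rightarrow> 'b::topological_space) \<Rightarrow> bool" where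
  "cadlag_on T x \<longleftrightarrow>
     (\<forall>t\<in>{0..<T}. (x \<longlongrightarrow> x t) (at_right t)) \<and>
     (\<forall>t\<in>{0<..T}. \<exists>l. (x \<longlongrightarrow> l) (at_left t))"

definition adapted_cadlag ::
  "'a measure \<Rightarrow> (real \<Rightarrow> 'a measure) \<Rightarrow> real \<Rightarrow> ('a, 'b::topological_space) process \<Rightarrow> bool" where
  "adapted_cadlag P F T X \<longleftrightarrow> adapted F T X \<and> (AE \<omega> in P. cadlag_on T (\<lambda>t. X t \<omega>))"

definition martingale ::
  "'a measure \<Rightarrow> (real \<Rightarrow> 'a measure) \<Rightarrow> real \<Rightarrow> ('a, real) process \<Rightarrow> bool" where
  "martingale Q F T X \<longleftrightarrow>
     adapted F T X \<and> (\<forall>t\<in>{0..T}. integrable Q (X t)) \<and>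
     (\<forall>s t. 0 \<le> s \<and> s \<le> t \<and> t \<le> T \<longrightarrow> (AE \<omega> in Q. real_cond_exp Q (F s) (X t) \<omega> = X s \<omega>))"

definition supermartingale ::
  "'a measure \<Rightarrow> (real \<Rightarrow> 'a measure) \<Rightarrow> real \<Rightarrow> ('a, real) process \<Rightarrow> bool" where
  "supermartingale Q F T X \<longleftrightarrow>
     adapted F T X \<and> (\<forall>t\<in>{0..T}. integrable Q (X t)) \<and>
     (\<forall>s t. 0 \<le> s \<and> s \<le> t \<and> t \<le> T \<longrightarrow> (AE \<omega> in Q. real_cond_exp Q (F s) (X t) \<omega> \<le> X s \<omega>))"

definition localizing ::
  "'a measure \<Rightarrow> (real \<Rightarrow> 'a measure) \<Rightarrow> real \<Rightarrow> (nat \<Rightarrow> 'a \<Rightarrow> real) \<Rightarrow> bool" where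
  "localizing Q F T \<tau> \<longleftrightarrow>
     (\<forall>n. stopping_time (clamp_filtration T F) (\<tau> n) \<and> \<tau> n \<in> space Q \<rightarrow> {0..T}) \<and>
     (AE \<omega> in Q. incseq (\<lambda>n. \<tau> n \<omega>) \<and> (\<forall>\<^sub>F n in sequentially. \<tau> n \<omega> = T))"

text \<open>As \<open>F 0\<close> need not be trivial, local properties are imposed on \<open>X - X\<^sub>0\<close>, so that they
  do not restrict the \<open>F 0\<close>-measurable initial value.\<close>

definition local_martingale ::
  "'a measure \<Rightarrow> (real \<Rightarrow> 'a measure) \<Rightarrow> real \<Rightarrow> ('a, real) process \<Rightarrow> bool" where
  "local_martingale Q F T X \<longleftrightarrow>
     adapted_cadlag Q F T X \<and>
     (\<exists>\<tau>. localizing Q F T \<tau> \<and>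
        (\<forall>n. martingale Q F T (\<lambda>t \<omega>. X (min t (\<tau> n \<omega>)) \<omega> - X 0 \<omega>)))"

definition locally_bounded ::
  "'a measure \<Rightarrow> (real \<Rightarrow> 'a measure) \<Rightarrow> real \<Rightarrow> ('a, 'b::real_normed_vector) process \<Rightarrow> bool" where
  "locally_bounded P F T X \<longleftrightarrow>
     (\<exists>\<tau>. localizing P F T \<tau> \<and>
        (\<forall>n. \<exists>c. AE \<omega> in P. \<forall>t\<in>{0..T}. norm (X (min t (\<tau> n \<omega>)) \<omega> - X 0 \<omega>) \<le> c))"

definition finite_variation_on :: "real \<Rightarrow> (real \<Rightarrow> real) \<Rightarrow> bool" where
  "finite_variation_on T a \<longleftrightarrow>
     (\<exists>c. \<forall>(k::nat) s. mono s \<and> range s \<subseteq> {0..T} \<longrightarrow> (\<Sum>i<k. \<bar>a (s (Suc i)) - a (s i)\<bar>) \<le> c)"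

definition semimartingale ::
  "'a measure \<Rightarrow> (real \<Rightarrow> 'a measure) \<Rightarrow> real \<Rightarrow> ('a, real) process \<Rightarrow> bool" where
  "semimartingale P F T X \<longleftrightarrow>
     adapted_cadlag P F T X \<and>
     (\<exists>L A. local_martingale P F T L \<and> adapted_cadlag P F T A \<and>
        (AE \<omega> in P. finite_variation_on T (\<lambda>t. A t \<omega>)) \<and>
        (AE \<omega> in P. \<forall>t\<in>{0..T}. X t \<omega> = L t \<omega> + A t \<omega>))"


section \<open>Vector stochastic integration\<close>

definition predictable_algebra ::
  "'a measure \<Rightarrow> (real \<Rightarrow> 'a measure) \<Rightarrow> real \<Rightarrow> (real \<times> 'a) measure" where
  "predictable_algebra P F T =
     sigma ({0..T} \<times> space P)
       ({{0} \<times> A | A. A \<in> sets (F 0)} \<union>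
        {{s<..t} \<times> A | s t A. 0 \<le> s \<and> s < t \<and> t \<le> T \<and> A \<in> sets (F s)})"

definition predictable ::
  "'a measure \<Rightarrow> (real \<Rightarrow> 'a measure) \<Rightarrow> real \<Rightarrow> ('a, 'b::topological_space) process \<Rightarrow> bool" where
  "predictable P F T H \<longleftrightarrow> (\<lambda>(t, \<omega>). H t \<omega>) \<in> borel_measurable (predictable_algebra P F T)"

text \<open>Integrals are taken over the interval \<open>{0<..t}\<close>, so the time-zero part of an integrand does
  not contribute.\<close>

definition elementary_integral ::
  "'a measure \<Rightarrow> (real \<Rightarrow> 'a measure) \<Rightarrow> real \<Rightarrow> ('a, 'b::euclidean_space) process
    \<Rightarrow> ('a, 'b) process \<Rightarrow> ('a, real) process \<Rightarrow> bool" where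
  "elementary_integral P F T S H Z \<longleftrightarrow>
     (\<exists>h0 (k::nat) s r h c.
        h0 \<in> borel_measurable (F 0) \<and> (\<forall>\<omega>\<in>space P. norm (h0 \<omega>) \<le> c) \<and>
        (\<forall>i<k. 0 \<le> s i \<and> s i < r i \<and> r i \<le> T \<and>
               h i \<in> borel_measurable (F (s i)) \<and> (\<forall>\<omega>\<in>space P. norm (h i \<omega>) \<le> c)) \<and>
        (\<forall>t\<in>{0..T}. \<forall>\<omega>\<in>space P.
           H t \<omega> = indicat_real {0} t *\<^sub>R h0 \<omega> + (\<Sum>i<k. indicat_real {s i<..r i} t *\<^sub>R h i \<omega>) \<and>
           Z t \<omega> = (\<Sum>i<k. h i \<omega> \<bullet> (S (min (r i) t) \<omega> - S (min (s i) t) \<omega>))))"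

text \<open>Convergence in probability, uniformly on \<open>{0..T}\<close>.\<close>

definition ucp_tendsto ::
  "'a measure \<Rightarrow> real \<Rightarrow> (nat \<Rightarrow> ('a, real) process) \<Rightarrow> ('a, real) process \<Rightarrow> bool" where
  "ucp_tendsto P T Z Z' \<longleftrightarrow>
     (\<forall>\<epsilon>>0. (\<lambda>n. measure P {\<omega>\<in>space P. \<exists>t\<in>{0..T}. \<bar>Z n t \<omega> - Z' t \<omega>\<bar> > \<epsilon>}) \<longlonglongrightarrow> 0)"

text \<open>The integral of bounded predictable integrands is the extension of the elementary integral
  that is continuous under uniformly bounded pointwise convergence of the integrands.  Here \<open>S\<close> is
  meant to be a semimartingale: by the dominated convergence theorem for stochastic integrals and a
  monotone class argument, every bounded predictable \<open>H\<close> is then related to exactly one \<open>Z\<close> up to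
  indistinguishability.\<close>

inductive bounded_integral ::
  "'a measure \<Rightarrow> (real \<Rightarrow> 'a measure) \<Rightarrow> real \<Rightarrow> ('a, 'b::euclidean_space) process
    \<Rightarrow> ('a, 'b) process \<Rightarrow> ('a, real) process \<Rightarrow> bool"
  for P F T S where
  elementary: "elementary_integral P F T S H Z \<Longrightarrow> bounded_integral P F T S H Z"
| limit: "\<lbrakk> \<And>n. bounded_integral P F T S (H n) (Z n);
            \<And>n t \<omega>. t \<in> {0..T} \<Longrightarrow> \<omega> \<in> space P \<Longrightarrow> norm (H n t \<omega>) \<le> c;
            \<And>t \<omega>. t \<in> {0..T} \<Longrightarrow> \<omega> \<in> space P \<Longrightarrow> (\<lambda>n. H n t \<omega>) \<longlonglongrightarrow> H' t \<omega>;
            adapted_cadlag P F T Z'; ucp_tendsto P T Z Z' \<rbrakk>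
          \<Longrightarrow> bounded_integral P F T S H' Z'"

text \<open>Convergence in Emery's semimartingale topology: the integrals of elementary integrands bounded
  by one converge to zero, uniformly in the integrand (expressed through arbitrary sequences of
  integrands).  The first conjunct only adds convergence of the initial values.\<close>

definition emery_tendsto ::
  "'a measure \<Rightarrow> (real \<Rightarrow> 'a measure) \<Rightarrow> real \<Rightarrow> (nat \<Rightarrow> ('a, real) process)
    \<Rightarrow> ('a, real) process \<Rightarrow> bool" where
  "emery_tendsto P F T X X' \<longleftrightarrow>
     ucp_tendsto P T X X' \<and>
     (\<forall>K Z. (\<forall>n. elementary_integral P F T (\<lambda>t \<omega>. X n t \<omega> - X' t \<omega>) (K n) (Z n) \<and>
                 (\<forall>t\<in>{0..T}. \<forall>\<omega>\<in>space P. \<bar>K n t \<omega>\<bar> \<le> (1::real)))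
            \<longrightarrow> ucp_tendsto P T Z (\<lambda>_ _. 0))"

text \<open>\<open>H\<close> is predictable and \<open>S\<close>-integrable, with integral process \<open>Z\<close>, in the sense of vector
  stochastic integration: the integrals of the truncated integrands converge to \<open>Z\<close> in the
  semimartingale topology.\<close>

definition stochastic_integral ::
  "'a measure \<Rightarrow> (real \<Rightarrow> 'a measure) \<Rightarrow> real \<Rightarrow> ('a, 'b::euclidean_space) process
    \<Rightarrow> ('a, 'b) process \<Rightarrow> ('a, real) process \<Rightarrow> bool" where
  "stochastic_integral P F T S H Z \<longleftrightarrow>
     predictable P F T H \<and> adapted_cadlag P F T Z \<and>
     (\<exists>Zn. (\<forall>n. bounded_integral P F T S
                  (\<lambda>t \<omega>. if norm (H t \<omega>) \<le> real n then H t \<omega> else 0) (Zn n)) \<and>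
           emery_tendsto P F T Zn Z)"


section \<open>The market\<close>

definition locally_bounded_semimartingale ::
  "'a measure \<Rightarrow> (real \<Rightarrow> 'a measure) \<Rightarrow> real \<Rightarrow> ('a, real^'d) process \<Rightarrow> bool" where
  "locally_bounded_semimartingale P F T S \<longleftrightarrow>
     (\<forall>i. semimartingale P F T (\<lambda>t \<omega>. S t \<omega> $ i)) \<and> locally_bounded P F T S"

definition equivalent_local_martingale_measures ::
  "'a measure \<Rightarrow> (real \<Rightarrow> 'a measure) \<Rightarrow> real \<Rightarrow> ('a, real^'d) process \<Rightarrow> 'a measure set" where
  "equivalent_local_martingale_measures P F T S =
     {Q. prob_space Q \<and> sets Q = sets P \<and> absolutely_continuous P Q \<and> absolutely_continuous Q P \<and>
         (\<forall>i. local_martingale Q F T (\<lambda>t \<omega>. S t \<omega> $ i))}"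

definition wealth_from ::
  "'a measure \<Rightarrow> (real \<Rightarrow> 'a measure) \<Rightarrow> real \<Rightarrow> ('a, real^'d) process \<Rightarrow> real
    \<Rightarrow> ('a, real) process \<Rightarrow> bool" where
  "wealth_from P F T S x X \<longleftrightarrow>
     (\<exists>H Z. stochastic_integral P F T S H Z \<and> (AE \<omega> in P. \<forall>t\<in>{0..T}. X t \<omega> = x + Z t \<omega>))"

definition wealth_process ::
  "'a measure \<Rightarrow> (real \<Rightarrow> 'a measure) \<Rightarrow> real \<Rightarrow> ('a, real^'d) process
    \<Rightarrow> ('a, real) process \<Rightarrow> bool" where
  "wealth_process P F T S X \<longleftrightarrow> (\<exists>x. wealth_from P F T S x X)"

definition nonneg_process :: "'a measure \<Rightarrow> real \<Rightarrow> ('a, real) process \<Rightarrow> bool" where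
  "nonneg_process P T X \<longleftrightarrow> (AE \<omega> in P. \<forall>t\<in>{0..T}. 0 \<le> X t \<omega>)"

definition nonneg_wealth ::
  "'a measure \<Rightarrow> (real \<Rightarrow> 'a measure) \<Rightarrow> real \<Rightarrow> ('a, real^'d) process \<Rightarrow> real
    \<Rightarrow> ('a, real) process set" where
  "nonneg_wealth P F T S x = {X. wealth_from P F T S x X \<and> nonneg_process P T X}"

definition maximal_wealth ::
  "'a measure \<Rightarrow> (real \<Rightarrow> 'a measure) \<Rightarrow> real \<Rightarrow> ('a, real^'d) process
    \<Rightarrow> ('a, real) process \<Rightarrow> bool" where
  "maximal_wealth P F T S X \<longleftrightarrow>
     (\<exists>x\<ge>0. X \<in> nonneg_wealth P F T S x \<and>
        (\<forall>X'\<in>nonneg_wealth P F T S x.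
           (AE \<omega> in P. X T \<omega> \<le> X' T \<omega>) \<longrightarrow> (AE \<omega> in P. X' T \<omega> = X T \<omega>)))"

definition acceptable ::
  "'a measure \<Rightarrow> (real \<Rightarrow> 'a measure) \<Rightarrow> real \<Rightarrow> ('a, real^'d) process
    \<Rightarrow> ('a, real) process \<Rightarrow> bool" where
  "acceptable P F T S X \<longleftrightarrow>
     wealth_process P F T S X \<and>
     (\<exists>X' X''. wealth_process P F T S X' \<and> nonneg_process P T X' \<and> maximal_wealth P F T S X'' \<and>
        (AE \<omega> in P. \<forall>t\<in>{0..T}. X t \<omega> = X' t \<omega> - X'' t \<omega>))"

definition workable ::
  "'a measure \<Rightarrow> (real \<Rightarrow> 'a measure) \<Rightarrow> real \<Rightarrow> ('a, real^'d) process
    \<Rightarrow> ('a, real) process \<Rightarrow> bool" where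
  "workable P F T S X \<longleftrightarrow> acceptable P F T S X \<and> acceptable P F T S (\<lambda>t \<omega>. - X t \<omega>)"

definition replicable ::
  "'a measure \<Rightarrow> (real \<Rightarrow> 'a measure) \<Rightarrow> real \<Rightarrow> ('a, real^'d) process \<Rightarrow> ('a \<Rightarrow> real) \<Rightarrow> bool" where
  "replicable P F T S g \<longleftrightarrow> (\<exists>X. workable P F T S X \<and> (AE \<omega> in P. g \<omega> = X T \<omega>))"


section \<open>Utility maximization and prices\<close>

definition utility_function :: "(real \<Rightarrow> real) \<Rightarrow> bool" where
  "utility_function U \<longleftrightarrow>
     (\<forall>x>0. \<forall>y>0. x \<noteq> y \<longrightarrow>
        (\<forall>t. 0 < t \<and> t < 1 \<longrightarrow> (1 - t) * U x + t * U y < U ((1 - t) * x + t * y))) \<and>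
     strict_mono_on {0<..} U \<and>
     (\<forall>x>0. U differentiable (at x)) \<and> continuous_on {0<..} (deriv U)"

definition inada :: "(real \<Rightarrow> real) \<Rightarrow> bool" where
  "inada U \<longleftrightarrow> filterlim (deriv U) at_top (at_right 0) \<and> (deriv U \<longlongrightarrow> 0) at_top"

definition extended_utility :: "(real \<Rightarrow> real) \<Rightarrow> real \<Rightarrow> ereal" where
  "extended_utility U x =
     (if 0 < x then ereal (U x)
      else if x = 0 then Lim (at_right 0) (\<lambda>z. ereal (U z))
      else -\<infinity>)"

definition extended_expectation :: "'a measure \<Rightarrow> ('a \<Rightarrow> ereal) \<Rightarrow> ereal" where
  "extended_expectation P g =
     (if (\<integral>\<^sup>+\<omega>. e2ennreal (- g \<omega>) \<partial>P) = \<infinity> then -\<infinity>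
      else enn2ereal (\<integral>\<^sup>+\<omega>. e2ennreal (g \<omega>) \<partial>P) - enn2ereal (\<integral>\<^sup>+\<omega>. e2ennreal (- g \<omega>) \<partial>P))"

definition superhedging_wealth ::
  "'a measure \<Rightarrow> (real \<Rightarrow> 'a measure) \<Rightarrow> real \<Rightarrow> ('a, real^'d) process \<Rightarrow> ('a \<Rightarrow> real^'n)
    \<Rightarrow> real \<Rightarrow> real^'n \<Rightarrow> ('a, real) process set" where
  "superhedging_wealth P F T S f x q =
     {X. acceptable P F T S X \<and> (AE \<omega> in P. X 0 \<omega> = x) \<and> (AE \<omega> in P. 0 \<le> X T \<omega> + q \<bullet> f \<omega>)}"

definition value_function ::
  "'a measure \<Rightarrow> (real \<Rightarrow> 'a measure) \<Rightarrow> real \<Rightarrow> ('a, real^'d) process \<Rightarrow> ('a \<Rightarrow> real^'n)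
    \<Rightarrow> (real \<Rightarrow> real) \<Rightarrow> real \<Rightarrow> real^'n \<Rightarrow> ereal" where
  "value_function P F T S f U x q =
     (SUP X\<in>{X. acceptable P F T S X \<and> (AE \<omega> in P. X 0 \<omega> = x)}.
        extended_expectation P (\<lambda>\<omega>. extended_utility U (X T \<omega> + q \<bullet> f \<omega>)))"

definition value_domain ::
  "'a measure \<Rightarrow> (real \<Rightarrow> 'a measure) \<Rightarrow> real \<Rightarrow> ('a, real^'d) process \<Rightarrow> ('a \<Rightarrow> real^'n)
    \<Rightarrow> (real \<Rightarrow> real) \<Rightarrow> (real \<times> (real^'n)) set" where
  "value_domain P F T S f U = {(x, q). value_function P F T S f U x q > -\<infinity>}"

definition conjugate_utility :: "(real \<Rightarrow> real) \<Rightarrow> real \<Rightarrow> ereal" where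
  "conjugate_utility U y = (SUP x. extended_utility U x - ereal (x * y))"

definition dual_processes ::
  "'a measure \<Rightarrow> (real \<Rightarrow> 'a measure) \<Rightarrow> real \<Rightarrow> ('a, real^'d) process \<Rightarrow> real
    \<Rightarrow> ('a, real) process set" where
  "dual_processes P F T S y =
     {Y. nonneg_process P T Y \<and> (AE \<omega> in P. Y 0 \<omega> = y) \<and>
         (\<forall>X\<in>nonneg_wealth P F T S 1. supermartingale P F T (\<lambda>t \<omega>. X t \<omega> * Y t \<omega>))}"

definition dual_value_function ::
  "'a measure \<Rightarrow> (real \<Rightarrow> 'a measure) \<Rightarrow> real \<Rightarrow> ('a, real^'d) process
    \<Rightarrow> (real \<Rightarrow> real) \<Rightarrow> real \<Rightarrow> ereal" where
  "dual_value_function P F T S U y =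
     (INF Y\<in>dual_processes P F T S y. extended_expectation P (\<lambda>\<omega>. conjugate_utility U (Y T \<omega>)))"

definition arbitrage_free_prices ::
  "'a measure \<Rightarrow> (real \<Rightarrow> 'a measure) \<Rightarrow> real \<Rightarrow> ('a, real^'d) process \<Rightarrow> ('a \<Rightarrow> real^'n)
    \<Rightarrow> (real^'n) set" where
  "arbitrage_free_prices P F T S f =
     {p. \<forall>q. \<forall>X\<in>superhedging_wealth P F T S f (- (p \<bullet> q)) q. AE \<omega> in P. X T \<omega> = - (q \<bullet> f \<omega>)}"

text \<open>Marginal prices are only defined where the value function is finite; elsewhere the set is
  empty by convention.\<close>

definition marginal_prices ::
  "'a measure \<Rightarrow> (real \<Rightarrow> 'a measure) \<Rightarrow> real \<Rightarrow> ('a, real^'d) process \<Rightarrow> ('a \<Rightarrow> real^'n)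
    \<Rightarrow> (real \<Rightarrow> real) \<Rightarrow> real \<Rightarrow> real^'n \<Rightarrow> (real^'n) set" where
  "marginal_prices P F T S f U x q =
     {p. \<bar>value_function P F T S f U x q\<bar> \<noteq> \<infinity> \<and>
         (\<forall>q'. value_function P F T S f U (x - q' \<bullet> p) (q + q') \<le> value_function P F T S f U x q)}"

end

theory Submission
  imports Defs
begin

text \<open>Let \<open>K\<close> be the set of all \<open>(x', q')\<close> for which some acceptable \<open>X\<close> with \<open>X\<^sub>0 = x'\<close> satisfies
  \<open>X\<^sub>T + q' f \<ge> 0\<close>.  This is a convex cone which contains \<open>{u > -\<infinity>}\<close>, and \<open>K + (\<epsilon>, 0)\<close> is contained in
  \<open>{u > -\<infinity>}\<close>, since a terminal value above \<open>\<epsilon> > 0\<close> has utility bounded below.  Hence the boundary point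
  \<open>(x, q)\<close> is not interior to \<open>K\<close>, and \<open>K\<close> is supported at \<open>(x, q)\<close> by a linear functional; as \<open>f\<close> is
  dominated, it can be normalized to \<open>x' + p q' \<ge> 0\<close> on \<open>K\<close>, with equality at \<open>(x, q)\<close>.  Let \<open>r\<close> be in
  \<open>[p\<^sub>0, p)\<close>.  If \<open>u (x - q' r, q + q') > -\<infinity>\<close>, then the supporting inequality yields \<open>q' r \<ge> q' p\<^sub>0\<close>, so that
  \<open>u (x - q' r, q + q') \<le> u (x - q' p\<^sub>0, q + q') \<le> u (x, q)\<close> by monotonicity.  If \<open>p\<close> were arbitrage-free, then
  \<open>X\<^sub>T = - q f\<close> for every \<open>X \<in> \<X>(x, q)\<close>; this forces \<open>X'\<close> in \<open>X = X' - X''\<close> to be maximal, and \<open>q f\<close> would be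
  replicable.

  The real work is to show that sums of acceptable processes are acceptable.  The integral is defined
  by truncation, and neither its additivity nor the possibility of switching strategies at time \<open>t\<close> on
  an event in \<open>F t\<close> is immediate.  Both follow from a control: a finite measure \<open>\<mu>\<close> on the predictable
  sets such that elementary integrals are uniformly small in probability when the integrand is small
  in \<open>L\<^sup>2(\<mu>)\<close>.  Under an equivalent local martingale measure \<open>Q\<close> the locally bounded \<open>S\<close> is locally a bounded
  martingale, whose Doleans measure controls the integrals, and smallness in \<open>Q\<close>-probability implies
  smallness in \<open>P\<close>-probability.\<close>

section \<open>Simple integrands\<close>

text \<open>Acceptability of sums hinges on maximality of sums: if \<open>X\<close>,
  \<open>Y\<close> are maximal and \<open>V\<close> dominates \<open>X + Y\<close> at
  \<open>T\<close>, then \<open>V - Y\<close> has to be shown non-negative at all times. Switching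
  strategies on an event of \<open>F t\<close> propagates the domination backwards, so differences
  of integrals and restrictions of integrals to \<open>{t<..T} \<times> A\<close> must again be
  integrals in the sense of \<open>stochastic_integral\<close>. The control passes from elementary
  to bounded integrands by approximation, gives existence and uniqueness of their integrals, and
  compares truncations of a sum with sums of truncations in the semimartingale topology. Only
  smallness in probability is asked of it, so that countably many localized Doleans measures can be
  mixed with positive weights. Each of them is built from the expected increments of the squared
  norm of a bounded martingale; countable additivity comes from right-continuity and from
  compactness of closed time intervals. In the final contradiction \<open>q\<close> is non-zero
  because \<open>x = - (p \<bullet> q)\<close> and \<open>(x, q)\<close> is not zero.\<close>

locale filtered_space = prob_space P for P :: "'a measure" +
  fixes F :: "real \<Rightarrow> 'a measure" and T :: real
  assumes T_pos: "0 < T" and usual: "usual_conditions P F T"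
begin

lemma space_F: "t \<in> {0..T} \<Longrightarrow> space (F t) = space P"
  using usual by (auto simp: usual_conditions_def subalgebra_def)

lemma sets_F: "t \<in> {0..T} \<Longrightarrow> sets (F t) \<subseteq> sets P"
  using usual by (auto simp: usual_conditions_def subalgebra_def)

lemma F_mono:
  assumes "0 \<le> s" "s \<le> t" "t \<le> T"
  shows "sets (F s) \<subseteq> sets (F t)"
proof -
  have "filtration (space P) (clamp_filtration T F)"
    using usual by (auto simp: usual_conditions_def)
  then have "sets (clamp_filtration T F s) \<subseteq> sets (clamp_filtration T F t)"
    using assms(2) by (simp add: filtration_def)
  then show ?thesis
    using assms by (simp add: clamp_filtration_def)
qed

lemma measurable_F_mono:
  assumes "f \<in> borel_measurable (F s)" "0 \<le> s" "s \<le> t" "t \<le> T"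
  shows "f \<in> borel_measurable (F t)"
  using assms F_mono[of s t] space_F[of s] space_F[of t]
  by (auto simp: measurable_def)

lemma measurable_F_P:
  assumes "f \<in> borel_measurable (F t)" "t \<in> {0..T}"
  shows "f \<in> borel_measurable P"
  using assms sets_F[of t] space_F[of t] by (auto simp: measurable_def)

section \<open>Finite time grids\<close>

definition grid :: "real set \<Rightarrow> bool" where
  "grid E \<longleftrightarrow> finite E \<and> 0 \<in> E \<and> T \<in> E \<and> E \<subseteq> {0..T}"

text \<open>The successor of \<open>a\<close> in the grid. It is meaningful for
  \<open>a \<in> E - {T}\<close>; at \<open>a = T\<close> the minimum is over the empty set, which
  is why all sums over cells run over \<open>E - {T}\<close>.\<close>

definition nxt :: "real set \<Rightarrow> real \<Rightarrow> real" where
  "nxt E a = Min {b \<in> E. a < b}"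

lemma nxt:
  assumes "grid E" "a \<in> E - {T}"
  shows "nxt E a \<in> E" "a < nxt E a" "nxt E a \<le> T" "0 \<le> a" "a < T" "a \<le> T"
    and "\<And>b. b \<in> E \<Longrightarrow> a < b \<Longrightarrow> nxt E a \<le> b"
proof -
  have fin: "finite {b \<in> E. a < b}" and ne: "{b \<in> E. a < b} \<noteq> {}"
    using assms by (auto simp: grid_def subset_eq less_le)
  from Min_in[OF fin ne] show "nxt E a \<in> E" "a < nxt E a" by (auto simp: nxt_def)
  then show "nxt E a \<le> T" "0 \<le> a" "a < T" "a \<le> T" using assms by (auto simp: grid_def less_le)
  show "\<And>b. b \<in> E \<Longrightarrow> a < b \<Longrightarrow> nxt E a \<le> b"
    using fin by (auto simp: nxt_def)
qed

lemma grid_Un: "grid E \<Longrightarrow> grid E' \<Longrightarrow> grid (E \<union> E')"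
  by (auto simp: grid_def)

text \<open>Cells are open on the left and closed on the right, as predictable rectangles are; the
  left end is the largest grid point strictly before \<open>t\<close>.\<close>

lemma grid_cell:
  assumes "grid E" "0 < t" "t \<le> T"
  obtains a where "a \<in> E - {T}" "a < t" "t \<le> nxt E a"
proof -
  have fin: "finite {b \<in> E. b < t}" and ne: "{b \<in> E. b < t} \<noteq> {}"
    using assms by (auto simp: grid_def)
  define a where "a = Max {b \<in> E. b < t}"
  have a: "a \<in> E" "a < t" using Max_in[OF fin ne] by (auto simp: a_def)
  have aT: "a \<in> E - {T}" using a assms by auto
  have "t \<le> nxt E a"
  proof (rule ccontr)
    assume "\<not> ?thesis"
    then have "nxt E a \<in> {b \<in> E. b < t}" using nxt[OF assms(1) aT] by auto
    then have "nxt E a \<le> a" unfolding a_def using fin by auto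
    then show False using nxt[OF assms(1) aT] by auto
  qed
  then show ?thesis using that aT a by auto
qed

text \<open>Counterpart for cells closed on the left. It sorts the points of a finer grid into the
  cells of a coarser one, where a point shared by both grids has to go to the cell that starts
  there.\<close>

lemma grid_cell_le:
  assumes "grid E" "0 \<le> t" "t < T"
  obtains a where "a \<in> E - {T}" "a \<le> t" "t < nxt E a"
proof -
  have fin: "finite {b \<in> E. b \<le> t}" and ne: "{b \<in> E. b \<le> t} \<noteq> {}"
    using assms by (auto simp: grid_def)
  define a where "a = Max {b \<in> E. b \<le> t}"
  have a: "a \<in> E" "a \<le> t" using Max_in[OF fin ne] by (auto simp: a_def)
  have aT: "a \<in> E - {T}" using a assms by auto
  have "t < nxt E a"
  proof (rule ccontr)
    assume "\<not> ?thesis"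
    then have "nxt E a \<in> {b \<in> E. b \<le> t}" using nxt[OF assms(1) aT] by auto
    then have "nxt E a \<le> a" unfolding a_def using fin by auto
    then show False using nxt[OF assms(1) aT] by auto
  qed
  then show ?thesis using that aT a by auto
qed

text \<open>Induction on the number of grid points in \<open>{u..<v}\<close>: the largest of them,
  \<open>w\<close>, has successor \<open>v\<close>, so its term contributes
  \<open>g v - g w\<close>, and the induction hypothesis covers the rest.\<close>

lemma grid_telescope:
  fixes g :: "real \<Rightarrow> 'c::ab_group_add"
  assumes E: "grid E" and "u \<in> E" "v \<in> E" "u \<le> v"
  shows "(\<Sum>a\<in>E \<inter> {u..<v}. g (nxt E a) - g a) = g v - g u"
  using assms(3,4)
proof (induction "card (E \<inter> {u..<v})" arbitrary: v rule: less_induct)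
  case less
  show ?case
  proof (cases "u = v")
    case False
    have fin: "finite (E \<inter> {u..<v})" and ne: "E \<inter> {u..<v} \<noteq> {}"
      using E less.prems assms(2) False by (auto simp: grid_def)
    define w where "w = Max (E \<inter> {u..<v})"
    have w: "w \<in> E" "u \<le> w" "w < v" using Max_in[OF fin ne] by (auto simp: w_def)
    have wT: "w \<in> E - {T}" using w less.prems E by (auto simp: grid_def)
    have nw: "nxt E w = v"
    proof (rule antisym)
      show "nxt E w \<le> v" using nxt(7)[OF E wT] less.prems w by auto
      show "v \<le> nxt E w"
      proof (rule ccontr)
        assume "\<not> v \<le> nxt E w"
        then have "nxt E w \<in> E \<inter> {u..<v}" using nxt[OF E wT] w by auto
        then have "nxt E w \<le> w" unfolding w_def using fin by auto
        then show False using nxt[OF E wT] by auto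
      qed
    qed
    have eq: "E \<inter> {u..<v} = insert w (E \<inter> {u..<w})"
    proof -
      have "a \<le> w" if "a \<in> E \<inter> {u..<v}" for a unfolding w_def using fin that by auto
      then show ?thesis using w by force
    qed
    have "card (E \<inter> {u..<w}) < card (E \<inter> {u..<v})"
      using fin by (intro psubset_card_mono) (use w in auto)
    from less.hyps[OF this w(1,2)] show ?thesis
      using E by (simp add: eq nw grid_def)
  qed (auto)
qed

lemma grid_refine_decomp:
  assumes "grid E" "grid E'" "E \<subseteq> E'"
  shows "E' - {T} = (\<Union>a\<in>E - {T}. E' \<inter> {a..<nxt E a})"
    and "disjoint_family_on (\<lambda>a. E' \<inter> {a..<nxt E a}) (E - {T})"
proof -
  show "E' - {T} = (\<Union>a\<in>E - {T}. E' \<inter> {a..<nxt E a})"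
  proof (intro set_eqI iffI)
    fix b assume b: "b \<in> E' - {T}"
    then have "0 \<le> b" "b < T" using assms(2) by (auto simp: grid_def less_le)
    from grid_cell_le[OF assms(1) this] obtain a where "a \<in> E - {T}" "a \<le> b" "b < nxt E a" .
    then show "b \<in> (\<Union>a\<in>E - {T}. E' \<inter> {a..<nxt E a})" using b by auto
  next
    fix b assume "b \<in> (\<Union>a\<in>E - {T}. E' \<inter> {a..<nxt E a})"
    then show "b \<in> E' - {T}" using nxt(3)[OF assms(1)] by force
  qed
  show "disjoint_family_on (\<lambda>a. E' \<inter> {a..<nxt E a}) (E - {T})"
    unfolding disjoint_family_on_def
  proof (intro ballI impI)
    fix a b assume ab: "a \<in> E - {T}" "b \<in> E - {T}" "a \<noteq> b"
    then have "nxt E a \<le> b \<or> nxt E b \<le> a"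
      using nxt(7)[OF assms(1), of a b] nxt(7)[OF assms(1), of b a] by force
    then show "E' \<inter> {a..<nxt E a} \<inter> (E' \<inter> {b..<nxt E b}) = {}" by auto
  qed
qed

text \<open>A simple predictable integrand is encoded by its values instead of by a list of
  coefficients: on each cell \<open>{a<..nxt E a}\<close> it is constant, and its value there, read
  off at the right end point, is known at time \<open>a\<close>. In this form sums, products and
  refinements need no bookkeeping.\<close>

definition simple :: "real set \<Rightarrow> (real \<Rightarrow> 'a \<Rightarrow> 'b::euclidean_space) \<Rightarrow> bool" where
  "simple E K \<longleftrightarrow> grid E \<and> K 0 \<in> borel_measurable (F 0) \<and>
     (\<exists>c. \<forall>t\<in>{0..T}. \<forall>\<omega>\<in>space P. norm (K t \<omega>) \<le> c) \<and>
     (\<forall>a\<in>E - {T}. K (nxt E a) \<in> borel_measurable (F a) \<and>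
        (\<forall>t\<in>{a<..nxt E a}. \<forall>\<omega>\<in>space P. K t \<omega> = K (nxt E a) \<omega>))"

lemma simple_grid: "simple E K \<Longrightarrow> grid E" by (simp add: simple_def)

lemma simple_zero: "simple E K \<Longrightarrow> K 0 \<in> borel_measurable (F 0)"
  by (simp add: simple_def)

lemma simple_bounded:
  assumes "simple E K"
  obtains c where "0 \<le> c" "\<And>t \<omega>. t \<in> {0..T} \<Longrightarrow> \<omega> \<in> space P \<Longrightarrow> norm (K t \<omega>) \<le> c"
proof -
  from assms obtain c where "\<forall>t\<in>{0..T}. \<forall>\<omega>\<in>space P. norm (K t \<omega>) \<le> c" by (auto simp: simple_def)
  then show ?thesis using that[of "max 0 c"] by (auto simp: max.coboundedI2)
qed

lemma simple_measurable: "simple E K \<Longrightarrow> a \<in> E - {T} \<Longrightarrow> K (nxt E a) \<in> borel_measurable (F a)"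
  by (simp add: simple_def)

lemma simple_cell:
  "simple E K \<Longrightarrow> a \<in> E - {T} \<Longrightarrow> a < t \<Longrightarrow> t \<le> nxt E a \<Longrightarrow> \<omega> \<in> space P \<Longrightarrow> K t \<omega> = K (nxt E a) \<omega>"
  unfolding simple_def by (metis greaterThanAtMost_iff)

lemma simpleI:
  assumes "grid E" "K 0 \<in> borel_measurable (F 0)"
    and "\<And>t \<omega>. t \<in> {0..T} \<Longrightarrow> \<omega> \<in> space P \<Longrightarrow> norm (K t \<omega>) \<le> c"
    and "\<And>a. a \<in> E - {T} \<Longrightarrow> K (nxt E a) \<in> borel_measurable (F a)"
    and "\<And>a t \<omega>. a \<in> E - {T} \<Longrightarrow> a < t \<Longrightarrow> t \<le> nxt E a \<Longrightarrow> \<omega> \<in> space P \<Longrightarrow> K t \<omega> = K (nxt E a) \<omega>"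
  shows "simple E K"
proof -
  have "\<exists>c. \<forall>t\<in>{0..T}. \<forall>\<omega>\<in>space P. norm (K t \<omega>) \<le> c" using assms(3) by blast
  moreover have "\<forall>a\<in>E - {T}. K (nxt E a) \<in> borel_measurable (F a) \<and>
        (\<forall>t\<in>{a<..nxt E a}. \<forall>\<omega>\<in>space P. K t \<omega> = K (nxt E a) \<omega>)"
    using assms(4,5) by (metis greaterThanAtMost_iff)
  ultimately show ?thesis using assms(1,2) unfolding simple_def by blast
qed

definition grid_integral ::
  "real set \<Rightarrow> (real \<Rightarrow> 'a \<Rightarrow> 'b::euclidean_space) \<Rightarrow> (real \<Rightarrow> 'a \<Rightarrow> 'b) \<Rightarrow> real \<Rightarrow> 'a \<Rightarrow> real" where
  "grid_integral E K X t \<omega> =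
     (\<Sum>a\<in>E - {T}. K (nxt E a) \<omega> \<bullet> (X (min (nxt E a) t) \<omega> - X (min a t) \<omega>))"

text \<open>On the part of the fine grid inside one coarse cell the integrand keeps its value, so
  the increments of the integrator telescope to the coarse increment.\<close>

lemma simple_refine:
  assumes K: "simple E K" and E': "grid E'" "E \<subseteq> E'"
  shows "simple E' K"
    and "\<omega> \<in> space P \<Longrightarrow> grid_integral E' K X t \<omega> = grid_integral E K X t \<omega>"
proof -
  have E: "grid E" using K by (simp add: simple_def)
  have cell: "K (nxt E' b) \<omega> = K (nxt E a) \<omega>" "a < nxt E' b" "nxt E' b \<le> nxt E a"
    if "a \<in> E - {T}" "b \<in> E'" "a \<le> b" "b < nxt E a" "\<omega> \<in> space P" for a b \<omega>
  proof -
    have b: "b \<in> E' - {T}" using that nxt[OF E that(1)] by auto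
    show "a < nxt E' b" using nxt(2)[OF E'(1) b] that by auto
    moreover show "nxt E' b \<le> nxt E a"
      using nxt(7)[OF E'(1) b] nxt(1)[OF E that(1)] that E'(2) by auto
    ultimately show "K (nxt E' b) \<omega> = K (nxt E a) \<omega>"
      using simple_cell[OF K that(1)] that(5) by blast
  qed
  obtain c where c: "\<And>t \<omega>. t \<in> {0..T} \<Longrightarrow> \<omega> \<in> space P \<Longrightarrow> norm (K t \<omega>) \<le> c"
    using simple_bounded[OF K] by metis
  show "simple E' K"
  proof (rule simpleI[where c=c])
    show "grid E'" by fact
    show "K 0 \<in> borel_measurable (F 0)" by (rule simple_zero[OF K])
    show "norm (K t \<omega>) \<le> c" if "t \<in> {0..T}" "\<omega> \<in> space P" for t \<omega> by (rule c[OF that])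
    fix b assume b: "b \<in> E' - {T}"
    then obtain a where a: "a \<in> E - {T}" "a \<le> b" "b < nxt E a"
      using grid_refine_decomp(1)[OF E E'] by auto
    have b0: "0 \<le> b" "b \<le> T" using b E'(1) by (auto simp: grid_def)
    have "K (nxt E a) \<in> borel_measurable (F b)"
      using simple_measurable[OF K a(1)] a b0 nxt[OF E a(1)] by (auto intro: measurable_F_mono[of "K (nxt E a)" a b])
    then show "K (nxt E' b) \<in> borel_measurable (F b)"
      by (subst measurable_cong[where g="K (nxt E a)"]) (use cell(1)[OF a(1) _ a(2,3)] b b0 space_F[of b] in auto)
    fix t \<omega> assume t: "b < t" "t \<le> nxt E' b" "\<omega> \<in> space P"
    then have "a < t" "t \<le> nxt E a" using a cell(3)[OF a(1) _ a(2,3) t(3)] b by auto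
    then have "K t \<omega> = K (nxt E a) \<omega>" using simple_cell[OF K a(1)] t by blast
    then show "K t \<omega> = K (nxt E' b) \<omega>" using cell(1)[OF a(1) _ a(2,3) t(3)] b by auto
  qed
  assume \<omega>: "\<omega> \<in> space P"
  have "grid_integral E' K X t \<omega> =
      (\<Sum>a\<in>E - {T}. \<Sum>b\<in>E' \<inter> {a..<nxt E a}. K (nxt E' b) \<omega> \<bullet> (X (min (nxt E' b) t) \<omega> - X (min b t) \<omega>))"
    unfolding grid_integral_def grid_refine_decomp(1)[OF E E']
    using grid_refine_decomp(2)[OF E E'] E E'(1)
    by (intro sum.UNION_disjoint) (auto simp: grid_def disjoint_family_on_def)
  also have "\<dots> = (\<Sum>a\<in>E - {T}. K (nxt E a) \<omega> \<bullet>
        (\<Sum>b\<in>E' \<inter> {a..<nxt E a}. X (min (nxt E' b) t) \<omega> - X (min b t) \<omega>))"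
    unfolding inner_sum_right
    by (intro sum.cong refl) (use cell(1) \<omega> in auto)
  also have "\<dots> = grid_integral E K X t \<omega>"
    unfolding grid_integral_def
  proof (intro sum.cong refl)
    fix a assume a: "a \<in> E - {T}"
    have "(\<Sum>b\<in>E' \<inter> {a..<nxt E a}. X (min (nxt E' b) t) \<omega> - X (min b t) \<omega>) =
        X (min (nxt E a) t) \<omega> - X (min a t) \<omega>"
      using grid_telescope[OF E'(1), of a "nxt E a" "\<lambda>b. X (min b t) \<omega>"] nxt[OF E a] a E'(2) by auto
    then show "K (nxt E a) \<omega> \<bullet> (\<Sum>b\<in>E' \<inter> {a..<nxt E a}. X (min (nxt E' b) t) \<omega> - X (min b t) \<omega>) =
       K (nxt E a) \<omega> \<bullet> (X (min (nxt E a) t) \<omega> - X (min a t) \<omega>)" by simp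
  qed
  finally show "grid_integral E' K X t \<omega> = grid_integral E K X t \<omega>" .
qed

section \<open>The elementary integral, independently of the grid\<close>

definition elem :: "(real \<Rightarrow> 'a \<Rightarrow> 'b::euclidean_space) \<Rightarrow> bool" where
  "elem K \<longleftrightarrow> (\<exists>E. simple E K)"

text \<open>Any grid may be chosen, by \<open>eint_eq\<close>; the choice makes the integral a
  function of integrand and integrator alone.\<close>

definition eint :: "(real \<Rightarrow> 'a \<Rightarrow> 'b::euclidean_space) \<Rightarrow> (real \<Rightarrow> 'a \<Rightarrow> 'b) \<Rightarrow> real \<Rightarrow> 'a \<Rightarrow> real" where
  "eint K X = grid_integral (SOME E. simple E K) K X"

text \<open>Both grids are refined to their union, where the two sums coincide.\<close>

lemma eint_eq:
  assumes "simple E K" "\<omega> \<in> space P"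
  shows "eint K X t \<omega> = grid_integral E K X t \<omega>"
proof -
  define E' where "E' = (SOME E. simple E K)"
  have E': "simple E' K" using assms(1) unfolding E'_def by (rule someI)
  then have g: "grid (E \<union> E')" using assms(1) by (auto simp: simple_def grid_Un)
  show ?thesis
    using simple_refine(2)[OF assms(1) g _ assms(2), of X t] simple_refine(2)[OF E' g _ assms(2), of X t]
    by (simp add: eint_def E'_def[symmetric])
qed

lemma simple_common:
  assumes "elem K" "elem K'"
  obtains E where "simple E K" "simple E K'"
proof -
  from assms obtain E E' where E: "simple E K" "simple E' K'" by (auto simp: elem_def)
  then have "grid (E \<union> E')" by (auto simp: simple_def grid_Un)
  then show ?thesis
    using that[of "E \<union> E'"] simple_refine(1)[OF E(1), of "E \<union> E'"] simple_refine(1)[OF E(2), of "E \<union> E'"] by auto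
qed

lemma simple_add:
  assumes "simple E K" "simple E K'"
  shows "simple E (\<lambda>t \<omega>. K t \<omega> + K' t \<omega>)"
proof -
  obtain c c' where c: "\<And>t \<omega>. t \<in> {0..T} \<Longrightarrow> \<omega> \<in> space P \<Longrightarrow> norm (K t \<omega>) \<le> c"
    "\<And>t \<omega>. t \<in> {0..T} \<Longrightarrow> \<omega> \<in> space P \<Longrightarrow> norm (K' t \<omega>) \<le> c'"
    using simple_bounded assms by metis
  show ?thesis
  proof (rule simpleI[where c="c + c'"])
    show "norm (K t \<omega> + K' t \<omega>) \<le> c + c'" if "t \<in> {0..T}" "\<omega> \<in> space P" for t \<omega>
      using c that by (intro norm_triangle_le add_mono)
    fix a t \<omega> assume a: "a \<in> E - {T}" "a < t" "t \<le> nxt E a" "\<omega> \<in> space P"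
    show "K t \<omega> + K' t \<omega> = K (nxt E a) \<omega> + K' (nxt E a) \<omega>"
      using simple_cell[OF assms(1) a] simple_cell[OF assms(2) a] by presburger
  qed (use simple_grid simple_zero simple_measurable assms in \<open>blast intro: borel_measurable_add\<close>)+
qed

lemma simple_scaleR:
  fixes K :: "real \<Rightarrow> 'a \<Rightarrow> 'b::euclidean_space"
  assumes "simple E k" "simple E K"
  shows "simple E (\<lambda>t \<omega>. k t \<omega> *\<^sub>R K t \<omega>)"
proof -
  obtain c c' where c: "\<And>t \<omega>. t \<in> {0..T} \<Longrightarrow> \<omega> \<in> space P \<Longrightarrow> norm (k t \<omega>) \<le> c" "0 \<le> c"
    "\<And>t \<omega>. t \<in> {0..T} \<Longrightarrow> \<omega> \<in> space P \<Longrightarrow> norm (K t \<omega>) \<le> c'"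
    using simple_bounded assms by metis
  show ?thesis
  proof (rule simpleI[where c="c * c'"])
    show "norm (k t \<omega> *\<^sub>R K t \<omega>) \<le> c * c'" if "t \<in> {0..T}" "\<omega> \<in> space P" for t \<omega>
      unfolding norm_scaleR using c(1,3)[OF that] c(2) by (intro mult_mono) auto
    fix a t \<omega> assume a: "a \<in> E - {T}" "a < t" "t \<le> nxt E a" "\<omega> \<in> space P"
    show "k t \<omega> *\<^sub>R K t \<omega> = k (nxt E a) \<omega> *\<^sub>R K (nxt E a) \<omega>"
      using simple_cell[OF assms(1) a] simple_cell[OF assms(2) a] by presburger
  next
    fix a assume a: "a \<in> E - {T}"
    show "(\<lambda>\<omega>. k (nxt E a) \<omega> *\<^sub>R K (nxt E a) \<omega>) \<in> borel_measurable (F a)"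
      using simple_measurable[OF assms(1) a] simple_measurable[OF assms(2) a]
      by (rule borel_measurable_scaleR)
  qed (use simple_grid[OF assms(1)] borel_measurable_scaleR[OF simple_zero[OF assms(1)] simple_zero[OF assms(2)]] in auto)
qed

lemma simple_const: "grid E \<Longrightarrow> simple E (\<lambda>t \<omega>. v)"
  by (rule simpleI[where c="norm v"]) auto

lemma elem_add: "elem K \<Longrightarrow> elem K' \<Longrightarrow> elem (\<lambda>t \<omega>. K t \<omega> + K' t \<omega>)"
  unfolding elem_def[of "\<lambda>t \<omega>. K t \<omega> + K' t \<omega>"] by (blast elim: simple_common intro: simple_add)

lemma elem_scaleR: "elem k \<Longrightarrow> elem K \<Longrightarrow> elem (\<lambda>t \<omega>. k t \<omega> *\<^sub>R K t \<omega>)"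
  unfolding elem_def[of "\<lambda>t \<omega>. k t \<omega> *\<^sub>R K t \<omega>"] by (blast elim: simple_common intro: simple_scaleR)

lemma grid_0T: "grid {0, T}"
  using T_pos by (auto simp: grid_def)

lemma elem_const: "elem (\<lambda>t \<omega>. v)"
  using simple_const[OF grid_0T] by (auto simp: elem_def)

lemma elem_cscaleR: "elem K \<Longrightarrow> elem (\<lambda>t \<omega>. c *\<^sub>R K t \<omega>)"
  using elem_scaleR[OF elem_const] .

lemma elem_diff: "elem K \<Longrightarrow> elem K' \<Longrightarrow> elem (\<lambda>t \<omega>. K t \<omega> - K' t \<omega>)"
  using elem_add[OF _ elem_cscaleR[of K' "-1"]] by auto

lemma eint_add:
  assumes "elem K" "elem K'" "\<omega> \<in> space P"
  shows "eint (\<lambda>t \<omega>. K t \<omega> + K' t \<omega>) X t \<omega> = eint K X t \<omega> + eint K' X t \<omega>"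
proof -
  obtain E where E: "simple E K" "simple E K'" by (rule simple_common[OF assms(1,2)])
  show ?thesis
    using assms(3)
    by (simp add: eint_eq[OF E(1)] eint_eq[OF E(2)] eint_eq[OF simple_add[OF E]] grid_integral_def
        inner_add_left sum.distrib)
qed

lemma eint_diff_right:
  "eint K (\<lambda>t \<omega>. X t \<omega> - Y t \<omega>) t \<omega> = eint K X t \<omega> - eint K Y t \<omega>"
  unfolding eint_def grid_integral_def sum_subtractf[symmetric]
  by (intro sum.cong refl) (simp add: inner_diff_right algebra_simps)

lemma eint_cong_right:
  assumes "elem K" "\<omega> \<in> space P" "t \<in> {0..T}" "\<And>s. s \<in> {0..t} \<Longrightarrow> X s \<omega> = Y s \<omega>"
  shows "eint K X t \<omega> = eint K Y t \<omega>"
proof -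
  obtain E where E: "simple E K" using assms by (auto simp: elem_def)
  have "0 \<le> a" "0 \<le> nxt E a" if "a \<in> E - {T}" for a
    using nxt[OF simple_grid[OF E] that] by linarith+
  then show ?thesis
    unfolding eint_eq[OF E assms(2)] grid_integral_def
    using assms(3,4) by (intro sum.cong refl) auto
qed

text \<open>Up to stopping at \<open>t\<close>, a cell before \<open>a\<close> is complete at both
  times and a cell after \<open>a\<close> has not begun to contribute over the interval, so only the
  term of the cell at \<open>a\<close> survives the difference.\<close>

lemma grid_integral_increment:
  assumes E: "grid E" and a: "a \<in> E - {T}"
  shows "grid_integral E K X (min (nxt E a) t) \<omega> - grid_integral E K X (min a t) \<omega> =
     K (nxt E a) \<omega> \<bullet> (X (min (nxt E a) t) \<omega> - X (min a t) \<omega>)"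
proof -
  let ?g = "\<lambda>b. K (nxt E b) \<omega> \<bullet> (X (min (nxt E b) (min (nxt E a) t)) \<omega> - X (min b (min (nxt E a) t)) \<omega>)
    - K (nxt E b) \<omega> \<bullet> (X (min (nxt E b) (min a t)) \<omega> - X (min b (min a t)) \<omega>)"
  have "grid_integral E K X (min (nxt E a) t) \<omega> - grid_integral E K X (min a t) \<omega> = (\<Sum>b\<in>E - {T}. ?g b)"
    unfolding grid_integral_def sum_subtractf by simp
  also have "\<dots> = (\<Sum>b\<in>{a}. ?g b)"
  proof (rule sum.mono_neutral_right)
    show "finite (E - {T})" "{a} \<subseteq> E - {T}" using E a by (auto simp: grid_def)
    show "\<forall>b\<in>E - {T} - {a}. ?g b = 0"
    proof
      fix b assume b: "b \<in> E - {T} - {a}"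
      then consider "b < a" "nxt E b \<le> a" | "a < b" "nxt E a \<le> b"
        using nxt(7)[OF E, of b a] nxt(7)[OF E a, of b] a by force
      then show "?g b = 0"
      proof cases
        case 1
        have "min (nxt E b) (min (nxt E a) t) = min (nxt E b) (min a t)" "min b (min (nxt E a) t) = min b (min a t)"
          using 1 nxt(2)[OF E a] by auto
        then show ?thesis by simp
      next
        case 2
        have "min (nxt E b) (min (nxt E a) t) = min (nxt E a) t" "min b (min (nxt E a) t) = min (nxt E a) t"
          "min (nxt E b) (min a t) = min a t" "min b (min a t) = min a t"
          using 2 nxt(2)[OF E a] nxt(2)[OF E, of b] b by auto
        then show ?thesis by simp
      qed
    qed
  qed
  also have "\<dots> = K (nxt E a) \<omega> \<bullet> (X (min (nxt E a) t) \<omega> - X (min a t) \<omega>)"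
  proof -
    have "min (nxt E a) (min (nxt E a) t) = min (nxt E a) t" "min a (min (nxt E a) t) = min a t"
      "min (nxt E a) (min a t) = min a t" "min a (min a t) = min a t"
      using nxt(2)[OF E a] by auto
    then show ?thesis by simp
  qed
  finally show ?thesis .
qed

text \<open>On a common grid each increment of \<open>eint K X\<close> is the single term given by
  \<open>grid_integral_increment\<close>, and the scalar \<open>k\<close> merges with
  \<open>K\<close>.\<close>

lemma eint_assoc:
  assumes "elem k" "elem K" "\<omega> \<in> space P"
  shows "eint k (eint K X) t \<omega> = eint (\<lambda>t \<omega>. k t \<omega> *\<^sub>R K t \<omega>) X t \<omega>"
proof -
  obtain E where E: "simple E k" "simple E K" by (rule simple_common[OF assms(1,2)])
  show ?thesis
    unfolding eint_eq[OF E(1) assms(3)] eint_eq[OF simple_scaleR[OF E] assms(3)] grid_integral_def[of _ k]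
      grid_integral_def[of _ "\<lambda>t \<omega>. k t \<omega> *\<^sub>R K t \<omega>"] eint_eq[OF E(2) assms(3)]
    by (intro sum.cong refl) (simp add: grid_integral_increment[OF simple_grid[OF E(1)]])
qed

text \<open>The cells of the grid, enumerated by \<open>e\<close>, serve as the intervals of the
  elementary integrand; at a given \<open>t > 0\<close> exactly one of them is active.\<close>

lemma elementary_integralI:
  assumes "elem K" "\<And>t \<omega>. t \<in> {0..T} \<Longrightarrow> \<omega> \<in> space P \<Longrightarrow> Z t \<omega> = eint K X t \<omega>"
  shows "elementary_integral P F T X K Z"
proof -
  obtain E where E: "simple E K" using assms by (auto simp: elem_def)
  have gE: "grid E" using E by (rule simple_grid)
  obtain c where c: "\<And>t \<omega>. t \<in> {0..T} \<Longrightarrow> \<omega> \<in> space P \<Longrightarrow> norm (K t \<omega>) \<le> c"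
    using simple_bounded[OF E] by metis
  obtain k and e :: "nat \<Rightarrow> real" where e: "bij_betw e {..<k} (E - {T})"
    using ex_bij_betw_nat_finite[of "E - {T}"] gE by (auto simp: grid_def atLeast0LessThan)
  have eE: "e i \<in> E - {T}" if "i < k" for i using e that by (auto simp: bij_betw_def)
  show ?thesis
    unfolding elementary_integral_def
  proof (intro exI conjI ballI allI impI)
    show "K 0 \<in> borel_measurable (F 0)" by (rule simple_zero[OF E])
    show "norm (K 0 \<omega>) \<le> c" if "\<omega> \<in> space P" for \<omega> using c that T_pos by auto
    fix i assume i: "i < k"
    note n = nxt[OF gE eE[OF i]]
    show "0 \<le> e i" "e i < nxt E (e i)" "nxt E (e i) \<le> T" using n by auto
    show "K (nxt E (e i)) \<in> borel_measurable (F (e i))" by (rule simple_measurable[OF E eE[OF i]])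
    show "norm (K (nxt E (e i)) \<omega>) \<le> c" if "\<omega> \<in> space P" for \<omega> using c that n by auto
  next
    fix t \<omega> assume t: "t \<in> {0..T}" "\<omega> \<in> space P"
    have "(\<Sum>i<k. K (nxt E (e i)) \<omega> \<bullet> (X (min (nxt E (e i)) t) \<omega> - X (min (e i) t) \<omega>)) = grid_integral E K X t \<omega>"
      unfolding grid_integral_def by (rule sum.reindex_bij_betw[OF e])
    then show "Z t \<omega> = (\<Sum>i<k. K (nxt E (e i)) \<omega> \<bullet> (X (min (nxt E (e i)) t) \<omega> - X (min (e i) t) \<omega>))"
      using assms(2)[OF t] eint_eq[OF E t(2)] by simp
    have "(\<Sum>i<k. indicat_real {e i<..nxt E (e i)} t *\<^sub>R K (nxt E (e i)) \<omega>) =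
      (\<Sum>a\<in>E - {T}. indicat_real {a<..nxt E a} t *\<^sub>R K (nxt E a) \<omega>)"
      by (rule sum.reindex_bij_betw[OF e])
    \<comment> \<open>At time zero no left-open cell is active, and the separate time-zero term
      supplies \<open>K 0 \<omega>\<close>.\<close>
    also have "\<dots> = (if t = 0 then 0 else K t \<omega>)"
    proof (cases "t = 0")
      case True
      then show ?thesis using gE by (force simp: indicator_def grid_def intro!: sum.neutral)
    next
      case False
      then obtain a where a: "a \<in> E - {T}" "a < t" "t \<le> nxt E a"
        using grid_cell[OF gE, of t] t by auto
      have "(\<Sum>a\<in>E - {T}. indicat_real {a<..nxt E a} t *\<^sub>R K (nxt E a) \<omega>) =
        (\<Sum>a\<in>{a}. indicat_real {a<..nxt E a} t *\<^sub>R K (nxt E a) \<omega>)"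
      proof (rule sum.mono_neutral_right)
        show "finite (E - {T})" "{a} \<subseteq> E - {T}" using gE a by (auto simp: grid_def)
        show "\<forall>b\<in>E - {T} - {a}. indicat_real {b<..nxt E b} t *\<^sub>R K (nxt E b) \<omega> = 0"
        proof
          fix b assume "b \<in> E - {T} - {a}"
          then have "nxt E b \<le> a \<or> nxt E a \<le> b"
            using nxt(7)[OF gE, of b a] nxt(7)[OF gE a(1), of b] a by force
          then show "indicat_real {b<..nxt E b} t *\<^sub>R K (nxt E b) \<omega> = 0"
            using a by (auto simp: indicator_def)
        qed
      qed
      also have "\<dots> = K t \<omega>"
      proof -
        have "K t \<omega> = K (nxt E a) \<omega>" using simple_cell[OF E a t(2)] .
        then show ?thesis using a by simp
      qed
      finally show ?thesis using False by simp
    qed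
    finally show "K t \<omega> = indicat_real {0} t *\<^sub>R K 0 \<omega> +
       (\<Sum>i<k. indicat_real {e i<..nxt E (e i)} t *\<^sub>R K (nxt E (e i)) \<omega>)"
      by auto
  qed
qed

text \<open>The intervals of an elementary integrand may overlap. Cutting along all their end points
  gives a grid on whose cells the integrand is constant.\<close>

lemma elementary_integralD:
  assumes "elementary_integral P F T X H Z"
  shows "elem H" "\<And>t \<omega>. t \<in> {0..T} \<Longrightarrow> \<omega> \<in> space P \<Longrightarrow> Z t \<omega> = eint H X t \<omega>"
proof -
  from assms obtain h0 and k :: nat and s r h c where *:
    "h0 \<in> borel_measurable (F 0)" "\<forall>\<omega>\<in>space P. norm (h0 \<omega>) \<le> c"
    "\<forall>i<k. 0 \<le> s i \<and> s i < r i \<and> r i \<le> T \<and>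
         h i \<in> borel_measurable (F (s i)) \<and> (\<forall>\<omega>\<in>space P. norm (h i \<omega>) \<le> c)"
    "\<forall>t\<in>{0..T}. \<forall>\<omega>\<in>space P.
           H t \<omega> = indicat_real {0} t *\<^sub>R h0 \<omega> + (\<Sum>i<k. indicat_real {s i<..r i} t *\<^sub>R h i \<omega>) \<and>
           Z t \<omega> = (\<Sum>i<k. h i \<omega> \<bullet> (X (min (r i) t) \<omega> - X (min (s i) t) \<omega>))"
    unfolding elementary_integral_def by (elim exE conjE) (rule that)
  note h0 = *(1,2)
  have h: "0 \<le> s i \<and> s i < r i \<and> r i \<le> T \<and>
         h i \<in> borel_measurable (F (s i)) \<and> (\<forall>\<omega>\<in>space P. norm (h i \<omega>) \<le> c)" if "i < k" for i
    using *(3) that by blast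
  have H: "H t \<omega> = indicat_real {0} t *\<^sub>R h0 \<omega> + (\<Sum>i<k. indicat_real {s i<..r i} t *\<^sub>R h i \<omega>)"
    and Z: "Z t \<omega> = (\<Sum>i<k. h i \<omega> \<bullet> (X (min (r i) t) \<omega> - X (min (s i) t) \<omega>))"
    if "t \<in> {0..T}" "\<omega> \<in> space P" for t \<omega>
    using *(4) that by blast+
  define E where "E = {0, T} \<union> s ` {..<k} \<union> r ` {..<k}"
  have gE: "grid E" using h T_pos by (fastforce simp: grid_def E_def)
  have sr: "s i \<in> E" "r i \<in> E" if "i < k" for i using that by (auto simp: E_def)
  \<comment> \<open>Since \<open>s i\<close> and \<open>r i\<close> are grid points, a time
    \<open>t\<close> in the cell at \<open>a\<close> lies in \<open>{s i<..r i}\<close> exactly if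
    \<open>a\<close> lies in \<open>{s i..<r i}\<close>. The right-hand side depends on
    \<open>a\<close> only and is known at time \<open>a\<close>.\<close>
  have cellval: "H t \<omega> = (\<Sum>i<k. indicat_real {s i..<r i} a *\<^sub>R h i \<omega>)"
    if a: "a \<in> E - {T}" and t: "t \<in> {a<..nxt E a}" and \<omega>: "\<omega> \<in> space P" for a t \<omega>
  proof -
    have "t \<in> {0..T}" "t \<noteq> 0" using nxt[OF gE a] t by auto
    then have "H t \<omega> = (\<Sum>i<k. indicat_real {s i<..r i} t *\<^sub>R h i \<omega>)" using H[of t \<omega>] \<omega> by auto
    also have "\<dots> = (\<Sum>i<k. indicat_real {s i..<r i} a *\<^sub>R h i \<omega>)"
    proof (intro sum.cong refl)
      fix i assume "i \<in> {..<k}"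
      then have i: "i < k" by simp
      have "s i < t \<longleftrightarrow> s i \<le> a" using nxt(7)[OF gE a sr(1)[OF i]] t by force
      moreover have "t \<le> r i \<longleftrightarrow> a < r i" using nxt(7)[OF gE a sr(2)[OF i]] t by force
      ultimately show "indicat_real {s i<..r i} t *\<^sub>R h i \<omega> = indicat_real {s i..<r i} a *\<^sub>R h i \<omega>"
        by (auto simp: indicator_def)
    qed
    finally show ?thesis .
  qed
  have sim: "simple E H"
  proof (rule simpleI[where c="c + (\<Sum>i<k. c)"])
    show "grid E" by fact
    show "H 0 \<in> borel_measurable (F 0)"
    proof (subst measurable_cong[where g=h0])
      fix \<omega> assume "\<omega> \<in> space (F 0)"
      then have "\<omega> \<in> space P" using space_F T_pos by auto
      moreover have "indicat_real {s i<..r i} 0 = 0" if "i < k" for i using h[OF that] by auto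
      ultimately show "H 0 \<omega> = h0 \<omega>" using H[of 0 \<omega>] T_pos by simp
    qed fact
    show "norm (H t \<omega>) \<le> c + (\<Sum>i<k. c)" if t: "t \<in> {0..T}" "\<omega> \<in> space P" for t \<omega>
    proof -
      have "norm (indicat_real {0} t *\<^sub>R h0 \<omega>) \<le> c"
        using h0 t order_trans[OF norm_ge_zero] by (force simp: indicator_def)
      moreover have "norm (\<Sum>i<k. indicat_real {s i<..r i} t *\<^sub>R h i \<omega>) \<le> (\<Sum>i<k. c)"
      proof (rule order_trans[OF norm_sum sum_mono])
        fix i assume "i \<in> {..<k}"
        then show "norm (indicat_real {s i<..r i} t *\<^sub>R h i \<omega>) \<le> c"
          using h[of i] t order_trans[OF norm_ge_zero] by (force simp: indicator_def)
      qed
      ultimately show "norm (H t \<omega>) \<le> c + (\<Sum>i<k. c)"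
        unfolding H[OF t] by (rule norm_triangle_le[OF add_mono])
    qed
    fix a assume a: "a \<in> E - {T}"
    show "H (nxt E a) \<in> borel_measurable (F a)"
    proof (subst measurable_cong[where g="\<lambda>\<omega>. \<Sum>i<k. indicat_real {s i..<r i} a *\<^sub>R h i \<omega>"])
      show "H (nxt E a) \<omega> = (\<Sum>i<k. indicat_real {s i..<r i} a *\<^sub>R h i \<omega>)" if "\<omega> \<in> space (F a)" for \<omega>
        using cellval[OF a, of "nxt E a" \<omega>] that nxt[OF gE a] space_F[of a] by auto
      show "(\<lambda>\<omega>. \<Sum>i<k. indicat_real {s i..<r i} a *\<^sub>R h i \<omega>) \<in> borel_measurable (F a)"
      proof (intro borel_measurable_sum)
        fix i assume "i \<in> {..<k}"
        then have i: "i < k" by simp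
        show "(\<lambda>\<omega>. indicat_real {s i..<r i} a *\<^sub>R h i \<omega>) \<in> borel_measurable (F a)"
        proof (cases "a \<in> {s i..<r i}")
          case True
          have "h i \<in> borel_measurable (F a)"
            by (rule measurable_F_mono[of _ "s i"]) (use h[OF i] True nxt[OF gE a] in auto)
          then show ?thesis using True by simp
        qed simp
      qed
    qed
    fix t \<omega> assume "a < t" "t \<le> nxt E a" "\<omega> \<in> space P"
    then show "H t \<omega> = H (nxt E a) \<omega>"
      using cellval[OF a, of t \<omega>] cellval[OF a, of "nxt E a" \<omega>] nxt[OF gE a] by auto
  qed
  then show "elem H" by (auto simp: elem_def)
  fix t \<omega> assume t: "t \<in> {0..T}" "\<omega> \<in> space P"
  have "eint H X t \<omega> = (\<Sum>a\<in>E - {T}. \<Sum>i<k. (if a \<in> {s i..<r i} then h i \<omega> \<bullet> (X (min (nxt E a) t) \<omega> - X (min a t) \<omega>) else 0))"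
    unfolding eint_eq[OF sim t(2)] grid_integral_def
  proof (intro sum.cong refl)
    fix a assume a: "a \<in> E - {T}"
    show "H (nxt E a) \<omega> \<bullet> (X (min (nxt E a) t) \<omega> - X (min a t) \<omega>) =
      (\<Sum>i<k. (if a \<in> {s i..<r i} then h i \<omega> \<bullet> (X (min (nxt E a) t) \<omega> - X (min a t) \<omega>) else 0))"
    proof -
      have eq: "H (nxt E a) \<omega> = (\<Sum>i<k. indicat_real {s i..<r i} a *\<^sub>R h i \<omega>)"
        using cellval[OF a, of "nxt E a" \<omega>] nxt[OF gE a] t by auto
      show ?thesis unfolding eq inner_sum_left by (intro sum.cong refl) (simp add: indicator_def)
    qed
  qed
  \<comment> \<open>After the interchange, the cells inside one interval telescope to the increment
    over that interval.\<close>
  also have "\<dots> = (\<Sum>i<k. \<Sum>a\<in>E - {T}. (if a \<in> {s i..<r i} then h i \<omega> \<bullet> (X (min (nxt E a) t) \<omega> - X (min a t) \<omega>) else 0))"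
    by (rule sum.swap)
  also have "\<dots> = (\<Sum>i<k. h i \<omega> \<bullet> (X (min (r i) t) \<omega> - X (min (s i) t) \<omega>))"
  proof (intro sum.cong refl)
    fix i assume "i \<in> {..<k}"
    then have i: "i < k" by simp
    have eq: "(E - {T}) \<inter> {s i..<r i} = E \<inter> {s i..<r i}" using h[OF i] by auto
    have "(\<Sum>a\<in>E - {T}. (if a \<in> {s i..<r i} then h i \<omega> \<bullet> (X (min (nxt E a) t) \<omega> - X (min a t) \<omega>) else 0)) =
      (\<Sum>a\<in>E \<inter> {s i..<r i}. h i \<omega> \<bullet> (X (min (nxt E a) t) \<omega> - X (min a t) \<omega>))"
      using gE by (subst sum.inter_restrict[symmetric]) (auto simp: grid_def eq)
    also have "\<dots> = h i \<omega> \<bullet> (X (min (r i) t) \<omega> - X (min (s i) t) \<omega>)"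
      using grid_telescope[OF gE sr[OF i], of "\<lambda>b. X (min b t) \<omega>"] h[OF i]
      by (simp add: inner_sum_right[symmetric])
    finally show "(\<Sum>a\<in>E - {T}. (if a \<in> {s i..<r i} then h i \<omega> \<bullet> (X (min (nxt E a) t) \<omega> - X (min a t) \<omega>) else 0)) =
      h i \<omega> \<bullet> (X (min (r i) t) \<omega> - X (min (s i) t) \<omega>)" .
  qed
  finally show "Z t \<omega> = eint H X t \<omega>" using Z[OF t] by simp
qed

end

section \<open>Cadlag paths and uniform convergence in probability\<close>

lemma cadlag_right: "cadlag_on T x \<Longrightarrow> 0 \<le> t \<Longrightarrow> t < T \<Longrightarrow> (x \<longlongrightarrow> x t) (at_right t)"
  by (simp add: cadlag_on_def)

lemma cadlag_left:
  assumes "cadlag_on T x" "0 < t" "t \<le> T"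
  obtains l where "(x \<longlongrightarrow> l) (at_left t)"
  using assms unfolding cadlag_on_def by (metis greaterThanAtMost_iff)

lemma cadlag_onI:
  assumes "\<And>t. 0 \<le> t \<Longrightarrow> t < T \<Longrightarrow> (x \<longlongrightarrow> x t) (at_right t)"
    and "\<And>t. 0 < t \<Longrightarrow> t \<le> T \<Longrightarrow> \<exists>l. (x \<longlongrightarrow> l) (at_left t)"
  shows "cadlag_on T x"
  using assms unfolding cadlag_on_def by auto

lemma cadlag_on_add:
  fixes x y :: "real \<Rightarrow> 'b::topological_monoid_add"
  assumes "cadlag_on T x" "cadlag_on T y"
  shows "cadlag_on T (\<lambda>t. x t + y t)"
proof (rule cadlag_onI)
  fix t assume t: "0 < t" "t \<le> T"
  obtain l where "(x \<longlongrightarrow> l) (at_left t)" by (rule cadlag_left[OF assms(1) t])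
  moreover obtain m where "(y \<longlongrightarrow> m) (at_left t)" by (rule cadlag_left[OF assms(2) t])
  ultimately show "\<exists>l. ((\<lambda>t. x t + y t) \<longlongrightarrow> l) (at_left t)"
    using tendsto_add by blast
qed (intro tendsto_add cadlag_right[OF assms(1)] cadlag_right[OF assms(2)])

lemma cadlag_on_inner:
  fixes x :: "real \<Rightarrow> 'b::real_inner"
  assumes "cadlag_on T x"
  shows "cadlag_on T (\<lambda>t. h \<bullet> x t)"
proof (rule cadlag_onI)
  fix t assume t: "0 < t" "t \<le> T"
  obtain l where "(x \<longlongrightarrow> l) (at_left t)" by (rule cadlag_left[OF assms(1) t])
  then have "((\<lambda>t. h \<bullet> x t) \<longlongrightarrow> h \<bullet> l) (at_left t)" by (intro tendsto_inner tendsto_const)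
  then show "\<exists>l. ((\<lambda>t. h \<bullet> x t) \<longlongrightarrow> l) (at_left t)" by blast
qed (intro tendsto_inner tendsto_const cadlag_right[OF assms(1)])

lemma cadlag_on_const: "cadlag_on T (\<lambda>t. c)"
  by (auto simp: cadlag_on_def)

lemma cadlag_on_sum:
  fixes x :: "'i \<Rightarrow> real \<Rightarrow> real"
  assumes "\<And>i. i \<in> I \<Longrightarrow> cadlag_on T (x i)"
  shows "cadlag_on T (\<lambda>t. \<Sum>i\<in>I. x i t)"
  using assms
  by (induction I rule: infinite_finite_induct) (auto intro: cadlag_on_add cadlag_on_const)

lemma cadlag_on_cmult:
  fixes x :: "real \<Rightarrow> real"
  shows "cadlag_on T x \<Longrightarrow> cadlag_on T (\<lambda>t. c * x t)"
  using cadlag_on_inner[of T x c] by simp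

lemma cadlag_on_diff:
  fixes x y :: "real \<Rightarrow> 'b::real_normed_vector"
  assumes "cadlag_on T x" "cadlag_on T y"
  shows "cadlag_on T (\<lambda>t. x t - y t)"
proof (rule cadlag_onI)
  fix t assume t: "0 < t" "t \<le> T"
  obtain l where "(x \<longlongrightarrow> l) (at_left t)" by (rule cadlag_left[OF assms(1) t])
  moreover obtain m where "(y \<longlongrightarrow> m) (at_left t)" by (rule cadlag_left[OF assms(2) t])
  ultimately show "\<exists>l. ((\<lambda>t. x t - y t) \<longlongrightarrow> l) (at_left t)"
    using tendsto_diff by blast
qed (intro tendsto_diff cadlag_right[OF assms(1)] cadlag_right[OF assms(2)])

lemma cadlag_on_stop:
  fixes x :: "real \<Rightarrow> 'b::t2_space"
  assumes x: "cadlag_on T x" and b: "0 \<le> b" "b \<le> T"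
  shows "cadlag_on T (\<lambda>t. x (min b t))"
  unfolding cadlag_on_def
proof (intro conjI ballI)
  fix t assume t: "t \<in> {0..<T}"
  show "((\<lambda>t. x (min b t)) \<longlongrightarrow> x (min b t)) (at_right t)"
  proof (cases "t < b")
    case True
    have "(x \<longlongrightarrow> x t) (at_right t)" using x t by (auto simp: cadlag_on_def)
    moreover have "\<forall>\<^sub>F s in at_right t. x (min b s) = x s"
      unfolding eventually_at_right_field using True by (intro exI[of _ b]) auto
    ultimately show ?thesis using True by (simp add: tendsto_cong)
  next
    case False
    have "\<forall>\<^sub>F s in at_right t. x (min b s) = x b"
      unfolding eventually_at_right_field using False t by (intro exI[of _ T]) auto
    then show ?thesis using False by (simp add: tendsto_cong)
  qed
next
  fix t assume t: "t \<in> {0<..T}"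
  show "\<exists>l. ((\<lambda>t. x (min b t)) \<longlongrightarrow> l) (at_left t)"
  proof (cases "t \<le> b")
    case True
    obtain l where "(x \<longlongrightarrow> l) (at_left t)" using cadlag_left[OF x] t by auto
    moreover have "\<forall>\<^sub>F s in at_left t. x (min b s) = x s"
      unfolding eventually_at_left_field using True by (intro exI[of _ "t - 1"]) auto
    ultimately show ?thesis by (metis tendsto_cong)
  next
    case False
    have "\<forall>\<^sub>F s in at_left t. x (min b s) = x b"
      unfolding eventually_at_left_field using False by (intro exI[of _ b]) auto
    then have "((\<lambda>t. x (min b t)) \<longlongrightarrow> x b) (at_left t)" by (simp add: tendsto_cong)
    then show ?thesis by blast
  qed
qed

text \<open>Right-continuity carries membership from rational times to every \<open>t < T\<close>.
  The time \<open>T\<close> has no right neighbourhood inside the interval and so belongs to the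
  test set.\<close>

lemma cadlag_on_closed:
  fixes x :: "real \<Rightarrow> 'b::topological_space"
  assumes x: "cadlag_on T x" and C: "closed C" and D: "\<And>t. t \<in> insert T ({0..T} \<inter> \<rat>) \<Longrightarrow> x t \<in> C"
    and t: "t \<in> {0..T}"
  shows "x t \<in> C"
proof (rule ccontr)
  assume n: "x t \<notin> C"
  then have "t \<noteq> T" using D by auto
  then have t': "0 \<le> t" "t < T" using t by auto
  then have "(x \<longlongrightarrow> x t) (at_right t)" using x by (auto simp: cadlag_on_def)
  then have "\<forall>\<^sub>F s in at_right t. x s \<in> - C"
    using C n by (intro topological_tendstoD) auto
  then obtain b where b: "b > t" "\<forall>y>t. y < b \<longrightarrow> x y \<in> - C"
    by (auto simp: eventually_at_right_field)
  obtain r where r: "r \<in> \<rat>" "t < r" "r < min b T" using Rats_dense_in_real[of t "min b T"] b t' by auto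
  then have "x r \<in> C" using D t' by auto
  then show False using b r by auto
qed

text \<open>Left limits are the delicate part: the left limits \<open>l k\<close> of the
  approximants form a Cauchy sequence, and its limit \<open>L\<close> is the left limit of
  \<open>y\<close>.\<close>

lemma cadlag_on_uniform_limit:
  fixes x :: "nat \<Rightarrow> real \<Rightarrow> real"
  assumes x: "\<And>k. cadlag_on T (x k)"
    and lim: "\<And>e. e > 0 \<Longrightarrow> \<forall>\<^sub>F k in sequentially. \<forall>t\<in>{0..T}. \<bar>x k t - y t\<bar> \<le> e"
  shows "cadlag_on T y"
  unfolding cadlag_on_def
proof (intro conjI ballI)
  fix t assume t: "t \<in> {0..<T}"
  show "(y \<longlongrightarrow> y t) (at_right t)"
  proof (rule tendstoI)
    fix e :: real assume "e > 0"
    then obtain k where k: "\<forall>t\<in>{0..T}. \<bar>x k t - y t\<bar> \<le> e / 3"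
      using eventually_happens[OF lim[of "e / 3"]] by auto
    have "(x k \<longlongrightarrow> x k t) (at_right t)" using x t by (auto simp: cadlag_on_def)
    then have "\<forall>\<^sub>F s in at_right t. dist (x k s) (x k t) < e / 3"
      using \<open>e > 0\<close> by (intro tendstoD) auto
    moreover have "\<forall>\<^sub>F s in at_right t. s \<in> {0..T}"
      unfolding eventually_at_right_field using t by (intro exI[of _ T]) auto
    ultimately show "\<forall>\<^sub>F s in at_right t. dist (y s) (y t) < e"
    proof eventually_elim
      case (elim s)
      have "\<bar>x k s - y s\<bar> \<le> e / 3" "\<bar>x k t - y t\<bar> \<le> e / 3" using k elim t by auto
      then show ?case using elim unfolding dist_real_def by linarith
    qed
  qed
next
  fix t assume t: "t \<in> {0<..T}"
  have "\<forall>k. \<exists>l. (x k \<longlongrightarrow> l) (at_left t)" using cadlag_left[OF x] t by (metis greaterThanAtMost_iff)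
  then obtain l where l: "\<And>k. (x k \<longlongrightarrow> l k) (at_left t)" by metis
  have ev: "\<forall>\<^sub>F s in at_left t. s \<in> {0..T}"
    unfolding eventually_at_left_field using t by (intro exI[of _ 0]) auto
  have nt: "at_left t \<noteq> bot" by (rule trivial_limit_at_left_real)
  have "Cauchy l"
  proof (rule metric_CauchyI)
    fix e :: real assume "e > 0"
    then obtain N where N: "\<And>k. k \<ge> N \<Longrightarrow> \<forall>t\<in>{0..T}. \<bar>x k t - y t\<bar> \<le> e / 4"
      using lim[of "e / 4"] by (auto simp: eventually_sequentially)
    have "dist (l m) (l n) < e" if "m \<ge> N" "n \<ge> N" for m n
    proof -
      have "\<forall>\<^sub>F s in at_left t. \<bar>x m s - x n s\<bar> \<le> e / 2"
        using ev
      proof eventually_elim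
        case (elim s)
        have "\<bar>x m s - y s\<bar> \<le> e / 4" "\<bar>x n s - y s\<bar> \<le> e / 4" using N that elim by blast+
        then show ?case by linarith
      qed
      then have "\<bar>l m - l n\<bar> \<le> e / 2"
        using nt by (intro tendsto_upperbound[OF tendsto_rabs[OF tendsto_diff[OF l l]]]) auto
      then show ?thesis using \<open>e > 0\<close> by (simp add: dist_real_def)
    qed
    then show "\<exists>M. \<forall>m\<ge>M. \<forall>n\<ge>M. dist (l m) (l n) < e" by blast
  qed
  then obtain L where L: "l \<longlonglongrightarrow> L" using Cauchy_convergent_iff convergent_def by blast
  have "(y \<longlongrightarrow> L) (at_left t)"
  proof (rule tendstoI)
    fix e :: real assume "e > 0"
    have "\<forall>\<^sub>F k in sequentially. dist (l k) L < e / 3" using L \<open>e > 0\<close> by (intro tendstoD) auto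
    then obtain k where k: "\<forall>t\<in>{0..T}. \<bar>x k t - y t\<bar> \<le> e / 3" "dist (l k) L < e / 3"
      using eventually_happens[OF eventually_conj[OF lim[of "e / 3"]]] \<open>e > 0\<close> by auto
    have "\<forall>\<^sub>F s in at_left t. dist (x k s) (l k) < e / 3"
      using \<open>e > 0\<close> l by (intro tendstoD) auto
    with ev show "\<forall>\<^sub>F s in at_left t. dist (y s) L < e"
    proof eventually_elim
      case (elim s)
      have "\<bar>x k s - y s\<bar> \<le> e / 3" using k elim by auto
      then show ?case using elim k unfolding dist_real_def by linarith
    qed
  qed
  then show "\<exists>l. (y \<longlongrightarrow> l) (at_left t)" by blast
qed

context filtered_space begin

text \<open>All null sets belong to \<open>F 0\<close>, hence to \<open>F t\<close>, and by
  completeness every subset of a null set is a null set. A change on a null set therefore keeps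
  measurability.\<close>

lemma measurable_F_AE:
  fixes f g :: "'a \<Rightarrow> 'b::topological_space"
  assumes f: "f \<in> borel_measurable (F t)" and t: "t \<in> {0..T}" and eq: "AE \<omega> in P. f \<omega> = g \<omega>"
  shows "g \<in> borel_measurable (F t)"
proof -
  have comp: "complete_measure P" and null: "null_sets P \<subseteq> sets (F t)"
    using usual F_mono[of 0 t] t by (auto simp: usual_conditions_def)
  obtain N where N: "N \<in> null_sets P" "{\<omega> \<in> space P. f \<omega> \<noteq> g \<omega>} \<subseteq> N"
    using AE_E[OF eq] by (metis null_setsI)
  have "g -` A \<inter> space (F t) \<in> sets (F t)" if "A \<in> sets borel" for A
  proof -
    have eq: "g -` A \<inter> space (F t) = (f -` A \<inter> space (F t) - N) \<union> (g -` A \<inter> space P \<inter> N)"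
      using N(2) space_F[OF t] by auto
    have "g -` A \<inter> space P \<inter> N \<in> sets P"
      by (rule complete_measure.complete[OF comp _ N(1)]) auto
    then have "g -` A \<inter> space P \<inter> N \<in> null_sets P"
      by (rule null_sets_subset[OF N(1)]) auto
    then have "g -` A \<inter> space P \<inter> N \<in> sets (F t)" using null by blast
    moreover have "f -` A \<inter> space (F t) - N \<in> sets (F t)"
      using measurable_sets[OF f that] N(1) null by auto
    ultimately show ?thesis unfolding eq by auto
  qed
  then show ?thesis by (auto simp: measurable_def)
qed

section \<open>A metric for uniform convergence in probability\<close>

definition dtimes :: "real set" where "dtimes = insert T ({0..T} \<inter> \<rat>)"

lemma dtimes: "countable dtimes" "dtimes \<subseteq> {0..T}" "T \<in> dtimes" "0 \<in> dtimes" "dtimes \<noteq> {}"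
  using T_pos by (auto simp: dtimes_def intro: countable_Int2 countable_rat)

definition meas_proc :: "('a, real) process \<Rightarrow> bool" where
  "meas_proc X \<longleftrightarrow> (\<forall>t\<in>{0..T}. X t \<in> borel_measurable P)"

abbreviation adc :: "('a, 'b::topological_space) process \<Rightarrow> bool" where
  "adc X \<equiv> adapted_cadlag P F T X"

text \<open>A supremum over countably many times is measurable, and for cadlag paths it controls all
  of \<open>{0..T}\<close>. Capping at one makes it integrable, so that its mean
  \<open>ucp_norm\<close> metrizes uniform convergence in probability of adapted cadlag processes,
  see \<open>ucp_iff\<close>.\<close>

definition csup :: "('a, real) process \<Rightarrow> 'a \<Rightarrow> real" where
  "csup X \<omega> = (SUP t\<in>dtimes. min 1 \<bar>X t \<omega>\<bar>)"

definition ucp_norm :: "('a, real) process \<Rightarrow> real" where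
  "ucp_norm X = (\<integral>\<omega>. csup X \<omega> \<partial>P)"

lemma adc_meas_proc: "adc X \<Longrightarrow> meas_proc X"
  by (auto simp: adapted_cadlag_def adapted_def meas_proc_def intro: measurable_F_P)

lemma adc_measurable: "adc X \<Longrightarrow> t \<in> {0..T} \<Longrightarrow> X t \<in> borel_measurable (F t)"
  by (auto simp: adapted_cadlag_def adapted_def)

lemma adc_cadlag: "adc X \<Longrightarrow> AE \<omega> in P. cadlag_on T (\<lambda>t. X t \<omega>)"
  by (auto simp: adapted_cadlag_def)

lemma meas_proc_measurable: "meas_proc X \<Longrightarrow> t \<in> dtimes \<Longrightarrow> X t \<in> borel_measurable P"
  using dtimes by (auto simp: meas_proc_def)

lemma bdd_csup: "bdd_above ((\<lambda>t. min 1 \<bar>X t \<omega>\<bar>) ` dtimes)" for X :: "('a, real) process"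
  by (rule bdd_aboveI[of _ 1]) auto

lemma csup_upper: "t \<in> dtimes \<Longrightarrow> min 1 \<bar>X t \<omega>\<bar> \<le> csup X \<omega>"
  unfolding csup_def by (rule cSUP_upper[OF _ bdd_csup])

lemma csup_least: "(\<And>t. t \<in> dtimes \<Longrightarrow> min 1 \<bar>X t \<omega>\<bar> \<le> c) \<Longrightarrow> csup X \<omega> \<le> c"
  unfolding csup_def by (rule cSUP_least[OF dtimes(5)])

lemma csup_bounds: "0 \<le> csup X \<omega>" "csup X \<omega> \<le> 1"
proof -
  show "csup X \<omega> \<le> 1" by (rule csup_least) auto
  show "0 \<le> csup X \<omega>" using csup_upper[OF dtimes(3), of X \<omega>] by linarith
qed

lemma csup_abs: "t \<in> dtimes \<Longrightarrow> csup X \<omega> < 1 \<Longrightarrow> \<bar>X t \<omega>\<bar> \<le> csup X \<omega>"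
  using csup_upper[of t X \<omega>] by (auto simp: min_def split: if_splits)

lemma csup_measurable: "meas_proc X \<Longrightarrow> csup X \<in> borel_measurable P"
  unfolding csup_def using dtimes(1) meas_proc_measurable[of X] bdd_csup by measurable

lemma csup_integrable: "meas_proc X \<Longrightarrow> integrable P (csup X)"
  using csup_measurable csup_bounds by (intro integrable_const_bound[where B=1]) auto

lemma ucp_norm_nonneg: "0 \<le> ucp_norm X"
  unfolding ucp_norm_def using csup_bounds by (intro integral_nonneg_AE) auto

lemma meas_proc_add: "meas_proc X \<Longrightarrow> meas_proc Y \<Longrightarrow> meas_proc (\<lambda>t \<omega>. X t \<omega> + Y t \<omega>)"
  by (auto simp: meas_proc_def intro: borel_measurable_add)

lemma meas_proc_diff: "meas_proc X \<Longrightarrow> meas_proc Y \<Longrightarrow> meas_proc (\<lambda>t \<omega>. X t \<omega> - Y t \<omega>)"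
  by (auto simp: meas_proc_def intro: borel_measurable_diff)

lemma meas_proc_cmult: "meas_proc X \<Longrightarrow> meas_proc (\<lambda>t \<omega>. c * X t \<omega>)"
  by (auto simp: meas_proc_def)

text \<open>Triangle inequalities, scaling and domination are all instances of this one integrated
  pathwise bound.\<close>

lemma ucp_norm_le_add:
  assumes "meas_proc X" "meas_proc Y" "meas_proc Z" "0 \<le> c"
    and "AE \<omega> in P. \<forall>t\<in>dtimes. min 1 \<bar>X t \<omega>\<bar> \<le> c * csup Y \<omega> + csup Z \<omega>"
  shows "ucp_norm X \<le> c * ucp_norm Y + ucp_norm Z"
proof -
  have "ucp_norm X \<le> (\<integral>\<omega>. c * csup Y \<omega> + csup Z \<omega> \<partial>P)"
    unfolding ucp_norm_def
    using assms(5) csup_integrable[OF assms(1)] csup_integrable[OF assms(2)] csup_integrable[OF assms(3)]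
    by (intro integral_mono_AE) (auto intro: csup_least)
  also have "\<dots> = c * ucp_norm Y + ucp_norm Z"
    unfolding ucp_norm_def using csup_integrable[OF assms(2)] csup_integrable[OF assms(3)] by simp
  finally show ?thesis .
qed

lemma ucp_norm_triangle:
  assumes "meas_proc X" "meas_proc Y" shows "ucp_norm (\<lambda>t \<omega>. X t \<omega> + Y t \<omega>) \<le> ucp_norm X + ucp_norm Y"
proof -
  have "min 1 \<bar>X t \<omega> + Y t \<omega>\<bar> \<le> 1 * csup X \<omega> + csup Y \<omega>" if "t \<in> dtimes" for t \<omega>
    using csup_upper[OF that, of X \<omega>] csup_upper[OF that, of Y \<omega>] by linarith
  then show ?thesis using ucp_norm_le_add[OF meas_proc_add[OF assms] assms, of 1] by simp
qed

lemma ucp_norm_triangle_diff: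
  assumes "meas_proc X" "meas_proc Y" shows "ucp_norm (\<lambda>t \<omega>. X t \<omega> - Y t \<omega>) \<le> ucp_norm X + ucp_norm Y"
proof -
  have "min 1 \<bar>X t \<omega> - Y t \<omega>\<bar> \<le> 1 * csup X \<omega> + csup Y \<omega>" if "t \<in> dtimes" for t \<omega>
    using csup_upper[OF that, of X \<omega>] csup_upper[OF that, of Y \<omega>] by linarith
  then show ?thesis using ucp_norm_le_add[OF meas_proc_diff[OF assms] assms, of 1] by simp
qed

lemma ucp_norm_zero_proc: "ucp_norm (\<lambda>t \<omega>. 0) = 0"
  using dtimes by (simp add: ucp_norm_def csup_def)

lemma csup_zero: "csup (\<lambda>t \<omega>. 0) \<omega> = 0"
  using dtimes by (simp add: csup_def)

lemma meas_proc_zero: "meas_proc (\<lambda>t \<omega>. 0)"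
  by (auto simp: meas_proc_def)

lemma ucp_norm_le_mult:
  assumes "meas_proc X" "meas_proc Y" "0 \<le> c" "AE \<omega> in P. \<forall>t\<in>dtimes. min 1 \<bar>X t \<omega>\<bar> \<le> c * csup Y \<omega>"
  shows "ucp_norm X \<le> c * ucp_norm Y"
  using ucp_norm_le_add[OF assms(1,2) meas_proc_zero assms(3)] assms(4) by (simp add: ucp_norm_zero_proc csup_zero)

lemma ucp_norm_cong:
  assumes "meas_proc X" "meas_proc Y" "AE \<omega> in P. \<forall>t\<in>dtimes. X t \<omega> = Y t \<omega>"
  shows "ucp_norm X = ucp_norm Y"
proof -
  have "AE \<omega> in P. csup X \<omega> = csup Y \<omega>" using assms(3) by eventually_elim (auto simp: csup_def)
  then show ?thesis
    unfolding ucp_norm_def using assms csup_measurable by (intro integral_cong_AE) auto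
qed

lemma ucp_norm_cong_space:
  assumes "\<And>t \<omega>. t \<in> {0..T} \<Longrightarrow> \<omega> \<in> space P \<Longrightarrow> X t \<omega> = Y t \<omega>"
  shows "ucp_norm X = ucp_norm Y"
  unfolding ucp_norm_def csup_def using assms dtimes(2)
  by (intro Bochner_Integration.integral_cong refl SUP_cong) auto

text \<open>The cap breaks homogeneity: \<open>min 1 \<bar>c * x\<bar>\<close> can exceed
  \<open>\<bar>c\<bar> * min 1 \<bar>x\<bar>\<close> when \<open>\<bar>c\<bar> < 1\<close>. The
  factor \<open>1 + \<bar>c\<bar>\<close> is safe for every \<open>c\<close>.\<close>

lemma ucp_norm_cmult:
  assumes "meas_proc X" shows "ucp_norm (\<lambda>t \<omega>. c * X t \<omega>) \<le> (1 + \<bar>c\<bar>) * ucp_norm X"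
proof (rule ucp_norm_le_mult[OF meas_proc_cmult[OF assms] assms])
  have "min 1 \<bar>c * X t \<omega>\<bar> \<le> (1 + \<bar>c\<bar>) * csup X \<omega>" if "t \<in> dtimes" for t \<omega>
  proof -
    have "min 1 (\<bar>c\<bar> * \<bar>X t \<omega>\<bar>) \<le> (1 + \<bar>c\<bar>) * min 1 \<bar>X t \<omega>\<bar>"
    proof (cases "\<bar>X t \<omega>\<bar> \<le> 1")
      case True
      then have "min 1 \<bar>X t \<omega>\<bar> = \<bar>X t \<omega>\<bar>" by simp
      then show ?thesis by (simp add: distrib_right min.coboundedI2)
    qed auto
    also have "\<dots> \<le> (1 + \<bar>c\<bar>) * csup X \<omega>"
      using csup_upper[OF that, of X \<omega>] by (intro mult_left_mono) auto
    finally show ?thesis by (simp add: abs_mult)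
  qed
  then show "AE \<omega> in P. \<forall>t\<in>dtimes. min 1 \<bar>c * X t \<omega>\<bar> \<le> (1 + \<bar>c\<bar>) * csup X \<omega>" by auto
qed auto

lemma ucp_norm_zeroD:
  assumes "meas_proc X" "ucp_norm X = 0" shows "AE \<omega> in P. \<forall>t\<in>dtimes. X t \<omega> = 0"
proof -
  have "AE \<omega> in P. csup X \<omega> = 0"
    using integral_nonneg_eq_0_iff_AE[OF csup_integrable[OF assms(1)]] csup_bounds assms(2)
    by (auto simp: ucp_norm_def)
  then show ?thesis
  proof eventually_elim
    case (elim \<omega>)
    show ?case using csup_abs[of _ X \<omega>] elim by auto
  qed
qed

lemma csup_gt_iff: "0 < e \<Longrightarrow> e < 1 \<Longrightarrow> e < csup X \<omega> \<longleftrightarrow> (\<exists>t\<in>dtimes. e < \<bar>X t \<omega>\<bar>)"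
  unfolding csup_def less_cSUP_iff[OF dtimes(5) bdd_csup] by auto

lemma exceed_sets: "meas_proc X \<Longrightarrow> {\<omega>\<in>space P. \<exists>t\<in>dtimes. e < \<bar>X t \<omega>\<bar>} \<in> sets P"
proof -
  assume "meas_proc X"
  then have [measurable]: "\<And>t. t \<in> dtimes \<Longrightarrow> X t \<in> borel_measurable P" by (rule meas_proc_measurable)
  have "{\<omega>\<in>space P. \<exists>t\<in>dtimes. e < \<bar>X t \<omega>\<bar>} = (\<Union>t\<in>dtimes. {\<omega>\<in>space P. e < \<bar>X t \<omega>\<bar>})" by auto
  also have "\<dots> \<in> sets P" using dtimes(1) by (intro sets.countable_UN') auto
  finally show ?thesis .
qed

text \<open>Off the exceptional event the path stays below \<open>e\<close> on
  \<open>dtimes\<close>; on it the cap bounds the supremum by one.\<close>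

lemma ucp_norm_le_prob:
  assumes "meas_proc X" "0 \<le> e"
  shows "ucp_norm X \<le> e + prob {\<omega>\<in>space P. \<exists>t\<in>dtimes. e < \<bar>X t \<omega>\<bar>}"
proof -
  define A where "A = {\<omega>\<in>space P. \<exists>t\<in>dtimes. e < \<bar>X t \<omega>\<bar>}"
  have A: "A \<in> sets P" unfolding A_def by (rule exceed_sets[OF assms(1)])
  have "ucp_norm X \<le> (\<integral>\<omega>. e + indicator A \<omega> \<partial>P)"
    unfolding ucp_norm_def
  proof (rule integral_mono[OF csup_integrable[OF assms(1)]])
    show "integrable P (\<lambda>\<omega>. e + indicator A \<omega>)"
      using A by (intro Bochner_Integration.integrable_add integrable_const integrable_real_indicator)
        (auto simp: emeasure_eq_measure)
    show "csup X \<omega> \<le> e + indicator A \<omega>" if "\<omega> \<in> space P" for \<omega>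
    proof (cases "\<omega> \<in> A")
      case True
      then show ?thesis using csup_bounds(2)[of X \<omega>] assms(2) by simp
    next
      case False
      then have "csup X \<omega> \<le> e" using that by (intro csup_least) (auto simp: A_def not_less min.coboundedI2)
      then show ?thesis using False by simp
    qed
  qed
  also have "\<dots> = e + prob A"
    using A by (subst Bochner_Integration.integral_add)
      (auto simp: prob_space emeasure_eq_measure intro!: integrable_real_indicator)
  finally show ?thesis unfolding A_def .
qed

text \<open>Markov's inequality for \<open>csup\<close>; the threshold has to lie below the
  cap.\<close>

lemma prob_le_nrm:
  assumes "meas_proc X" "0 < e" "e < 1"
  shows "prob {\<omega>\<in>space P. \<exists>t\<in>dtimes. e < \<bar>X t \<omega>\<bar>} \<le> ucp_norm X / e"
proof -
  have "prob {\<omega>\<in>space P. \<exists>t\<in>dtimes. e < \<bar>X t \<omega>\<bar>} \<le> prob {\<omega>\<in>space P. e \<le> csup X \<omega>}"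
    using assms csup_measurable[OF assms(1)]
    by (intro finite_measure_mono) (auto simp: csup_gt_iff[symmetric])
  also have "\<dots> \<le> ucp_norm X / e"
    unfolding ucp_norm_def
    using assms csup_bounds by (intro integral_Markov_inequality_measure[where A="{}"] csup_integrable) auto
  finally show ?thesis .
qed

text \<open>The quantifier over \<open>c\<close> stands inside the almost-sure statement, so the
  bound may depend on the path; it is later used with \<open>c\<close> equal to
  \<open>csup X \<omega>\<close>.\<close>

lemma adc_bound_dtimes:
  fixes X :: "('a, real) process"
  assumes "adc X"
  shows "AE \<omega> in P. \<forall>c. (\<forall>t\<in>dtimes. \<bar>X t \<omega>\<bar> \<le> c) \<longrightarrow> (\<forall>t\<in>{0..T}. \<bar>X t \<omega>\<bar> \<le> c)"
  using adc_cadlag[OF assms]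
proof eventually_elim
  case (elim \<omega>)
  show ?case
  proof (intro allI impI ballI)
    fix c t assume c: "\<forall>t\<in>dtimes. \<bar>X t \<omega>\<bar> \<le> c" and t: "t \<in> {0..T}"
    have "X t \<omega> \<in> {-c..c}"
    proof (rule cadlag_on_closed[OF elim _ _ t])
      show "closed {-c..c}" by simp
      fix s assume "s \<in> insert T ({0..T} \<inter> \<rat>)"
      then have "\<bar>X s \<omega>\<bar> \<le> c" using c unfolding dtimes_def by blast
      then show "X s \<omega> \<in> {-c..c}" by auto
    qed
    then show "\<bar>X t \<omega>\<bar> \<le> c" by auto
  qed
qed

lemma adc_add:
  fixes X Y :: "('a, real) process"
  assumes "adc X" "adc Y" shows "adc (\<lambda>t \<omega>. X t \<omega> + Y t \<omega>)"
proof -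
  have "AE \<omega> in P. cadlag_on T (\<lambda>t. X t \<omega> + Y t \<omega>)"
    using adc_cadlag[OF assms(1)] adc_cadlag[OF assms(2)] by eventually_elim (rule cadlag_on_add)
  moreover have "(\<lambda>\<omega>. X t \<omega> + Y t \<omega>) \<in> borel_measurable (F t)" if "t \<in> {0..T}" for t
    using adc_measurable[OF assms(1) that] adc_measurable[OF assms(2) that] by (rule borel_measurable_add)
  ultimately show ?thesis by (simp add: adapted_cadlag_def adapted_def)
qed

lemma adc_cmult:
  fixes X :: "('a, real) process"
  assumes "adc X" shows "adc (\<lambda>t \<omega>. c * X t \<omega>)"
proof -
  have "AE \<omega> in P. cadlag_on T (\<lambda>t. c * X t \<omega>)"
    using adc_cadlag[OF assms(1)] by eventually_elim (rule cadlag_on_cmult)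
  then show ?thesis using assms by (auto simp: adapted_cadlag_def adapted_def)
qed

lemma adc_diff:
  fixes X Y :: "('a, real) process"
  assumes "adc X" "adc Y" shows "adc (\<lambda>t \<omega>. X t \<omega> - Y t \<omega>)"
  using adc_add[OF assms(1) adc_cmult[OF assms(2), of "-1"]] by simp

lemma adc_eint:
  fixes X :: "('a, 'b::euclidean_space) process"
  assumes X: "adc X" and K: "elem K" shows "adc (eint K X)"
proof -
  obtain E where E: "simple E K" using K by (auto simp: elem_def)
  note gE = simple_grid[OF E]
  have "adapted F T (eint K X)"
    unfolding adapted_def
  proof
    fix t assume t: "t \<in> {0..T}"
    have "(\<lambda>\<omega>. grid_integral E K X t \<omega>) \<in> borel_measurable (F t)"
      unfolding grid_integral_def
    proof (rule borel_measurable_sum)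
      fix a assume a: "a \<in> E - {T}"
      note n = nxt[OF gE a]
      show "(\<lambda>\<omega>. K (nxt E a) \<omega> \<bullet> (X (min (nxt E a) t) \<omega> - X (min a t) \<omega>)) \<in> borel_measurable (F t)"
      proof (cases "t \<le> a")
        case True
        then have "min (nxt E a) t = min a t" using n by auto
        then show ?thesis by simp
      next
        case False
        have 1: "K (nxt E a) \<in> borel_measurable (F t)"
          by (rule measurable_F_mono[OF simple_measurable[OF E a]]) (use False t n in auto)
        have 2: "X (min b t) \<in> borel_measurable (F t)" if "0 \<le> b" for b
          by (rule measurable_F_mono[OF adc_measurable[OF X]]) (use that t in auto)
        show ?thesis using 1 2[of a] 2[of "nxt E a"] n by (intro borel_measurable_inner borel_measurable_diff) auto
      qed
    qed
    then show "eint K X t \<in> borel_measurable (F t)"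
      by (subst measurable_cong[where g="grid_integral E K X t"]) (auto simp: eint_eq[OF E] space_F[OF t])
  qed
  moreover have "AE \<omega> in P. cadlag_on T (\<lambda>t. eint K X t \<omega>)"
    using adc_cadlag[OF X] AE_space
  proof eventually_elim
    case (elim \<omega>)
    have "cadlag_on T (\<lambda>t. grid_integral E K X t \<omega>)"
      unfolding grid_integral_def
    proof (rule cadlag_on_sum)
      fix a assume a: "a \<in> E - {T}"
      have st: "cadlag_on T (\<lambda>t. X (min b t) \<omega>)" if "0 \<le> b" "b \<le> T" for b
        by (rule cadlag_on_stop[OF elim(1) that])
      have "0 \<le> nxt E a" using nxt(2,4)[OF gE a] by linarith
      then show "cadlag_on T (\<lambda>t. K (nxt E a) \<omega> \<bullet> (X (min (nxt E a) t) \<omega> - X (min a t) \<omega>))"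
        using nxt(3,4,6)[OF gE a] by (intro cadlag_on_inner cadlag_on_diff st)
    qed
    then show ?case using elim(2) by (simp add: eint_eq[OF E])
  qed
  ultimately show ?thesis by (simp add: adapted_cadlag_def)
qed

lemma eint_zero: "elem K \<Longrightarrow> \<omega> \<in> space P \<Longrightarrow> eint K X 0 \<omega> = 0"
proof -
  assume "elem K" "\<omega> \<in> space P"
  then obtain E where E: "simple E K" by (auto simp: elem_def)
  have "0 \<le> a" "0 \<le> nxt E a" if "a \<in> E - {T}" for a
    using nxt[OF simple_grid[OF E] that] by linarith+
  then show ?thesis using \<open>\<omega> \<in> space P\<close>
    by (simp add: eint_eq[OF E] grid_integral_def min_absorb2)
qed

text \<open>The constant grows with the number of cells of \<open>K\<close>, so this estimate serves
  one fixed integrand. Uniformity over integrands has to come from the control.\<close>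

lemma eint_ucp_norm_bound:
  assumes K: "elem (K :: ('a, real) process)"
  obtains c where "0 \<le> c" "\<And>X. adc X \<Longrightarrow> ucp_norm (eint K X) \<le> c * ucp_norm X"
proof -
  obtain E where E: "simple E K" using K by (auto simp: elem_def)
  note gE = simple_grid[OF E]
  obtain B where B: "0 \<le> B" "\<And>t \<omega>. t \<in> {0..T} \<Longrightarrow> \<omega> \<in> space P \<Longrightarrow> norm (K t \<omega>) \<le> B"
    using simple_bounded[OF E] by metis
  \<comment> \<open>The summand one covers the paths with \<open>csup X \<omega> = 1\<close>, where
    the cap hides the size of the path.\<close>
  define c where "c = 1 + (\<Sum>a\<in>E - {T}. 2 * B)"
  have c1: "c \<ge> 1" using B by (auto simp: c_def intro!: sum_nonneg)
  have "ucp_norm (eint K X) \<le> c * ucp_norm X" if X: "adc X" for X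
  proof (rule ucp_norm_le_mult)
    show "meas_proc (eint K X)" using adc_meas_proc[OF adc_eint[OF X K]] .
    show "meas_proc X" by (rule adc_meas_proc[OF X])
    show "0 \<le> c" using c1 by auto
    show "AE \<omega> in P. \<forall>t\<in>dtimes. min 1 \<bar>eint K X t \<omega>\<bar> \<le> c * csup X \<omega>"
      using adc_bound_dtimes[OF X] AE_space
    proof eventually_elim
      case (elim \<omega>)
      show ?case
      proof
        fix t assume t: "t \<in> dtimes"
        show "min 1 \<bar>eint K X t \<omega>\<bar> \<le> c * csup X \<omega>"
        proof (cases "csup X \<omega> < 1")
          case False
          then have "csup X \<omega> = 1" using csup_bounds[of X \<omega>] by auto
          then show ?thesis using c1 by auto
        next
          case True
          then have b: "\<bar>X s \<omega>\<bar> \<le> csup X \<omega>" if "s \<in> {0..T}" for s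
            using elim csup_abs that by blast
          have "\<bar>eint K X t \<omega>\<bar> \<le> (\<Sum>a\<in>E - {T}. 2 * B * csup X \<omega>)"
            unfolding eint_eq[OF E elim(2)] grid_integral_def
          proof (rule order_trans[OF sum_abs sum_mono])
            fix a assume a: "a \<in> E - {T}"
            note n = nxt[OF gE a]
            have m: "min (nxt E a) t \<in> {0..T}" "min a t \<in> {0..T}" using n t dtimes(2) by auto
            have "\<bar>K (nxt E a) \<omega> \<bullet> (X (min (nxt E a) t) \<omega> - X (min a t) \<omega>)\<bar> \<le>
              B * (csup X \<omega> + csup X \<omega>)"
              unfolding inner_real_def abs_mult
              using b[OF m(1)] b[OF m(2)] B(2)[of "nxt E a" \<omega>] n elim(2) B(1)
              by (intro mult_mono) auto
            then show "\<bar>K (nxt E a) \<omega> \<bullet> (X (min (nxt E a) t) \<omega> - X (min a t) \<omega>)\<bar> \<le> 2 * B * csup X \<omega>"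
              by (simp add: algebra_simps)
          qed
          also have "\<dots> \<le> c * csup X \<omega>"
            using csup_bounds(1)[of X \<omega>] by (simp add: c_def sum_distrib_right[symmetric] distrib_right)
          finally show ?thesis by auto
        qed
      qed
    qed
  qed
  then show ?thesis using that[of c] c1 by auto
qed

text \<open>Translates \<open>ucp_tendsto\<close> through the inequalities
  \<open>ucp_norm_le_prob\<close> and \<open>prob_le_nrm\<close>. The events in its definition range
  over uncountably many times and have to be identified with countable ones first.\<close>

lemma ucp_iff:
  assumes Z: "\<And>n. adc (Z n)" and Z': "adc Z'"
  shows "ucp_tendsto P T Z Z' \<longleftrightarrow> (\<lambda>n. ucp_norm (\<lambda>t \<omega>. Z n t \<omega> - Z' t \<omega>)) \<longlonglongrightarrow> 0"
proof -
  let ?D = "\<lambda>n t \<omega>. Z n t \<omega> - Z' t \<omega>"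
  have D: "adc (?D n)" for n using adc_diff Z Z' by blast
  note m = adc_meas_proc[OF D]
  have eq: "prob {\<omega>\<in>space P. \<exists>t\<in>{0..T}. \<bar>?D n t \<omega>\<bar> > e} = prob {\<omega>\<in>space P. \<exists>t\<in>dtimes. e < \<bar>?D n t \<omega>\<bar>}"
    for n e
  proof (rule measure_eq_AE)
    show "AE \<omega> in P. (\<omega> \<in> {\<omega>\<in>space P. \<exists>t\<in>{0..T}. \<bar>?D n t \<omega>\<bar> > e}) =
        (\<omega> \<in> {\<omega>\<in>space P. \<exists>t\<in>dtimes. e < \<bar>?D n t \<omega>\<bar>})"
    proof (rule AE_mp[OF adc_bound_dtimes[OF D[of n]]], intro AE_I2 impI)
      fix \<omega> assume *: "\<forall>c. (\<forall>t\<in>dtimes. \<bar>?D n t \<omega>\<bar> \<le> c) \<longrightarrow> (\<forall>t\<in>{0..T}. \<bar>?D n t \<omega>\<bar> \<le> c)"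
      have "(\<exists>t\<in>{0..T}. \<bar>?D n t \<omega>\<bar> > e) \<longleftrightarrow> (\<exists>t\<in>dtimes. e < \<bar>?D n t \<omega>\<bar>)"
        using *[rule_format, of e] dtimes(2) by (meson not_le subsetD)
      then show "(\<omega> \<in> {\<omega>\<in>space P. \<exists>t\<in>{0..T}. \<bar>?D n t \<omega>\<bar> > e}) =
        (\<omega> \<in> {\<omega>\<in>space P. \<exists>t\<in>dtimes. e < \<bar>?D n t \<omega>\<bar>})" by simp
    qed
    show B: "{\<omega>\<in>space P. \<exists>t\<in>dtimes. e < \<bar>?D n t \<omega>\<bar>} \<in> sets P" by (rule exceed_sets[OF m])
    have comp: "complete_measure P" using usual by (auto simp: usual_conditions_def)
    obtain N where N0: "{\<omega>\<in>space P. \<not> (\<forall>c. (\<forall>t\<in>dtimes. \<bar>?D n t \<omega>\<bar> \<le> c) \<longrightarrow> (\<forall>t\<in>{0..T}. \<bar>?D n t \<omega>\<bar> \<le> c))} \<subseteq> N"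
      "emeasure P N = 0" "N \<in> sets P"
      by (rule AE_E[OF adc_bound_dtimes[OF D[of n]]])
    have N: "N \<in> null_sets P" using N0 by (simp add: null_sets_def)
    let ?A = "{\<omega>\<in>space P. \<exists>t\<in>{0..T}. \<bar>?D n t \<omega>\<bar> > e}" and ?B = "{\<omega>\<in>space P. \<exists>t\<in>dtimes. e < \<bar>?D n t \<omega>\<bar>}"
    have "?A - ?B \<subseteq> N"
    proof
      fix \<omega> assume \<omega>: "\<omega> \<in> ?A - ?B"
      then have "\<forall>t\<in>dtimes. \<bar>?D n t \<omega>\<bar> \<le> e" by (auto simp: not_less)
      moreover have "\<not> (\<forall>t\<in>{0..T}. \<bar>?D n t \<omega>\<bar> \<le> e)" using \<omega> by (auto simp: not_le)
      ultimately show "\<omega> \<in> N" using N0(1) \<omega> by blast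
    qed
    \<comment> \<open>The event over all of \<open>{0..T}\<close> exceeds the countable one by a
      subset of a null set; completeness of \<open>P\<close> makes this difference
      measurable.\<close>
    then have AB: "?A - ?B \<in> sets P" by (rule complete_measure.complete[OF comp _ N])
    have "?B \<union> (?A - ?B) = ?A" using dtimes(2) by auto
    then show "?A \<in> sets P" using sets.Un[OF B AB] by (simp only:)
  qed
  show ?thesis
  proof
    assume ucp: "ucp_tendsto P T Z Z'"
    show "(\<lambda>n. ucp_norm (?D n)) \<longlonglongrightarrow> 0"
    proof (rule LIMSEQ_I)
      fix r :: real assume r: "0 < r"
      then have "0 < r / 2" by simp
      then have "(\<lambda>n. prob {\<omega>\<in>space P. \<exists>t\<in>{0..T}. \<bar>?D n t \<omega>\<bar> > r / 2}) \<longlonglongrightarrow> 0"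
        by (rule ucp[unfolded ucp_tendsto_def, rule_format])
      then have "\<forall>\<^sub>F n in sequentially. prob {\<omega>\<in>space P. \<exists>t\<in>dtimes. r / 2 < \<bar>?D n t \<omega>\<bar>} < r / 2"
        unfolding eq using \<open>0 < r / 2\<close> by (rule order_tendstoD(2))
      then obtain N where
        N: "\<And>n. n \<ge> N \<Longrightarrow> prob {\<omega>\<in>space P. \<exists>t\<in>dtimes. r / 2 < \<bar>?D n t \<omega>\<bar>} < r / 2"
        unfolding eventually_sequentially by blast
      have "norm (ucp_norm (?D n) - 0) < r" if "n \<ge> N" for n
      proof -
        have "ucp_norm (?D n) < r" using ucp_norm_le_prob[OF m, of "r / 2" n] N[OF that] r by linarith
        then show ?thesis using ucp_norm_nonneg[of "?D n"] by simp
      qed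
      then show "\<exists>N. \<forall>n\<ge>N. norm (ucp_norm (?D n) - 0) < r" by blast
    qed
  next
    assume lim: "(\<lambda>n. ucp_norm (?D n)) \<longlonglongrightarrow> 0"
    show "ucp_tendsto P T Z Z'"
      unfolding ucp_tendsto_def
    proof (intro allI impI)
      fix e :: real assume e: "0 < e"
      \<comment> \<open>\<open>prob_le_nrm\<close> requires a threshold below the cap at
        one.\<close>
      define e' where "e' = min e (1/2)"
      have e': "0 < e'" "e' < 1" "e' \<le> e" using e by (auto simp: e'_def)
      have "(\<lambda>n. ucp_norm (?D n) / e') \<longlonglongrightarrow> 0" using tendsto_divide[OF lim tendsto_const] e' by force
      then have l: "(\<lambda>n. ucp_norm (?D n) / e') \<longlonglongrightarrow> 0" .
      have bound: "prob {\<omega>\<in>space P. \<exists>t\<in>{0..T}. \<bar>?D n t \<omega>\<bar> > e} \<le> ucp_norm (?D n) / e'" for n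
      proof -
        have "prob {\<omega>\<in>space P. \<exists>t\<in>dtimes. e < \<bar>?D n t \<omega>\<bar>} \<le> prob {\<omega>\<in>space P. \<exists>t\<in>dtimes. e' < \<bar>?D n t \<omega>\<bar>}"
          using e' exceed_sets[OF m] by (intro finite_measure_mono) force+
        also have "\<dots> \<le> ucp_norm (?D n) / e'" by (rule prob_le_nrm[OF m e'(1,2)])
        finally show ?thesis unfolding eq .
      qed
      show "(\<lambda>n. prob {\<omega>\<in>space P. \<exists>t\<in>{0..T}. \<bar>?D n t \<omega>\<bar> > e}) \<longlonglongrightarrow> 0"
        by (rule tendsto_sandwich[OF always_eventually[OF allI[OF measure_nonneg]]
            always_eventually[OF allI[OF bound]] tendsto_const l])
    qed
  qed
qed

text \<open>A subsequence with summable distances converges uniformly outside a null set, so that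
  its limit is cadlag; the Cauchy property extends the convergence to the whole sequence.\<close>

lemma ucp_norm_complete:
  assumes X: "\<And>n. adc (X n)"
    and C: "\<And>e. e > 0 \<Longrightarrow> \<exists>N. \<forall>m\<ge>N. \<forall>n\<ge>N. ucp_norm (\<lambda>t \<omega>. X m t \<omega> - X n t \<omega>) < e"
  obtains Y :: "('a, real) process" where "adc Y" "(\<lambda>n. ucp_norm (\<lambda>t \<omega>. X n t \<omega> - Y t \<omega>)) \<longlonglongrightarrow> 0"
proof -
  have "\<exists>N. \<forall>k. \<forall>m\<ge>N k. \<forall>n\<ge>N k. ucp_norm (\<lambda>t \<omega>. X m t \<omega> - X n t \<omega>) < (1/2)^k"
    using C[of "(1/2)^_"] by (intro choice) auto
  then obtain N where N: "\<And>k m n. m \<ge> N k \<Longrightarrow> n \<ge> N k \<Longrightarrow> ucp_norm (\<lambda>t \<omega>. X m t \<omega> - X n t \<omega>) < (1/2)^k"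
    by blast
  \<comment> \<open>Strictly increasing indices with \<open>r k \<ge> N k\<close>, so that
    consecutive distances are at most \<open>(1/2)^k\<close>.\<close>
  define r where "r = rec_nat (N 0) (\<lambda>k m. max (Suc m) (N (Suc k)))"
  have r: "r (Suc k) > r k" "r k \<ge> N k" for k by (cases k; auto simp: r_def)+
  define D where "D k t \<omega> = X (r (Suc k)) t \<omega> - X (r k) t \<omega>" for k t \<omega>
  have aD: "adc (D k)" for k unfolding D_def using adc_diff X by blast
  note mD = adc_meas_proc[OF aD]
  have nD: "ucp_norm (D k) \<le> (1/2)^k" for k
    using N[of k "r (Suc k)" "r k"] r(1)[of k] r(2)[of k] by (simp add: D_def[abs_def])
  have "AE \<omega> in P. (\<Sum>k. ennreal (csup (D k) \<omega>)) \<noteq> \<infinity>"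
  proof (rule nn_integral_PInf_AE)
    show "(\<lambda>\<omega>. \<Sum>k. ennreal (csup (D k) \<omega>)) \<in> borel_measurable P"
      using csup_measurable[OF mD] by measurable
    have "(\<integral>\<^sup>+\<omega>. (\<Sum>k. ennreal (csup (D k) \<omega>)) \<partial>P) = (\<Sum>k. \<integral>\<^sup>+\<omega>. ennreal (csup (D k) \<omega>) \<partial>P)"
      using csup_measurable[OF mD] by (intro nn_integral_suminf) auto
    also have "\<dots> = (\<Sum>k. ennreal (ucp_norm (D k)))"
      unfolding ucp_norm_def using csup_integrable[OF mD] csup_bounds by (simp add: nn_integral_eq_integral)
    also have "\<dots> \<le> (\<Sum>k. ennreal ((1/2)^k))"
      using nD by (intro suminf_le) (auto intro: ennreal_leI)
    also have "\<dots> = ennreal (\<Sum>k. (1/2)^k)"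
      by (intro suminf_ennreal2) auto
    finally show "(\<integral>\<^sup>+\<omega>. (\<Sum>k. ennreal (csup (D k) \<omega>)) \<partial>P) \<noteq> \<infinity>"
      by (auto simp: top_unique)
  qed
  then have sm: "AE \<omega> in P. summable (\<lambda>k. csup (D k) \<omega>)"
    by eventually_elim (auto intro!: summable_suminf_not_top csup_bounds)
  \<comment> \<open>\<open>lim\<close> is total, so each \<open>Y t\<close> is a measurable function
    of the values at time \<open>t\<close> on the whole space, and adaptedness is immediate.\<close>
  define Y where "Y t \<omega> = lim (\<lambda>k. X (r k) t \<omega>)" for t \<omega>
  have "AE \<omega> in P. \<forall>k. \<forall>c. (\<forall>t\<in>dtimes. \<bar>D k t \<omega>\<bar> \<le> c) \<longrightarrow> (\<forall>t\<in>{0..T}. \<bar>D k t \<omega>\<bar> \<le> c)"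
    using adc_bound_dtimes[OF aD] by (simp add: AE_all_countable)
  moreover have "AE \<omega> in P. \<forall>k. cadlag_on T (\<lambda>t. X k t \<omega>)"
    using adc_cadlag[OF X] by (simp add: AE_all_countable)
  ultimately have good: "AE \<omega> in P. (\<forall>e>0. \<forall>\<^sub>F k in sequentially. \<forall>t\<in>{0..T}. \<bar>X (r k) t \<omega> - Y t \<omega>\<bar> \<le> e) \<and>
     (\<forall>k. cadlag_on T (\<lambda>t. X k t \<omega>))"
    using sm
  proof eventually_elim
    case (elim \<omega>)
    let ?d = "\<lambda>k. csup (D k) \<omega>"
    have "?d \<longlonglongrightarrow> 0" using elim(3) by (rule summable_LIMSEQ_zero)
    then have "\<forall>\<^sub>F k in sequentially. ?d k < 1" by (auto intro: order_tendstoD)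
    then obtain k0 where k0: "\<And>k. k \<ge> k0 \<Longrightarrow> ?d k < 1" by (auto simp: eventually_sequentially)
    have step: "\<bar>D k t \<omega>\<bar> \<le> ?d k" if "k \<ge> k0" "t \<in> {0..T}" for k t
      using elim(1) csup_abs k0[OF that(1)] that(2) by blast
    define \<tau> where "\<tau> k = (\<Sum>i. ?d (i + k))" for k
    have \<tau>0: "\<tau> \<longlonglongrightarrow> 0"
      unfolding \<tau>_def[abs_def] using suminf_exist_split2[OF elim(3)] by simp
    have fin: "\<bar>X (r (k + j)) t \<omega> - X (r k) t \<omega>\<bar> \<le> \<tau> k" if "k \<ge> k0" "t \<in> {0..T}" for k j t
    proof -
      have "\<bar>X (r (k + j)) t \<omega> - X (r k) t \<omega>\<bar> \<le> (\<Sum>i<j. ?d (i + k))"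
      proof (induction j)
        case (Suc j)
        have "\<bar>D (j + k) t \<omega>\<bar> \<le> ?d (j + k)" using step that by auto
        moreover have "D (j + k) t \<omega> = X (r (k + Suc j)) t \<omega> - X (r (k + j)) t \<omega>"
          by (simp add: D_def add.commute)
        ultimately show ?case using Suc unfolding sum.lessThan_Suc by linarith
      qed simp
      also have "\<dots> \<le> \<tau> k"
        unfolding \<tau>_def using elim(3) csup_bounds(1) by (intro sum_le_suminf) (auto intro: summable_ignore_initial_segment)
      finally show ?thesis .
    qed
    have conv: "(\<lambda>k. X (r k) t \<omega>) \<longlonglongrightarrow> Y t \<omega>" if "t \<in> {0..T}" for t
    proof -
      have "Cauchy (\<lambda>k. X (r k) t \<omega>)"
      proof (rule metric_CauchyI)
        fix e :: real assume "e > 0"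
        then have "\<forall>\<^sub>F k in sequentially. \<tau> k < e / 2" using order_tendstoD(2)[OF \<tau>0, of "e / 2"] by auto
        then obtain K where K: "K \<ge> k0" "\<tau> K < e / 2"
          by (metis eventually_sequentially nle_le)
        have "dist (X (r m) t \<omega>) (X (r n) t \<omega>) < e" if "m \<ge> K" "n \<ge> K" for m n
          using fin[OF K(1) \<open>t \<in> {0..T}\<close>, of "m - K"] fin[OF K(1) \<open>t \<in> {0..T}\<close>, of "n - K"] that K(2)
          by (simp add: dist_real_def)
        then show "\<exists>M. \<forall>m\<ge>M. \<forall>n\<ge>M. dist (X (r m) t \<omega>) (X (r n) t \<omega>) < e" by blast
      qed
      then show ?thesis unfolding Y_def by (simp add: Cauchy_convergent_iff convergent_LIMSEQ_iff)
    qed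
    have "\<bar>X (r k) t \<omega> - Y t \<omega>\<bar> \<le> \<tau> k" if "k \<ge> k0" "t \<in> {0..T}" for k t
    proof -
      have "(\<lambda>j. \<bar>X (r (k + j)) t \<omega> - X (r k) t \<omega>\<bar>) \<longlonglongrightarrow> \<bar>Y t \<omega> - X (r k) t \<omega>\<bar>"
        using LIMSEQ_ignore_initial_segment[OF conv[OF that(2)], of k]
        by (intro tendsto_rabs tendsto_diff tendsto_const) (simp add: add.commute)
      from LIMSEQ_le_const2[OF this] fin[OF that] show ?thesis by (auto simp: abs_minus_commute)
    qed
    then have "\<forall>\<^sub>F k in sequentially. \<forall>t\<in>{0..T}. \<bar>X (r k) t \<omega> - Y t \<omega>\<bar> \<le> e" if "e > 0" for e
      using eventually_conj[OF order_tendstoD(2)[OF \<tau>0 that] eventually_ge_at_top[of k0]]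
      by (rule_tac eventually_mono) (assumption, force)
    then show ?case using elim(2) by blast
  qed
  have adY: "adc Y"
    unfolding adapted_cadlag_def adapted_def
  proof (intro conjI ballI)
    show "Y t \<in> borel_measurable (F t)" if "t \<in> {0..T}" for t
      unfolding Y_def using adc_measurable[OF X that] by (intro borel_measurable_lim_metric) auto
    show "AE \<omega> in P. cadlag_on T (\<lambda>t. Y t \<omega>)"
      using good by eventually_elim (rule cadlag_on_uniform_limit[where x="\<lambda>k t. X (r k) t _"]; auto)
  qed
  have adYX: "adc (\<lambda>t \<omega>. X (r k) t \<omega> - Y t \<omega>)" for k using adc_diff X adY by blast
  have lim: "(\<lambda>k. ucp_norm (\<lambda>t \<omega>. X (r k) t \<omega> - Y t \<omega>)) \<longlonglongrightarrow> (\<integral>\<omega>. 0 \<partial>P)"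
    unfolding ucp_norm_def
  proof (rule integral_dominated_convergence[where w="\<lambda>_. 1"])
    show "csup (\<lambda>t \<omega>. X (r k) t \<omega> - Y t \<omega>) \<in> borel_measurable P" for k
      by (rule csup_measurable[OF adc_meas_proc[OF adYX]])
    show "AE \<omega> in P. (\<lambda>k. csup (\<lambda>t \<omega>. X (r k) t \<omega> - Y t \<omega>) \<omega>) \<longlonglongrightarrow> 0"
      using good
    proof eventually_elim
      case (elim \<omega>)
      show ?case
      proof (rule LIMSEQ_I)
        fix e :: real assume e: "0 < e"
        then have "0 < e / 2" by simp
        then have "\<forall>\<^sub>F k in sequentially. \<forall>t\<in>{0..T}. \<bar>X (r k) t \<omega> - Y t \<omega>\<bar> \<le> e / 2" using elim by blast
        then obtain K where K: "\<And>k. k \<ge> K \<Longrightarrow> \<forall>t\<in>{0..T}. \<bar>X (r k) t \<omega> - Y t \<omega>\<bar> \<le> e / 2"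
          unfolding eventually_sequentially by blast
        have "csup (\<lambda>t \<omega>. X (r k) t \<omega> - Y t \<omega>) \<omega> \<le> e / 2" if "k \<ge> K" for k
        proof (rule csup_least)
          fix t assume "t \<in> dtimes"
          then have "\<bar>X (r k) t \<omega> - Y t \<omega>\<bar> \<le> e / 2" using K[OF that] dtimes(2) by blast
          then show "min 1 \<bar>X (r k) t \<omega> - Y t \<omega>\<bar> \<le> e / 2" by (rule min.coboundedI2)
        qed
        then have "norm (csup (\<lambda>t \<omega>. X (r k) t \<omega> - Y t \<omega>) \<omega> - 0) < e" if "k \<ge> K" for k
          using that csup_bounds(1)[of "\<lambda>t \<omega>. X (r k) t \<omega> - Y t \<omega>" \<omega>] e by fastforce
        then show "\<exists>N. \<forall>n\<ge>N. norm (csup (\<lambda>t \<omega>. X (r n) t \<omega> - Y t \<omega>) \<omega> - 0) < e" by blast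
      qed
    qed
  qed (use csup_bounds in auto)
  have "(\<lambda>n. ucp_norm (\<lambda>t \<omega>. X n t \<omega> - Y t \<omega>)) \<longlonglongrightarrow> 0"
  proof (rule LIMSEQ_I)
    fix e :: real assume e: "0 < e"
    obtain M where M: "\<forall>m\<ge>M. \<forall>n\<ge>M. ucp_norm (\<lambda>t \<omega>. X m t \<omega> - X n t \<omega>) < e / 2" using C[of "e / 2"] e by auto
    have "\<forall>\<^sub>F k in sequentially. ucp_norm (\<lambda>t \<omega>. X (r k) t \<omega> - Y t \<omega>) < e / 2"
      using order_tendstoD(2)[OF lim, of "e / 2"] e by simp
    moreover have "strict_mono r" using r(1) by (simp add: strict_mono_Suc_iff)
    then have "\<forall>\<^sub>F k in sequentially. r k \<ge> M"
      using filterlim_subseq[of r] by (auto simp: filterlim_at_top)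
    ultimately obtain k where k: "ucp_norm (\<lambda>t \<omega>. X (r k) t \<omega> - Y t \<omega>) < e / 2" "r k \<ge> M"
      using eventually_happens[OF eventually_conj] by force
    have "norm (ucp_norm (\<lambda>t \<omega>. X n t \<omega> - Y t \<omega>) - 0) < e" if "n \<ge> M" for n
    proof -
      have "ucp_norm (\<lambda>t \<omega>. (X n t \<omega> - X (r k) t \<omega>) + (X (r k) t \<omega> - Y t \<omega>)) \<le>
         ucp_norm (\<lambda>t \<omega>. X n t \<omega> - X (r k) t \<omega>) + ucp_norm (\<lambda>t \<omega>. X (r k) t \<omega> - Y t \<omega>)"
        using adc_meas_proc[OF adc_diff[OF X X]] adc_meas_proc[OF adYX] by (intro ucp_norm_triangle)
      moreover have "ucp_norm (\<lambda>t \<omega>. X n t \<omega> - X (r k) t \<omega>) < e / 2" using M that k by auto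
      ultimately show ?thesis using k ucp_norm_nonneg[of "\<lambda>t \<omega>. X n t \<omega> - Y t \<omega>"] by simp
    qed
    then show "\<exists>N. \<forall>n\<ge>N. norm (ucp_norm (\<lambda>t \<omega>. X n t \<omega> - Y t \<omega>) - 0) < e" by blast
  qed
  then show ?thesis using that adY by blast
qed

end

lemma cadlag_on_cong:
  assumes "cadlag_on T x" "\<And>t. t \<in> {0..T} \<Longrightarrow> x t = y t"
  shows "cadlag_on T y"
proof (rule cadlag_onI)
  fix t assume t: "0 \<le> t" "t < T"
  have "\<forall>\<^sub>F s in at_right t. x s = y s"
    unfolding eventually_at_right_field using assms(2) t by (intro exI[of _ T]) auto
  moreover have "(x \<longlongrightarrow> y t) (at_right t)" using cadlag_right[OF assms(1) t] assms(2)[of t] t by simp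
  ultimately show "(y \<longlongrightarrow> y t) (at_right t)" using tendsto_cong by blast
next
  fix t assume t: "0 < t" "t \<le> T"
  obtain l where l: "(x \<longlongrightarrow> l) (at_left t)" by (rule cadlag_left[OF assms(1) t])
  have "\<forall>\<^sub>F s in at_left t. x s = y s"
    unfolding eventually_at_left_field using assms(2) t by (intro exI[of _ 0]) auto
  then show "\<exists>l. (y \<longlongrightarrow> l) (at_left t)" using l tendsto_cong by blast
qed

lemma norm_add_square_le: "(norm (x + y))\<^sup>2 \<le> 2 * (norm x)\<^sup>2 + 2 * (norm y)\<^sup>2"
proof -
  have "(norm (x + y))\<^sup>2 \<le> (norm x + norm y)\<^sup>2" by (intro power_mono norm_triangle_ineq) simp
  also have "\<dots> \<le> 2 * (norm x)\<^sup>2 + 2 * (norm y)\<^sup>2"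
    using sum_squares_bound[of "norm x" "norm y"] by (simp add: power2_sum)
  finally show ?thesis .
qed

context filtered_space begin

lemma adc_cong_AE:
  fixes X Y :: "('a, 'b::topological_space) process"
  assumes "adc X" "AE \<omega> in P. \<forall>t\<in>{0..T}. X t \<omega> = Y t \<omega>"
  shows "adc Y"
  unfolding adapted_cadlag_def adapted_def
proof (intro conjI ballI)
  fix t assume t: "t \<in> {0..T}"
  have "AE \<omega> in P. X t \<omega> = Y t \<omega>" using assms(2) by eventually_elim (use t in blast)
  then show "Y t \<in> borel_measurable (F t)" by (rule measurable_F_AE[OF adc_measurable[OF assms(1) t] t])
next
  show "AE \<omega> in P. cadlag_on T (\<lambda>t. Y t \<omega>)"
    using assms(2) adc_cadlag[OF assms(1)]
  proof eventually_elim
    case (elim \<omega>)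
    show ?case by (rule cadlag_on_cong[OF elim(2)]) (use elim(1) in blast)
  qed
qed

lemma adc_cong:
  fixes X Y :: "('a, 'b::topological_space) process"
  assumes "adc X" "\<And>t \<omega>. t \<in> {0..T} \<Longrightarrow> \<omega> \<in> space P \<Longrightarrow> X t \<omega> = Y t \<omega>"
  shows "adc Y"
  by (rule adc_cong_AE[OF assms(1)]) (use assms(2) in \<open>simp add: AE_I2\<close>)

lemma adc_zero: "adc (\<lambda>t \<omega>. 0 :: real)"
  by (simp add: adapted_cadlag_def adapted_def cadlag_on_const)

text \<open>Boundedness of the composition comes from compactness: \<open>K\<close> takes its values
  in a ball, and \<open>\<phi>\<close> maps this ball to a bounded set. It serves to clip integrands
  in \<open>elem_dense\<close>.\<close>

lemma simple_compose:
  fixes K :: "real \<Rightarrow> 'a \<Rightarrow> 'b::euclidean_space" and \<phi> :: "'b \<Rightarrow> 'c::euclidean_space"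
  assumes K: "simple E K" and \<phi>: "continuous_on UNIV \<phi>"
  shows "simple E (\<lambda>t \<omega>. \<phi> (K t \<omega>))"
proof -
  obtain c where c: "0 \<le> c" "\<And>t \<omega>. t \<in> {0..T} \<Longrightarrow> \<omega> \<in> space P \<Longrightarrow> norm (K t \<omega>) \<le> c"
    using simple_bounded[OF K] by blast
  have "compact (\<phi> ` cball 0 c)"
    using \<phi> by (intro compact_continuous_image continuous_on_subset[OF \<phi>]) auto
  then obtain d where d: "\<And>x. x \<in> cball 0 c \<Longrightarrow> norm (\<phi> x) \<le> d"
    using compact_imp_bounded[of "\<phi> ` cball 0 c"] unfolding bounded_iff by blast
  have m: "\<phi> \<in> borel_measurable borel" by (rule borel_measurable_continuous_onI[OF \<phi>])
  show ?thesis
  proof (rule simpleI[where c=d])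
    show "grid E" by (rule simple_grid[OF K])
    show "(\<lambda>\<omega>. \<phi> (K 0 \<omega>)) \<in> borel_measurable (F 0)" by (rule measurable_compose[OF simple_zero[OF K] m])
    show "norm (\<phi> (K t \<omega>)) \<le> d" if "t \<in> {0..T}" "\<omega> \<in> space P" for t \<omega>
      using c(2)[OF that] by (intro d) simp
    show "(\<lambda>\<omega>. \<phi> (K (nxt E a) \<omega>)) \<in> borel_measurable (F a)" if "a \<in> E - {T}" for a
      by (rule measurable_compose[OF simple_measurable[OF K that] m])
    show "\<phi> (K t \<omega>) = \<phi> (K (nxt E a) \<omega>)" if "a \<in> E - {T}" "a < t" "t \<le> nxt E a" "\<omega> \<in> space P" for a t \<omega>
      using simple_cell[OF K that] by (rule arg_cong)
  qed
qed

lemma elem_compose: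
  fixes K :: "real \<Rightarrow> 'a \<Rightarrow> 'b::euclidean_space" and \<phi> :: "'b \<Rightarrow> 'c::euclidean_space"
  shows "elem K \<Longrightarrow> continuous_on UNIV \<phi> \<Longrightarrow> elem (\<lambda>t \<omega>. \<phi> (K t \<omega>))"
  unfolding elem_def using simple_compose by blast

text \<open>Reading the indicator as an elementary integrand against the zero integrator lets
  \<open>elementary_integralD\<close> supply the grid.\<close>

lemma elem_rectangle:
  assumes "0 \<le> s" "s < r" "r \<le> T" "A \<in> sets (F s)"
  shows "elem (\<lambda>t \<omega>. indicat_real {s<..r} t * indicat_real A \<omega>)"
proof (rule elementary_integralD(1))
  show "elementary_integral P F T (\<lambda>_ _. 0) (\<lambda>t \<omega>. indicat_real {s<..r} t * indicat_real A \<omega>) (\<lambda>_ _. 0)"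
    unfolding elementary_integral_def
  proof (rule exI[of _ "\<lambda>_. 0"], rule exI[of _ 1], rule exI[of _ "\<lambda>_. s"], rule exI[of _ "\<lambda>_. r"],
      rule exI[of _ "\<lambda>_. indicat_real A"], rule exI[of _ 1], intro conjI)
    show "\<forall>i<1. 0 \<le> s \<and> s < r \<and> r \<le> T \<and> indicat_real A \<in> borel_measurable (F s) \<and>
        (\<forall>\<omega>\<in>space P. norm (indicat_real A \<omega>) \<le> 1)"
      using assms by (simp add: indicator_def)
  qed (simp_all add: lessThan_Suc)
qed

lemma elem_initial:
  assumes "A \<in> sets (F 0)"
  shows "elem (\<lambda>t \<omega>. indicat_real {0} t * indicat_real A \<omega>)"
proof (rule elementary_integralD(1))
  show "elementary_integral P F T (\<lambda>_ _. 0) (\<lambda>t \<omega>. indicat_real {0} t * indicat_real A \<omega>) (\<lambda>_ _. 0)"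
    unfolding elementary_integral_def
  proof (rule exI[of _ "indicat_real A"], rule exI[of _ 0], rule exI, rule exI,
      rule exI, rule exI[of _ 1], intro conjI)
    show "\<forall>\<omega>\<in>space P. norm (indicat_real A \<omega>) \<le> 1" by (simp add: indicator_def)
  qed (use assms in simp_all)
qed

section \<open>Predictable sets and bounded predictable integrands\<close>

abbreviation PA :: "(real \<times> 'a) measure" where "PA \<equiv> predictable_algebra P F T"

definition pred_gen :: "(real \<times> 'a) set set" where
  "pred_gen = {{0} \<times> A | A. A \<in> sets (F 0)} \<union>
        {{s<..t} \<times> A | s t A. 0 \<le> s \<and> s < t \<and> t \<le> T \<and> A \<in> sets (F s)}"

lemma pred_gen_subset: "pred_gen \<subseteq> Pow ({0..T} \<times> space P)"
proof -
  have "A \<subseteq> space P" if "A \<in> sets (F s)" "0 \<le> s" "s \<le> T" for A s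
    using sets.sets_into_space[OF that(1)] space_F[of s] that by auto
  then show ?thesis using T_pos unfolding pred_gen_def by fastforce
qed

lemma space_PA: "space PA = {0..T} \<times> space P"
  by (simp add: predictable_algebra_def space_measure_of_conv)

lemma sets_PA: "sets PA = sigma_sets ({0..T} \<times> space P) pred_gen"
  using pred_gen_subset by (simp add: predictable_algebra_def pred_gen_def[symmetric])

lemma pred_gen_in_PA: "A \<in> pred_gen \<Longrightarrow> A \<in> sets PA"
  unfolding sets_PA by (rule sigma_sets.Basic)

text \<open>The intersection of two rectangles starts at the later of the two left end points, and
  by then both bases are known. Intersection stability is what the Dynkin argument in
  \<open>bint_indicator\<close> requires.\<close>

lemma Int_stable_pred_gen: "Int_stable pred_gen"
proof (rule Int_stableI)
  have empty: "{} \<in> pred_gen"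
  proof -
    have "{} = {0} \<times> {} \<and> {} \<in> sets (F 0)" by auto
    then show ?thesis unfolding pred_gen_def by blast
  qed
  have aux: "{0} \<times> A \<inter> {s<..t} \<times> B = {}" if "0 \<le> s" for A and s t :: real and B :: "'a set"
    using that by auto
  fix a b assume "a \<in> pred_gen" "b \<in> pred_gen"
  then consider
    (1) A B where "a = {0} \<times> A" "b = {0} \<times> B" "A \<in> sets (F 0)" "B \<in> sets (F 0)"
  | (2) A s t B where "a = {0} \<times> A" "b = {s<..t} \<times> B" "0 \<le> s"
  | (3) A s t B where "b = {0} \<times> A" "a = {s<..t} \<times> B" "0 \<le> s"
  | (4) s t A s' t' A' where "a = {s<..t} \<times> A" "b = {s'<..t'} \<times> A'" "0 \<le> s" "t \<le> T" "A \<in> sets (F s)"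
      "0 \<le> s'" "t' \<le> T" "A' \<in> sets (F s')"
    unfolding pred_gen_def by blast
  then show "a \<inter> b \<in> pred_gen"
  proof cases
    case 1
    then have "a \<inter> b = {0} \<times> (A \<inter> B)" "A \<inter> B \<in> sets (F 0)" by auto
    then show ?thesis unfolding pred_gen_def by blast
  next
    case 2
    then show ?thesis using aux[OF 2(3)] empty by simp
  next
    case 3
    then show ?thesis using aux[OF 3(3)] empty by (simp add: Int_commute)
  next
    case 4
    have eq: "a \<inter> b = {max s s'<..min t t'} \<times> (A \<inter> A')" using 4 by auto
    show ?thesis
    proof (cases "max s s' < min t t'")
      case True
      have "A \<in> sets (F (max s s'))" "A' \<in> sets (F (max s s'))"
        using F_mono[of s "max s s'"] F_mono[of s' "max s s'"] 4 True by auto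
      then have "A \<inter> A' \<in> sets (F (max s s'))" by auto
      moreover have "0 \<le> max s s'" "min t t' \<le> T" using 4 by auto
      ultimately show ?thesis using True eq unfolding pred_gen_def by blast
    next
      case False
      then have "{max s s'<..min t t'} = {}" by simp
      then have "a \<inter> b = {}" using eq by simp
      then show ?thesis using empty by simp
    qed
  qed
qed

text \<open>Outside the interval the function vanishes. The preimage of a set that contains zero is
  therefore the complement of a rectangle, and any other preimage is a rectangle.\<close>

lemma rectangle_measurable:
  fixes h :: "'a \<Rightarrow> 'b::euclidean_space"
  assumes I: "\<And>B. B \<in> sets (F s) \<Longrightarrow> I \<times> B \<in> sets PA" and s: "0 \<le> s" "s \<le> T"
    and h: "h \<in> borel_measurable (F s)"
  shows "(\<lambda>p. indicat_real I (fst p) *\<^sub>R h (snd p)) \<in> borel_measurable PA"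
proof (rule measurableI)
  fix B :: "'b set" assume B: "B \<in> sets borel"
  let ?g = "\<lambda>p. indicat_real I (fst p) *\<^sub>R h (snd p)"
  have pre: "h -` C \<inter> space P \<in> sets (F s)" if "C \<in> sets borel" for C
    using measurable_sets[OF h that] space_F[of s] s by simp
  show "?g -` B \<inter> space PA \<in> sets PA"
  proof (cases "0 \<in> B")
    case True
    have "?g -` B \<inter> space PA = space PA - I \<times> (h -` (- B) \<inter> space P)"
      using True by (auto simp: space_PA indicator_def split: if_splits)
    moreover have "I \<times> (h -` (- B) \<inter> space P) \<in> sets PA" using B by (intro I pre) auto
    ultimately show ?thesis by auto
  next
    case False
    have sub: "I \<times> (h -` B \<inter> space P) \<subseteq> space PA"
      using I[OF pre[OF B]] by (rule sets.sets_into_space)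
    have "?g -` B \<inter> space PA = I \<times> (h -` B \<inter> space P)"
    proof (intro set_eqI iffI)
      fix p assume "p \<in> ?g -` B \<inter> space PA"
      then show "p \<in> I \<times> (h -` B \<inter> space P)"
        using False by (cases "fst p \<in> I") (auto simp: space_PA)
    next
      fix p assume p: "p \<in> I \<times> (h -` B \<inter> space P)"
      then show "p \<in> ?g -` B \<inter> space PA" using sub by auto
    qed
    then show ?thesis using I[OF pre[OF B]] by simp
  qed
qed simp

lemma elem_predictable:
  fixes K :: "real \<Rightarrow> 'a \<Rightarrow> 'b::euclidean_space"
  assumes "elem K" shows "(\<lambda>p. K (fst p) (snd p)) \<in> borel_measurable PA"
proof -
  obtain E where E: "simple E K" using assms by (auto simp: elem_def)
  note gE = simple_grid[OF E]
  have fE: "finite (E - {T})" using gE by (simp add: grid_def)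
  have "(\<lambda>p. indicat_real {0} (fst p) *\<^sub>R K 0 (snd p) +
      (\<Sum>a\<in>E - {T}. indicat_real {a<..nxt E a} (fst p) *\<^sub>R K (nxt E a) (snd p))) \<in> borel_measurable PA"
  proof (intro borel_measurable_add borel_measurable_sum)
    show "(\<lambda>p. indicat_real {0} (fst p) *\<^sub>R K 0 (snd p)) \<in> borel_measurable PA"
      by (rule rectangle_measurable[OF _ _ _ simple_zero[OF E]])
        (use T_pos in \<open>auto intro!: pred_gen_in_PA simp: pred_gen_def\<close>)
    fix a assume a: "a \<in> E - {T}"
    show "(\<lambda>p. indicat_real {a<..nxt E a} (fst p) *\<^sub>R K (nxt E a) (snd p)) \<in> borel_measurable PA"
    proof (rule rectangle_measurable[OF _ _ _ simple_measurable[OF E a]])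
      show "0 \<le> a" "a \<le> T" using nxt[OF gE a] by auto
      show "{a<..nxt E a} \<times> B \<in> sets PA" if "B \<in> sets (F a)" for B
        by (rule pred_gen_in_PA) (use that nxt[OF gE a] in \<open>unfold pred_gen_def, blast\<close>)
    qed
  qed
  then show ?thesis
  proof (subst measurable_cong)
    fix p assume "p \<in> space PA"
    then have p: "fst p \<in> {0..T}" "snd p \<in> space P" by (auto simp: space_PA)
    show "K (fst p) (snd p) = indicat_real {0} (fst p) *\<^sub>R K 0 (snd p) +
      (\<Sum>a\<in>E - {T}. indicat_real {a<..nxt E a} (fst p) *\<^sub>R K (nxt E a) (snd p))"
    proof (cases "fst p = 0")
      case True
      have "indicat_real {a<..nxt E a} 0 *\<^sub>R K (nxt E a) (snd p) = 0" if "a \<in> E - {T}" for a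
        using nxt(4)[OF gE that] by simp
      then have "(\<Sum>a\<in>E - {T}. indicat_real {a<..nxt E a} 0 *\<^sub>R K (nxt E a) (snd p)) = 0"
        by (intro sum.neutral) blast
      then show ?thesis using True by simp
    next
      case False
      then obtain a where a: "a \<in> E - {T}" "a < fst p" "fst p \<le> nxt E a"
        using grid_cell[OF gE, of "fst p"] p by auto
      have "(\<Sum>b\<in>E - {T}. indicat_real {b<..nxt E b} (fst p) *\<^sub>R K (nxt E b) (snd p)) =
        (\<Sum>b\<in>{a}. indicat_real {b<..nxt E b} (fst p) *\<^sub>R K (nxt E b) (snd p))"
      proof (rule sum.mono_neutral_right[OF fE])
        show "{a} \<subseteq> E - {T}" using a by simp
        show "\<forall>b\<in>E - {T} - {a}. indicat_real {b<..nxt E b} (fst p) *\<^sub>R K (nxt E b) (snd p) = 0"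
        proof
          fix b assume "b \<in> E - {T} - {a}"
          then have "nxt E b \<le> a \<or> nxt E a \<le> b"
            using nxt(7)[OF gE, of b a] nxt(7)[OF gE a(1), of b] a by force
          then have "fst p \<notin> {b<..nxt E b}" using a by auto
          then show "indicat_real {b<..nxt E b} (fst p) *\<^sub>R K (nxt E b) (snd p) = 0" by simp
        qed
      qed
      also have "\<dots> = K (fst p) (snd p)" using simple_cell[OF E a p(2)] a by simp
      finally show ?thesis using False by simp
    qed
  qed
qed

definition bdd_by :: "(real \<Rightarrow> 'a \<Rightarrow> 'b::euclidean_space) \<Rightarrow> real \<Rightarrow> bool" where
  "bdd_by H c \<longleftrightarrow> (\<forall>t\<in>{0..T}. \<forall>\<omega>\<in>space P. norm (H t \<omega>) \<le> c)"

definition bdd_pred :: "(real \<Rightarrow> 'a \<Rightarrow> 'b::euclidean_space) \<Rightarrow> bool" where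
  "bdd_pred H \<longleftrightarrow> (\<lambda>p. H (fst p) (snd p)) \<in> borel_measurable PA \<and> (\<exists>c\<ge>0. bdd_by H c)"

lemma bdd_byD: "bdd_by H c \<Longrightarrow> t \<in> {0..T} \<Longrightarrow> \<omega> \<in> space P \<Longrightarrow> norm (H t \<omega>) \<le> c"
  by (simp add: bdd_by_def)

lemma bdd_predE:
  assumes "bdd_pred H" obtains c where "0 \<le> c" "bdd_by H c"
  using assms unfolding bdd_pred_def by blast

lemma bdd_pred_measurable: "bdd_pred H \<Longrightarrow> (\<lambda>p. H (fst p) (snd p)) \<in> borel_measurable PA"
  by (simp add: bdd_pred_def)

lemma predictable_iff: "predictable P F T H \<longleftrightarrow> (\<lambda>p. H (fst p) (snd p)) \<in> borel_measurable PA"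
  by (simp add: predictable_def split_beta')

lemma bdd_predI: "(\<lambda>p. H (fst p) (snd p)) \<in> borel_measurable PA \<Longrightarrow> bdd_by H c \<Longrightarrow> bdd_pred H"
  unfolding bdd_pred_def by (intro conjI exI[of _ "max 0 c"]) (auto simp: bdd_by_def max.coboundedI2)

lemma elem_bdd_pred: "elem K \<Longrightarrow> bdd_pred K"
proof -
  assume K: "elem K"
  then obtain E where "simple E K" by (auto simp: elem_def)
  from simple_bounded[OF this] obtain c where "\<And>t \<omega>. t \<in> {0..T} \<Longrightarrow> \<omega> \<in> space P \<Longrightarrow> norm (K t \<omega>) \<le> c"
    by blast
  then have "bdd_by K c" unfolding bdd_by_def by blast
  then show ?thesis by (rule bdd_predI[OF elem_predictable[OF K]])
qed

lemma bdd_pred_add: "bdd_pred H \<Longrightarrow> bdd_pred G \<Longrightarrow> bdd_pred (\<lambda>t \<omega>. H t \<omega> + G t \<omega>)"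
proof -
  assume H: "bdd_pred H" and G: "bdd_pred G"
  obtain c where c: "bdd_by H c" using H by (rule bdd_predE)
  obtain d where d: "bdd_by G d" using G by (rule bdd_predE)
  show ?thesis
  proof (rule bdd_predI)
    show "(\<lambda>p. H (fst p) (snd p) + G (fst p) (snd p)) \<in> borel_measurable PA"
      by (rule borel_measurable_add[OF bdd_pred_measurable[OF H] bdd_pred_measurable[OF G]])
    show "bdd_by (\<lambda>t \<omega>. H t \<omega> + G t \<omega>) (c + d)"
      unfolding bdd_by_def by (intro ballI norm_triangle_le add_mono bdd_byD[OF c] bdd_byD[OF d])
  qed
qed

lemma bdd_by_scaleR:
  assumes "bdd_by k c" "bdd_by H d" "0 \<le> c" shows "bdd_by (\<lambda>t \<omega>. k t \<omega> *\<^sub>R H t \<omega>) (c * d)"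
  unfolding bdd_by_def
proof (intro ballI)
  fix t \<omega> assume t: "t \<in> {0..T}" "\<omega> \<in> space P"
  show "norm (k t \<omega> *\<^sub>R H t \<omega>) \<le> c * d"
    unfolding norm_scaleR using bdd_byD[OF assms(1) t] bdd_byD[OF assms(2) t] assms(3)
    by (intro mult_mono) auto
qed

lemma bdd_pred_scaleR: "bdd_pred k \<Longrightarrow> bdd_pred H \<Longrightarrow> bdd_pred (\<lambda>t \<omega>. k t \<omega> *\<^sub>R H t \<omega>)"
proof -
  assume k: "bdd_pred k" and H: "bdd_pred H"
  obtain c where c: "0 \<le> c" "bdd_by k c" using k by (rule bdd_predE)
  obtain d where d: "bdd_by H d" using H by (rule bdd_predE)
  show ?thesis
  proof (rule bdd_predI[OF _ bdd_by_scaleR[OF c(2) d c(1)]])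
    show "(\<lambda>p. k (fst p) (snd p) *\<^sub>R H (fst p) (snd p)) \<in> borel_measurable PA"
      by (rule borel_measurable_scaleR[OF bdd_pred_measurable[OF k] bdd_pred_measurable[OF H]])
  qed
qed

lemma bdd_pred_cscaleR: "bdd_pred H \<Longrightarrow> bdd_pred (\<lambda>t \<omega>. c *\<^sub>R H t \<omega>)"
  using bdd_pred_scaleR[OF elem_bdd_pred[OF elem_const]] .

lemma bdd_pred_diff: "bdd_pred H \<Longrightarrow> bdd_pred G \<Longrightarrow> bdd_pred (\<lambda>t \<omega>. H t \<omega> - G t \<omega>)"
  using bdd_pred_add[OF _ bdd_pred_cscaleR[of G "-1"]] by simp

lemma bdd_pred_limit:
  assumes H: "\<And>n. bdd_pred (H n)" and c: "\<And>n. bdd_by (H n) c"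
    and lim: "\<And>t \<omega>. t \<in> {0..T} \<Longrightarrow> \<omega> \<in> space P \<Longrightarrow> (\<lambda>n. H n t \<omega>) \<longlonglongrightarrow> H' t \<omega>"
  shows "bdd_pred H'" "bdd_by H' c"
proof -
  show B: "bdd_by H' c"
    unfolding bdd_by_def
  proof (intro ballI)
    fix t \<omega> assume t: "t \<in> {0..T}" "\<omega> \<in> space P"
    show "norm (H' t \<omega>) \<le> c"
      by (rule LIMSEQ_le_const2[OF tendsto_norm[OF lim[OF t]]]) (use bdd_byD[OF c t] in blast)
  qed
  show "bdd_pred H'"
  proof (rule bdd_predI[OF _ B])
    show "(\<lambda>p. H' (fst p) (snd p)) \<in> borel_measurable PA"
      by (rule borel_measurable_LIMSEQ_metric[OF bdd_pred_measurable[OF H]]) (rule lim, auto simp: space_PA)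
  qed
qed

text \<open>The value at time zero, viewed as a process constant in time, is bounded by
  \<open>csup\<close> of the difference, because \<open>0 \<in> dtimes\<close> and the approximants
  start at zero.\<close>

lemma zero_start_limit:
  assumes X: "\<And>n. adc (X n)" "\<And>n. AE \<omega> in P. X n 0 \<omega> = 0" and Z: "adc Z"
    and lim: "(\<lambda>n. ucp_norm (\<lambda>t \<omega>. X n t \<omega> - Z t \<omega>)) \<longlonglongrightarrow> 0"
  shows "AE \<omega> in P. Z 0 \<omega> = 0"
proof -
  define Y where "Y = (\<lambda>t :: real. Z 0)"
  have Y: "meas_proc Y" using adc_meas_proc[OF Z] T_pos by (auto simp: Y_def meas_proc_def)
  have b: "ucp_norm Y \<le> ucp_norm (\<lambda>t \<omega>. X n t \<omega> - Z t \<omega>)" for n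
  proof -
    let ?D = "\<lambda>t \<omega>. X n t \<omega> - Z t \<omega>"
    have "AE \<omega> in P. \<forall>t\<in>dtimes. min 1 \<bar>Y t \<omega>\<bar> \<le> 1 * csup ?D \<omega>"
      using X(2)[of n]
    proof eventually_elim
      case (elim \<omega>)
      have "\<bar>Y t \<omega>\<bar> = \<bar>?D 0 \<omega>\<bar>" for t by (simp add: Y_def elim)
      then show ?case using csup_upper[OF dtimes(4), of ?D \<omega>] by simp
    qed
    from ucp_norm_le_mult[OF Y adc_meas_proc[OF adc_diff[OF X(1) Z]] _ this] show ?thesis by simp
  qed
  have "ucp_norm Y \<le> 0" using b by (intro LIMSEQ_le_const[OF lim]) blast
  then have "ucp_norm Y = 0" using ucp_norm_nonneg[of Y] by simp
  from ucp_norm_zeroD[OF Y this] show ?thesis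
    by eventually_elim (use dtimes(4) in \<open>auto simp: Y_def\<close>)
qed

end

section \<open>Integration under an L2 control\<close>

text \<open>Since \<open>\<mu>\<close> is finite, bounded pointwise convergence of integrands is
  convergence in \<open>L\<^sup>2(\<mu>)\<close>. Together with \<open>control\<close> this takes
  the place of dominated convergence for stochastic integrals.\<close>

locale controlled = filtered_space P F T
  for P :: "'a measure" and F :: "real \<Rightarrow> 'a measure" and T :: real +
  fixes S :: "('a, 'b::euclidean_space) process" and \<mu> :: "(real \<times> 'a) measure"
  assumes S_adc: "adapted_cadlag P F T S"
    and fin_mu: "finite_measure \<mu>" and sets_mu: "sets \<mu> = sets (predictable_algebra P F T)"
    and control: "0 < e \<Longrightarrow>
      \<exists>d>0. \<forall>K. elem K \<longrightarrow> (\<integral>p. (norm (K (fst p) (snd p)))\<^sup>2 \<partial>\<mu>) < d \<longrightarrow> ucp_norm (eint K S) < e"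
begin

lemma space_mu: "space \<mu> = {0..T} \<times> space P"
  using sets_eq_imp_space_eq[OF sets_mu] space_PA by simp

text \<open>The square of the norm in \<open>L\<^sup>2(\<mu>)\<close>. Without the root the triangle
  inequality carries factors two, see \<open>l2_add\<close>; the constants \<open>d / 4\<close>
  below stem from that.\<close>

definition l2 :: "(real \<Rightarrow> 'a \<Rightarrow> 'c::euclidean_space) \<Rightarrow> real" where
  "l2 K = (\<integral>p. (norm (K (fst p) (snd p)))\<^sup>2 \<partial>\<mu>)"

lemma l2_integrable:
  assumes "bdd_pred H" shows "integrable \<mu> (\<lambda>p. (norm (H (fst p) (snd p)))\<^sup>2)"
proof -
  obtain c where c: "0 \<le> c" "bdd_by H c" using assms by (rule bdd_predE)
  interpret finite_measure \<mu> by (rule fin_mu)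
  show ?thesis
  proof (rule integrable_const_bound[where B="c\<^sup>2"])
    have "(norm (H (fst p) (snd p)))\<^sup>2 \<le> c\<^sup>2" if "p \<in> space \<mu>" for p
      using bdd_byD[OF c(2), of "fst p" "snd p"] that by (intro power_mono) (auto simp: space_mu)
    then show "AE p in \<mu>. norm ((norm (H (fst p) (snd p)))\<^sup>2) \<le> c\<^sup>2" by (intro AE_I2) simp
    have "(\<lambda>p. H (fst p) (snd p)) \<in> borel_measurable \<mu>"
      using bdd_pred_measurable[OF assms] by (simp add: measurable_cong_sets[OF sets_mu refl])
    then show "(\<lambda>p. (norm (H (fst p) (snd p)))\<^sup>2) \<in> borel_measurable \<mu>" by measurable
  qed
qed

lemma l2_nonneg: "0 \<le> l2 H"
  unfolding l2_def by (rule integral_nonneg_AE) simp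

lemma l2_add:
  assumes "bdd_pred H" "bdd_pred G" shows "l2 (\<lambda>t \<omega>. H t \<omega> + G t \<omega>) \<le> 2 * l2 H + 2 * l2 G"
proof -
  have "l2 (\<lambda>t \<omega>. H t \<omega> + G t \<omega>) \<le>
      (\<integral>p. 2 * (norm (H (fst p) (snd p)))\<^sup>2 + 2 * (norm (G (fst p) (snd p)))\<^sup>2 \<partial>\<mu>)"
    unfolding l2_def
    using l2_integrable[OF bdd_pred_add[OF assms]] l2_integrable[OF assms(1)] l2_integrable[OF assms(2)]
    by (intro integral_mono norm_add_square_le) auto
  also have "\<dots> = 2 * l2 H + 2 * l2 G"
    unfolding l2_def using l2_integrable[OF assms(1)] l2_integrable[OF assms(2)] by simp
  finally show ?thesis .
qed

lemma l2_minus_commute: "l2 (\<lambda>t \<omega>. H t \<omega> - G t \<omega>) = l2 (\<lambda>t \<omega>. G t \<omega> - H t \<omega>)"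
  by (simp add: l2_def norm_minus_commute)

lemma l2_mono:
  assumes "bdd_pred H" "bdd_pred G" "0 \<le> c"
    and "\<And>t \<omega>. t \<in> {0..T} \<Longrightarrow> \<omega> \<in> space P \<Longrightarrow> norm (H t \<omega>) \<le> c * norm (G t \<omega>)"
  shows "l2 H \<le> c\<^sup>2 * l2 G"
proof -
  have "l2 H \<le> (\<integral>p. c\<^sup>2 * (norm (G (fst p) (snd p)))\<^sup>2 \<partial>\<mu>)"
    unfolding l2_def
  proof (rule integral_mono)
    fix p assume "p \<in> space \<mu>"
    then have "norm (H (fst p) (snd p)) \<le> c * norm (G (fst p) (snd p))"
      by (intro assms(4)) (auto simp: space_mu)
    then show "(norm (H (fst p) (snd p)))\<^sup>2 \<le> c\<^sup>2 * (norm (G (fst p) (snd p)))\<^sup>2"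
      by (metis norm_ge_zero power_mono power_mult_distrib)
  qed (use l2_integrable[OF assms(1)] l2_integrable[OF assms(2)] in auto)
  then show ?thesis by (simp add: l2_def)
qed

lemma l2_limit:
  assumes H: "\<And>n. bdd_pred (H n)" and c: "\<And>n. bdd_by (H n) c"
    and lim: "\<And>t \<omega>. t \<in> {0..T} \<Longrightarrow> \<omega> \<in> space P \<Longrightarrow> (\<lambda>n. H n t \<omega>) \<longlonglongrightarrow> H' t \<omega>"
  shows "(\<lambda>n. l2 (\<lambda>t \<omega>. H n t \<omega> - H' t \<omega>)) \<longlonglongrightarrow> 0"
proof -
  interpret finite_measure \<mu> by (rule fin_mu)
  note H' = bdd_pred_limit[OF H c lim]
  have "(\<lambda>n. \<integral>p. (norm (H n (fst p) (snd p) - H' (fst p) (snd p)))\<^sup>2 \<partial>\<mu>) \<longlonglongrightarrow> (\<integral>p. 0 \<partial>\<mu>)"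
  proof (rule integral_dominated_convergence[where w="\<lambda>_. (2 * c)\<^sup>2"])
    show "(\<lambda>p. (norm (H n (fst p) (snd p) - H' (fst p) (snd p)))\<^sup>2) \<in> borel_measurable \<mu>" for n
      by (rule borel_measurable_integrable[OF l2_integrable[OF bdd_pred_diff[OF H H'(1)]]])
    show "AE p in \<mu>. (\<lambda>n. (norm (H n (fst p) (snd p) - H' (fst p) (snd p)))\<^sup>2) \<longlonglongrightarrow> 0"
    proof (rule AE_I2)
      fix p assume "p \<in> space \<mu>"
      then have "(\<lambda>n. H n (fst p) (snd p)) \<longlonglongrightarrow> H' (fst p) (snd p)" by (intro lim) (auto simp: space_mu)
      then have "(\<lambda>n. (norm (H n (fst p) (snd p) - H' (fst p) (snd p)))\<^sup>2) \<longlonglongrightarrow>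
         (norm (H' (fst p) (snd p) - H' (fst p) (snd p)))\<^sup>2"
        by (intro tendsto_power tendsto_norm tendsto_diff tendsto_const)
      then show "(\<lambda>n. (norm (H n (fst p) (snd p) - H' (fst p) (snd p)))\<^sup>2) \<longlonglongrightarrow> 0" by simp
    qed
    show "AE p in \<mu>. norm ((norm (H n (fst p) (snd p) - H' (fst p) (snd p)))\<^sup>2) \<le> (2 * c)\<^sup>2" for n
    proof (rule AE_I2)
      fix p assume "p \<in> space \<mu>"
      then have "norm (H n (fst p) (snd p)) \<le> c" "norm (H' (fst p) (snd p)) \<le> c"
        using bdd_byD[OF c] bdd_byD[OF H'(2)] by (auto simp: space_mu)
      then have "norm (H n (fst p) (snd p) - H' (fst p) (snd p)) \<le> 2 * c"
        using norm_triangle_ineq4[of "H n (fst p) (snd p)" "H' (fst p) (snd p)"] by linarith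
      then have "(norm (H n (fst p) (snd p) - H' (fst p) (snd p)))\<^sup>2 \<le> (2 * c)\<^sup>2" by (intro power_mono) auto
      then show "norm ((norm (H n (fst p) (snd p) - H' (fst p) (snd p)))\<^sup>2) \<le> (2 * c)\<^sup>2" by simp
    qed
  qed simp_all
  then show ?thesis by (simp add: l2_def)
qed

end

section \<open>Integrals of bounded predictable integrands\<close>

context controlled begin

abbreviation bint :: "('a, 'b) process \<Rightarrow> ('a, real) process \<Rightarrow> bool" where
  "bint \<equiv> bounded_integral P F T S"

lemma bint_elementary: "elem K \<Longrightarrow> bint K (eint K S)"
  by (intro bounded_integral.elementary elementary_integralI) auto

lemma ucp_norm_minus_triangle:
  assumes "adc X" "adc Y" "adc Z"
  shows "ucp_norm (\<lambda>t \<omega>. X t \<omega> - Z t \<omega>) \<le> ucp_norm (\<lambda>t \<omega>. X t \<omega> - Y t \<omega>) + ucp_norm (\<lambda>t \<omega>. Y t \<omega> - Z t \<omega>)"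
  using ucp_norm_triangle[OF adc_meas_proc[OF adc_diff[OF assms(1,2)]] adc_meas_proc[OF adc_diff[OF assms(2,3)]]] by simp

text \<open>Rule induction. In the limit step each \<open>H n\<close> is replaced by an elementary
  integrand within \<open>inverse (real (Suc n))\<close> in both senses at once, so that a single
  sequence approximates integrand and integral.\<close>

lemma bint_approx:
  assumes "bint H Z"
  shows "adc Z \<and> bdd_pred H \<and> (\<exists>K. (\<forall>j. elem (K j)) \<and> (\<lambda>j. l2 (\<lambda>t \<omega>. K j t \<omega> - H t \<omega>)) \<longlonglongrightarrow> 0 \<and>
     (\<lambda>j. ucp_norm (\<lambda>t \<omega>. eint (K j) S t \<omega> - Z t \<omega>)) \<longlonglongrightarrow> 0)"
  using assms
proof (induction rule: bounded_integral.induct)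
  case (elementary H Z)
  note el = elementary_integralD[OF elementary]
  have "adc Z" by (rule adc_cong[OF adc_eint[OF S_adc el(1)]]) (simp add: el(2))
  moreover have "ucp_norm (\<lambda>t \<omega>. eint H S t \<omega> - Z t \<omega>) = ucp_norm (\<lambda>t \<omega>. 0)"
    by (rule ucp_norm_cong_space) (simp add: el(2))
  ultimately show ?case
    using el(1) elem_bdd_pred[OF el(1)] by (intro conjI exI[of _ "\<lambda>_. H"]) (simp_all add: l2_def ucp_norm_zero_proc)
next
  case (limit H Z c H' Z')
  have aZ: "adc (Z n)" and bH: "bdd_pred (H n)" for n using limit.IH by blast+
  have B: "bdd_by (H n) c" for n unfolding bdd_by_def using limit.hyps(2) by blast
  note H' = bdd_pred_limit[OF bH B limit.hyps(3)]
  have l2lim: "(\<lambda>n. l2 (\<lambda>t \<omega>. H n t \<omega> - H' t \<omega>)) \<longlonglongrightarrow> 0" by (rule l2_limit[OF bH B limit.hyps(3)])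
  have nlim: "(\<lambda>n. ucp_norm (\<lambda>t \<omega>. Z n t \<omega> - Z' t \<omega>)) \<longlonglongrightarrow> 0"
    using limit.hyps(5) ucp_iff[OF aZ limit.hyps(4)] by simp
  have "\<forall>n. \<exists>K. elem K \<and> l2 (\<lambda>t \<omega>. K t \<omega> - H n t \<omega>) < inverse (real (Suc n)) \<and>
      ucp_norm (\<lambda>t \<omega>. eint K S t \<omega> - Z n t \<omega>) < inverse (real (Suc n))" (is "\<forall>n. ?Q n")
  proof
    fix n
    obtain K where K: "\<And>j. elem (K j)" "(\<lambda>j. l2 (\<lambda>t \<omega>. K j t \<omega> - H n t \<omega>)) \<longlonglongrightarrow> 0"
      "(\<lambda>j. ucp_norm (\<lambda>t \<omega>. eint (K j) S t \<omega> - Z n t \<omega>)) \<longlonglongrightarrow> 0" using limit.IH[of n] by blast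
    have p: "0 < inverse (real (Suc n))" by simp
    obtain j where "l2 (\<lambda>t \<omega>. K j t \<omega> - H n t \<omega>) < inverse (real (Suc n))"
      "ucp_norm (\<lambda>t \<omega>. eint (K j) S t \<omega> - Z n t \<omega>) < inverse (real (Suc n))"
      using eventually_happens[OF eventually_conj[OF order_tendstoD(2)[OF K(2) p] order_tendstoD(2)[OF K(3) p]]]
      by auto
    then show "?Q n" using K(1) by blast
  qed
  from choice[OF this] obtain K where K: "\<And>n. elem (K n)"
    "\<And>n. l2 (\<lambda>t \<omega>. K n t \<omega> - H n t \<omega>) < inverse (real (Suc n))"
    "\<And>n. ucp_norm (\<lambda>t \<omega>. eint (K n) S t \<omega> - Z n t \<omega>) < inverse (real (Suc n))" by blast
  have "(\<lambda>n. 2 * inverse (real (Suc n)) + 2 * l2 (\<lambda>t \<omega>. H n t \<omega> - H' t \<omega>)) \<longlonglongrightarrow> 2 * 0 + 2 * 0"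
    by (intro tendsto_add tendsto_mult tendsto_const l2lim LIMSEQ_inverse_real_of_nat)
  then have lim1: "(\<lambda>n. 2 * inverse (real (Suc n)) + 2 * l2 (\<lambda>t \<omega>. H n t \<omega> - H' t \<omega>)) \<longlonglongrightarrow> 0" by simp
  have "(\<lambda>n. inverse (real (Suc n)) + ucp_norm (\<lambda>t \<omega>. Z n t \<omega> - Z' t \<omega>)) \<longlonglongrightarrow> 0 + 0"
    by (intro tendsto_add nlim LIMSEQ_inverse_real_of_nat)
  then have lim2: "(\<lambda>n. inverse (real (Suc n)) + ucp_norm (\<lambda>t \<omega>. Z n t \<omega> - Z' t \<omega>)) \<longlonglongrightarrow> 0" by simp
  have b1: "l2 (\<lambda>t \<omega>. K n t \<omega> - H' t \<omega>) \<le> 2 * inverse (real (Suc n)) + 2 * l2 (\<lambda>t \<omega>. H n t \<omega> - H' t \<omega>)" for n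
    using l2_add[OF bdd_pred_diff[OF elem_bdd_pred[OF K(1)[of n]] bH[of n]] bdd_pred_diff[OF bH[of n] H'(1)]] K(2)[of n]
    by simp
  have b2: "ucp_norm (\<lambda>t \<omega>. eint (K n) S t \<omega> - Z' t \<omega>) \<le>
      inverse (real (Suc n)) + ucp_norm (\<lambda>t \<omega>. Z n t \<omega> - Z' t \<omega>)" for n
    using ucp_norm_minus_triangle[OF adc_eint[OF S_adc K(1)[of n]] aZ[of n] limit.hyps(4)] K(3)[of n] by linarith
  have "(\<lambda>n. l2 (\<lambda>t \<omega>. K n t \<omega> - H' t \<omega>)) \<longlonglongrightarrow> 0"
    by (rule tendsto_sandwich[OF always_eventually[OF allI[OF l2_nonneg]] always_eventually[OF allI[OF b1]]
          tendsto_const lim1])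
  moreover have "(\<lambda>n. ucp_norm (\<lambda>t \<omega>. eint (K n) S t \<omega> - Z' t \<omega>)) \<longlonglongrightarrow> 0"
    by (rule tendsto_sandwich[OF always_eventually[OF allI[OF ucp_norm_nonneg]] always_eventually[OF allI[OF b2]]
          tendsto_const lim2])
  ultimately show ?case using limit.hyps(4) H'(1) K(1) by blast
qed

lemma bint_adc: "bint H Z \<Longrightarrow> adc Z" and bint_bdd_pred: "bint H Z \<Longrightarrow> bdd_pred H"
  using bint_approx by blast+

text \<open>The bound of \<open>control\<close> passes from elementary to bounded integrands:
  \<open>H\<close> is approximated by an elementary \<open>K j\<close>, whose \<open>l2\<close>
  stays below \<open>2 * (d / 4) + 2 * (d / 4) = d\<close>.\<close>

lemma bint_small:
  assumes "0 < e"
  obtains d where "0 < d" "\<And>H Z. bint H Z \<Longrightarrow> l2 H < d \<Longrightarrow> ucp_norm Z < e"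
proof -
  have "0 < e / 2" using assms by simp
  from control[OF this] obtain d where d: "0 < d" "\<And>K. elem K \<Longrightarrow> l2 K < d \<Longrightarrow> ucp_norm (eint K S) < e / 2"
    unfolding l2_def by blast
  have "ucp_norm Z < e" if Z: "bint H Z" and H: "l2 H < d / 4" for H Z
  proof -
    obtain K where K: "\<And>j. elem (K j)" "(\<lambda>j. l2 (\<lambda>t \<omega>. K j t \<omega> - H t \<omega>)) \<longlonglongrightarrow> 0"
      "(\<lambda>j. ucp_norm (\<lambda>t \<omega>. eint (K j) S t \<omega> - Z t \<omega>)) \<longlonglongrightarrow> 0" using bint_approx[OF Z] by blast
    have p: "0 < d / 4" "0 < e / 2" using d(1) assms by auto
    obtain j where j: "l2 (\<lambda>t \<omega>. K j t \<omega> - H t \<omega>) < d / 4" "ucp_norm (\<lambda>t \<omega>. eint (K j) S t \<omega> - Z t \<omega>) < e / 2"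
      using eventually_happens'[OF trivial_limit_sequentially
          eventually_conj[OF order_tendstoD(2)[OF K(2) p(1)] order_tendstoD(2)[OF K(3) p(2)]]] by blast
    have "l2 (K j) < d"
      using l2_add[OF bdd_pred_diff[OF elem_bdd_pred[OF K(1)[of j]] bint_bdd_pred[OF Z]] bint_bdd_pred[OF Z]] j(1) H by simp
    then have "ucp_norm (eint (K j) S) < e / 2" by (rule d(2)[OF K(1)])
    moreover have "ucp_norm (\<lambda>t \<omega>. eint (K j) S t \<omega> - (eint (K j) S t \<omega> - Z t \<omega>)) \<le>
        ucp_norm (eint (K j) S) + ucp_norm (\<lambda>t \<omega>. eint (K j) S t \<omega> - Z t \<omega>)"
      using adc_eint[OF S_adc K(1)[of j]] bint_adc[OF Z] by (intro ucp_norm_triangle_diff adc_meas_proc adc_diff)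
    ultimately show ?thesis using j(2) by simp
  qed
  then show ?thesis using that[of "d / 4"] d(1) by simp
qed

lemma ucp_norm_eqI: "adc X \<Longrightarrow> (\<And>e. 0 < e \<Longrightarrow> ucp_norm X < e) \<Longrightarrow> ucp_norm X = 0"
  using ucp_norm_nonneg[of X] by (metis less_irrefl order_le_less)

text \<open>The rule \<open>limit\<close>, applied to constant sequences, replaces the integrand off
  \<open>{0..T} \<times> space P\<close> and the integral by an indistinguishable version.\<close>

lemma bint_cong:
  assumes "bint H Z" "\<And>t \<omega>. t \<in> {0..T} \<Longrightarrow> \<omega> \<in> space P \<Longrightarrow> H t \<omega> = H' t \<omega>"
    and "adc Z'" "ucp_norm (\<lambda>t \<omega>. Z t \<omega> - Z' t \<omega>) = 0"
  shows "bint H' Z'"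
proof -
  obtain c where c: "bdd_by H c" using bdd_predE[OF bint_bdd_pred[OF assms(1)]] by blast
  show ?thesis
  proof (rule bounded_integral.limit[of _ _ _ _ "\<lambda>_. H" "\<lambda>_. Z" c])
    show "bint H Z" by fact
    show "norm (H t \<omega>) \<le> c" if "t \<in> {0..T}" "\<omega> \<in> space P" for t \<omega> by (rule bdd_byD[OF c that])
    show "(\<lambda>n. H t \<omega>) \<longlonglongrightarrow> H' t \<omega>" if "t \<in> {0..T}" "\<omega> \<in> space P" for t \<omega> using assms(2)[OF that] by simp
    show "adc Z'" by fact
    show "ucp_tendsto P T (\<lambda>_. Z) Z'"
      using ucp_iff[of "\<lambda>_. Z" Z', OF bint_adc[OF assms(1)] assms(3)] assms(4) by simp
  qed
qed

lemma bint_cong_space: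
  assumes "bint H Z" "\<And>t \<omega>. t \<in> {0..T} \<Longrightarrow> \<omega> \<in> space P \<Longrightarrow> H t \<omega> = H' t \<omega>"
    and "\<And>t \<omega>. t \<in> {0..T} \<Longrightarrow> \<omega> \<in> space P \<Longrightarrow> Z t \<omega> = Z' t \<omega>"
  shows "bint H' Z'"
proof (rule bint_cong[OF assms(1,2)])
  show "adc Z'" by (rule adc_cong[OF bint_adc[OF assms(1)] assms(3)])
  have "ucp_norm (\<lambda>t \<omega>. Z t \<omega> - Z' t \<omega>) = ucp_norm (\<lambda>t \<omega>. 0)" by (rule ucp_norm_cong_space) (simp add: assms(3))
  then show "ucp_norm (\<lambda>t \<omega>. Z t \<omega> - Z' t \<omega>) = 0" by (simp add: ucp_norm_zero_proc)
qed

text \<open>A nested induction: limits in the second argument are taken first, for elementary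
  \<open>H\<close>, and then limits in the first argument for arbitrary \<open>G\<close>.\<close>

lemma bint_add:
  assumes "bint H Z" "bint G W"
  shows "bint (\<lambda>t \<omega>. H t \<omega> + G t \<omega>) (\<lambda>t \<omega>. Z t \<omega> + W t \<omega>)"
  using assms
proof (induction arbitrary: G W rule: bounded_integral.induct)
  case (elementary H Z)
  note H = elementary_integralD[OF elementary(1)]
  show ?case
    using elementary(2)
  proof (induction rule: bounded_integral.induct)
    case (elementary G W)
    note G = elementary_integralD[OF elementary]
    show ?case
      by (intro bounded_integral.elementary elementary_integralI elem_add[OF H(1) G(1)])
        (simp add: H(2) G(2) eint_add[OF H(1) G(1)])
  next
    case (limit G W c G' W')
    obtain d where d: "bdd_by H d" using bdd_predE[OF elem_bdd_pred[OF H(1)]] by blast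
    show ?case
    proof (rule bounded_integral.limit[of _ _ _ _ "\<lambda>n t \<omega>. H t \<omega> + G n t \<omega>" "\<lambda>n t \<omega>. Z t \<omega> + W n t \<omega>" "d + c"])
      show "norm (H t \<omega> + G n t \<omega>) \<le> d + c" if "t \<in> {0..T}" "\<omega> \<in> space P" for n t \<omega>
        by (rule norm_triangle_le[OF add_mono[OF bdd_byD[OF d that] limit.hyps(2)[OF that]]])
      show "(\<lambda>n. H t \<omega> + G n t \<omega>) \<longlonglongrightarrow> H t \<omega> + G' t \<omega>" if "t \<in> {0..T}" "\<omega> \<in> space P" for t \<omega>
        by (intro tendsto_add tendsto_const limit.hyps(3)[OF that])
      show "adc (\<lambda>t \<omega>. Z t \<omega> + W' t \<omega>)"
        by (rule adc_add[OF bint_adc[OF bounded_integral.elementary[OF \<open>elementary_integral P F T S H Z\<close>]] limit.hyps(4)])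
      show "ucp_tendsto P T (\<lambda>n t \<omega>. Z t \<omega> + W n t \<omega>) (\<lambda>t \<omega>. Z t \<omega> + W' t \<omega>)"
        using limit.hyps(5) by (simp add: ucp_tendsto_def)
    qed (rule limit.IH)
  qed
next
  case (limit H Z c H' Z')
  obtain d where d: "bdd_by G d" using bdd_predE[OF bint_bdd_pred[OF limit.prems]] by blast
  show ?case
  proof (rule bounded_integral.limit[of _ _ _ _ "\<lambda>n t \<omega>. H n t \<omega> + G t \<omega>" "\<lambda>n t \<omega>. Z n t \<omega> + W t \<omega>" "c + d"])
    show "norm (H n t \<omega> + G t \<omega>) \<le> c + d" if "t \<in> {0..T}" "\<omega> \<in> space P" for n t \<omega>
      by (rule norm_triangle_le[OF add_mono[OF limit.hyps(2)[OF that] bdd_byD[OF d that]]])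
    show "(\<lambda>n. H n t \<omega> + G t \<omega>) \<longlonglongrightarrow> H' t \<omega> + G t \<omega>" if "t \<in> {0..T}" "\<omega> \<in> space P" for t \<omega>
      by (intro tendsto_add tendsto_const limit.hyps(3)[OF that])
    show "adc (\<lambda>t \<omega>. Z' t \<omega> + W t \<omega>)" by (rule adc_add[OF limit.hyps(4) bint_adc[OF limit.prems]])
    show "ucp_tendsto P T (\<lambda>n t \<omega>. Z n t \<omega> + W t \<omega>) (\<lambda>t \<omega>. Z' t \<omega> + W t \<omega>)"
      using limit.hyps(5) by (simp add: ucp_tendsto_def)
  qed (rule limit.IH[OF limit.prems])
qed

text \<open>For fixed \<open>k\<close> the map \<open>eint k\<close> is continuous in the integrator
  by \<open>eint_ucp_norm_bound\<close>, so associativity survives the limits that define the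
  integral.\<close>

lemma bint_elem_mult:
  assumes k: "elem k" and "bint H Z"
  shows "bint (\<lambda>t \<omega>. k t \<omega> *\<^sub>R H t \<omega>) (eint k Z)"
  using assms(2)
proof (induction rule: bounded_integral.induct)
  case (elementary H Z)
  note H = elementary_integralD[OF elementary]
  show ?case
  proof (rule bounded_integral.elementary[OF elementary_integralI[OF elem_scaleR[OF k H(1)]]])
    fix t \<omega> assume t: "t \<in> {0..T}" "\<omega> \<in> space P"
    have "eint k Z t \<omega> = eint k (eint H S) t \<omega>"
      by (rule eint_cong_right[OF k t(2,1)]) (use t in \<open>auto intro!: H(2)\<close>)
    then show "eint k Z t \<omega> = eint (\<lambda>t \<omega>. k t \<omega> *\<^sub>R H t \<omega>) S t \<omega>" by (simp add: eint_assoc[OF k H(1) t(2)])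
  qed
next
  case (limit H Z c H' Z')
  obtain d where d: "0 \<le> d" "bdd_by k d" by (rule bdd_predE[OF elem_bdd_pred[OF k]])
  obtain C where C: "0 \<le> C" "\<And>X. adc X \<Longrightarrow> ucp_norm (eint k X) \<le> C * ucp_norm X" using eint_ucp_norm_bound[OF k] by blast
  have aZ: "adc (Z n)" for n by (rule bint_adc[OF limit.hyps(1)])
  have Bc: "bdd_by (H n) c" for n unfolding bdd_by_def using limit.hyps(2) by blast
  show ?case
  proof (rule bounded_integral.limit[of _ _ _ _ "\<lambda>n t \<omega>. k t \<omega> *\<^sub>R H n t \<omega>" "\<lambda>n. eint k (Z n)" "d * c"])
    show "norm (k t \<omega> *\<^sub>R H n t \<omega>) \<le> d * c" if "t \<in> {0..T}" "\<omega> \<in> space P" for n t \<omega>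
      by (rule bdd_byD[OF bdd_by_scaleR[OF d(2) Bc d(1)] that])
    show "(\<lambda>n. k t \<omega> *\<^sub>R H n t \<omega>) \<longlonglongrightarrow> k t \<omega> *\<^sub>R H' t \<omega>" if "t \<in> {0..T}" "\<omega> \<in> space P" for t \<omega>
      by (intro tendsto_scaleR tendsto_const limit.hyps(3)[OF that])
    show a: "adc (eint k Z')" by (rule adc_eint[OF limit.hyps(4) k])
    have "(\<lambda>n. C * ucp_norm (\<lambda>t \<omega>. Z n t \<omega> - Z' t \<omega>)) \<longlonglongrightarrow> C * 0"
      using limit.hyps(5) ucp_iff[OF aZ limit.hyps(4)] by (intro tendsto_mult tendsto_const) simp
    then have lim: "(\<lambda>n. C * ucp_norm (\<lambda>t \<omega>. Z n t \<omega> - Z' t \<omega>)) \<longlonglongrightarrow> 0" by simp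
    have b: "ucp_norm (\<lambda>t \<omega>. eint k (Z n) t \<omega> - eint k Z' t \<omega>) \<le> C * ucp_norm (\<lambda>t \<omega>. Z n t \<omega> - Z' t \<omega>)" for n
      using C(2)[OF adc_diff[OF aZ[of n] limit.hyps(4)]] by (simp add: eint_diff_right[abs_def])
    show "ucp_tendsto P T (\<lambda>n. eint k (Z n)) (eint k Z')"
      unfolding ucp_iff[OF adc_eint[OF aZ k] a]
      by (rule tendsto_sandwich[OF always_eventually[OF allI[OF ucp_norm_nonneg]] always_eventually[OF allI[OF b]]
          tendsto_const lim])
  qed (rule limit.IH)
qed

lemma eint_const: "\<omega> \<in> space P \<Longrightarrow> t \<in> {0..T} \<Longrightarrow> eint (\<lambda>t \<omega>. c) X t \<omega> = c * (X t \<omega> - X 0 \<omega>)"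
  for X :: "('a, real) process"
proof -
  assume \<omega>: "\<omega> \<in> space P" and t: "t \<in> {0..T}"
  have "nxt {0, T} 0 = T"
  proof -
    have "{b \<in> {0, T}. 0 < b} = {T}" using T_pos by auto
    then show ?thesis by (simp add: nxt_def)
  qed
  moreover have "{0, T} - {T} = {0}" using T_pos by auto
  moreover have "min T t = t" "min 0 t = 0" using t by auto
  ultimately show ?thesis by (simp add: eint_eq[OF simple_const[OF grid_0T] \<omega>] grid_integral_def)
qed

lemma bint_zero_start:
  assumes "bint H Z" shows "AE \<omega> in P. Z 0 \<omega> = 0"
proof -
  obtain K where K: "\<And>j. elem (K j)" "(\<lambda>j. ucp_norm (\<lambda>t \<omega>. eint (K j) S t \<omega> - Z t \<omega>)) \<longlonglongrightarrow> 0"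
    using bint_approx[OF assms] by blast
  show ?thesis
    by (rule zero_start_limit[OF adc_eint[OF S_adc K(1)] _ bint_adc[OF assms] K(2)])
      (auto intro: AE_I2 eint_zero[OF K(1)])
qed

text \<open>Scaling is multiplication by a constant elementary integrand. That produces
  \<open>c * (Z t \<omega> - Z 0 \<omega>)\<close>, and the integral starts at zero almost
  surely.\<close>

lemma bint_scale:
  assumes "bint H Z" shows "bint (\<lambda>t \<omega>. c *\<^sub>R H t \<omega>) (\<lambda>t \<omega>. c * Z t \<omega>)"
proof (rule bint_cong[OF bint_elem_mult[OF elem_const[of c] assms]])
  note a = adc_cmult[OF bint_adc[OF assms], of c]
  show "adc (\<lambda>t \<omega>. c * Z t \<omega>)" by (rule a)
  have "ucp_norm (\<lambda>t \<omega>. eint (\<lambda>t \<omega>. c) Z t \<omega> - c * Z t \<omega>) = ucp_norm (\<lambda>t \<omega>. 0)"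
  proof (rule ucp_norm_cong[OF adc_meas_proc[OF adc_diff[OF adc_eint[OF bint_adc[OF assms] elem_const] a]] meas_proc_zero])
    show "AE \<omega> in P. \<forall>t\<in>dtimes. eint (\<lambda>t \<omega>. c) Z t \<omega> - c * Z t \<omega> = 0"
      using bint_zero_start[OF assms] AE_space
    proof eventually_elim
      case (elim \<omega>)
      show ?case using dtimes(2) elim by (auto simp: eint_const)
    qed
  qed
  then show "ucp_norm (\<lambda>t \<omega>. eint (\<lambda>t \<omega>. c) Z t \<omega> - c * Z t \<omega>) = 0" by (simp add: ucp_norm_zero_proc)
qed simp

lemma bint_diff:
  assumes "bint H Z" "bint G W"
  shows "bint (\<lambda>t \<omega>. H t \<omega> - G t \<omega>) (\<lambda>t \<omega>. Z t \<omega> - W t \<omega>)"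
  using bint_add[OF assms(1) bint_scale[OF assms(2), of "-1"]] by simp

text \<open>The difference is an integral of the zero integrand, whose \<open>l2\<close> is zero, so
  \<open>bint_small\<close> applies for every \<open>e\<close>.\<close>

lemma bint_unique:
  assumes "bint H Z" "bint H Z'" shows "ucp_norm (\<lambda>t \<omega>. Z t \<omega> - Z' t \<omega>) = 0"
proof (rule ucp_norm_eqI)
  show "adc (\<lambda>t \<omega>. Z t \<omega> - Z' t \<omega>)" using assms by (intro adc_diff bint_adc)
  fix e :: real assume "0 < e"
  then obtain d where d: "0 < d" "\<And>H Z. bint H Z \<Longrightarrow> l2 H < d \<Longrightarrow> ucp_norm Z < e" using bint_small by blast
  show "ucp_norm (\<lambda>t \<omega>. Z t \<omega> - Z' t \<omega>) < e"
    by (rule d(2)[OF bint_diff[OF assms]]) (simp add: l2_def d(1))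
qed

text \<open>The integrands converge in \<open>l2\<close>, so the integrals are Cauchy by
  \<open>bint_small\<close>, and \<open>ucp_norm_complete\<close> provides their limit.\<close>

lemma bint_limit_exists:
  assumes bint: "\<And>n. bint (H n) (Z n)" and c: "\<And>n. bdd_by (H n) c"
    and lim: "\<And>t \<omega>. t \<in> {0..T} \<Longrightarrow> \<omega> \<in> space P \<Longrightarrow> (\<lambda>n. H n t \<omega>) \<longlonglongrightarrow> H' t \<omega>"
  obtains Z' where "bint H' Z'" "(\<lambda>n. ucp_norm (\<lambda>t \<omega>. Z n t \<omega> - Z' t \<omega>)) \<longlonglongrightarrow> 0"
proof -
  have bH: "bdd_pred (H n)" and aZ: "adc (Z n)" for n using bint_bdd_pred[OF bint] bint_adc[OF bint] by auto
  note H' = bdd_pred_limit[OF bH c lim]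
  have l2lim: "(\<lambda>n. l2 (\<lambda>t \<omega>. H n t \<omega> - H' t \<omega>)) \<longlonglongrightarrow> 0" by (rule l2_limit[OF bH c lim])
  have "\<exists>N. \<forall>m\<ge>N. \<forall>n\<ge>N. ucp_norm (\<lambda>t \<omega>. Z m t \<omega> - Z n t \<omega>) < e" if e: "0 < e" for e
  proof -
    obtain d where d: "0 < d" "\<And>H Z. bint H Z \<Longrightarrow> l2 H < d \<Longrightarrow> ucp_norm Z < e" using bint_small[OF e] by blast
    have "0 < d / 4" using d(1) by simp
    from order_tendstoD(2)[OF l2lim this] obtain N where
      N: "\<And>n. n \<ge> N \<Longrightarrow> l2 (\<lambda>t \<omega>. H n t \<omega> - H' t \<omega>) < d / 4" unfolding eventually_sequentially by blast
    have "ucp_norm (\<lambda>t \<omega>. Z m t \<omega> - Z n t \<omega>) < e" if "m \<ge> N" "n \<ge> N" for m n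
    proof (rule d(2)[OF bint_diff[OF bint bint]])
      have "l2 (\<lambda>t \<omega>. (H m t \<omega> - H' t \<omega>) + (H' t \<omega> - H n t \<omega>)) \<le>
        2 * l2 (\<lambda>t \<omega>. H m t \<omega> - H' t \<omega>) + 2 * l2 (\<lambda>t \<omega>. H' t \<omega> - H n t \<omega>)"
        by (intro l2_add bdd_pred_diff bH H'(1))
      then show "l2 (\<lambda>t \<omega>. H m t \<omega> - H n t \<omega>) < d"
        using N[OF that(1)] N[OF that(2)] l2_minus_commute[of H' "H n"] by simp
    qed
    then show ?thesis by blast
  qed
  from ucp_norm_complete[OF aZ this] obtain Z' where
    Z': "adc Z'" "(\<lambda>n. ucp_norm (\<lambda>t \<omega>. Z n t \<omega> - Z' t \<omega>)) \<longlonglongrightarrow> 0" by blast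
  have "bint H' Z'"
  proof (rule bounded_integral.limit[of _ _ _ _ H Z c])
    show "bint (H n) (Z n)" for n by (rule bint)
    show "norm (H n t \<omega>) \<le> c" if "t \<in> {0..T}" "\<omega> \<in> space P" for n t \<omega> by (rule bdd_byD[OF c that])
    show "(\<lambda>n. H n t \<omega>) \<longlonglongrightarrow> H' t \<omega>" if "t \<in> {0..T}" "\<omega> \<in> space P" for t \<omega> by (rule lim[OF that])
    show "ucp_tendsto P T Z Z'" using ucp_iff[OF aZ Z'(1)] Z'(2) by simp
  qed (rule Z'(1))
  then show ?thesis using that Z'(2) by blast
qed

lemma bint_sum:
  assumes "finite I" "\<And>i. i \<in> I \<Longrightarrow> \<exists>Z. bint (H i) Z"
  shows "\<exists>Z. bint (\<lambda>t \<omega>. \<Sum>i\<in>I. H i t \<omega>) Z"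
  using assms
proof (induction I rule: finite_induct)
  case empty
  show ?case using bint_elementary[OF elem_const[of 0]] by (auto simp: )
next
  case (insert i I)
  then obtain Z W where "bint (H i) Z" "bint (\<lambda>t \<omega>. \<Sum>i\<in>I. H i t \<omega>) W" by blast
  from bint_add[OF this] show ?case using insert by auto
qed

text \<open>A Dynkin argument over the rectangles: complements use linearity and the indicator of
  the whole space, disjoint unions use \<open>bint_limit_exists\<close> along partial sums.\<close>

lemma bint_indicator:
  assumes "B \<in> sets PA" shows "\<exists>Z. bint (\<lambda>t \<omega>. indicat_real B (t, \<omega>) *\<^sub>R v) Z"
proof -
  have bnd: "bdd_by (\<lambda>t \<omega>. indicat_real C (t, \<omega>) *\<^sub>R v) (norm v)" for C
    by (auto simp: bdd_by_def indicator_def)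
  have whole: "elem (\<lambda>t \<omega>. indicat_real ({0..T} \<times> space P) (t, \<omega>))"
  proof -
    have "elem (\<lambda>t \<omega>. indicat_real {0} t * indicat_real (space P) \<omega> +
        indicat_real {0<..T} t * indicat_real (space P) \<omega>)"
      using T_pos sets.top[of "F 0"] space_F[of 0]
      by (intro elem_add elem_initial elem_rectangle) auto
    moreover have "(\<lambda>t \<omega>. indicat_real {0} t * indicat_real (space P) \<omega> +
        indicat_real {0<..T} t * indicat_real (space P) \<omega>) = (\<lambda>t \<omega>. indicat_real ({0..T} \<times> space P) (t, \<omega>))"
      using T_pos by (intro ext) (auto simp: indicator_def)
    ultimately show ?thesis by simp
  qed
  show ?thesis
    using Int_stable_pred_gen pred_gen_subset assms[unfolded sets_PA]
  proof (induction rule: sigma_sets_induct_disjoint)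
    case (basic A)
    then consider (1) B where "A = {0} \<times> B" "B \<in> sets (F 0)"
      | (2) s t B where "A = {s<..t} \<times> B" "0 \<le> s" "s < t" "t \<le> T" "B \<in> sets (F s)"
      unfolding pred_gen_def by blast
    then have "elem (\<lambda>t \<omega>. indicat_real A (t, \<omega>))"
    proof cases
      case 1
      then show ?thesis using elem_initial[OF 1(2)] by (simp add: indicator_times)
    next
      case 2
      then show ?thesis using elem_rectangle[OF 2(2-5)] by (simp add: indicator_times)
    qed
    from bint_elementary[OF elem_scaleR[OF this elem_const[of v]]] show ?case by blast
  next
    case empty
    show ?case using bint_elementary[OF elem_const[of 0]] by auto
  next
    case (compl A)
    then obtain Z where Z: "bint (\<lambda>t \<omega>. indicat_real A (t, \<omega>) *\<^sub>R v) Z" by blast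
    have sub: "A \<subseteq> {0..T} \<times> space P"
      using compl(1) pred_gen_subset sigma_sets_into_sp by blast
    have "bint (\<lambda>t \<omega>. indicat_real ({0..T} \<times> space P - A) (t, \<omega>) *\<^sub>R v)
       (\<lambda>t \<omega>. eint (\<lambda>t \<omega>. indicat_real ({0..T} \<times> space P) (t, \<omega>) *\<^sub>R v) S t \<omega> - Z t \<omega>)"
    proof (rule bint_cong_space[OF bint_diff[OF bint_elementary[OF elem_scaleR[OF whole elem_const[of v]]] Z]])
      fix t \<omega>
      show "indicat_real ({0..T} \<times> space P) (t, \<omega>) *\<^sub>R v - indicat_real A (t, \<omega>) *\<^sub>R v =
        indicat_real ({0..T} \<times> space P - A) (t, \<omega>) *\<^sub>R v"
        using sub by (auto simp: indicator_def)
    qed simp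
    then show ?case by blast
  next
    case (union A)
    have "\<forall>n. \<exists>Z. bint (\<lambda>t \<omega>. \<Sum>i<n. indicat_real (A i) (t, \<omega>) *\<^sub>R v) Z"
      using union.IH by (intro allI bint_sum) auto
    from choice[OF this] obtain Z
      where Z: "\<And>n. bint (\<lambda>t \<omega>. \<Sum>i<n. indicat_real (A i) (t, \<omega>) *\<^sub>R v) (Z n)" by blast
    have eq: "(\<Sum>i<n. indicat_real (A i) p *\<^sub>R v) = indicat_real (\<Union>i<n. A i) p *\<^sub>R v" for n p
      using union.hyps(1)
      by (subst indicator_UN_disjoint) (auto simp: disjoint_family_on_def scaleR_sum_left)
    obtain Z' where "bint (\<lambda>t \<omega>. indicat_real (\<Union>i. A i) (t, \<omega>) *\<^sub>R v) Z'"
    proof (rule bint_limit_exists[OF Z])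
      show "bdd_by (\<lambda>t \<omega>. \<Sum>i<n. indicat_real (A i) (t, \<omega>) *\<^sub>R v) (norm v)" for n
        unfolding eq by (rule bnd)
      show "(\<lambda>n. \<Sum>i<n. indicat_real (A i) (t, \<omega>) *\<^sub>R v) \<longlonglongrightarrow> indicat_real (\<Union>i. A i) (t, \<omega>) *\<^sub>R v" for t \<omega>
        unfolding eq by (intro tendsto_scaleR tendsto_const LIMSEQ_indicator_UN)
    qed blast
    then show ?case by blast
  qed
qed

text \<open>Simple functions bounded by twice the norm of \<open>H\<close> converge to it pointwise;
  the common bound \<open>2 * c\<close> makes \<open>bint_limit_exists\<close> applicable.\<close>

lemma bint_exists:
  assumes "bdd_pred H" shows "\<exists>Z. bint H Z"
proof -
  obtain c where c: "0 \<le> c" "bdd_by H c" using assms by (rule bdd_predE)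
  obtain G where G: "\<And>i. simple_function PA (G i)"
    "\<And>p. p \<in> space PA \<Longrightarrow> (\<lambda>i. G i p) \<longlonglongrightarrow> H (fst p) (snd p)"
    "\<And>i p. p \<in> space PA \<Longrightarrow> dist (G i p) 0 \<le> 2 * dist (H (fst p) (snd p)) 0"
    using borel_measurable_implies_sequence_metric[OF bdd_pred_measurable[OF assms], of 0] by blast
  have "\<forall>i. \<exists>Z. bint (\<lambda>t \<omega>. G i (t, \<omega>)) Z"
  proof
    fix i
    let ?B = "\<lambda>v. G i -` {v} \<inter> space PA"
    have "finite (G i ` space PA)" "\<And>v. ?B v \<in> sets PA" using G(1)[of i] by (auto simp: simple_function_def intro: simple_functionD)
    then have "\<exists>Z. bint (\<lambda>t \<omega>. \<Sum>v\<in>G i ` space PA. indicat_real (?B v) (t, \<omega>) *\<^sub>R v) Z"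
      by (intro bint_sum bint_indicator)
    then obtain Z where Z: "bint (\<lambda>t \<omega>. \<Sum>v\<in>G i ` space PA. indicat_real (?B v) (t, \<omega>) *\<^sub>R v) Z" by blast
    have "bint (\<lambda>t \<omega>. G i (t, \<omega>)) Z"
    proof (rule bint_cong_space[OF Z])
      fix t \<omega> assume "t \<in> {0..T}" "\<omega> \<in> space P"
      then have p: "(t, \<omega>) \<in> space PA" by (simp add: space_PA)
      have "(\<Sum>v\<in>G i ` space PA. indicat_real (?B v) (t, \<omega>) *\<^sub>R v) =
        (\<Sum>v\<in>{G i (t, \<omega>)}. indicat_real (?B v) (t, \<omega>) *\<^sub>R v)"
        using \<open>finite (G i ` space PA)\<close> p by (intro sum.mono_neutral_right) (auto simp: indicator_def)
      then show "(\<Sum>v\<in>G i ` space PA. indicat_real (?B v) (t, \<omega>) *\<^sub>R v) = G i (t, \<omega>)" using p by simp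
    qed simp
    then show "\<exists>Z. bint (\<lambda>t \<omega>. G i (t, \<omega>)) Z" by blast
  qed
  from choice[OF this] obtain Z where Z: "\<And>i. bint (\<lambda>t \<omega>. G i (t, \<omega>)) (Z i)" by blast
  show ?thesis
  proof (rule bint_limit_exists[OF Z])
    show "bdd_by (\<lambda>t \<omega>. G i (t, \<omega>)) (2 * c)" for i
      unfolding bdd_by_def
    proof (intro ballI)
      fix t \<omega> assume t: "t \<in> {0..T}" "\<omega> \<in> space P"
      then have "norm (G i (t, \<omega>)) \<le> 2 * norm (H t \<omega>)" using G(3)[of "(t, \<omega>)" i] by (simp add: space_PA)
      then show "norm (G i (t, \<omega>)) \<le> 2 * c" using bdd_byD[OF c(2) t] by linarith
    qed
    show "(\<lambda>i. G i (t, \<omega>)) \<longlonglongrightarrow> H t \<omega>" if "t \<in> {0..T}" "\<omega> \<in> space P" for t \<omega>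
      using G(2)[of "(t, \<omega>)"] that by (simp add: space_PA)
  qed blast
qed

end

section \<open>Convergence in the semimartingale topology\<close>

context filtered_space begin

text \<open>The definition speaks of one integrand per index. Taking for each \<open>n\<close> an
  integrand that violates the bound, whenever there is one, turns it into uniformity over all
  integrands.\<close>

lemma emery_uniform:
  assumes Z: "\<And>n. adc (Z n)" and Z': "adc Z'" and em: "emery_tendsto P F T Z Z'" and e: "0 < e"
  shows "\<forall>\<^sub>F n in sequentially. \<forall>k. elem k \<longrightarrow> bdd_by k 1 \<longrightarrow> ucp_norm (eint k (\<lambda>t \<omega>. Z n t \<omega> - Z' t \<omega>)) < e"
proof -
  let ?D = "\<lambda>n t \<omega>. Z n t \<omega> - Z' t \<omega>"
  let ?bad = "\<lambda>n k. elem k \<and> bdd_by k 1 \<and> \<not> ucp_norm (eint k (?D n)) < e"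
  have D: "adc (?D n)" for n by (rule adc_diff[OF Z Z'])
  define k where "k n = (if \<exists>k. ?bad n k then (SOME k. ?bad n k) else (\<lambda>t \<omega>. 0))" for n
  have k: "elem (k n) \<and> bdd_by (k n) 1" for n
  proof (cases "\<exists>k. ?bad n k")
    case True
    from someI_ex[OF True] show ?thesis using True by (simp add: k_def)
  next
    case False
    then have "k n = (\<lambda>t \<omega>. 0)" unfolding k_def by (simp only: if_False)
    then show ?thesis using elem_const[of "0::real"] by (simp add: bdd_by_def)
  qed
  have "ucp_tendsto P T (\<lambda>n. eint (k n) (?D n)) (\<lambda>_ _. 0)"
  proof -
    have "\<forall>n. elementary_integral P F T (?D n) (k n) (eint (k n) (?D n)) \<and>
        (\<forall>t\<in>{0..T}. \<forall>\<omega>\<in>space P. \<bar>k n t \<omega>\<bar> \<le> 1)"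
      using k by (intro allI conjI elementary_integralI) (auto simp: bdd_by_def)
    then show ?thesis
      using em[unfolded emery_tendsto_def, THEN conjunct2, THEN spec[of _ k],
        THEN spec[of _ "\<lambda>n. eint (k n) (?D n)"]] by (rule rev_mp)
  qed
  then have "(\<lambda>n. ucp_norm (eint (k n) (?D n))) \<longlonglongrightarrow> 0"
    using ucp_iff[of "\<lambda>n. eint (k n) (?D n)" "\<lambda>_ _. 0"] adc_eint[OF D] k adc_zero by simp
  from order_tendstoD(2)[OF this e] show ?thesis
  proof eventually_elim
    case (elim n)
    have "\<not> (\<exists>k. ?bad n k)"
    proof
      assume ex: "\<exists>k. ?bad n k"
      from someI_ex[OF ex] show False using elim ex by (simp add: k_def)
    qed
    then show ?case by blast
  qed
qed

lemma emery_tendstoI: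
  assumes Z: "\<And>n. adc (Z n)" and Z': "adc Z'" and lim: "(\<lambda>n. ucp_norm (\<lambda>t \<omega>. Z n t \<omega> - Z' t \<omega>)) \<longlonglongrightarrow> 0"
    and un: "\<And>e. 0 < e \<Longrightarrow> \<forall>\<^sub>F n in sequentially. \<forall>k. elem k \<longrightarrow> bdd_by k 1 \<longrightarrow> ucp_norm (eint k (\<lambda>t \<omega>. Z n t \<omega> - Z' t \<omega>)) < e"
  shows "emery_tendsto P F T Z Z'"
  unfolding emery_tendsto_def
proof (intro conjI allI impI)
  show "ucp_tendsto P T Z Z'" using ucp_iff[OF Z Z'] lim by simp
  fix K :: "nat \<Rightarrow> real \<Rightarrow> 'a \<Rightarrow> real" and W
  assume KW: "\<forall>n. elementary_integral P F T (\<lambda>t \<omega>. Z n t \<omega> - Z' t \<omega>) (K n) (W n) \<and>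
    (\<forall>t\<in>{0..T}. \<forall>\<omega>\<in>space P. \<bar>K n t \<omega>\<bar> \<le> 1)"
  have el: "elementary_integral P F T (\<lambda>t \<omega>. Z n t \<omega> - Z' t \<omega>) (K n) (W n)" for n using KW by blast
  note K = elementary_integralD[OF el]
  have K1: "bdd_by (K n) 1" for n using KW unfolding bdd_by_def real_norm_def by blast
  have aW: "adc (W n)" for n
    by (rule adc_cong[OF adc_eint[OF adc_diff[OF Z Z'] K(1)]]) (simp add: K(2))
  have eq: "ucp_norm (W n) = ucp_norm (eint (K n) (\<lambda>t \<omega>. Z n t \<omega> - Z' t \<omega>))" for n
    by (rule ucp_norm_cong_space) (simp add: K(2))
  have "(\<lambda>n. ucp_norm (W n)) \<longlonglongrightarrow> 0"
  proof (rule order_tendstoI)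
    fix e :: real assume "0 < e"
    from un[OF this] show "\<forall>\<^sub>F n in sequentially. ucp_norm (W n) < e"
    proof eventually_elim
      case (elim n)
      then show ?case unfolding eq using K(1) K1 by blast
    qed
  next
    fix e :: real assume "e < 0"
    then show "\<forall>\<^sub>F n in sequentially. e < ucp_norm (W n)"
      by (intro always_eventually allI less_le_trans[OF _ ucp_norm_nonneg])
  qed
  then show "ucp_tendsto P T W (\<lambda>_ _. 0)" using ucp_iff[OF aW adc_zero] by simp
qed

end

context controlled begin

text \<open>\<open>bint_approx\<close> yields density for integrands with values in the space of
  \<open>S\<close>. A scalar \<open>k\<close> is therefore placed along a basis vector
  \<open>b\<close>; projecting the approximants back and clipping them to \<open>{-1..1}\<close>
  brings them no further away from \<open>k\<close>.\<close>

lemma elem_dense: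
  fixes k :: "real \<Rightarrow> 'a \<Rightarrow> real"
  assumes k: "bdd_pred k" "bdd_by k 1"
  obtains \<kappa> where "\<And>j. elem (\<kappa> j)" "\<And>j. bdd_by (\<kappa> j) 1" "(\<lambda>j. l2 (\<lambda>t \<omega>. \<kappa> j t \<omega> - k t \<omega>)) \<longlonglongrightarrow> 0"
proof -
  obtain b :: 'b where b: "b \<in> Basis" using nonempty_Basis by blast
  have bp: "bdd_pred (\<lambda>t \<omega>. k t \<omega> *\<^sub>R b)" by (rule bdd_pred_scaleR[OF k(1) elem_bdd_pred[OF elem_const]])
  obtain Z where "bint (\<lambda>t \<omega>. k t \<omega> *\<^sub>R b) Z" using bint_exists[OF bp] by blast
  then obtain K where K: "\<And>j. elem (K j)" "(\<lambda>j. l2 (\<lambda>t \<omega>. K j t \<omega> - k t \<omega> *\<^sub>R b)) \<longlonglongrightarrow> 0"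
    using bint_approx by blast
  define \<phi> where "\<phi> x = max (-1) (min 1 (x \<bullet> b))" for x
  have "continuous_on UNIV \<phi>" unfolding \<phi>_def by (intro continuous_intros)
  then have el: "elem (\<lambda>t \<omega>. \<phi> (K j t \<omega>))" for j by (rule elem_compose[OF K(1)])
  have le: "\<bar>\<phi> x - r\<bar> \<le> norm (x - r *\<^sub>R b)" if "\<bar>r\<bar> \<le> 1" for x r
  proof -
    have "\<bar>\<phi> x - r\<bar> \<le> \<bar>x \<bullet> b - r\<bar>" using that by (auto simp: \<phi>_def)
    also have "x \<bullet> b - r = (x - r *\<^sub>R b) \<bullet> b" using b by (simp add: inner_diff_left)
    also have "\<bar>\<dots>\<bar> \<le> norm (x - r *\<^sub>R b)" using Basis_le_norm[OF b] .
    finally show ?thesis .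
  qed
  have bound: "l2 (\<lambda>t \<omega>. \<phi> (K j t \<omega>) - k t \<omega>) \<le> 1\<^sup>2 * l2 (\<lambda>t \<omega>. K j t \<omega> - k t \<omega> *\<^sub>R b)" for j
  proof (rule l2_mono)
    show "bdd_pred (\<lambda>t \<omega>. \<phi> (K j t \<omega>) - k t \<omega>)" by (rule bdd_pred_diff[OF elem_bdd_pred[OF el] k(1)])
    show "bdd_pred (\<lambda>t \<omega>. K j t \<omega> - k t \<omega> *\<^sub>R b)" by (rule bdd_pred_diff[OF elem_bdd_pred[OF K(1)] bp])
    fix t \<omega> assume "t \<in> {0..T}" "\<omega> \<in> space P"
    from bdd_byD[OF k(2) this] have "\<bar>k t \<omega>\<bar> \<le> 1" by simp
    from le[OF this] show "norm (\<phi> (K j t \<omega>) - k t \<omega>) \<le> 1 * norm (K j t \<omega> - k t \<omega> *\<^sub>R b)" by simp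
  qed simp
  have "(\<lambda>j. l2 (\<lambda>t \<omega>. \<phi> (K j t \<omega>) - k t \<omega>)) \<longlonglongrightarrow> 0"
    using bound
    by (intro tendsto_sandwich[OF always_eventually[OF allI[OF l2_nonneg]] always_eventually[OF allI]
          tendsto_const K(2)]) simp
  moreover have "bdd_by (\<lambda>t \<omega>. \<phi> (K j t \<omega>)) 1" for j by (auto simp: bdd_by_def \<phi>_def)
  ultimately show ?thesis using that[of "\<lambda>j t \<omega>. \<phi> (K j t \<omega>)"] el by blast
qed

text \<open>The integral of \<open>G\<close> lies within \<open>e\<close> of zero in the
  semimartingale topology. It is expressed through \<open>G\<close>, so that estimates can be made
  on integrands.\<close>

definition emery_small :: "('a, 'b) process \<Rightarrow> real \<Rightarrow> bool" where
  "emery_small G e \<longleftrightarrow> (\<forall>k Z. elem k \<longrightarrow> bdd_by k 1 \<longrightarrow> bint (\<lambda>t \<omega>. k t \<omega> *\<^sub>R G t \<omega>) Z \<longrightarrow> ucp_norm Z \<le> e)"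

lemma emery_smallD: "emery_small G e \<Longrightarrow> elem k \<Longrightarrow> bdd_by k 1 \<Longrightarrow> bint (\<lambda>t \<omega>. k t \<omega> *\<^sub>R G t \<omega>) Z \<Longrightarrow> ucp_norm Z \<le> e"
  unfolding emery_small_def by blast

lemma ucp_norm_eq_of_BI:
  assumes "bint H Z" "bint H Z'" shows "ucp_norm Z = ucp_norm Z'"
proof -
  note a = bint_adc[OF assms(1)] bint_adc[OF assms(2)]
  have "AE \<omega> in P. \<forall>t\<in>dtimes. Z t \<omega> - Z' t \<omega> = 0"
    by (rule ucp_norm_zeroD[OF adc_meas_proc[OF adc_diff[OF a]] bint_unique[OF assms]])
  then have "AE \<omega> in P. \<forall>t\<in>dtimes. Z t \<omega> = Z' t \<omega>" by simp
  then show ?thesis by (rule ucp_norm_cong[OF adc_meas_proc[OF a(1)] adc_meas_proc[OF a(2)]])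
qed

lemma bint_ucp_norm_approx:
  assumes "bint H Z" "\<And>j. bint (G j) (W j)" "\<And>j. ucp_norm (W j) \<le> e" "(\<lambda>j. l2 (\<lambda>t \<omega>. G j t \<omega> - H t \<omega>)) \<longlonglongrightarrow> 0"
  shows "ucp_norm Z \<le> e"
proof (rule field_le_epsilon)
  fix r :: real assume "0 < r"
  then obtain d where d: "0 < d" "\<And>H Z. bint H Z \<Longrightarrow> l2 H < d \<Longrightarrow> ucp_norm Z < r" using bint_small by blast
  obtain j where "l2 (\<lambda>t \<omega>. G j t \<omega> - H t \<omega>) < d"
    using eventually_happens'[OF trivial_limit_sequentially order_tendstoD(2)[OF assms(4) d(1)]] by blast
  from d(2)[OF bint_diff[OF assms(2,1)] this] have "ucp_norm (\<lambda>t \<omega>. W j t \<omega> - Z t \<omega>) < r" .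
  moreover have "ucp_norm (\<lambda>t \<omega>. W j t \<omega> - (W j t \<omega> - Z t \<omega>)) \<le> ucp_norm (W j) + ucp_norm (\<lambda>t \<omega>. W j t \<omega> - Z t \<omega>)"
    by (intro ucp_norm_triangle_diff adc_meas_proc adc_diff bint_adc[OF assms(1)] bint_adc[OF assms(2)])
  ultimately show "ucp_norm Z \<le> e + r" using assms(3)[of j] by simp
qed

lemma emery_small_add:
  assumes "emery_small G e" "emery_small G' e'" "bdd_pred G" "bdd_pred G'"
  shows "emery_small (\<lambda>t \<omega>. G t \<omega> + G' t \<omega>) (e + e')"
  unfolding emery_small_def
proof (intro allI impI)
  fix k Z assume k: "elem k" "bdd_by k 1" and Z: "bint (\<lambda>t \<omega>. k t \<omega> *\<^sub>R (G t \<omega> + G' t \<omega>)) Z"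
  obtain W where W: "bint (\<lambda>t \<omega>. k t \<omega> *\<^sub>R G t \<omega>) W" using bint_exists[OF bdd_pred_scaleR[OF elem_bdd_pred[OF k(1)] assms(3)]] ..
  obtain W' where W': "bint (\<lambda>t \<omega>. k t \<omega> *\<^sub>R G' t \<omega>) W'" using bint_exists[OF bdd_pred_scaleR[OF elem_bdd_pred[OF k(1)] assms(4)]] ..
  have "bint (\<lambda>t \<omega>. k t \<omega> *\<^sub>R (G t \<omega> + G' t \<omega>)) (\<lambda>t \<omega>. W t \<omega> + W' t \<omega>)"
    using bint_add[OF W W'] by (simp add: scaleR_add_right)
  from ucp_norm_eq_of_BI[OF Z this] have "ucp_norm Z \<le> ucp_norm W + ucp_norm W'"
    using ucp_norm_triangle[OF adc_meas_proc[OF bint_adc[OF W]] adc_meas_proc[OF bint_adc[OF W']]] by simp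
  then show "ucp_norm Z \<le> e + e'" using emery_smallD[OF assms(1) k W] emery_smallD[OF assms(2) k W'] by linarith
qed

lemma emery_small_scale:
  assumes "emery_small G e" "bdd_pred G"
  shows "emery_small (\<lambda>t \<omega>. c *\<^sub>R G t \<omega>) ((1 + \<bar>c\<bar>) * e)"
  unfolding emery_small_def
proof (intro allI impI)
  fix k Z assume k: "elem k" "bdd_by k 1" and Z: "bint (\<lambda>t \<omega>. k t \<omega> *\<^sub>R c *\<^sub>R G t \<omega>) Z"
  obtain W where W: "bint (\<lambda>t \<omega>. k t \<omega> *\<^sub>R G t \<omega>) W" using bint_exists[OF bdd_pred_scaleR[OF elem_bdd_pred[OF k(1)] assms(2)]] ..
  have "bint (\<lambda>t \<omega>. k t \<omega> *\<^sub>R c *\<^sub>R G t \<omega>) (\<lambda>t \<omega>. c * W t \<omega>)"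
    using bint_scale[OF W, of c] by (simp add: mult.commute)
  from ucp_norm_eq_of_BI[OF Z this] have "ucp_norm Z \<le> (1 + \<bar>c\<bar>) * ucp_norm W"
    using ucp_norm_cmult[OF adc_meas_proc[OF bint_adc[OF W]], of c] by simp
  also have "\<dots> \<le> (1 + \<bar>c\<bar>) * e" using emery_smallD[OF assms(1) k W] by (intro mult_left_mono) auto
  finally show "ucp_norm Z \<le> (1 + \<bar>c\<bar>) * e" .
qed

text \<open>If \<open>\<theta>\<close> is elementary, then \<open>k * \<theta>\<close> is itself an
  admissible test integrand. A general \<open>\<theta>\<close> is approximated in \<open>l2\<close>
  by elementary \<open>\<kappa> j\<close> with the same bound, and boundedness of \<open>G\<close>
  carries this over to the products.\<close>

lemma emery_small_solid:
  fixes \<theta> :: "real \<Rightarrow> 'a \<Rightarrow> real"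
  assumes G: "emery_small G e" "bdd_pred G" and \<theta>: "bdd_pred \<theta>" "bdd_by \<theta> 1"
  shows "emery_small (\<lambda>t \<omega>. \<theta> t \<omega> *\<^sub>R G t \<omega>) e"
  unfolding emery_small_def
proof (intro allI impI)
  fix k Z assume k: "elem k" "bdd_by k 1" and Z: "bint (\<lambda>t \<omega>. k t \<omega> *\<^sub>R \<theta> t \<omega> *\<^sub>R G t \<omega>) Z"
  obtain \<kappa> where \<kappa>: "\<And>j. elem (\<kappa> j)" "\<And>j. bdd_by (\<kappa> j) 1" "(\<lambda>j. l2 (\<lambda>t \<omega>. \<kappa> j t \<omega> - \<theta> t \<omega>)) \<longlonglongrightarrow> 0"
    using elem_dense[OF \<theta>] by blast
  obtain c where c: "0 \<le> c" "bdd_by G c" using G(2) by (rule bdd_predE)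
  define q where "q = (\<lambda>j t \<omega>. k t \<omega> *\<^sub>R \<kappa> j t \<omega>)"
  have q: "elem (q j)" for j unfolding q_def by (rule elem_scaleR[OF k(1) \<kappa>(1)])
  have q1: "bdd_by (q j) 1" for j unfolding q_def using bdd_by_scaleR[OF k(2) \<kappa>(2)[of j]] by simp
  have bq: "bdd_pred (\<lambda>t \<omega>. q j t \<omega> *\<^sub>R G t \<omega>)" for j by (rule bdd_pred_scaleR[OF elem_bdd_pred[OF q] G(2)])
  have "\<forall>j. \<exists>W. bint (\<lambda>t \<omega>. q j t \<omega> *\<^sub>R G t \<omega>) W" using bint_exists[OF bq] by blast
  from choice[OF this] obtain W where W: "\<And>j. bint (\<lambda>t \<omega>. q j t \<omega> *\<^sub>R G t \<omega>) (W j)" by blast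
  show "ucp_norm Z \<le> e"
  proof (rule bint_ucp_norm_approx[OF Z W])
    show "ucp_norm (W j) \<le> e" for j by (rule emery_smallD[OF G(1) q q1 W])
    have b: "l2 (\<lambda>t \<omega>. q j t \<omega> *\<^sub>R G t \<omega> - k t \<omega> *\<^sub>R \<theta> t \<omega> *\<^sub>R G t \<omega>) \<le> c\<^sup>2 * l2 (\<lambda>t \<omega>. \<kappa> j t \<omega> - \<theta> t \<omega>)" for j
    proof (rule l2_mono[OF bdd_pred_diff[OF bq bint_bdd_pred[OF Z]] bdd_pred_diff[OF elem_bdd_pred[OF \<kappa>(1)] \<theta>(1)] c(1)])
      fix t \<omega> assume t: "t \<in> {0..T}" "\<omega> \<in> space P"
      have "q j t \<omega> *\<^sub>R G t \<omega> - k t \<omega> *\<^sub>R \<theta> t \<omega> *\<^sub>R G t \<omega> = k t \<omega> *\<^sub>R (\<kappa> j t \<omega> - \<theta> t \<omega>) *\<^sub>R G t \<omega>"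
        by (simp add: q_def algebra_simps)
      also have "norm \<dots> \<le> 1 * (norm (\<kappa> j t \<omega> - \<theta> t \<omega>) * c)"
        unfolding norm_scaleR real_norm_def[symmetric]
        using bdd_byD[OF k(2) t] bdd_byD[OF c(2) t] by (intro mult_mono) auto
      finally show "norm (q j t \<omega> *\<^sub>R G t \<omega> - k t \<omega> *\<^sub>R \<theta> t \<omega> *\<^sub>R G t \<omega>) \<le> c * norm (\<kappa> j t \<omega> - \<theta> t \<omega>)"
        by (simp add: mult.commute)
    qed
    have "(\<lambda>j. c\<^sup>2 * l2 (\<lambda>t \<omega>. \<kappa> j t \<omega> - \<theta> t \<omega>)) \<longlonglongrightarrow> c\<^sup>2 * 0" by (intro tendsto_mult tendsto_const \<kappa>(3))
    then have lim: "(\<lambda>j. c\<^sup>2 * l2 (\<lambda>t \<omega>. \<kappa> j t \<omega> - \<theta> t \<omega>)) \<longlonglongrightarrow> 0" by simp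
    show "(\<lambda>j. l2 (\<lambda>t \<omega>. q j t \<omega> *\<^sub>R G t \<omega> - k t \<omega> *\<^sub>R \<theta> t \<omega> *\<^sub>R G t \<omega>)) \<longlonglongrightarrow> 0"
      by (rule tendsto_sandwich[OF always_eventually[OF allI[OF l2_nonneg]] always_eventually[OF allI[OF b]]
          tendsto_const lim])
  qed
qed

text \<open>Multiplication by a test integrand bounded by one does not increase \<open>l2\<close>,
  so \<open>bint_small\<close> holds uniformly over test integrands.\<close>

lemma emery_small_small:
  assumes "0 < e"
  obtains d where "0 < d" "\<And>G. bdd_pred G \<Longrightarrow> l2 G < d \<Longrightarrow> emery_small G e"
proof -
  obtain d where d: "0 < d" "\<And>H Z. bint H Z \<Longrightarrow> l2 H < d \<Longrightarrow> ucp_norm Z < e" using bint_small[OF assms] by blast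
  have "emery_small G e" if G: "bdd_pred G" "l2 G < d" for G
    unfolding emery_small_def
  proof (intro allI impI)
    fix k Z assume k: "elem k" "bdd_by k 1" and Z: "bint (\<lambda>t \<omega>. k t \<omega> *\<^sub>R G t \<omega>) Z"
    have "l2 (\<lambda>t \<omega>. k t \<omega> *\<^sub>R G t \<omega>) \<le> 1\<^sup>2 * l2 G"
    proof (rule l2_mono[OF bint_bdd_pred[OF Z] G(1)])
      fix t \<omega> assume t: "t \<in> {0..T}" "\<omega> \<in> space P"
      show "norm (k t \<omega> *\<^sub>R G t \<omega>) \<le> 1 * norm (G t \<omega>)"
        unfolding norm_scaleR real_norm_def[symmetric] using bdd_byD[OF k(2) t] by (intro mult_right_mono) auto
    qed simp
    then show "ucp_norm Z \<le> e" using d(2)[OF Z] G(2) by simp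
  qed
  then show ?thesis using that d(1) by blast
qed

section \<open>Unbounded integrands and their truncations\<close>

definition trunc :: "('a, 'b) process \<Rightarrow> nat \<Rightarrow> ('a, 'b) process" where
  "trunc H n = (\<lambda>t \<omega>. if norm (H t \<omega>) \<le> real n then H t \<omega> else 0)"

lemma stochastic_integral_iff:
  "stochastic_integral P F T S H Z \<longleftrightarrow> predictable P F T H \<and> adc Z \<and>
     (\<exists>W. (\<forall>n. bint (trunc H n) (W n)) \<and> emery_tendsto P F T W Z)"
  unfolding stochastic_integral_def trunc_def by blast

lemma trunc_bdd_by: "bdd_by (trunc H n) (real n)"
  by (simp add: bdd_by_def trunc_def)

lemma predictable_norm_le:
  assumes "predictable P F T (H :: ('a, 'b) process)"
  shows "bdd_pred (\<lambda>t \<omega>. if norm (H t \<omega>) \<le> c then 1 else (0::real))"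
    and "bdd_pred (\<lambda>t \<omega>. if norm (H t \<omega>) \<le> c then 0 else (1::real))"
proof -
  have m: "(\<lambda>p. H (fst p) (snd p)) \<in> borel_measurable PA" using assms by (simp add: predictable_iff)
  show "bdd_pred (\<lambda>t \<omega>. if norm (H t \<omega>) \<le> c then 1 else (0::real))"
    "bdd_pred (\<lambda>t \<omega>. if norm (H t \<omega>) \<le> c then 0 else (1::real))"
    using m by (intro bdd_predI[where c=1]; simp add: bdd_by_def)+
qed

lemma trunc_bdd_pred:
  assumes "predictable P F T (H :: ('a, 'b) process)" shows "bdd_pred (trunc H n)"
proof (rule bdd_predI[OF _ trunc_bdd_by])
  have m: "(\<lambda>p. H (fst p) (snd p)) \<in> borel_measurable PA" using assms by (simp add: predictable_iff)
  show "(\<lambda>p. trunc H n (fst p) (snd p)) \<in> borel_measurable PA" unfolding trunc_def using m by measurable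
qed

text \<open>At each point the indicator of the tail is eventually zero, and it is bounded by one, so
  \<open>l2_limit\<close> applies.\<close>

lemma tail_l2:
  assumes H: "predictable P F T (H :: ('a, 'b) process)"
  shows "(\<lambda>n. l2 (\<lambda>t \<omega>. if norm (H t \<omega>) \<le> real n then 0 else (1::real))) \<longlonglongrightarrow> 0"
proof -
  have "(\<lambda>n. l2 (\<lambda>t \<omega>. (if norm (H t \<omega>) \<le> real n then 0 else (1::real)) - 0)) \<longlonglongrightarrow> 0"
  proof (rule l2_limit[where c=1])
    show "bdd_pred (\<lambda>t \<omega>. if norm (H t \<omega>) \<le> real n then 0 else (1::real))" for n by (rule predictable_norm_le[OF H])
    show "bdd_by (\<lambda>t \<omega>. if norm (H t \<omega>) \<le> real n then 0 else (1::real)) 1" for n by (simp add: bdd_by_def)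
    fix t \<omega>
    obtain N where N: "norm (H t \<omega>) \<le> real N" using real_arch_simple by blast
    have "\<forall>\<^sub>F n in sequentially. (if norm (H t \<omega>) \<le> real n then 0 else (1::real)) = 0"
      using eventually_ge_at_top[of N] by eventually_elim (use N in auto)
    then show "(\<lambda>n. if norm (H t \<omega>) \<le> real n then 0 else (1::real)) \<longlonglongrightarrow> 0"
      by (rule tendsto_eventually)
  qed
  then show ?thesis by simp
qed

text \<open>Two integrals of truncations that are close to \<open>Z\<close>, uniformly over test
  integrands, are close to each other. Stated for the integrands, this no longer mentions the limit
  \<open>Z\<close>.\<close>

lemma stochastic_integral_cauchy:
  assumes Z: "adc Z" and W: "\<And>n. bint (trunc H n) (W n)" and em: "emery_tendsto P F T W Z" and e: "0 < e"
  shows "\<exists>M. \<forall>m\<ge>M. \<forall>n\<ge>M. emery_small (\<lambda>t \<omega>. trunc H m t \<omega> - trunc H n t \<omega>) e"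
proof -
  have aW: "adc (W n)" for n by (rule bint_adc[OF W])
  have "0 < e / 2" using e by simp
  from emery_uniform[OF aW Z em this] obtain M where
    M: "\<And>n k. n \<ge> M \<Longrightarrow> elem k \<Longrightarrow> bdd_by k 1 \<Longrightarrow> ucp_norm (eint k (\<lambda>t \<omega>. W n t \<omega> - Z t \<omega>)) < e / 2"
    unfolding eventually_sequentially by blast
  have "emery_small (\<lambda>t \<omega>. trunc H m t \<omega> - trunc H n t \<omega>) e" if mn: "m \<ge> M" "n \<ge> M" for m n
    unfolding emery_small_def
  proof (intro allI impI)
    fix k V assume k: "elem k" "bdd_by k 1" and V: "bint (\<lambda>t \<omega>. k t \<omega> *\<^sub>R (trunc H m t \<omega> - trunc H n t \<omega>)) V"
    have "ucp_norm V = ucp_norm (eint k (\<lambda>t \<omega>. W m t \<omega> - W n t \<omega>))"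
      by (rule ucp_norm_eq_of_BI[OF V bint_elem_mult[OF k(1) bint_diff[OF W W]]])
    also have "\<dots> = ucp_norm (\<lambda>t \<omega>. eint k (\<lambda>t \<omega>. W m t \<omega> - Z t \<omega>) t \<omega> - eint k (\<lambda>t \<omega>. W n t \<omega> - Z t \<omega>) t \<omega>)"
      by (rule ucp_norm_cong_space) (simp add: eint_diff_right)
    also have "\<dots> \<le> ucp_norm (eint k (\<lambda>t \<omega>. W m t \<omega> - Z t \<omega>)) + ucp_norm (eint k (\<lambda>t \<omega>. W n t \<omega> - Z t \<omega>))"
      by (intro ucp_norm_triangle_diff adc_meas_proc adc_eint[OF _ k(1)] adc_diff aW Z)
    also have "\<dots> \<le> e" using M[OF mn(1) k] M[OF mn(2) k] by simp
    finally show "ucp_norm V \<le> e" .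
  qed
  then show ?thesis by blast
qed

lemma stochastic_integral_zero_start:
  assumes "stochastic_integral P F T S H Z" shows "AE \<omega> in P. Z 0 \<omega> = 0"
proof -
  obtain W where W: "\<And>n. bint (trunc H n) (W n)" "emery_tendsto P F T W Z" and Z: "adc Z"
    using assms unfolding stochastic_integral_iff by blast
  have "ucp_tendsto P T W Z" using W(2) by (simp add: emery_tendsto_def)
  then show ?thesis
    by (intro zero_start_limit[OF bint_adc[OF W(1)] bint_zero_start[OF W(1)] Z]) (simp add: ucp_iff[OF bint_adc[OF W(1)] Z])
qed

text \<open>Truncations of a sum are not sums of truncations.  The comparison below isolates the three places
  where they differ; each of them lives on a set of small measure.\<close>

lemma truncation_compare:
  fixes H G :: "('a, 'b) process" and a b :: real
  defines "K \<equiv> \<lambda>t \<omega>. a *\<^sub>R H t \<omega> + b *\<^sub>R G t \<omega>"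
  defines "L \<equiv> \<lambda>m t \<omega>. a *\<^sub>R trunc H m t \<omega> + b *\<^sub>R trunc G m t \<omega>"
  assumes H: "predictable P F T H" and G: "predictable P F T G"
    and cauchy: "\<And>e. 0 < e \<Longrightarrow> \<exists>M. \<forall>m\<ge>M. \<forall>n\<ge>M. emery_small (\<lambda>t \<omega>. L m t \<omega> - L n t \<omega>) e"
    and e: "0 < e"
  shows "\<exists>n0. \<forall>n\<ge>n0. \<forall>\<^sub>F m in sequentially. emery_small (\<lambda>t \<omega>. trunc K n t \<omega> - L m t \<omega>) e"
proof -
  have K: "predictable P F T K"
    using H G unfolding K_def predictable_iff by measurable
  have bL: "bdd_pred (L m)" for m
    unfolding L_def by (intro bdd_pred_add bdd_pred_cscaleR trunc_bdd_pred H G)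
  \<comment> \<open>One share for the first of the three terms and two for each of the others,
    because \<open>unif\<close> splits once more.\<close>
  define e' where "e' = e / 5"
  have e': "0 < e'" using e by (simp add: e'_def)
  obtain M where M: "\<And>m n. m \<ge> M \<Longrightarrow> n \<ge> M \<Longrightarrow> emery_small (\<lambda>t \<omega>. L m t \<omega> - L n t \<omega>) e'"
    using cauchy[OF e'] by blast
  obtain d where d: "0 < d" "\<And>G. bdd_pred G \<Longrightarrow> l2 G < d \<Longrightarrow> emery_small G e'" using emery_small_small[OF e'] by blast
  obtain c where c: "0 \<le> c" "bdd_by (L M) c" using bdd_predE[OF bL] by blast
  \<comment> \<open>Chosen so that \<open>c\<^sup>2 * \<delta> < d\<close>; the summand one keeps
    the denominator positive.\<close>
  define \<delta> where "\<delta> = d / (c\<^sup>2 + 1)"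
  have \<delta>: "0 < \<delta>" using d(1) unfolding \<delta>_def by (intro divide_pos_pos) (simp_all add: add_nonneg_pos)
  \<comment> \<open>Uniform absolute continuity of the \<open>L m\<close>: after multiplication by a
    factor with small \<open>l2\<close>, the difference \<open>L m - L M\<close> stays small by
    solidity, and the single bounded \<open>L M\<close> becomes small in \<open>l2\<close>.\<close>
  have unif: "emery_small (\<lambda>t \<omega>. \<theta> t \<omega> *\<^sub>R L m t \<omega>) (2 * e')"
    if \<theta>: "bdd_pred \<theta>" "bdd_by \<theta> 1" "l2 \<theta> < \<delta>" and m: "m \<ge> M" for \<theta> :: "real \<Rightarrow> 'a \<Rightarrow> real" and m
  proof -
    have 1: "emery_small (\<lambda>t \<omega>. \<theta> t \<omega> *\<^sub>R (L m t \<omega> - L M t \<omega>)) e'"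
      by (rule emery_small_solid[OF M[OF m order_refl] bdd_pred_diff[OF bL bL] \<theta>(1,2)])
    have "l2 (\<lambda>t \<omega>. \<theta> t \<omega> *\<^sub>R L M t \<omega>) \<le> c\<^sup>2 * l2 \<theta>"
    proof (rule l2_mono[OF bdd_pred_scaleR[OF \<theta>(1) bL] \<theta>(1) c(1)])
      fix t \<omega> assume t: "t \<in> {0..T}" "\<omega> \<in> space P"
      show "norm (\<theta> t \<omega> *\<^sub>R L M t \<omega>) \<le> c * norm (\<theta> t \<omega>)"
        using mult_left_mono[OF bdd_byD[OF c(2) t], of "\<bar>\<theta> t \<omega>\<bar>"] by (simp add: mult.commute)
    qed
    also have "\<dots> \<le> c\<^sup>2 * \<delta>" using \<theta>(3) by (intro mult_left_mono) auto
    also have "\<dots> < d"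
    proof -
      have "c\<^sup>2 * \<delta> < (c\<^sup>2 + 1) * \<delta>" using \<delta> by simp
      also have "(c\<^sup>2 + 1) * \<delta> = d"
        unfolding \<delta>_def using add_nonneg_pos[OF zero_le_power2[of c] zero_less_one] by simp
      finally show ?thesis .
    qed
    finally have 2: "emery_small (\<lambda>t \<omega>. \<theta> t \<omega> *\<^sub>R L M t \<omega>) e'" by (intro d(2) bdd_pred_scaleR[OF \<theta>(1) bL])
    show ?thesis
      using emery_small_add[OF 1 2 bdd_pred_scaleR[OF \<theta>(1) bdd_pred_diff[OF bL bL]] bdd_pred_scaleR[OF \<theta>(1) bL]]
      by (simp add: scaleR_diff_right)
  qed
  \<comment> \<open>\<open>A m\<close> marks where both truncations at level \<open>m\<close> are
    inactive, so that \<open>L m = K\<close> there. \<open>Ac m\<close> marks the complement, and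
    \<open>Cc n\<close> marks where \<open>K\<close> itself is cut at level
    \<open>n\<close>.\<close>
  define A where "A = (\<lambda>m t \<omega>. (if norm (H t \<omega>) \<le> real m then 1 else (0::real)) * (if norm (G t \<omega>) \<le> real m then 1 else 0))"
  define Ac where "Ac = (\<lambda>m t \<omega>. 1 - A m t \<omega>)"
  define Cc where "Cc = (\<lambda>n t \<omega>. if norm (K t \<omega>) \<le> real n then 0 else (1::real))"
  have A: "bdd_pred (A m)" "bdd_by (A m) 1" for m
    unfolding A_def using bdd_pred_scaleR[OF predictable_norm_le(1)[OF H] predictable_norm_le(1)[OF G]]
    by (simp_all add: bdd_by_def)
  have Ac: "bdd_pred (Ac m)" "bdd_by (Ac m) 1" for m
    unfolding Ac_def by (rule bdd_pred_diff[OF elem_bdd_pred[OF elem_const] A(1)]) (simp add: bdd_by_def A_def)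
  have Cc: "bdd_pred (Cc n)" "bdd_by (Cc n) 1" for n
    unfolding Cc_def by (rule predictable_norm_le(2)[OF K]) (simp add: bdd_by_def)
  have Ac_lim: "(\<lambda>m. l2 (Ac m)) \<longlonglongrightarrow> 0"
  proof -
    have b: "l2 (Ac m) \<le> 2 * l2 (\<lambda>t \<omega>. if norm (H t \<omega>) \<le> real m then 0 else (1::real)) +
        2 * l2 (\<lambda>t \<omega>. if norm (G t \<omega>) \<le> real m then 0 else (1::real))" for m
    proof -
      have "l2 (Ac m) \<le> 1\<^sup>2 * l2 (\<lambda>t \<omega>. (if norm (H t \<omega>) \<le> real m then 0 else (1::real)) +
         (if norm (G t \<omega>) \<le> real m then 0 else (1::real)))"
        by (intro l2_mono Ac bdd_pred_add predictable_norm_le(2)[OF H] predictable_norm_le(2)[OF G])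
          (simp_all add: Ac_def A_def)
      also have "\<dots> \<le> 2 * l2 (\<lambda>t \<omega>. if norm (H t \<omega>) \<le> real m then 0 else (1::real)) +
        2 * l2 (\<lambda>t \<omega>. if norm (G t \<omega>) \<le> real m then 0 else (1::real))"
        using l2_add[OF predictable_norm_le(2)[OF H] predictable_norm_le(2)[OF G], of "real m" "real m"] by simp
      finally show ?thesis .
    qed
    have "(\<lambda>m. 2 * l2 (\<lambda>t \<omega>. if norm (H t \<omega>) \<le> real m then 0 else (1::real)) +
        2 * l2 (\<lambda>t \<omega>. if norm (G t \<omega>) \<le> real m then 0 else (1::real))) \<longlonglongrightarrow> 2 * 0 + 2 * 0"
      by (intro tendsto_add tendsto_mult tendsto_const tail_l2[OF H] tail_l2[OF G])
    then have lim: "(\<lambda>m. 2 * l2 (\<lambda>t \<omega>. if norm (H t \<omega>) \<le> real m then 0 else (1::real)) +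
        2 * l2 (\<lambda>t \<omega>. if norm (G t \<omega>) \<le> real m then 0 else (1::real))) \<longlonglongrightarrow> 0" by simp
    show ?thesis
      by (rule tendsto_sandwich[OF always_eventually[OF allI[OF l2_nonneg]] always_eventually[OF allI[OF b]]
          tendsto_const lim])
  qed
  have "(\<lambda>n. l2 (Cc n)) \<longlonglongrightarrow> 0" unfolding Cc_def by (rule tail_l2[OF K])
  from order_tendstoD(2)[OF this \<delta>] obtain n0 where n0: "\<And>n. n \<ge> n0 \<Longrightarrow> l2 (Cc n) < \<delta>"
    unfolding eventually_sequentially by blast
  have "\<forall>\<^sub>F m in sequentially. emery_small (\<lambda>t \<omega>. trunc K n t \<omega> - L m t \<omega>) e" if n: "n \<ge> n0" for n
  proof -
    have "(\<lambda>m. (real n)\<^sup>2 * l2 (Ac m)) \<longlonglongrightarrow> (real n)\<^sup>2 * 0" by (intro tendsto_mult tendsto_const Ac_lim)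
    then have "(\<lambda>m. (real n)\<^sup>2 * l2 (Ac m)) \<longlonglongrightarrow> 0" by simp
    from order_tendstoD(2)[OF this d(1)] order_tendstoD(2)[OF Ac_lim \<delta>] eventually_ge_at_top[of M]
    show ?thesis
    proof eventually_elim
      case (elim m)
      have bK: "bdd_pred (trunc K n)" by (rule trunc_bdd_pred[OF K])
      have "l2 (\<lambda>t \<omega>. Ac m t \<omega> *\<^sub>R trunc K n t \<omega>) \<le> (real n)\<^sup>2 * l2 (Ac m)"
      proof (rule l2_mono[OF bdd_pred_scaleR[OF Ac(1) bK] Ac(1)])
        fix t \<omega> assume t: "t \<in> {0..T}" "\<omega> \<in> space P"
        show "norm (Ac m t \<omega> *\<^sub>R trunc K n t \<omega>) \<le> real n * norm (Ac m t \<omega>)"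
          using mult_left_mono[OF bdd_byD[OF trunc_bdd_by t, of K n], of "\<bar>Ac m t \<omega>\<bar>"] by (simp add: mult.commute)
      qed simp
      then have 1: "emery_small (\<lambda>t \<omega>. Ac m t \<omega> *\<^sub>R trunc K n t \<omega>) e'"
        using elim(1) by (intro d(2) bdd_pred_scaleR[OF Ac(1) bK]) simp
      have 2: "emery_small (\<lambda>t \<omega>. (- Cc n t \<omega> * A m t \<omega>) *\<^sub>R L m t \<omega>) (2 * e')"
      proof (rule unif[OF _ _ _ elim(3)])
        show bb: "bdd_pred (\<lambda>t \<omega>. - Cc n t \<omega> * A m t \<omega>)"
          using bdd_pred_scaleR[OF bdd_pred_cscaleR[OF Cc(1), of "-1"] A(1)] by simp
        show "bdd_by (\<lambda>t \<omega>. - Cc n t \<omega> * A m t \<omega>) 1" by (simp add: bdd_by_def Cc_def A_def)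
        have "l2 (\<lambda>t \<omega>. - Cc n t \<omega> * A m t \<omega>) \<le> 1\<^sup>2 * l2 (Cc n)"
          by (rule l2_mono[OF bb Cc(1)]) (simp_all add: Cc_def A_def)
        then show "l2 (\<lambda>t \<omega>. - Cc n t \<omega> * A m t \<omega>) < \<delta>" using n0[OF n] by simp
      qed
      have 3: "emery_small (\<lambda>t \<omega>. (- Ac m t \<omega>) *\<^sub>R L m t \<omega>) (2 * e')"
      proof (rule unif[OF _ _ _ elim(3)])
        show "bdd_pred (\<lambda>t \<omega>. - Ac m t \<omega>)" using bdd_pred_cscaleR[OF Ac(1), of "-1"] by simp
        show "bdd_by (\<lambda>t \<omega>. - Ac m t \<omega>) 1" using Ac(2)[of m] by (simp add: bdd_by_def)
        show "l2 (\<lambda>t \<omega>. - Ac m t \<omega>) < \<delta>" using elim(2) by (simp add: l2_def)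
      qed
      have b2: "bdd_pred (\<lambda>t \<omega>. (- Cc n t \<omega> * A m t \<omega>) *\<^sub>R L m t \<omega>)"
        using bdd_pred_scaleR[OF bdd_pred_scaleR[OF bdd_pred_cscaleR[OF Cc(1), of "-1"] A(1)] bL] by simp
      have b3: "bdd_pred (\<lambda>t \<omega>. (- Ac m t \<omega>) *\<^sub>R L m t \<omega>)"
        using bdd_pred_scaleR[OF bdd_pred_cscaleR[OF Ac(1), of "-1"] bL] by simp
      have "emery_small (\<lambda>t \<omega>. Ac m t \<omega> *\<^sub>R trunc K n t \<omega> +
          ((- Cc n t \<omega> * A m t \<omega>) *\<^sub>R L m t \<omega> + (- Ac m t \<omega>) *\<^sub>R L m t \<omega>)) (e' + (2 * e' + 2 * e'))"
        by (intro emery_small_add 1 2 3 b2 b3 bdd_pred_add bdd_pred_scaleR[OF Ac(1) bK])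
      \<comment> \<open>Where \<open>A m\<close> is zero, the first and the last term give the
        difference. Where it is one, \<open>L m = K\<close>, and the middle term is
        \<open>- K\<close> exactly where \<open>trunc K n\<close> cuts.\<close>
      moreover have "(\<lambda>t \<omega>. Ac m t \<omega> *\<^sub>R trunc K n t \<omega> +
          ((- Cc n t \<omega> * A m t \<omega>) *\<^sub>R L m t \<omega> + (- Ac m t \<omega>) *\<^sub>R L m t \<omega>)) = (\<lambda>t \<omega>. trunc K n t \<omega> - L m t \<omega>)"
      proof (intro ext)
        fix t \<omega>
        show "Ac m t \<omega> *\<^sub>R trunc K n t \<omega> + ((- Cc n t \<omega> * A m t \<omega>) *\<^sub>R L m t \<omega> + (- Ac m t \<omega>) *\<^sub>R L m t \<omega>) =
          trunc K n t \<omega> - L m t \<omega>"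
        proof (cases "A m t \<omega> = 0")
          case True
          then show ?thesis by (simp add: Ac_def)
        next
          case False
          then have HG: "norm (H t \<omega>) \<le> real m" "norm (G t \<omega>) \<le> real m"
            unfolding A_def by (auto split: if_splits)
          then have "A m t \<omega> = 1" "L m t \<omega> = K t \<omega>" by (simp_all add: A_def L_def K_def trunc_def)
          then show ?thesis by (simp add: Ac_def Cc_def trunc_def)
        qed
      qed
      ultimately show ?case by (simp add: e'_def)
    qed
  qed
  then show ?thesis by blast
qed

text \<open>The integrals \<open>X n\<close> of the truncated sum exist by
  \<open>bint_exists\<close>. They are compared with the combinations \<open>V m\<close> of the
  integrals of the truncations, which tend to the claimed limit; \<open>m\<close> is taken large
  after \<open>n\<close> and the test integrand are fixed.\<close>

lemma stochastic_integral_linear: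
  assumes "stochastic_integral P F T S H Z" "stochastic_integral P F T S G W"
  shows "stochastic_integral P F T S (\<lambda>t \<omega>. a *\<^sub>R H t \<omega> + b *\<^sub>R G t \<omega>) (\<lambda>t \<omega>. a * Z t \<omega> + b * W t \<omega>)"
proof -
  let ?K = "\<lambda>t \<omega>. a *\<^sub>R H t \<omega> + b *\<^sub>R G t \<omega>" and ?Y = "\<lambda>t \<omega>. a * Z t \<omega> + b * W t \<omega>"
  obtain Zn where Z: "predictable P F T H" "adc Z" "\<And>n. bint (trunc H n) (Zn n)" "emery_tendsto P F T Zn Z"
    using assms(1) unfolding stochastic_integral_iff by blast
  obtain Wn where W: "predictable P F T G" "adc W" "\<And>n. bint (trunc G n) (Wn n)" "emery_tendsto P F T Wn W"
    using assms(2) unfolding stochastic_integral_iff by blast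
  define L where "L = (\<lambda>m t \<omega>. a *\<^sub>R trunc H m t \<omega> + b *\<^sub>R trunc G m t \<omega>)"
  define V where "V = (\<lambda>m t \<omega>. a * Zn m t \<omega> + b * Wn m t \<omega>)"
  have LV: "bint (L m) (V m)" for m unfolding L_def V_def by (intro bint_add bint_scale Z(3) W(3))
  have bL: "bdd_pred (L m)" for m by (rule bint_bdd_pred[OF LV])
  have K: "predictable P F T ?K" using Z(1) W(1) unfolding predictable_iff by measurable
  have Y: "adc ?Y" by (intro adc_add adc_cmult Z(2) W(2))
  have aZn: "adc (Zn n)" and aWn: "adc (Wn n)" and aV: "adc (V n)" for n
    using bint_adc[OF Z(3)] bint_adc[OF W(3)] bint_adc[OF LV] by auto
  have Vlim: "(\<lambda>n. ucp_norm (\<lambda>t \<omega>. V n t \<omega> - ?Y t \<omega>)) \<longlonglongrightarrow> 0"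
  proof -
    have l1: "(\<lambda>n. ucp_norm (\<lambda>t \<omega>. Zn n t \<omega> - Z t \<omega>)) \<longlonglongrightarrow> 0"
      using Z(4) ucp_iff[OF aZn Z(2)] by (simp add: emery_tendsto_def)
    have l2: "(\<lambda>n. ucp_norm (\<lambda>t \<omega>. Wn n t \<omega> - W t \<omega>)) \<longlonglongrightarrow> 0"
      using W(4) ucp_iff[OF aWn W(2)] by (simp add: emery_tendsto_def)
    have b: "ucp_norm (\<lambda>t \<omega>. V n t \<omega> - ?Y t \<omega>) \<le> (1 + \<bar>a\<bar>) * ucp_norm (\<lambda>t \<omega>. Zn n t \<omega> - Z t \<omega>) +
        (1 + \<bar>b\<bar>) * ucp_norm (\<lambda>t \<omega>. Wn n t \<omega> - W t \<omega>)" for n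
    proof -
      note m1 = adc_meas_proc[OF adc_diff[OF aZn[of n] Z(2)]] and m2 = adc_meas_proc[OF adc_diff[OF aWn[of n] W(2)]]
      have "ucp_norm (\<lambda>t \<omega>. V n t \<omega> - ?Y t \<omega>) =
          ucp_norm (\<lambda>t \<omega>. a * (Zn n t \<omega> - Z t \<omega>) + b * (Wn n t \<omega> - W t \<omega>))"
        by (simp add: V_def algebra_simps)
      also have "\<dots> \<le> ucp_norm (\<lambda>t \<omega>. a * (Zn n t \<omega> - Z t \<omega>)) + ucp_norm (\<lambda>t \<omega>. b * (Wn n t \<omega> - W t \<omega>))"
        by (rule ucp_norm_triangle[OF meas_proc_cmult[OF m1] meas_proc_cmult[OF m2]])
      finally show ?thesis using ucp_norm_cmult[OF m1, of a] ucp_norm_cmult[OF m2, of b] by linarith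
    qed
    have "(\<lambda>n. (1 + \<bar>a\<bar>) * ucp_norm (\<lambda>t \<omega>. Zn n t \<omega> - Z t \<omega>) +
        (1 + \<bar>b\<bar>) * ucp_norm (\<lambda>t \<omega>. Wn n t \<omega> - W t \<omega>)) \<longlonglongrightarrow> (1 + \<bar>a\<bar>) * 0 + (1 + \<bar>b\<bar>) * 0"
      by (intro tendsto_add tendsto_mult tendsto_const l1 l2)
    then have lim: "(\<lambda>n. (1 + \<bar>a\<bar>) * ucp_norm (\<lambda>t \<omega>. Zn n t \<omega> - Z t \<omega>) +
        (1 + \<bar>b\<bar>) * ucp_norm (\<lambda>t \<omega>. Wn n t \<omega> - W t \<omega>)) \<longlonglongrightarrow> 0" by simp
    show ?thesis
      by (rule tendsto_sandwich[OF always_eventually[OF allI[OF ucp_norm_nonneg]] always_eventually[OF allI[OF b]]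
          tendsto_const lim])
  qed
  have cauchy: "\<exists>M. \<forall>m\<ge>M. \<forall>n\<ge>M. emery_small (\<lambda>t \<omega>. L m t \<omega> - L n t \<omega>) e" if e: "0 < e" for e
  proof -
    define e1 where "e1 = (e / 2) / (1 + \<bar>a\<bar>)"
    define e2 where "e2 = (e / 2) / (1 + \<bar>b\<bar>)"
    have p: "0 < e1" "0 < e2" using e by (auto simp: e1_def e2_def intro!: divide_pos_pos)
    obtain M1 where M1: "\<forall>m\<ge>M1. \<forall>n\<ge>M1. emery_small (\<lambda>t \<omega>. trunc H m t \<omega> - trunc H n t \<omega>) e1"
      using stochastic_integral_cauchy[OF Z(2-4) p(1)] by blast
    obtain M2 where M2: "\<forall>m\<ge>M2. \<forall>n\<ge>M2. emery_small (\<lambda>t \<omega>. trunc G m t \<omega> - trunc G n t \<omega>) e2"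
      using stochastic_integral_cauchy[OF W(2-4) p(2)] by blast
    have "emery_small (\<lambda>t \<omega>. L m t \<omega> - L n t \<omega>) e" if "m \<ge> max M1 M2" "n \<ge> max M1 M2" for m n
    proof -
      have bH: "bdd_pred (\<lambda>t \<omega>. trunc H m t \<omega> - trunc H n t \<omega>)" and bG: "bdd_pred (\<lambda>t \<omega>. trunc G m t \<omega> - trunc G n t \<omega>)"
        by (intro bdd_pred_diff trunc_bdd_pred Z(1) W(1))+
      have "emery_small (\<lambda>t \<omega>. a *\<^sub>R (trunc H m t \<omega> - trunc H n t \<omega>) + b *\<^sub>R (trunc G m t \<omega> - trunc G n t \<omega>))
        ((1 + \<bar>a\<bar>) * e1 + (1 + \<bar>b\<bar>) * e2)"
        using M1 M2 that by (intro emery_small_add emery_small_scale bH bG bdd_pred_cscaleR) auto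
      moreover have "(1 + \<bar>a\<bar>) * e1 + (1 + \<bar>b\<bar>) * e2 = e"
      proof -
        have "1 + \<bar>a\<bar> \<noteq> 0" "1 + \<bar>b\<bar> \<noteq> 0" by linarith+
        then have "e / 2 = e1 * (1 + \<bar>a\<bar>)" "e / 2 = e2 * (1 + \<bar>b\<bar>)"
          using nonzero_divide_eq_eq[of _ "e / 2"] e1_def e2_def by blast+
        then show ?thesis by (simp add: mult.commute)
      qed
      moreover have "(\<lambda>t \<omega>. a *\<^sub>R (trunc H m t \<omega> - trunc H n t \<omega>) + b *\<^sub>R (trunc G m t \<omega> - trunc G n t \<omega>)) =
        (\<lambda>t \<omega>. L m t \<omega> - L n t \<omega>)"
        by (intro ext) (simp add: L_def algebra_simps)
      ultimately show ?thesis by simp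
    qed
    then show ?thesis by blast
  qed
  have cmp: "\<exists>n0. \<forall>n\<ge>n0. \<forall>\<^sub>F m in sequentially. emery_small (\<lambda>t \<omega>. trunc ?K n t \<omega> - L m t \<omega>) e" if "0 < e" for e
    unfolding L_def by (rule truncation_compare[OF Z(1) W(1) cauchy[unfolded L_def] that])
  have "\<forall>n. \<exists>X. bint (trunc ?K n) X" using bint_exists[OF trunc_bdd_pred[OF K]] by blast
  from choice[OF this] obtain X where X: "\<And>n. bint (trunc ?K n) (X n)" by blast
  have aX: "adc (X n)" for n by (rule bint_adc[OF X])
  \<comment> \<open>Here \<open>m\<close> may depend on the test integrand \<open>k\<close>, whose
    constant \<open>C\<close> is not uniform, while \<open>n0\<close> may not; the uniform part of
    the estimate comes from \<open>emery_small\<close>.\<close>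
  have near: "\<exists>n0. \<forall>n\<ge>n0. \<forall>k. elem k \<longrightarrow> bdd_by k 1 \<longrightarrow> ucp_norm (\<lambda>t \<omega>. X n t \<omega> - ?Y t \<omega>) < e \<and>
      ucp_norm (eint k (\<lambda>t \<omega>. X n t \<omega> - ?Y t \<omega>)) < e" if e: "0 < e" for e
  proof -
    have e2: "0 < e / 2" using e by simp
    obtain n0 where n0: "\<And>n. n \<ge> n0 \<Longrightarrow> \<forall>\<^sub>F m in sequentially. emery_small (\<lambda>t \<omega>. trunc ?K n t \<omega> - L m t \<omega>) (e / 2)"
      using cmp[OF e2] by blast
    have "ucp_norm (\<lambda>t \<omega>. X n t \<omega> - ?Y t \<omega>) < e \<and> ucp_norm (eint k (\<lambda>t \<omega>. X n t \<omega> - ?Y t \<omega>)) < e"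
      if n: "n \<ge> n0" and k: "elem k" "bdd_by k 1" for n k
    proof -
      obtain C where C: "0 \<le> C" "\<And>X. adc X \<Longrightarrow> ucp_norm (eint k X) \<le> C * ucp_norm X" using eint_ucp_norm_bound[OF k(1)] by blast
      have "(\<lambda>m. C * ucp_norm (\<lambda>t \<omega>. V m t \<omega> - ?Y t \<omega>)) \<longlonglongrightarrow> C * 0" by (intro tendsto_mult tendsto_const Vlim)
      then have "(\<lambda>m. C * ucp_norm (\<lambda>t \<omega>. V m t \<omega> - ?Y t \<omega>)) \<longlonglongrightarrow> 0" by simp
      from eventually_happens'[OF trivial_limit_sequentially eventually_conj[OF n0[OF n]
          eventually_conj[OF order_tendstoD(2)[OF this e2] order_tendstoD(2)[OF Vlim e2]]]]
      obtain m where m: "emery_small (\<lambda>t \<omega>. trunc ?K n t \<omega> - L m t \<omega>) (e / 2)"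
        "C * ucp_norm (\<lambda>t \<omega>. V m t \<omega> - ?Y t \<omega>) < e / 2" "ucp_norm (\<lambda>t \<omega>. V m t \<omega> - ?Y t \<omega>) < e / 2" by blast
      have XV: "bint (\<lambda>t \<omega>. trunc ?K n t \<omega> - L m t \<omega>) (\<lambda>t \<omega>. X n t \<omega> - V m t \<omega>)" by (rule bint_diff[OF X LV])
      \<comment> \<open>The constant test integrand one recovers the plain distance from
        \<open>emery_small\<close>.\<close>
      have one: "ucp_norm (\<lambda>t \<omega>. X n t \<omega> - V m t \<omega>) \<le> e / 2"
        by (rule emery_smallD[OF m(1) elem_const[of 1]]) (use XV in \<open>simp_all add: bdd_by_def\<close>)
      have two: "ucp_norm (eint k (\<lambda>t \<omega>. X n t \<omega> - V m t \<omega>)) \<le> e / 2"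
        by (rule emery_smallD[OF m(1) k bint_elem_mult[OF k(1) XV]])
      have "ucp_norm (\<lambda>t \<omega>. X n t \<omega> - ?Y t \<omega>) < e"
        using ucp_norm_minus_triangle[OF aX aV Y, of n m] one m(3) by linarith
      moreover have "ucp_norm (eint k (\<lambda>t \<omega>. X n t \<omega> - ?Y t \<omega>)) < e"
      proof -
        have "ucp_norm (eint k (\<lambda>t \<omega>. X n t \<omega> - ?Y t \<omega>)) =
            ucp_norm (\<lambda>t \<omega>. eint k (\<lambda>t \<omega>. X n t \<omega> - V m t \<omega>) t \<omega> + eint k (\<lambda>t \<omega>. V m t \<omega> - ?Y t \<omega>) t \<omega>)"
          by (rule ucp_norm_cong_space) (simp add: eint_diff_right)
        also have "\<dots> \<le> ucp_norm (eint k (\<lambda>t \<omega>. X n t \<omega> - V m t \<omega>)) + ucp_norm (eint k (\<lambda>t \<omega>. V m t \<omega> - ?Y t \<omega>))"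
          by (intro ucp_norm_triangle adc_meas_proc adc_eint[OF _ k(1)] adc_diff aX aV Y)
        finally show ?thesis using two C(2)[OF adc_diff[OF aV[of m] Y]] m(2) by linarith
      qed
      ultimately show ?thesis ..
    qed
    then show ?thesis by blast
  qed
  have "emery_tendsto P F T X ?Y"
  proof (rule emery_tendstoI[OF aX Y])
    show "(\<lambda>n. ucp_norm (\<lambda>t \<omega>. X n t \<omega> - ?Y t \<omega>)) \<longlonglongrightarrow> 0"
    proof (rule order_tendstoI)
      fix e :: real assume "0 < e"
      have "bdd_by (\<lambda>t \<omega>. 0 :: real) 1" by (simp add: bdd_by_def)
      with near[OF \<open>0 < e\<close>] obtain n0 where "\<And>n. n \<ge> n0 \<Longrightarrow> ucp_norm (\<lambda>t \<omega>. X n t \<omega> - ?Y t \<omega>) < e"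
        using elem_const[of "0::real"] by meson
      then show "\<forall>\<^sub>F n in sequentially. ucp_norm (\<lambda>t \<omega>. X n t \<omega> - ?Y t \<omega>) < e"
        unfolding eventually_sequentially by blast
    next
      fix e :: real assume "e < 0"
      then show "\<forall>\<^sub>F n in sequentially. e < ucp_norm (\<lambda>t \<omega>. X n t \<omega> - ?Y t \<omega>)"
        by (intro always_eventually allI less_le_trans[OF _ ucp_norm_nonneg])
    qed
    show "\<forall>\<^sub>F n in sequentially. \<forall>k. elem k \<longrightarrow> bdd_by k 1 \<longrightarrow> ucp_norm (eint k (\<lambda>t \<omega>. X n t \<omega> - ?Y t \<omega>)) < e"
      if "0 < e" for e
      using near[OF that] unfolding eventually_sequentially by blast
  qed
  then show ?thesis unfolding stochastic_integral_iff using X by (intro conjI K Y exI[of _ X]) simp_all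
qed

text \<open>For \<open>k\<close> with values zero and one, truncation commutes with multiplication
  by \<open>k\<close>. This is the case that occurs when strategies are switched on an
  event.\<close>

lemma stochastic_integral_elem_mult:
  assumes SI: "stochastic_integral P F T S H Z" and k: "elem k"
    and k01: "\<And>t \<omega>. t \<in> {0..T} \<Longrightarrow> \<omega> \<in> space P \<Longrightarrow> k t \<omega> \<in> {0, 1 :: real}"
  shows "stochastic_integral P F T S (\<lambda>t \<omega>. k t \<omega> *\<^sub>R H t \<omega>) (eint k Z)"
proof -
  obtain W where Z: "predictable P F T H" "adc Z" "\<And>n. bint (trunc H n) (W n)" "emery_tendsto P F T W Z"
    using SI unfolding stochastic_integral_iff by blast
  have aW: "adc (W n)" for n by (rule bint_adc[OF Z(3)])
  obtain C where C: "0 \<le> C" "\<And>X. adc X \<Longrightarrow> ucp_norm (eint k X) \<le> C * ucp_norm X" using eint_ucp_norm_bound[OF k] by blast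
  have pr: "predictable P F T (\<lambda>t \<omega>. k t \<omega> *\<^sub>R H t \<omega>)"
    using Z(1) elem_predictable[OF k] unfolding predictable_iff by measurable
  have k1: "bdd_by k 1" using k01 by (fastforce simp: bdd_by_def)
  have BI': "bint (trunc (\<lambda>t \<omega>. k t \<omega> *\<^sub>R H t \<omega>) n) (eint k (W n))" for n
  proof (rule bint_cong_space[OF bint_elem_mult[OF k Z(3)]])
    fix t \<omega> assume "t \<in> {0..T}" "\<omega> \<in> space P"
    from k01[OF this] show "k t \<omega> *\<^sub>R trunc H n t \<omega> = trunc (\<lambda>t \<omega>. k t \<omega> *\<^sub>R H t \<omega>) n t \<omega>"
      by (auto simp: trunc_def)
  qed simp
  have a: "adc (eint k Z)" by (rule adc_eint[OF Z(2) k])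
  have "emery_tendsto P F T (\<lambda>n. eint k (W n)) (eint k Z)"
  proof (rule emery_tendstoI[OF adc_eint[OF aW k] a])
    have "(\<lambda>n. C * ucp_norm (\<lambda>t \<omega>. W n t \<omega> - Z t \<omega>)) \<longlonglongrightarrow> C * 0"
      using Z(4) ucp_iff[OF aW Z(2)] by (intro tendsto_mult tendsto_const) (simp add: emery_tendsto_def)
    then have lim: "(\<lambda>n. C * ucp_norm (\<lambda>t \<omega>. W n t \<omega> - Z t \<omega>)) \<longlonglongrightarrow> 0" by simp
    have b: "ucp_norm (\<lambda>t \<omega>. eint k (W n) t \<omega> - eint k Z t \<omega>) \<le> C * ucp_norm (\<lambda>t \<omega>. W n t \<omega> - Z t \<omega>)" for n
      using C(2)[OF adc_diff[OF aW[of n] Z(2)]] by (simp add: eint_diff_right[abs_def])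
    show "(\<lambda>n. ucp_norm (\<lambda>t \<omega>. eint k (W n) t \<omega> - eint k Z t \<omega>)) \<longlonglongrightarrow> 0"
      by (rule tendsto_sandwich[OF always_eventually[OF allI[OF ucp_norm_nonneg]] always_eventually[OF allI[OF b]]
          tendsto_const lim])
    fix e :: real assume "0 < e"
    from emery_uniform[OF aW Z(2,4) this]
    show "\<forall>\<^sub>F n in sequentially. \<forall>k'. elem k' \<longrightarrow> bdd_by k' 1 \<longrightarrow> ucp_norm (eint k' (\<lambda>t \<omega>. eint k (W n) t \<omega> - eint k Z t \<omega>)) < e"
    proof eventually_elim
      case (elim n)
      show ?case
      proof (intro allI impI)
        fix k' :: "real \<Rightarrow> 'a \<Rightarrow> real" assume k': "elem k'" "bdd_by k' 1"
        \<comment> \<open>A test integrand \<open>k'\<close> for the integrals against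
          \<open>k\<close> becomes the test integrand \<open>k' * k\<close> for the original
          ones.\<close>
        have "ucp_norm (eint k' (\<lambda>t \<omega>. eint k (W n) t \<omega> - eint k Z t \<omega>)) =
          ucp_norm (eint (\<lambda>t \<omega>. k' t \<omega> *\<^sub>R k t \<omega>) (\<lambda>t \<omega>. W n t \<omega> - Z t \<omega>))"
          by (rule ucp_norm_cong_space) (simp only: eint_diff_right eint_assoc[OF k'(1) k])
        also have "\<dots> < e"
          using elim elem_scaleR[OF k'(1) k] bdd_by_scaleR[OF k'(2) k1] by simp
        finally show "ucp_norm (eint k' (\<lambda>t \<omega>. eint k (W n) t \<omega> - eint k Z t \<omega>)) < e" .
      qed
    qed
  qed
  then show ?thesis
    unfolding stochastic_integral_iff using BI' by (intro conjI pr a exI[of _ "\<lambda>n. eint k (W n)"]) simp_all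
qed

end

section \<open>Optional stopping\<close>

lemma right_limit_sequence:
  fixes x :: "real \<Rightarrow> 'b::metric_space"
  assumes x: "(x \<longlongrightarrow> x s) (at_right s)" and r: "\<And>n. s \<le> r n" "r \<longlonglongrightarrow> s"
  shows "(\<lambda>n. x (r n)) \<longlonglongrightarrow> x s"
proof (rule tendstoI)
  fix e :: real assume "0 < e"
  then obtain b where b: "s < b" "\<And>y. s < y \<Longrightarrow> y < b \<Longrightarrow> dist (x y) (x s) < e"
    using tendstoD[OF x] unfolding eventually_at_right_field by blast
  have "\<forall>\<^sub>F n in sequentially. r n < b" by (rule order_tendstoD(2)[OF r(2) b(1)])
  then show "\<forall>\<^sub>F n in sequentially. dist (x (r n)) (x s) < e"
  proof eventually_elim
    case (elim n)
    show ?case using b(2)[of "r n"] elim r(1)[of n] \<open>0 < e\<close> by (cases "r n = s") auto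
  qed
qed

context filtered_space begin

text \<open>Martingales in weak form, tested against bounded \<open>F a\<close>-measurable factors.
  Conditional expectations become plain integrals, which are easy to stop and to pass to the
  limit.\<close>

definition mart :: "('a, real) process \<Rightarrow> bool" where
  "mart X \<longleftrightarrow> (\<forall>t\<in>{0..T}. X t \<in> borel_measurable (F t) \<and> integrable P (X t)) \<and>
     (\<forall>a b h c. 0 \<le> a \<longrightarrow> a \<le> b \<longrightarrow> b \<le> T \<longrightarrow> h \<in> borel_measurable (F a) \<longrightarrow> (\<forall>\<omega>\<in>space P. \<bar>h \<omega>\<bar> \<le> c) \<longrightarrow>
        (\<integral>\<omega>. h \<omega> * X b \<omega> \<partial>P) = (\<integral>\<omega>. h \<omega> * X a \<omega> \<partial>P))"

lemma mart_measurable: "mart X \<Longrightarrow> t \<in> {0..T} \<Longrightarrow> X t \<in> borel_measurable (F t)"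
  and mart_integrable: "mart X \<Longrightarrow> t \<in> {0..T} \<Longrightarrow> integrable P (X t)"
  unfolding mart_def by blast+

lemma mart_eq:
  assumes "mart X" "0 \<le> a" "a \<le> b" "b \<le> T" "h \<in> borel_measurable (F a)"
    "\<And>\<omega>. \<omega> \<in> space P \<Longrightarrow> \<bar>h \<omega>\<bar> \<le> c"
  shows "(\<integral>\<omega>. h \<omega> * X b \<omega> \<partial>P) = (\<integral>\<omega>. h \<omega> * X a \<omega> \<partial>P)"
  using assms unfolding mart_def by blast

lemma integrable_bounded_mult:
  fixes h X :: "'a \<Rightarrow> real"
  assumes "h \<in> borel_measurable P" "\<And>\<omega>. \<omega> \<in> space P \<Longrightarrow> \<bar>h \<omega>\<bar> \<le> c" "integrable P X"
  shows "integrable P (\<lambda>\<omega>. h \<omega> * X \<omega>)"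
proof (rule Bochner_Integration.integrable_bound[where f="\<lambda>\<omega>. c * X \<omega>"])
  show "integrable P (\<lambda>\<omega>. c * X \<omega>)" using assms(3) by simp
  show "(\<lambda>\<omega>. h \<omega> * X \<omega>) \<in> borel_measurable P"
    using assms(1) borel_measurable_integrable[OF assms(3)] by (rule borel_measurable_times)
  show "AE \<omega> in P. norm (h \<omega> * X \<omega>) \<le> norm (c * X \<omega>)"
  proof (rule AE_I2)
    fix \<omega> assume "\<omega> \<in> space P"
    from assms(2)[OF this] have "\<bar>h \<omega>\<bar> \<le> \<bar>c\<bar>" by linarith
    then show "norm (h \<omega> * X \<omega>) \<le> norm (c * X \<omega>)" by (simp add: abs_mult mult_right_mono)
  qed
qed

lemma martingale_mart:
  assumes "martingale P F T X" shows "mart X"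
  unfolding mart_def
proof (intro conjI ballI allI impI)
  show "X t \<in> borel_measurable (F t)" if "t \<in> {0..T}" for t
    using assms that unfolding martingale_def adapted_def by blast
  show int: "integrable P (X t)" if "t \<in> {0..T}" for t
    using assms that unfolding martingale_def by blast
  fix a b c :: real and h :: "'a \<Rightarrow> real"
  assume ab: "0 \<le> a" "a \<le> b" "b \<le> T" and h: "h \<in> borel_measurable (F a)" "\<forall>\<omega>\<in>space P. \<bar>h \<omega>\<bar> \<le> c"
  have "subalgebra P (F a)" using usual ab unfolding usual_conditions_def by auto
  then interpret finite_measure_subalgebra P "F a" by unfold_locales
  have hP: "h \<in> borel_measurable P" using measurable_F_P[OF h(1)] ab by simp
  have ib: "integrable P (X b)" and ia: "integrable P (X a)" using int ab by auto
  have ih: "integrable P (\<lambda>\<omega>. h \<omega> * X b \<omega>)" using integrable_bounded_mult[OF hP _ ib] h(2) by blast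
  have "(\<integral>\<omega>. h \<omega> * X b \<omega> \<partial>P) = (\<integral>\<omega>. h \<omega> * real_cond_exp P (F a) (X b) \<omega> \<partial>P)"
    using real_cond_exp_intg(2)[OF ih h(1) borel_measurable_integrable[OF ib]] by simp
  also have "\<dots> = (\<integral>\<omega>. h \<omega> * X a \<omega> \<partial>P)"
  proof (rule integral_cong_AE)
    have "AE \<omega> in P. real_cond_exp P (F a) (X b) \<omega> = X a \<omega>"
      using assms ab unfolding martingale_def by blast
    then show "AE \<omega> in P. h \<omega> * real_cond_exp P (F a) (X b) \<omega> = h \<omega> * X a \<omega>" by eventually_elim simp
  qed (use hP ia in auto)
  finally show "(\<integral>\<omega>. h \<omega> * X b \<omega> \<partial>P) = (\<integral>\<omega>. h \<omega> * X a \<omega> \<partial>P)" .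
qed

section \<open>Stopping times and their discretization\<close>

definition stop_time :: "('a \<Rightarrow> real) \<Rightarrow> bool" where
  "stop_time \<sigma> \<longleftrightarrow> \<sigma> \<in> space P \<rightarrow> {0..T} \<and> (\<forall>t\<in>{0..T}. {\<omega>\<in>space P. \<sigma> \<omega> \<le> t} \<in> sets (F t))"

lemma stopping_time_stop_time:
  assumes "stopping_time (clamp_filtration T F) \<sigma>" "\<sigma> \<in> space P \<rightarrow> {0..T}"
  shows "stop_time \<sigma>"
  unfolding stop_time_def
proof (intro conjI ballI)
  fix t assume t: "t \<in> {0..T}"
  then have "clamp_filtration T F t = F t" by (simp add: clamp_filtration_def)
  then have "Measurable.pred (F t) (\<lambda>\<omega>. \<sigma> \<omega> \<le> t)"
    using assms(1) by (metis stopping_time_def)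
  then show "{\<omega>\<in>space P. \<sigma> \<omega> \<le> t} \<in> sets (F t)"
    using space_F[OF t] by (simp add: pred_def)
qed (rule assms(2))

lemma stop_time_min:
  assumes "stop_time \<sigma>" "stop_time \<tau>" shows "stop_time (\<lambda>\<omega>. min (\<sigma> \<omega>) (\<tau> \<omega>))"
  unfolding stop_time_def
proof (intro conjI ballI)
  show "(\<lambda>\<omega>. min (\<sigma> \<omega>) (\<tau> \<omega>)) \<in> space P \<rightarrow> {0..T}"
    using assms unfolding stop_time_def Pi_def by (auto simp: min_def)
  fix t assume "t \<in> {0..T}"
  then have "{\<omega>\<in>space P. \<sigma> \<omega> \<le> t} \<union> {\<omega>\<in>space P. \<tau> \<omega> \<le> t} \<in> sets (F t)"
    using assms unfolding stop_time_def by auto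
  moreover have "{\<omega>\<in>space P. \<sigma> \<omega> \<le> t} \<union> {\<omega>\<in>space P. \<tau> \<omega> \<le> t} = {\<omega>\<in>space P. min (\<sigma> \<omega>) (\<tau> \<omega>) \<le> t}"
    by (auto simp: min_le_iff_disj)
  ultimately show "{\<omega>\<in>space P. min (\<sigma> \<omega>) (\<tau> \<omega>) \<le> t} \<in> sets (F t)" by simp
qed

lemma stop_time_bounds: "stop_time \<sigma> \<Longrightarrow> \<omega> \<in> space P \<Longrightarrow> 0 \<le> \<sigma> \<omega>" "stop_time \<sigma> \<Longrightarrow> \<omega> \<in> space P \<Longrightarrow> \<sigma> \<omega> \<le> T"
  unfolding stop_time_def by auto

lemma stop_time_less: "stop_time \<sigma> \<Longrightarrow> t \<in> {0..T} \<Longrightarrow> {\<omega>\<in>space P. t < \<sigma> \<omega>} \<in> sets (F t)"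
proof -
  assume "stop_time \<sigma>" and t: "t \<in> {0..T}"
  then have "{\<omega>\<in>space P. \<sigma> \<omega> \<le> t} \<in> sets (F t)" unfolding stop_time_def by blast
  then have "space (F t) - {\<omega>\<in>space P. \<sigma> \<omega> \<le> t} \<in> sets (F t)" by (rule sets.compl_sets)
  moreover have "space (F t) - {\<omega>\<in>space P. \<sigma> \<omega> \<le> t} = {\<omega>\<in>space P. t < \<sigma> \<omega>}" using space_F[OF t] by auto
  ultimately show ?thesis by simp
qed

text \<open>Rounding up to the grid turns a stopping time into one with finitely many values;
  rounding down would look into the future.\<close>

definition ceil_in :: "real set \<Rightarrow> real \<Rightarrow> real" where "ceil_in E s = Min {e\<in>E. s \<le> e}"

lemma ceil_in:
  assumes "grid E" "s \<le> T"
  shows "ceil_in E s \<in> E" "s \<le> ceil_in E s" "\<And>e. e \<in> E \<Longrightarrow> s \<le> e \<Longrightarrow> ceil_in E s \<le> e"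
    and "\<And>e. e \<in> E \<Longrightarrow> e < s \<longleftrightarrow> e < ceil_in E s"
proof -
  have fin: "finite {e\<in>E. s \<le> e}" and ne: "{e\<in>E. s \<le> e} \<noteq> {}" using assms by (auto simp: grid_def)
  show 1: "ceil_in E s \<in> E" "s \<le> ceil_in E s" using Min_in[OF fin ne] by (auto simp: ceil_in_def)
  show 2: "ceil_in E s \<le> e" if "e \<in> E" "s \<le> e" for e using fin that by (auto simp: ceil_in_def)
  show "e < s \<longleftrightarrow> e < ceil_in E s" if "e \<in> E" for e using 1(2) 2[OF that] by linarith
qed

text \<open>For grid points, \<open>e < s\<close> is equivalent to \<open>e < ceil_in E s\<close>,
  so the indicator switches the increments off exactly at the rounded time.\<close>

lemma grid_stopped_telescope:
  fixes g :: "real \<Rightarrow> real"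
  assumes E: "grid E" and ab: "a \<in> E" "b \<in> E" "a \<le> b" and s: "s \<le> T"
  shows "(\<Sum>e\<in>E \<inter> {a..<b}. (if e < s then 1 else 0) * (g (nxt E e) - g e)) = g (min b (ceil_in E s)) - g (min a (ceil_in E s))"
proof -
  note u = ceil_in[OF E s]
  have fin: "finite (E \<inter> {a..<b})" using E by (auto simp: grid_def)
  have "(\<Sum>e\<in>E \<inter> {a..<b}. (if e < s then 1 else 0) * (g (nxt E e) - g e)) =
    (\<Sum>e\<in>E \<inter> {a..<b} \<inter> {e. e < s}. g (nxt E e) - g e)"
    by (subst sum.inter_restrict[OF fin]) (auto intro!: sum.cong)
  also have "E \<inter> {a..<b} \<inter> {e. e < s} = E \<inter> {a..<min b (ceil_in E s)}" using u(4) by auto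
  also have "(\<Sum>e\<in>\<dots>. g (nxt E e) - g e) = g (min b (ceil_in E s)) - g (min a (ceil_in E s))"
  proof (cases "a \<le> ceil_in E s")
    case True
    have "min b (ceil_in E s) \<in> E" using ab u(1) by (simp add: min_def)
    from grid_telescope[OF E ab(1) this] show ?thesis using True ab(3) by simp
  next
    case False
    then have "{a..<min b (ceil_in E s)} = {}" "min b (ceil_in E s) = ceil_in E s" "min a (ceil_in E s) = ceil_in E s" using ab(3) by auto
    then show ?thesis by simp
  qed
  finally show ?thesis .
qed

text \<open>The rounded time is \<open>e\<close> if \<open>\<sigma>\<close> lies above all earlier
  grid points and not above \<open>e\<close>, which is known at time \<open>e\<close>. At
  \<open>e = b\<close> the minimum removes the second condition.\<close>

lemma ceil_in_measurable_set:
  assumes E: "grid E" and \<sigma>: "stop_time \<sigma>" and b: "b \<in> E" and e: "e \<in> E" "e \<le> b"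
  shows "{\<omega>\<in>space P. min b (ceil_in E (\<sigma> \<omega>)) = e} \<in> sets (F e)"
proof -
  have e0: "0 \<le> e" "e \<le> T" using E e(1) by (auto simp: grid_def)
  have le: "ceil_in E (\<sigma> \<omega>) \<le> e \<longleftrightarrow> \<sigma> \<omega> \<le> e" if "e \<in> E" "\<omega> \<in> space P" for e \<omega>
    using ceil_in(4)[OF E stop_time_bounds(2)[OF \<sigma> that(2)] that(1)] by linarith
  have A: "{\<omega>\<in>space P. \<sigma> \<omega> \<le> e} \<in> sets (F e)" using \<sigma> e0 unfolding stop_time_def by auto
  have B: "{\<omega>\<in>space P. \<sigma> \<omega> \<le> e'} \<in> sets (F e)" if "e' \<in> E" "e' < e" for e'
  proof -
    have "0 \<le> e'" "e' \<le> T" using E that(1) by (auto simp: grid_def)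
    then have "{\<omega>\<in>space P. \<sigma> \<omega> \<le> e'} \<in> sets (F e')" using \<sigma> unfolding stop_time_def by auto
    then show ?thesis using F_mono[of e' e] \<open>0 \<le> e'\<close> that(2) e0 by auto
  qed
  have fin: "finite {e'\<in>E. e' < e}" using E by (auto simp: grid_def)
  have U: "(\<Union>e'\<in>{e'\<in>E. e' < e}. {\<omega>\<in>space P. \<sigma> \<omega> \<le> e'}) \<in> sets (F e)"
    using fin B by (intro sets.finite_UN) auto
  have before: "(\<exists>e'\<in>E. e' < e \<and> \<sigma> \<omega> \<le> e') \<longleftrightarrow> ceil_in E (\<sigma> \<omega>) < e" if "\<omega> \<in> space P" for \<omega>
    using ceil_in(1,2,3)[OF E stop_time_bounds(2)[OF \<sigma> that]] by (meson le_less_trans)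
  have W: "space P \<in> sets (F e)" using sets.top[of "F e"] space_F[of e] e0 by simp
  have "{\<omega>\<in>space P. min b (ceil_in E (\<sigma> \<omega>)) = e} =
      (if e = b then space P - (\<Union>e'\<in>{e'\<in>E. e' < e}. {\<omega>\<in>space P. \<sigma> \<omega> \<le> e'})
       else {\<omega>\<in>space P. \<sigma> \<omega> \<le> e} - (\<Union>e'\<in>{e'\<in>E. e' < e}. {\<omega>\<in>space P. \<sigma> \<omega> \<le> e'}))"
  proof (cases "e = b")
    case True
    have "min b (ceil_in E (\<sigma> \<omega>)) = e \<longleftrightarrow> \<not> (\<exists>e'\<in>E. e' < e \<and> \<sigma> \<omega> \<le> e')" if "\<omega> \<in> space P" for \<omega>
      unfolding before[OF that] using True by auto
    then show ?thesis using True by auto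
  next
    case False
    have "min b (ceil_in E (\<sigma> \<omega>)) = e \<longleftrightarrow> \<sigma> \<omega> \<le> e \<and> \<not> (\<exists>e'\<in>E. e' < e \<and> \<sigma> \<omega> \<le> e')" if "\<omega> \<in> space P" for \<omega>
      unfolding before[OF that] le[OF e(1) that, symmetric] using False e(2) by auto
    then show ?thesis using False by auto
  qed
  then show ?thesis using A U W by auto
qed

text \<open>The sign \<open>s\<close> of \<open>X e\<close>, set to zero where
  \<open>\<bar>X e \<omega>\<bar> \<le> L\<close> and off \<open>G\<close>, is known at time
  \<open>e\<close> and serves as test factor: \<open>s * X - \<bar>s\<bar> * L\<close> equals the
  excess at time \<open>e\<close> and is at most the excess at time \<open>b\<close>.\<close>

lemma mart_excess:
  assumes X: "mart X" and e: "0 \<le> e" "e \<le> b" "b \<le> T" and G: "G \<in> sets (F e)" and L: "0 \<le> L"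
  shows "(\<integral>\<omega>. indicator G \<omega> * max 0 (\<bar>X e \<omega>\<bar> - L) \<partial>P) \<le> (\<integral>\<omega>. indicator G \<omega> * max 0 (\<bar>X b \<omega>\<bar> - L) \<partial>P)"
proof -
  have eb: "e \<in> {0..T}" "b \<in> {0..T}" using e by auto
  note ie = mart_integrable[OF X eb(1)] and ib = mart_integrable[OF X eb(2)]
  have Xe[measurable]: "X e \<in> borel_measurable (F e)" by (rule mart_measurable[OF X eb(1)])
  note G[measurable]
  define s where "s \<omega> = (indicator G \<omega> * (if L < X e \<omega> then 1 else if X e \<omega> < - L then -1 else 0) :: real)" for \<omega>
  have sm: "s \<in> borel_measurable (F e)" unfolding s_def[abs_def] by measurable
  have sP: "s \<in> borel_measurable P" by (rule measurable_F_P[OF sm eb(1)])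
  have s1: "\<bar>s \<omega>\<bar> \<le> 1" for \<omega> by (auto simp: s_def indicator_def)
  have ise: "integrable P (\<lambda>\<omega>. s \<omega> * X e \<omega>)" and isb: "integrable P (\<lambda>\<omega>. s \<omega> * X b \<omega>)"
    using integrable_bounded_mult[OF sP _ ie] integrable_bounded_mult[OF sP _ ib] s1 by blast+
  have isa: "integrable P (\<lambda>\<omega>. \<bar>s \<omega>\<bar> * L)"
    using sP s1 L by (intro integrable_const_bound[where B=L]) (auto intro!: AE_I2 mult_left_le_one_le)
  have GP: "G \<in> sets P" using G sets_F[OF eb(1)] by auto
  have imb: "integrable P (\<lambda>\<omega>. indicator G \<omega> * max 0 (\<bar>X b \<omega>\<bar> - L))"
    using GP ib by (intro integrable_bounded_mult[where c=1]) (auto simp: indicator_def)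
  have "(\<integral>\<omega>. indicator G \<omega> * max 0 (\<bar>X e \<omega>\<bar> - L) \<partial>P) = (\<integral>\<omega>. s \<omega> * X e \<omega> - \<bar>s \<omega>\<bar> * L \<partial>P)"
    using L by (intro Bochner_Integration.integral_cong) (auto simp: s_def indicator_def max_def)
  also have "\<dots> = (\<integral>\<omega>. s \<omega> * X e \<omega> \<partial>P) - (\<integral>\<omega>. \<bar>s \<omega>\<bar> * L \<partial>P)" using ise isa by simp
  also have "(\<integral>\<omega>. s \<omega> * X e \<omega> \<partial>P) = (\<integral>\<omega>. s \<omega> * X b \<omega> \<partial>P)"
    by (rule mart_eq[OF X e sm s1, symmetric])
  also have "\<dots> - (\<integral>\<omega>. \<bar>s \<omega>\<bar> * L \<partial>P) = (\<integral>\<omega>. s \<omega> * X b \<omega> - \<bar>s \<omega>\<bar> * L \<partial>P)" using isb isa by simp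
  also have "\<dots> \<le> (\<integral>\<omega>. indicator G \<omega> * max 0 (\<bar>X b \<omega>\<bar> - L) \<partial>P)"
    using isb isa imb by (intro integral_mono) (auto simp: s_def indicator_def max_def)
  finally show ?thesis .
qed

text \<open>The space is split according to the value \<open>e\<close> of the rounded time, and
  \<open>mart_excess\<close> is applied on each piece \<open>G e\<close>. The bound does not depend
  on the grid, which gives uniform integrability.\<close>

lemma mart_excess_stopped:
  assumes X: "mart X" and E: "grid E" and \<sigma>: "stop_time \<sigma>" and b: "b \<in> E" and L: "0 \<le> L"
  shows "integrable P (\<lambda>\<omega>. X (min b (ceil_in E (\<sigma> \<omega>))) \<omega>)"
    and "(\<integral>\<omega>. max 0 (\<bar>X (min b (ceil_in E (\<sigma> \<omega>))) \<omega>\<bar> - L) \<partial>P) \<le> (\<integral>\<omega>. max 0 (\<bar>X b \<omega>\<bar> - L) \<partial>P)"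
    and "(\<lambda>\<omega>. X (min b (ceil_in E (\<sigma> \<omega>))) \<omega>) \<in> borel_measurable (F b)"
proof -
  define J where "J = {e\<in>E. e \<le> b}"
  define G where "G e = {\<omega>\<in>space P. min b (ceil_in E (\<sigma> \<omega>)) = e}" for e
  have fin: "finite J" using E by (auto simp: J_def grid_def)
  have bT: "0 \<le> b" "b \<le> T" using E b by (auto simp: grid_def)
  have Je: "0 \<le> e" "e \<le> b" "e \<le> T" "e \<in> {0..T}" if "e \<in> J" for e using that E bT by (auto simp: J_def grid_def)
  have G: "G e \<in> sets (F e)" "G e \<in> sets P" if "e \<in> J" for e
    using ceil_in_measurable_set[OF E \<sigma> b] sets_F[OF Je(4)[OF that]] that by (auto simp: G_def J_def)
  have dec: "g (min b (ceil_in E (\<sigma> \<omega>))) = (\<Sum>e\<in>J. indicator (G e) \<omega> * g e)" if "\<omega> \<in> space P" for \<omega> and g :: "real \<Rightarrow> real"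
  proof -
    have "min b (ceil_in E (\<sigma> \<omega>)) \<in> J"
      using ceil_in(1)[OF E stop_time_bounds(2)[OF \<sigma> that]] b by (auto simp: J_def min_def)
    moreover have "(\<Sum>e\<in>J. indicator (G e) \<omega> * g e) = (\<Sum>e\<in>J. if min b (ceil_in E (\<sigma> \<omega>)) = e then g e else 0)"
      using that by (intro sum.cong) (auto simp: G_def)
    ultimately show ?thesis using fin by simp
  qed
  have i1: "integrable P (\<lambda>\<omega>. indicator (G e) \<omega> * X e \<omega>)" if "e \<in> J" for e
    using mart_integrable[OF X Je(4)[OF that]] G(2)[OF that]
    by (intro integrable_bounded_mult[where c=1]) (auto simp: indicator_def)
  have "integrable P (\<lambda>\<omega>. \<Sum>e\<in>J. indicator (G e) \<omega> * X e \<omega>)" using i1 by simp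
  then show "integrable P (\<lambda>\<omega>. X (min b (ceil_in E (\<sigma> \<omega>))) \<omega>)"
    by (subst Bochner_Integration.integrable_cong[OF refl dec]) auto
  have im: "integrable P (\<lambda>\<omega>. indicator (G e) \<omega> * max 0 (\<bar>X s \<omega>\<bar> - L))" if "e \<in> J" "s \<in> {0..T}" for e s
    using mart_integrable[OF X that(2)] G(2)[OF that(1)]
    by (intro integrable_bounded_mult[where c=1]) (auto simp: indicator_def)
  have "(\<integral>\<omega>. max 0 (\<bar>X (min b (ceil_in E (\<sigma> \<omega>))) \<omega>\<bar> - L) \<partial>P) = (\<integral>\<omega>. (\<Sum>e\<in>J. indicator (G e) \<omega> * max 0 (\<bar>X e \<omega>\<bar> - L)) \<partial>P)"
    by (intro Bochner_Integration.integral_cong refl) (rule dec)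
  also have "\<dots> = (\<Sum>e\<in>J. (\<integral>\<omega>. indicator (G e) \<omega> * max 0 (\<bar>X e \<omega>\<bar> - L) \<partial>P))"
    using im Je(4) by (intro Bochner_Integration.integral_sum) auto
  also have "\<dots> \<le> (\<Sum>e\<in>J. (\<integral>\<omega>. indicator (G e) \<omega> * max 0 (\<bar>X b \<omega>\<bar> - L) \<partial>P))"
    by (intro sum_mono mart_excess[OF X _ _ bT(2) _ L] Je G)
  also have "\<dots> = (\<integral>\<omega>. (\<Sum>e\<in>J. indicator (G e) \<omega> * max 0 (\<bar>X b \<omega>\<bar> - L)) \<partial>P)"
    using im bT by (intro Bochner_Integration.integral_sum[symmetric]) auto
  also have "\<dots> = (\<integral>\<omega>. max 0 (\<bar>X b \<omega>\<bar> - L) \<partial>P)"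
    by (intro Bochner_Integration.integral_cong refl) (rule dec[symmetric])
  finally show "(\<integral>\<omega>. max 0 (\<bar>X (min b (ceil_in E (\<sigma> \<omega>))) \<omega>\<bar> - L) \<partial>P) \<le> (\<integral>\<omega>. max 0 (\<bar>X b \<omega>\<bar> - L) \<partial>P)" .
  have "(\<lambda>\<omega>. \<Sum>e\<in>J. indicator (G e) \<omega> * X e \<omega>) \<in> borel_measurable (F b)"
  proof (rule borel_measurable_sum)
    fix e assume e: "e \<in> J"
    have "(\<lambda>\<omega>. indicator (G e) \<omega> * X e \<omega>) \<in> borel_measurable (F e)"
      using G(1)[OF e] mart_measurable[OF X Je(4)[OF e]] by measurable
    then show "(\<lambda>\<omega>. indicator (G e) \<omega> * X e \<omega>) \<in> borel_measurable (F b)"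
      by (rule measurable_F_mono) (use Je[OF e] bT in auto)
  qed
  then show "(\<lambda>\<omega>. X (min b (ceil_in E (\<sigma> \<omega>))) \<omega>) \<in> borel_measurable (F b)"
    by (subst measurable_cong[OF dec]) (use space_F[of b] bT in auto)
qed

definition dyadic :: "nat \<Rightarrow> real set" where
  "dyadic n = (\<lambda>i. T * real i / 2 ^ n) ` {..2 ^ n}"

lemma dyadic_grid: "finite A \<Longrightarrow> A \<subseteq> {0..T} \<Longrightarrow> grid (dyadic n \<union> A)"
proof -
  assume A: "finite A" "A \<subseteq> {0..T}"
  have "(0::real) \<in> dyadic n" unfolding dyadic_def by (rule image_eqI[of _ _ 0]) auto
  moreover have "T \<in> dyadic n" unfolding dyadic_def by (rule image_eqI[of _ _ "2 ^ n"]) auto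
  moreover have "dyadic n \<subseteq> {0..T}"
  proof
    fix x assume "x \<in> dyadic n"
    then obtain i where i: "i \<le> 2 ^ n" "x = T * real i / 2 ^ n" by (auto simp: dyadic_def)
    have "real i \<le> 2 ^ n" using i(1) by (metis of_nat_le_iff of_nat_numeral of_nat_power)
    then have "T * real i \<le> T * 2 ^ n" using T_pos by (intro mult_left_mono) auto
    then show "x \<in> {0..T}" using i(2) T_pos by (simp add: divide_le_eq)
  qed
  moreover have "finite (dyadic n)" by (simp add: dyadic_def)
  ultimately show ?thesis using A by (auto simp: grid_def)
qed

lemma ceil_in_dyadic:
  assumes A: "finite A" "A \<subseteq> {0..T}" and s: "0 \<le> s" "s \<le> T"
  shows "s \<le> ceil_in (dyadic n \<union> A) s" "ceil_in (dyadic n \<union> A) s \<le> s + T / 2 ^ n"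
proof -
  note u = ceil_in[OF dyadic_grid[OF A, of n] s(2)]
  show "s \<le> ceil_in (dyadic n \<union> A) s" by (rule u(2))
  define i where "i = nat \<lceil>s * 2 ^ n / T\<rceil>"
  have r: "real i = of_int \<lceil>s * 2 ^ n / T\<rceil>" using s T_pos by (simp add: i_def)
  have 1: "s * 2 ^ n / T \<le> real i" "real i < s * 2 ^ n / T + 1" unfolding r by linarith+
  have "s * 2 ^ n / T \<le> 2 ^ n" using s T_pos by (simp add: divide_le_eq mult.commute mult_left_mono)
  then have "\<lceil>s * 2 ^ n / T\<rceil> \<le> 2 ^ n" by (simp add: ceiling_le_iff)
  then have i: "i \<le> 2 ^ n" unfolding i_def by (simp add: nat_le_iff)
  then have "T * real i / 2 ^ n \<in> dyadic n \<union> A" unfolding dyadic_def by blast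
  moreover have "s \<le> T * real i / 2 ^ n"
    using 1(1) T_pos by (simp add: field_simps)
  ultimately have "ceil_in (dyadic n \<union> A) s \<le> T * real i / 2 ^ n" by (rule u(3))
  also have "\<dots> \<le> s + T / 2 ^ n" using 1(2) T_pos by (simp add: field_simps)
  finally show "ceil_in (dyadic n \<union> A) s \<le> s + T / 2 ^ n" .
qed

lemma ceil_in_dyadic_lim:
  assumes A: "finite A" "A \<subseteq> {0..T}" and s: "0 \<le> s" "s \<le> T"
  shows "(\<lambda>n. ceil_in (dyadic n \<union> A) s) \<longlonglongrightarrow> s"
proof (rule tendsto_sandwich[OF always_eventually[OF allI] always_eventually[OF allI] tendsto_const])
  show "s \<le> ceil_in (dyadic n \<union> A) s" "ceil_in (dyadic n \<union> A) s \<le> s + T * (1/2) ^ n" for n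
    using ceil_in_dyadic[OF A s, of n] by (auto simp: power_one_over)
  have "(\<lambda>n. s + T * (1/2) ^ n) \<longlonglongrightarrow> s + T * 0"
    by (intro tendsto_add tendsto_mult tendsto_const LIMSEQ_power_zero) auto
  then show "(\<lambda>n. s + T * (1/2) ^ n) \<longlonglongrightarrow> s" by simp
qed

text \<open>For \<open>s < b\<close> the rounded times approach \<open>s\<close> from the right.
  Otherwise they all stay at or above \<open>b\<close>, and the sequence is constant.\<close>

lemma stopped_limit:
  fixes x :: "real \<Rightarrow> real"
  assumes x: "cadlag_on T x" and A: "finite A" "A \<subseteq> {0..T}" and b: "b \<in> {0..T}" and s: "0 \<le> s" "s \<le> T"
  shows "(\<lambda>n. x (min b (ceil_in (dyadic n \<union> A) s))) \<longlonglongrightarrow> x (min b s)"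
proof (cases "s < b")
  case True
  show ?thesis
  proof (rule right_limit_sequence[where s="min b s" and x=x and r="\<lambda>n. min b (ceil_in (dyadic n \<union> A) s)"])
    show "min b s \<le> min b (ceil_in (dyadic n \<union> A) s)" for n using ceil_in_dyadic(1)[OF A s, of n] by auto
    show "(\<lambda>n. min b (ceil_in (dyadic n \<union> A) s)) \<longlonglongrightarrow> min b s"
      by (intro tendsto_min tendsto_const ceil_in_dyadic_lim[OF A s])
    show "(x \<longlongrightarrow> x (min b s)) (at_right (min b s))"
      using True b s by (intro cadlag_right[OF x]) auto
  qed
next
  case False
  have "min b (ceil_in (dyadic n \<union> A) s) = b" for n using ceil_in_dyadic(1)[OF A s, of n] False by auto
  then show ?thesis using False by simp
qed

lemma excess_tendsto_0:
  assumes "integrable P (X :: 'a \<Rightarrow> real)"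
  shows "(\<lambda>m. \<integral>\<omega>. max 0 (\<bar>X \<omega>\<bar> - real m) \<partial>P) \<longlonglongrightarrow> 0"
proof -
  have "(\<lambda>m. \<integral>\<omega>. max 0 (\<bar>X \<omega>\<bar> - real m) \<partial>P) \<longlonglongrightarrow> (\<integral>\<omega>. 0 \<partial>P)"
  proof (rule integral_dominated_convergence[where w="\<lambda>\<omega>. \<bar>X \<omega>\<bar>"])
    show "AE \<omega> in P. (\<lambda>m. max 0 (\<bar>X \<omega>\<bar> - real m)) \<longlonglongrightarrow> 0"
    proof (rule AE_I2)
      fix \<omega>
      obtain N where N: "\<bar>X \<omega>\<bar> \<le> real N" using real_arch_simple by blast
      have "\<forall>\<^sub>F m in sequentially. max 0 (\<bar>X \<omega>\<bar> - real m) = 0"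
        using eventually_ge_at_top[of N] by eventually_elim (use N in auto)
      then show "(\<lambda>m. max 0 (\<bar>X \<omega>\<bar> - real m)) \<longlonglongrightarrow> 0" by (rule tendsto_eventually)
    qed
    show "AE \<omega> in P. norm (max 0 (\<bar>X \<omega>\<bar> - real m)) \<le> \<bar>X \<omega>\<bar>" for m by (intro AE_I2) auto
  qed (use assms in auto)
  then show ?thesis by simp
qed

text \<open>Uniform integrability of the values of a martingale at the discretized times is what makes the
  limit of discrete optional stopping legitimate.\<close>

lemma stopped_expectation_limit:
  assumes X: "mart X" and cad: "AE \<omega> in P. cadlag_on T (\<lambda>t. X t \<omega>)" and \<sigma>: "stop_time \<sigma>"
    and bnd: "AE \<omega> in P. \<forall>t\<in>{0..T}. \<bar>X (min t (\<sigma> \<omega>)) \<omega>\<bar> \<le> c"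
    and A: "finite A" "A \<subseteq> {0..T}" "b \<in> A"
    and h: "h \<in> borel_measurable P" "\<And>\<omega>. \<omega> \<in> space P \<Longrightarrow> \<bar>h \<omega>\<bar> \<le> 1"
    and Ym: "(\<lambda>\<omega>. X (min b (\<sigma> \<omega>)) \<omega>) \<in> borel_measurable P"
  shows "(\<lambda>n. \<integral>\<omega>. h \<omega> * X (min b (ceil_in (dyadic n \<union> A) (\<sigma> \<omega>))) \<omega> \<partial>P) \<longlonglongrightarrow> (\<integral>\<omega>. h \<omega> * X (min b (\<sigma> \<omega>)) \<omega> \<partial>P)"
proof -
  have b: "b \<in> {0..T}" using A by auto
  define Xn where "Xn n \<omega> = X (min b (ceil_in (dyadic n \<union> A) (\<sigma> \<omega>))) \<omega>" for n \<omega>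
  define Y where "Y \<omega> = X (min b (\<sigma> \<omega>)) \<omega>" for \<omega>
  have bA: "b \<in> dyadic n \<union> A" for n using A(3) by blast
  note ex = mart_excess_stopped[OF X dyadic_grid[OF A(1,2)] \<sigma> bA]
  have iX: "integrable P (Xn n)" for n unfolding Xn_def[abs_def] by (rule ex(1)[OF order_refl])
  have Ym: "Y \<in> borel_measurable P" using Ym by (simp add: Y_def[abs_def])
  have Yc: "AE \<omega> in P. \<bar>Y \<omega>\<bar> \<le> c" using bnd by eventually_elim (use b in \<open>auto simp: Y_def\<close>)
  have iY: "integrable P Y" using Yc Ym by (intro integrable_const_bound[where B=c]) auto
  have lim: "AE \<omega> in P. (\<lambda>n. Xn n \<omega>) \<longlonglongrightarrow> Y \<omega>"
    using cad AE_space
  proof eventually_elim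
    case (elim \<omega>)
    show ?case unfolding Xn_def Y_def
      by (rule stopped_limit[OF elim(1) A(1,2) b]) (use stop_time_bounds[OF \<sigma> elim(2)] in auto)
  qed
  \<comment> \<open>Each value is its clipped part, treated by bounded convergence, plus an excess
    over \<open>m\<close>, treated by \<open>mart_excess_stopped\<close>.\<close>
  define clip where "clip m x = max (- real m) (min (real m) x)" for m :: nat and x :: real
  have clipm: "(\<lambda>\<omega>. clip m (Z \<omega>)) \<in> borel_measurable P" if "Z \<in> borel_measurable P" for m and Z :: "'a \<Rightarrow> real"
    unfolding clip_def using that by measurable
  have cl: "(\<lambda>n. \<integral>\<omega>. \<bar>clip m (Xn n \<omega>) - clip m (Y \<omega>)\<bar> \<partial>P) \<longlonglongrightarrow> 0" for m
  proof -
    have "(\<lambda>n. \<integral>\<omega>. \<bar>clip m (Xn n \<omega>) - clip m (Y \<omega>)\<bar> \<partial>P) \<longlonglongrightarrow> (\<integral>\<omega>. 0 \<partial>P)"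
    proof (rule integral_dominated_convergence[where w="\<lambda>_. 2 * real m"])
      show "(\<lambda>\<omega>. \<bar>clip m (Xn n \<omega>) - clip m (Y \<omega>)\<bar>) \<in> borel_measurable P" for n
        using clipm[OF borel_measurable_integrable[OF iX[of n]], of m] clipm[OF Ym, of m] by measurable
      show "AE \<omega> in P. (\<lambda>n. \<bar>clip m (Xn n \<omega>) - clip m (Y \<omega>)\<bar>) \<longlonglongrightarrow> 0"
        using lim
      proof eventually_elim
        case (elim \<omega>)
        have "(\<lambda>n. \<bar>clip m (Xn n \<omega>) - clip m (Y \<omega>)\<bar>) \<longlonglongrightarrow> \<bar>clip m (Y \<omega>) - clip m (Y \<omega>)\<bar>"
          unfolding clip_def by (intro tendsto_rabs tendsto_diff tendsto_max tendsto_min tendsto_const elim)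
        then show ?case by simp
      qed
      show "AE \<omega> in P. norm \<bar>clip m (Xn n \<omega>) - clip m (Y \<omega>)\<bar> \<le> 2 * real m" for n
        by (intro AE_I2) (auto simp: clip_def)
    qed simp_all
    then show ?thesis by simp
  qed
  have "(\<lambda>n. \<integral>\<omega>. h \<omega> * Xn n \<omega> \<partial>P) \<longlonglongrightarrow> (\<integral>\<omega>. h \<omega> * Y \<omega> \<partial>P)"
  proof (rule LIMSEQ_I)
    fix r :: real assume r: "0 < r"
    have "0 < r / 2" using r by simp
    from order_tendstoD(2)[OF excess_tendsto_0[OF mart_integrable[OF X b]] this]
    obtain m0 where m0: "\<And>m. m \<ge> m0 \<Longrightarrow> (\<integral>\<omega>. max 0 (\<bar>X b \<omega>\<bar> - real m) \<partial>P) < r / 2"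
      unfolding eventually_sequentially by blast
    obtain m1 where m1: "c \<le> real m1" using real_arch_simple by blast
    \<comment> \<open>Besides making the excess small, \<open>m\<close> is at least the bound
      \<open>c\<close> of the stopped process, so that clipping leaves \<open>Y\<close> unchanged
      almost surely.\<close>
    define m where "m = max m0 m1"
    have m: "(\<integral>\<omega>. max 0 (\<bar>X b \<omega>\<bar> - real m) \<partial>P) < r / 2" "c \<le> real m"
      using m0[of m] m1 by (auto simp: m_def)
    from order_tendstoD(2)[OF cl[of m] \<open>0 < r / 2\<close>]
    obtain N where N: "\<And>n. n \<ge> N \<Longrightarrow> (\<integral>\<omega>. \<bar>clip m (Xn n \<omega>) - clip m (Y \<omega>)\<bar> \<partial>P) < r / 2"
      unfolding eventually_sequentially by blast
    have "norm ((\<integral>\<omega>. h \<omega> * Xn n \<omega> \<partial>P) - (\<integral>\<omega>. h \<omega> * Y \<omega> \<partial>P)) < r" if n: "n \<ge> N" for n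
    proof -
      have ihX: "integrable P (\<lambda>\<omega>. h \<omega> * Xn n \<omega>)" and ihY: "integrable P (\<lambda>\<omega>. h \<omega> * Y \<omega>)"
        using integrable_bounded_mult[OF h(1,2) iX] integrable_bounded_mult[OF h(1,2) iY] by blast+
      have i1: "integrable P (\<lambda>\<omega>. max 0 (\<bar>Xn n \<omega>\<bar> - real m))" using iX[of n] by simp
      have i2: "integrable P (\<lambda>\<omega>. \<bar>clip m (Xn n \<omega>) - clip m (Y \<omega>)\<bar>)"
        using clipm[OF borel_measurable_integrable[OF iX[of n]], of m] clipm[OF Ym, of m]
        by (intro integrable_const_bound[where B="2 * real m"]) (auto simp: clip_def intro!: AE_I2)
      have "norm ((\<integral>\<omega>. h \<omega> * Xn n \<omega> \<partial>P) - (\<integral>\<omega>. h \<omega> * Y \<omega> \<partial>P)) = \<bar>\<integral>\<omega>. h \<omega> * Xn n \<omega> - h \<omega> * Y \<omega> \<partial>P\<bar>"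
        using ihX ihY by simp
      also have "\<dots> \<le> (\<integral>\<omega>. \<bar>h \<omega> * Xn n \<omega> - h \<omega> * Y \<omega>\<bar> \<partial>P)" by (rule integral_abs_bound)
      also have "\<dots> \<le> (\<integral>\<omega>. max 0 (\<bar>Xn n \<omega>\<bar> - real m) + \<bar>clip m (Xn n \<omega>) - clip m (Y \<omega>)\<bar> \<partial>P)"
      proof (rule integral_mono_AE)
        show "AE \<omega> in P. \<bar>h \<omega> * Xn n \<omega> - h \<omega> * Y \<omega>\<bar> \<le> max 0 (\<bar>Xn n \<omega>\<bar> - real m) + \<bar>clip m (Xn n \<omega>) - clip m (Y \<omega>)\<bar>"
          using Yc AE_space
        proof eventually_elim
          case (elim \<omega>)
          have "\<bar>h \<omega> * Xn n \<omega> - h \<omega> * Y \<omega>\<bar> = \<bar>h \<omega>\<bar> * \<bar>Xn n \<omega> - Y \<omega>\<bar>"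
            by (simp add: abs_mult[symmetric] right_diff_distrib)
          also have "\<dots> \<le> 1 * \<bar>Xn n \<omega> - Y \<omega>\<bar>" by (rule mult_right_mono[OF h(2)[OF elim(2)]]) simp
          also have "\<dots> \<le> max 0 (\<bar>Xn n \<omega>\<bar> - real m) + \<bar>clip m (Xn n \<omega>) - clip m (Y \<omega>)\<bar>"
            using elim(1) m(2) by (auto simp: clip_def)
          finally show ?case .
        qed
      qed (use ihX ihY i1 i2 in auto)
      also have "\<dots> = (\<integral>\<omega>. max 0 (\<bar>Xn n \<omega>\<bar> - real m) \<partial>P) + (\<integral>\<omega>. \<bar>clip m (Xn n \<omega>) - clip m (Y \<omega>)\<bar> \<partial>P)"
        using i1 i2 by simp
      also have "\<dots> < r / 2 + r / 2"
      proof (rule add_strict_mono)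
        have "(\<integral>\<omega>. max 0 (\<bar>Xn n \<omega>\<bar> - real m) \<partial>P) \<le> (\<integral>\<omega>. max 0 (\<bar>X b \<omega>\<bar> - real m) \<partial>P)"
          unfolding Xn_def by (rule ex(2)) simp
        then show "(\<integral>\<omega>. max 0 (\<bar>Xn n \<omega>\<bar> - real m) \<partial>P) < r / 2" using m(1) by linarith
      qed (rule N[OF n])
      finally show ?thesis by simp
    qed
    then show "\<exists>N. \<forall>n\<ge>N. norm ((\<integral>\<omega>. h \<omega> * Xn n \<omega> \<partial>P) - (\<integral>\<omega>. h \<omega> * Y \<omega> \<partial>P)) < r" by blast
  qed
  then show ?thesis by (simp add: Xn_def Y_def)
qed

text \<open>A limit of discretized values, each of them \<open>F b\<close>-measurable because of the
  minimum with \<open>b\<close>. The limit holds off a null set, which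
  \<open>measurable_F_AE\<close> absorbs.\<close>

lemma stopped_measurable:
  assumes X: "mart X" and cad: "AE \<omega> in P. cadlag_on T (\<lambda>t. X t \<omega>)" and \<sigma>: "stop_time \<sigma>" and b: "b \<in> {0..T}"
  shows "(\<lambda>\<omega>. X (min b (\<sigma> \<omega>)) \<omega>) \<in> borel_measurable (F b)"
proof (rule measurable_F_AE[OF _ b])
  have A: "finite {b}" "{b} \<subseteq> {0..T}" using b by auto
  have bA: "b \<in> dyadic n \<union> {b}" for n by blast
  show "(\<lambda>\<omega>. lim (\<lambda>n. X (min b (ceil_in (dyadic n \<union> {b}) (\<sigma> \<omega>))) \<omega>)) \<in> borel_measurable (F b)"
    by (rule borel_measurable_lim_metric, rule mart_excess_stopped(3)[OF X dyadic_grid[OF A] \<sigma> bA order_refl])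
  show "AE \<omega> in P. lim (\<lambda>n. X (min b (ceil_in (dyadic n \<union> {b}) (\<sigma> \<omega>))) \<omega>) = X (min b (\<sigma> \<omega>)) \<omega>"
    using cad AE_space
  proof eventually_elim
    case (elim \<omega>)
    show ?case
      by (rule limI[OF stopped_limit[OF elim(1) A b]]) (use stop_time_bounds[OF \<sigma> elim(2)] in auto)
  qed
qed

text \<open>For the rounded time the two sides differ by a sum of terms, each a factor known at
  \<open>e\<close> times the increment of \<open>X\<close> over the cell at \<open>e\<close>, and
  each of mean zero. \<open>stopped_expectation_limit\<close> then lets the mesh tend to
  zero.\<close>

lemma optional_stopping:
  assumes X: "mart X" and cad: "AE \<omega> in P. cadlag_on T (\<lambda>t. X t \<omega>)" and \<sigma>: "stop_time \<sigma>"
    and bnd: "AE \<omega> in P. \<forall>t\<in>{0..T}. \<bar>X (min t (\<sigma> \<omega>)) \<omega>\<bar> \<le> c"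
  shows "mart (\<lambda>t \<omega>. X (min t (\<sigma> \<omega>)) \<omega>)"
  unfolding mart_def
proof (intro conjI ballI allI impI)
  show m: "(\<lambda>\<omega>. X (min t (\<sigma> \<omega>)) \<omega>) \<in> borel_measurable (F t)" if "t \<in> {0..T}" for t
    by (rule stopped_measurable[OF X cad \<sigma> that])
  show "integrable P (\<lambda>\<omega>. X (min t (\<sigma> \<omega>)) \<omega>)" if "t \<in> {0..T}" for t
  proof (rule integrable_const_bound[where B=c])
    show "AE \<omega> in P. norm (X (min t (\<sigma> \<omega>)) \<omega>) \<le> c" using bnd by eventually_elim (use that in auto)
    show "(\<lambda>\<omega>. X (min t (\<sigma> \<omega>)) \<omega>) \<in> borel_measurable P" by (rule measurable_F_P[OF m[OF that] that])
  qed
  fix a b d :: real and h :: "'a \<Rightarrow> real"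
  assume ab: "0 \<le> a" "a \<le> b" "b \<le> T" and h: "h \<in> borel_measurable (F a)" "\<forall>\<omega>\<in>space P. \<bar>h \<omega>\<bar> \<le> d"
  \<comment> \<open>Normalized to the bound one that \<open>stopped_expectation_limit\<close> asks
    for; the added one avoids division by zero.\<close>
  define h' where "h' \<omega> = h \<omega> / (\<bar>d\<bar> + 1)" for \<omega>
  have h'm: "h' \<in> borel_measurable (F a)" unfolding h'_def[abs_def] using h(1) by measurable
  have h'1: "\<bar>h' \<omega>\<bar> \<le> 1" if "\<omega> \<in> space P" for \<omega>
  proof -
    have "\<bar>h \<omega>\<bar> \<le> \<bar>d\<bar> + 1" using h(2)[rule_format, OF that] by linarith
    then show ?thesis by (simp add: h'_def abs_divide divide_le_eq_1_pos)
  qed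
  have a: "a \<in> {0..T}" and b: "b \<in> {0..T}" using ab by auto
  have h'P: "h' \<in> borel_measurable P" by (rule measurable_F_P[OF h'm a])
  let ?A = "{a, b}" let ?E = "\<lambda>n. dyadic n \<union> ?A"
  have A: "finite ?A" "?A \<subseteq> {0..T}" "a \<in> ?A" "b \<in> ?A" using ab by auto
  note gE = dyadic_grid[OF A(1,2)]
  have eq: "(\<integral>\<omega>. h' \<omega> * X (min b (ceil_in (?E n) (\<sigma> \<omega>))) \<omega> \<partial>P) = (\<integral>\<omega>. h' \<omega> * X (min a (ceil_in (?E n) (\<sigma> \<omega>))) \<omega> \<partial>P)" for n
  proof -
    let ?k = "\<lambda>e \<omega>. h' \<omega> * indicat_real {\<omega>\<in>space P. e < \<sigma> \<omega>} \<omega>"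
    have cell: "e \<in> ?E n - {T}" "a \<le> e" "e \<in> {0..T}" "nxt (?E n) e \<in> {0..T}" "e < nxt (?E n) e" if "e \<in> ?E n \<inter> {a..<b}" for e
    proof -
      show e: "e \<in> ?E n - {T}" using that ab by auto
      show "a \<le> e" using that by auto
      show "e \<in> {0..T}" using nxt(4,6)[OF gE e] by auto
      show "e < nxt (?E n) e" by (rule nxt(2)[OF gE e])
      then show "nxt (?E n) e \<in> {0..T}" using nxt(3,4)[OF gE e] by auto
    qed
    have km: "?k e \<in> borel_measurable (F e)" if e: "e \<in> ?E n \<inter> {a..<b}" for e
      using measurable_F_mono[OF h'm ab(1) cell(2)[OF e]] cell(3)[OF e] stop_time_less[OF \<sigma> cell(3)[OF e]]
      by (intro borel_measurable_times) auto
    have k1: "\<bar>?k e \<omega>\<bar> \<le> 1" if "\<omega> \<in> space P" for e \<omega> using h'1[OF that] by (auto simp: indicator_def)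
    have ik: "integrable P (\<lambda>\<omega>. ?k e \<omega> * X s \<omega>)" if "e \<in> ?E n \<inter> {a..<b}" "s \<in> {0..T}" for e s
      by (rule integrable_bounded_mult[OF measurable_F_P[OF km[OF that(1)] cell(3)[OF that(1)]] k1 mart_integrable[OF X that(2)]])
    have "(\<integral>\<omega>. h' \<omega> * X (min b (ceil_in (?E n) (\<sigma> \<omega>))) \<omega> \<partial>P) - (\<integral>\<omega>. h' \<omega> * X (min a (ceil_in (?E n) (\<sigma> \<omega>))) \<omega> \<partial>P) =
       (\<integral>\<omega>. h' \<omega> * X (min b (ceil_in (?E n) (\<sigma> \<omega>))) \<omega> - h' \<omega> * X (min a (ceil_in (?E n) (\<sigma> \<omega>))) \<omega> \<partial>P)"
      using integrable_bounded_mult[OF h'P h'1 mart_excess_stopped(1)[OF X gE \<sigma> _ order_refl]]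
      by (intro Bochner_Integration.integral_diff[symmetric]) auto
    also have "\<dots> = (\<integral>\<omega>. (\<Sum>e\<in>?E n \<inter> {a..<b}. ?k e \<omega> * X (nxt (?E n) e) \<omega> - ?k e \<omega> * X e \<omega>) \<partial>P)"
    proof (intro Bochner_Integration.integral_cong refl)
      fix \<omega> assume \<omega>: "\<omega> \<in> space P"
      have "h' \<omega> * X (min b (ceil_in (?E n) (\<sigma> \<omega>))) \<omega> - h' \<omega> * X (min a (ceil_in (?E n) (\<sigma> \<omega>))) \<omega> =
        h' \<omega> * (\<Sum>e\<in>?E n \<inter> {a..<b}. (if e < \<sigma> \<omega> then 1 else 0) * (X (nxt (?E n) e) \<omega> - X e \<omega>))"
        using grid_stopped_telescope[OF gE _ _ ab(2) stop_time_bounds(2)[OF \<sigma> \<omega>], of n "\<lambda>t. X t \<omega>"]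
        by (simp add: right_diff_distrib)
      also have "\<dots> = (\<Sum>e\<in>?E n \<inter> {a..<b}. ?k e \<omega> * X (nxt (?E n) e) \<omega> - ?k e \<omega> * X e \<omega>)"
        unfolding sum_distrib_left using \<omega> by (intro sum.cong refl) (simp add: algebra_simps)
      finally show "h' \<omega> * X (min b (ceil_in (?E n) (\<sigma> \<omega>))) \<omega> - h' \<omega> * X (min a (ceil_in (?E n) (\<sigma> \<omega>))) \<omega> =
        (\<Sum>e\<in>?E n \<inter> {a..<b}. ?k e \<omega> * X (nxt (?E n) e) \<omega> - ?k e \<omega> * X e \<omega>)" .
    qed
    also have "\<dots> = (\<Sum>e\<in>?E n \<inter> {a..<b}. \<integral>\<omega>. ?k e \<omega> * X (nxt (?E n) e) \<omega> - ?k e \<omega> * X e \<omega> \<partial>P)"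
      by (intro Bochner_Integration.integral_sum Bochner_Integration.integrable_diff ik cell)
    also have "\<dots> = 0"
    proof (rule sum.neutral, rule ballI)
      fix e assume e: "e \<in> ?E n \<inter> {a..<b}"
      have "(\<integral>\<omega>. ?k e \<omega> * X (nxt (?E n) e) \<omega> \<partial>P) = (\<integral>\<omega>. ?k e \<omega> * X e \<omega> \<partial>P)"
        using cell[OF e] by (intro mart_eq[OF X _ _ _ km[OF e] k1]) auto
      then show "(\<integral>\<omega>. ?k e \<omega> * X (nxt (?E n) e) \<omega> - ?k e \<omega> * X e \<omega> \<partial>P) = 0"
        using ik[OF e] cell[OF e] by simp
    qed
    finally show ?thesis by simp
  qed
  have la: "(\<lambda>n. \<integral>\<omega>. h' \<omega> * X (min a (ceil_in (?E n) (\<sigma> \<omega>))) \<omega> \<partial>P) \<longlonglongrightarrow> (\<integral>\<omega>. h' \<omega> * X (min a (\<sigma> \<omega>)) \<omega> \<partial>P)"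
    by (rule stopped_expectation_limit[OF X cad \<sigma> bnd A(1,2,3) h'P h'1 measurable_F_P[OF m[OF a] a]])
  have lb: "(\<lambda>n. \<integral>\<omega>. h' \<omega> * X (min b (ceil_in (?E n) (\<sigma> \<omega>))) \<omega> \<partial>P) \<longlonglongrightarrow> (\<integral>\<omega>. h' \<omega> * X (min b (\<sigma> \<omega>)) \<omega> \<partial>P)"
    by (rule stopped_expectation_limit[OF X cad \<sigma> bnd A(1,2,4) h'P h'1 measurable_F_P[OF m[OF b] b]])
  have "(\<integral>\<omega>. h' \<omega> * X (min b (\<sigma> \<omega>)) \<omega> \<partial>P) = (\<integral>\<omega>. h' \<omega> * X (min a (\<sigma> \<omega>)) \<omega> \<partial>P)"
    using LIMSEQ_unique[OF lb[unfolded eq] la] .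
  then have h'eq: "(\<integral>\<omega>. h' \<omega> * X (min b (\<sigma> \<omega>)) \<omega> \<partial>P) = (\<integral>\<omega>. h' \<omega> * X (min a (\<sigma> \<omega>)) \<omega> \<partial>P)" .
  show "(\<integral>\<omega>. h \<omega> * X (min b (\<sigma> \<omega>)) \<omega> \<partial>P) = (\<integral>\<omega>. h \<omega> * X (min a (\<sigma> \<omega>)) \<omega> \<partial>P)"
  proof -
    have "\<bar>d\<bar> + 1 \<noteq> 0" by linarith
    then show ?thesis using h'eq by (simp add: h'_def)
  qed
qed

section \<open>Doleans measures\<close>

definition ind_of :: "(real \<times> 'a) set \<Rightarrow> ('a, real) process" where
  "ind_of A = (\<lambda>t \<omega>. indicat_real A (t, \<omega>))"

text \<open>Finite unions of predictable rectangles, described through their indicators so that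
  operations on sets become operations on elementary integrands. They form a ring that generates the
  predictable sets.\<close>

definition rects :: "(real \<times> 'a) set set" where
  "rects = {A. A \<subseteq> {0..T} \<times> space P \<and> elem (ind_of A)}"

text \<open>The base of \<open>A\<close> over the cell that starts at \<open>a\<close>, read off at
  the right end point; \<open>cell_iff\<close> justifies this for every time in the cell.\<close>

definition cell :: "real set \<Rightarrow> (real \<times> 'a) set \<Rightarrow> real \<Rightarrow> 'a set" where
  "cell E A a = {\<omega>\<in>space P. (nxt E a, \<omega>) \<in> A}"

lemma eint_rectangle:
  fixes X :: "('a, real) process"
  assumes "0 \<le> s" "s < r" "r \<le> T" "A \<in> sets (F s)" and t: "t \<in> {0..T}" "\<omega> \<in> space P"
  shows "eint (\<lambda>t \<omega>. indicat_real {s<..r} t * indicat_real A \<omega>) X t \<omega> =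
     indicat_real A \<omega> * (X (min r t) \<omega> - X (min s t) \<omega>)"
proof -
  have "elementary_integral P F T X (\<lambda>t \<omega>. indicat_real {s<..r} t * indicat_real A \<omega>)
      (\<lambda>t \<omega>. indicat_real A \<omega> * (X (min r t) \<omega> - X (min s t) \<omega>))"
    unfolding elementary_integral_def
  proof (rule exI[of _ "\<lambda>_. 0"], rule exI[of _ 1], rule exI[of _ "\<lambda>_. s"], rule exI[of _ "\<lambda>_. r"],
      rule exI[of _ "\<lambda>_. indicat_real A"], rule exI[of _ 1], intro conjI)
    show "\<forall>i<1. 0 \<le> s \<and> s < r \<and> r \<le> T \<and> indicat_real A \<in> borel_measurable (F s) \<and>
        (\<forall>\<omega>\<in>space P. norm (indicat_real A \<omega>) \<le> 1)"
      using assms by (simp add: indicator_def)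
  qed (simp_all add: lessThan_Suc)
  from elementary_integralD(2)[OF this t] show ?thesis by simp
qed

lemma ind_of_rectangle: "ind_of ({s<..r} \<times> A) = (\<lambda>t \<omega>. indicat_real {s<..r} t * indicat_real A \<omega>)"
  by (simp add: ind_of_def indicator_times)

lemma rects_rectangle:
  assumes "0 \<le> s" "s < r" "r \<le> T" "A \<in> sets (F s)" shows "{s<..r} \<times> A \<in> rects"
proof -
  have "A \<subseteq> space P" using sets.sets_into_space[OF assms(4)] space_F[of s] assms by auto
  then show ?thesis
    using elem_rectangle[OF assms] assms by (auto simp: rects_def ind_of_rectangle)
qed

lemma rects_initial:
  assumes "A \<in> sets (F 0)" shows "{0} \<times> A \<in> rects"
proof -
  have "A \<subseteq> space P" using sets.sets_into_space[OF assms] space_F[of 0] T_pos by auto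
  moreover have "ind_of ({0} \<times> A) = (\<lambda>t \<omega>. indicat_real {0} t * indicat_real A \<omega>)"
    by (simp add: ind_of_def indicator_times)
  ultimately show ?thesis using elem_initial[OF assms] T_pos unfolding rects_def by auto
qed

lemma rects_Int: "A \<in> rects \<Longrightarrow> B \<in> rects \<Longrightarrow> A \<inter> B \<in> rects"
proof -
  assume A: "A \<in> rects" and B: "B \<in> rects"
  have "ind_of (A \<inter> B) = (\<lambda>t \<omega>. ind_of A t \<omega> *\<^sub>R ind_of B t \<omega>)" by (intro ext) (simp add: ind_of_def indicator_def)
  then show ?thesis using A B elem_scaleR[of "ind_of A" "ind_of B"] unfolding rects_def by auto
qed

lemma rects_Diff: "A \<in> rects \<Longrightarrow> B \<in> rects \<Longrightarrow> A - B \<in> rects"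
proof -
  assume A: "A \<in> rects" and B: "B \<in> rects"
  have "ind_of (A - B) = (\<lambda>t \<omega>. ind_of A t \<omega> - ind_of (A \<inter> B) t \<omega>)" by (intro ext) (simp add: ind_of_def indicator_def)
  then show ?thesis using A rects_Int[OF A B] elem_diff[of "ind_of A" "ind_of (A \<inter> B)"] unfolding rects_def by auto
qed

lemma rects_Un: "A \<in> rects \<Longrightarrow> B \<in> rects \<Longrightarrow> A \<union> B \<in> rects"
proof -
  assume A: "A \<in> rects" and B: "B \<in> rects"
  have "ind_of (A \<union> B) = (\<lambda>t \<omega>. ind_of A t \<omega> + ind_of (B - A) t \<omega>)" by (intro ext) (auto simp: ind_of_def indicator_def)
  then show ?thesis using A B rects_Diff[OF B A] elem_add[of "ind_of A" "ind_of (B - A)"] unfolding rects_def by auto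
qed

lemma rects_empty: "{} \<in> rects"
  using elem_const[of "0::real"] by (simp add: rects_def ind_of_def)

lemma ring_rects: "ring_of_sets ({0..T} \<times> space P) rects"
  by (intro ring_of_setsI rects_empty rects_Un rects_Diff) (auto simp: rects_def)

lemma ind_of_vimage: "A \<subseteq> space PA \<Longrightarrow> (\<lambda>p. ind_of A (fst p) (snd p)) -` {1} \<inter> space PA = A"
  by (auto simp: ind_of_def indicator_def split: if_splits)

lemma sigma_rects: "sigma_sets ({0..T} \<times> space P) rects = sets PA"
proof
  have "rects \<subseteq> sets PA"
  proof
    fix A assume "A \<in> rects"
    then have A: "A \<subseteq> space PA" "elem (ind_of A)" by (auto simp: rects_def space_PA)
    have "(\<lambda>p. ind_of A (fst p) (snd p)) -` {1} \<inter> space PA \<in> sets PA"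
      by (rule measurable_sets[OF elem_predictable[OF A(2)]]) simp
    then show "A \<in> sets PA" unfolding ind_of_vimage[OF A(1)] .
  qed
  then show "sigma_sets ({0..T} \<times> space P) rects \<subseteq> sets PA"
    using sets.sigma_sets_subset[of rects PA] by (simp add: space_PA)
  have "pred_gen \<subseteq> rects" unfolding pred_gen_def using rects_rectangle rects_initial by blast
  then show "sets PA \<subseteq> sigma_sets ({0..T} \<times> space P) rects"
    unfolding sets_PA by (rule sigma_sets_mono')
qed

lemma cell_sets:
  assumes E: "simple E (ind_of A)" and a: "a \<in> E - {T}" shows "cell E A a \<in> sets (F a)"
proof -
  have sp: "space (F a) = space P" using nxt[OF simple_grid[OF E] a] by (intro space_F) auto
  have "ind_of A (nxt E a) -` {1} \<inter> space (F a) \<in> sets (F a)"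
    by (rule measurable_sets[OF simple_measurable[OF E a]]) simp
  moreover have "ind_of A (nxt E a) -` {1} \<inter> space (F a) = cell E A a"
    unfolding sp by (auto simp: ind_of_def indicator_def cell_def split: if_splits)
  ultimately show ?thesis by simp
qed

lemma cell_subset: "cell E A a \<subseteq> space P" by (auto simp: cell_def)

lemma cell_iff:
  assumes E: "simple E (ind_of A)" and a: "a \<in> E - {T}" "a < t" "t \<le> nxt E a" and \<omega>: "\<omega> \<in> space P"
  shows "(t, \<omega>) \<in> A \<longleftrightarrow> \<omega> \<in> cell E A a"
proof -
  have "indicat_real A (t, \<omega>) = indicat_real A (nxt E a, \<omega>)"
    using simple_cell[OF E a \<omega>] by (simp add: ind_of_def)
  then show ?thesis using \<omega> by (auto simp: cell_def indicator_def split: if_splits)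
qed

lemma rects_simple: "A \<in> rects \<Longrightarrow> \<exists>E. simple E (ind_of A)"
  by (simp add: rects_def elem_def)

end

text \<open>\<open>W\<close> stands for a bounded cadlag submartingale, with the submartingale
  property tested on events. It is later the squared norm of a bounded martingale.\<close>

locale increments = filtered_space P F T
  for P :: "'a measure" and F :: "real \<Rightarrow> 'a measure" and T :: real +
  fixes W :: "real \<Rightarrow> 'a \<Rightarrow> real" and c :: real
  assumes W_measurable: "t \<in> {0..T} \<Longrightarrow> W t \<in> borel_measurable (F t)"
    and W_bounded: "t \<in> {0..T} \<Longrightarrow> \<omega> \<in> space P \<Longrightarrow> \<bar>W t \<omega>\<bar> \<le> c"
    and W_cadlag: "AE \<omega> in P. cadlag_on T (\<lambda>t. W t \<omega>)"
    and W_increasing: "0 \<le> a \<Longrightarrow> a \<le> b \<Longrightarrow> b \<le> T \<Longrightarrow> B \<in> sets (F a) \<Longrightarrow>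
      0 \<le> (\<integral>\<omega>. indicat_real B \<omega> * (W b \<omega> - W a \<omega>) \<partial>P)"
begin

lemma W_integrable:
  assumes "a \<in> {0..T}" "b \<in> {0..T}" "B \<in> sets P"
  shows "integrable P (\<lambda>\<omega>. indicat_real B \<omega> * (W b \<omega> - W a \<omega>))"
proof (rule integrable_const_bound[where B="2 * c"])
  show "(\<lambda>\<omega>. indicat_real B \<omega> * (W b \<omega> - W a \<omega>)) \<in> borel_measurable P"
    using measurable_F_P[OF W_measurable] assms by measurable
  show "AE \<omega> in P. norm (indicat_real B \<omega> * (W b \<omega> - W a \<omega>)) \<le> 2 * c"
  proof (rule AE_I2)
    fix \<omega> assume "\<omega> \<in> space P"
    from W_bounded[OF assms(1) this] W_bounded[OF assms(2) this]
    show "norm (indicat_real B \<omega> * (W b \<omega> - W a \<omega>)) \<le> 2 * c" by (auto simp: indicator_def)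
  qed
qed

lemma eint_W:
  assumes E: "simple E (ind_of A)" and \<omega>: "\<omega> \<in> space P"
  shows "eint (ind_of A) W T \<omega> = (\<Sum>a\<in>E - {T}. indicat_real (cell E A a) \<omega> * (W (nxt E a) \<omega> - W a \<omega>))"
  unfolding eint_eq[OF E \<omega>] grid_integral_def
proof (intro sum.cong refl)
  fix a assume a: "a \<in> E - {T}"
  have "min (nxt E a) T = nxt E a" "min a T = a" using nxt[OF simple_grid[OF E] a] by auto
  moreover have "ind_of A (nxt E a) \<omega> = indicat_real (cell E A a) \<omega>"
    using \<omega> by (simp add: ind_of_def cell_def indicator_def)
  ultimately show "ind_of A (nxt E a) \<omega> \<bullet> (W (min (nxt E a) T) \<omega> - W (min a T) \<omega>) =
    indicat_real (cell E A a) \<omega> * (W (nxt E a) \<omega> - W a \<omega>)" by simp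
qed

lemma cell_integrable:
  assumes E: "simple E (ind_of A)" and a: "a \<in> E - {T}"
  shows "integrable P (\<lambda>\<omega>. indicat_real (cell E A a) \<omega> * (W (nxt E a) \<omega> - W a \<omega>))"
proof -
  note n = nxt[OF simple_grid[OF E] a]
  have a': "a \<in> {0..T}" "nxt E a \<in> {0..T}" using n by auto
  show ?thesis using cell_sets[OF E a] sets_F[OF a'(1)] by (intro W_integrable a') auto
qed

text \<open>The expected increment of \<open>W\<close> over \<open>A\<close>, the content that is to
  be extended to the predictable sets. Time zero contributes nothing to it.\<close>

definition vol :: "(real \<times> 'a) set \<Rightarrow> real" where "vol A = (\<integral>\<omega>. eint (ind_of A) W T \<omega> \<partial>P)"

lemma eint_W_integrable: "A \<in> rects \<Longrightarrow> integrable P (eint (ind_of A) W T)"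
proof -
  assume "A \<in> rects"
  then obtain E where E: "simple E (ind_of A)" using rects_simple by blast
  have "integrable P (\<lambda>\<omega>. \<Sum>a\<in>E - {T}. indicat_real (cell E A a) \<omega> * (W (nxt E a) \<omega> - W a \<omega>))"
    by (intro Bochner_Integration.integrable_sum cell_integrable[OF E])
  then show ?thesis by (subst Bochner_Integration.integrable_cong[OF refl eint_W[OF E]])
qed

lemma vol_eq:
  assumes E: "simple E (ind_of A)"
  shows "vol A = (\<Sum>a\<in>E - {T}. \<integral>\<omega>. indicat_real (cell E A a) \<omega> * (W (nxt E a) \<omega> - W a \<omega>) \<partial>P)"
proof -
  have "vol A = (\<integral>\<omega>. (\<Sum>a\<in>E - {T}. indicat_real (cell E A a) \<omega> * (W (nxt E a) \<omega> - W a \<omega>)) \<partial>P)"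
    unfolding vol_def by (intro Bochner_Integration.integral_cong refl eint_W[OF E])
  also have "\<dots> = (\<Sum>a\<in>E - {T}. \<integral>\<omega>. indicat_real (cell E A a) \<omega> * (W (nxt E a) \<omega> - W a \<omega>) \<partial>P)"
    by (intro Bochner_Integration.integral_sum cell_integrable[OF E])
  finally show ?thesis .
qed

lemma vol_nonneg: "A \<in> rects \<Longrightarrow> 0 \<le> vol A"
proof -
  assume "A \<in> rects"
  then obtain E where E: "simple E (ind_of A)" using rects_simple by blast
  show ?thesis
    unfolding vol_eq[OF E]
  proof (rule sum_nonneg)
    fix a assume a: "a \<in> E - {T}"
    note n = nxt[OF simple_grid[OF E] a]
    show "0 \<le> (\<integral>\<omega>. indicat_real (cell E A a) \<omega> * (W (nxt E a) \<omega> - W a \<omega>) \<partial>P)"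
      by (rule W_increasing[OF _ _ _ cell_sets[OF E a]]) (use n in auto)
  qed
qed

lemma vol_Un: "A \<in> rects \<Longrightarrow> B \<in> rects \<Longrightarrow> A \<inter> B = {} \<Longrightarrow> vol (A \<union> B) = vol A + vol B"
proof -
  assume A: "A \<in> rects" and B: "B \<in> rects" and AB: "A \<inter> B = {}"
  have "ind_of (A \<union> B) = (\<lambda>t \<omega>. ind_of A t \<omega> + ind_of B t \<omega>)"
    using AB by (intro ext) (auto simp: ind_of_def indicator_def)
  then have "vol (A \<union> B) = (\<integral>\<omega>. eint (ind_of A) W T \<omega> + eint (ind_of B) W T \<omega> \<partial>P)"
    unfolding vol_def using A B by (intro Bochner_Integration.integral_cong refl) (auto simp: rects_def eint_add)
  then show ?thesis unfolding vol_def using eint_W_integrable[OF A] eint_W_integrable[OF B] by simp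
qed

lemma vol_rectangle:
  assumes "0 \<le> a" "a < b" "b \<le> T" "B \<in> sets (F a)"
  shows "vol ({a<..b} \<times> B) = (\<integral>\<omega>. indicat_real B \<omega> * (W b \<omega> - W a \<omega>) \<partial>P)"
  unfolding vol_def ind_of_rectangle
proof (intro Bochner_Integration.integral_cong refl)
  fix \<omega> assume \<omega>: "\<omega> \<in> space P"
  have T: "T \<in> {0..T}" and m: "min b T = b" "min a T = a" using T_pos assms by auto
  show "eint (\<lambda>t \<omega>. indicat_real {a<..b} t * indicat_real B \<omega>) W T \<omega> = indicat_real B \<omega> * (W b \<omega> - W a \<omega>)"
    using eint_rectangle[OF assms T \<omega>, of W] unfolding m .
qed

lemma vol_initial: "B \<in> sets (F 0) \<Longrightarrow> vol ({0} \<times> B) = 0"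
proof -
  assume B: "B \<in> sets (F 0)"
  obtain E where E: "simple E (ind_of ({0} \<times> B))" using rects_simple[OF rects_initial[OF B]] by blast
  have "cell E ({0} \<times> B) a = {}" if "a \<in> E - {T}" for a
    using nxt(2,4)[OF simple_grid[OF E] that] by (auto simp: cell_def)
  then show ?thesis unfolding vol_eq[OF E] by (intro sum.neutral) simp
qed

definition evol :: "(real \<times> 'a) set \<Rightarrow> ennreal" where "evol A = ennreal (vol A)"

lemma evol_positive: "positive rects evol"
  using vol_initial[of "{}"] by (simp add: positive_def evol_def)

lemma evol_additive: "additive rects evol"
  unfolding additive_def evol_def using vol_Un vol_nonneg by (auto simp: ennreal_plus)

text \<open>Enlarge \<open>A\<close> by letting every path that has entered one of its cells stay in
  until \<open>T\<close>. Each added piece has non-negative expected increment, and pathwise the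
  enlarged sum telescopes to \<open>W T - W m\<close>, with \<open>m\<close> the start of the first
  cell entered; this is at most \<open>2 * c\<close>, and the sum is zero for paths that enter no
  cell.\<close>

lemma vol_le_prob:
  assumes A: "A \<in> rects" and E: "simple E (ind_of A)"
  shows "vol A \<le> 2 * c * prob (\<Union>a\<in>E - {T}. cell E A a)"
proof -
  note gE = simple_grid[OF E]
  have fin: "finite (E - {T})" using gE by (simp add: grid_def)
  \<comment> \<open>\<open>B a\<close> collects the paths that have met \<open>A\<close> in a cell
    starting at or before \<open>a\<close>; it is known at time \<open>a\<close>.\<close>
  define B where "B a = (\<Union>e\<in>{e\<in>E - {T}. e \<le> a}. cell E A e)" for a
  define D where "D = (\<Union>a\<in>E - {T}. cell E A a)"
  have n: "a \<in> {0..T}" "nxt E a \<in> {0..T}" "0 \<le> a" "a \<le> nxt E a" "nxt E a \<le> T" if "a \<in> E - {T}" for a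
    using nxt[OF gE that] by auto
  have cellF: "cell E A e \<in> sets (F a)" if "e \<in> E - {T}" "e \<le> a" "a \<in> E - {T}" for e a
    using cell_sets[OF E that(1)] F_mono[OF n(3)[OF that(1)] that(2)] n(1)[OF that(3)] by auto
  have BF: "B a \<in> sets (F a)" if "a \<in> E - {T}" for a
    unfolding B_def using fin that by (intro sets.finite_UN) (auto intro: cellF)
  have BP: "B a \<in> sets P" if "a \<in> E - {T}" for a using BF[OF that] sets_F[OF n(1)[OF that]] by auto
  have DP: "D \<in> sets P"
    unfolding D_def using fin cell_sets[OF E] sets_F[OF n(1)] by (intro sets.finite_UN) auto
  have c0: "0 \<le> c" using W_bounded[of 0] not_empty T_pos by fastforce
  have "vol A \<le> (\<Sum>a\<in>E - {T}. \<integral>\<omega>. indicat_real (B a) \<omega> * (W (nxt E a) \<omega> - W a \<omega>) \<partial>P)"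
    unfolding vol_eq[OF E]
  proof (rule sum_mono)
    fix a assume a: "a \<in> E - {T}"
    have sub: "cell E A a \<subseteq> B a" using a by (auto simp: B_def)
    have BC: "B a - cell E A a \<in> sets (F a)" using BF[OF a] cellF[OF a order_refl a] by auto
    have "0 \<le> (\<integral>\<omega>. indicat_real (B a - cell E A a) \<omega> * (W (nxt E a) \<omega> - W a \<omega>) \<partial>P)"
      by (rule W_increasing[OF n(3,4,5)[OF a] BC])
    also have "\<dots> = (\<integral>\<omega>. indicat_real (B a) \<omega> * (W (nxt E a) \<omega> - W a \<omega>) -
        indicat_real (cell E A a) \<omega> * (W (nxt E a) \<omega> - W a \<omega>) \<partial>P)"
      using sub by (intro Bochner_Integration.integral_cong refl) (auto simp: indicator_def)
    also have "\<dots> = (\<integral>\<omega>. indicat_real (B a) \<omega> * (W (nxt E a) \<omega> - W a \<omega>) \<partial>P) -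
        (\<integral>\<omega>. indicat_real (cell E A a) \<omega> * (W (nxt E a) \<omega> - W a \<omega>) \<partial>P)"
      by (rule Bochner_Integration.integral_diff[OF W_integrable[OF n(1,2)[OF a] BP[OF a]] cell_integrable[OF E a]])
    finally show "(\<integral>\<omega>. indicat_real (cell E A a) \<omega> * (W (nxt E a) \<omega> - W a \<omega>) \<partial>P) \<le>
      (\<integral>\<omega>. indicat_real (B a) \<omega> * (W (nxt E a) \<omega> - W a \<omega>) \<partial>P)" by simp
  qed
  also have "\<dots> = (\<integral>\<omega>. (\<Sum>a\<in>E - {T}. indicat_real (B a) \<omega> * (W (nxt E a) \<omega> - W a \<omega>)) \<partial>P)"
    by (rule Bochner_Integration.integral_sum[symmetric]) (rule W_integrable[OF n(1,2) BP])
  also have "\<dots> \<le> (\<integral>\<omega>. 2 * c * indicat_real D \<omega> \<partial>P)"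
  proof (rule integral_mono)
    show "integrable P (\<lambda>\<omega>. \<Sum>a\<in>E - {T}. indicat_real (B a) \<omega> * (W (nxt E a) \<omega> - W a \<omega>))"
      by (rule Bochner_Integration.integrable_sum) (rule W_integrable[OF n(1,2) BP])
    show "integrable P (\<lambda>\<omega>. 2 * c * indicat_real D \<omega>)" using DP by (simp add: emeasure_eq_measure)
    fix \<omega> assume \<omega>: "\<omega> \<in> space P"
    show "(\<Sum>a\<in>E - {T}. indicat_real (B a) \<omega> * (W (nxt E a) \<omega> - W a \<omega>)) \<le> 2 * c * indicat_real D \<omega>"
    proof (cases "\<omega> \<in> D")
      case False
      then have "indicat_real (B a) \<omega> = 0" for a by (auto simp: B_def D_def)
      then show ?thesis using c0 by simp
    next
      case True
      let ?M = "{e\<in>E - {T}. \<omega> \<in> cell E A e}"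
      have fM: "finite ?M" "?M \<noteq> {}" using fin True by (auto simp: D_def)
      define m where "m = Min ?M"
      have m: "m \<in> E - {T}" "\<omega> \<in> cell E A m" using Min_in[OF fM] by (auto simp: m_def)
      have mle: "m \<le> e" if "e \<in> E - {T}" "\<omega> \<in> cell E A e" for e unfolding m_def using fM that by auto
      have Bm: "\<omega> \<in> B a \<longleftrightarrow> m \<le> a" if "a \<in> E - {T}" for a
        using m mle by (auto simp: B_def) (meson DiffD2 insertI1 order_trans mle DiffI)
      have TE: "T \<in> E" using gE by (simp add: grid_def)
      have "(\<Sum>a\<in>E - {T}. indicat_real (B a) \<omega> * (W (nxt E a) \<omega> - W a \<omega>)) =
        (\<Sum>a\<in>E - {T}. if a \<in> {m..<T} then W (nxt E a) \<omega> - W a \<omega> else 0)"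
      proof (intro sum.cong refl)
        fix a assume a: "a \<in> E - {T}"
        have "a < T" by (rule nxt(5)[OF gE a])
        then show "indicat_real (B a) \<omega> * (W (nxt E a) \<omega> - W a \<omega>) = (if a \<in> {m..<T} then W (nxt E a) \<omega> - W a \<omega> else 0)"
          using Bm[OF a] by simp
      qed
      also have "\<dots> = (\<Sum>a\<in>(E - {T}) \<inter> {m..<T}. W (nxt E a) \<omega> - W a \<omega>)"
        by (rule sum.inter_restrict[OF fin, symmetric])
      also have "(E - {T}) \<inter> {m..<T} = E \<inter> {m..<T}" by auto
      also have "(\<Sum>a\<in>\<dots>. W (nxt E a) \<omega> - W a \<omega>) = W T \<omega> - W m \<omega>"
        using grid_telescope[OF gE _ TE, of m "\<lambda>t. W t \<omega>"] m(1) nxt(6)[OF gE m(1)] by simp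
      also have "\<dots> \<le> 2 * c"
        using W_bounded[of T \<omega>] W_bounded[OF n(1)[OF m(1)] \<omega>] \<omega> T_pos by fastforce
      finally show ?thesis using True by simp
    qed
  qed
  also have "\<dots> = 2 * c * prob D" using DP by (simp add: emeasure_eq_measure)
  finally show ?thesis by (simp add: D_def)
qed

end

section \<open>Countable additivity of the content\<close>

context increments begin

text \<open>The left end points of the cells are cut off, so that the remaining half-open cells lie in compact
  subsets of the original set.\<close>

lemma shrink:
  assumes A: "A \<in> rects" and e: "0 < e"
  obtains A' \<kappa> where "A' \<in> rects" "A' \<subseteq> A" "vol (A - A') \<le> e" "\<And>\<omega>. compact (\<kappa> \<omega> :: real set)"
    "\<And>t \<omega>. (t, \<omega>) \<in> A' \<Longrightarrow> t \<in> \<kappa> \<omega>" "\<And>t \<omega>. t \<in> \<kappa> \<omega> \<Longrightarrow> \<omega> \<in> space P \<Longrightarrow> (t, \<omega>) \<in> A"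
    "\<And>t \<omega>. (t, \<omega>) \<in> A' \<Longrightarrow> 0 < t"
proof -
  obtain E where E: "simple E (ind_of A)" using rects_simple[OF A] by blast
  note gE = simple_grid[OF E]
  have fin: "finite (E - {T})" using gE by (simp add: grid_def)
  define B where "B = cell E A"
  \<comment> \<open>Cut points in each cell that decrease to its left end; right-continuity of
    \<open>W\<close> makes the expected increment over the removed part vanish in the limit.\<close>
  define p where "p n a = a + (nxt E a - a) * (1/2) ^ Suc n" for n a
  have n: "0 \<le> a" "a < nxt E a" "nxt E a \<le> T" "a \<le> T" if "a \<in> E - {T}" for a using nxt[OF gE that] by auto
  have p: "a < p k a" "p k a < nxt E a" if "a \<in> E - {T}" for k a
  proof -
    have "(1/2::real) ^ Suc k \<le> (1/2) ^ 1" by (rule power_decreasing) auto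
    then have "0 < (1/2::real) ^ Suc k" "(1/2::real) ^ Suc k < 1" by simp_all
    then have "0 < (nxt E a - a) * (1/2) ^ Suc k" "(nxt E a - a) * (1/2) ^ Suc k < (nxt E a - a) * 1"
      using n(2)[OF that] by (intro mult_pos_pos mult_strict_left_mono; simp)+
    then show "a < p k a" "p k a < nxt E a" by (auto simp: p_def)
  qed
  have BF: "B a \<in> sets (F a)" if "a \<in> E - {T}" for a unfolding B_def by (rule cell_sets[OF E that])
  have BP: "B a \<in> sets P" if "a \<in> E - {T}" for a using BF[OF that] sets_F[of a] n[OF that] by auto
  have lim: "(\<lambda>k. \<integral>\<omega>. indicat_real (B a) \<omega> * (W (p k a) \<omega> - W a \<omega>) \<partial>P) \<longlonglongrightarrow> 0" if a: "a \<in> E - {T}" for a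
  proof -
    have pT: "p k a \<in> {0..T}" and aT: "a \<in> {0..T}" for k using p[OF a, of k] n[OF a] by auto
    have "(\<lambda>k. (1/2::real) ^ Suc k) \<longlonglongrightarrow> 0" by (intro LIMSEQ_Suc LIMSEQ_power_zero) simp
    then have "(\<lambda>k. p k a) \<longlonglongrightarrow> a + (nxt E a - a) * 0"
      unfolding p_def by (intro tendsto_add tendsto_mult tendsto_const)
    then have pl: "(\<lambda>k. p k a) \<longlonglongrightarrow> a" by simp
    have "(\<lambda>k. \<integral>\<omega>. indicat_real (B a) \<omega> * (W (p k a) \<omega> - W a \<omega>) \<partial>P) \<longlonglongrightarrow> (\<integral>\<omega>. 0 \<partial>P)"
    proof (rule integral_dominated_convergence[where w="\<lambda>_. 2 * c"])
      show "(\<lambda>\<omega>. indicat_real (B a) \<omega> * (W (p k a) \<omega> - W a \<omega>)) \<in> borel_measurable P" for k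
        by (rule borel_measurable_integrable[OF W_integrable[OF aT pT BP[OF a]]])
      show "AE \<omega> in P. (\<lambda>k. indicat_real (B a) \<omega> * (W (p k a) \<omega> - W a \<omega>)) \<longlonglongrightarrow> 0"
        using W_cadlag
      proof eventually_elim
        case (elim \<omega>)
        have "((\<lambda>t. W t \<omega>) \<longlongrightarrow> W a \<omega>) (at_right a)"
          using n[OF a] by (intro cadlag_right[OF elim]) auto
        from right_limit_sequence[OF this _ pl] have "(\<lambda>k. W (p k a) \<omega>) \<longlonglongrightarrow> W a \<omega>"
          using p(1)[OF a] by (simp add: less_imp_le)
        then have "(\<lambda>k. indicat_real (B a) \<omega> * (W (p k a) \<omega> - W a \<omega>)) \<longlonglongrightarrow> indicat_real (B a) \<omega> * (W a \<omega> - W a \<omega>)"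
          by (intro tendsto_mult tendsto_diff tendsto_const)
        then show ?case by simp
      qed
      show "AE \<omega> in P. norm (indicat_real (B a) \<omega> * (W (p k a) \<omega> - W a \<omega>)) \<le> 2 * c" for k
      proof (rule AE_I2)
        fix \<omega> assume "\<omega> \<in> space P"
        then have "\<bar>W (p k a) \<omega>\<bar> \<le> c" "\<bar>W a \<omega>\<bar> \<le> c" using W_bounded pT aT by blast+
        then show "norm (indicat_real (B a) \<omega> * (W (p k a) \<omega> - W a \<omega>)) \<le> 2 * c"
          by (auto simp: indicator_def)
      qed
    qed simp_all
    then show ?thesis by simp
  qed
  have "(\<lambda>k. \<Sum>a\<in>E - {T}. \<integral>\<omega>. indicat_real (B a) \<omega> * (W (p k a) \<omega> - W a \<omega>) \<partial>P) \<longlonglongrightarrow> (\<Sum>a\<in>E - {T}. 0)"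
    by (intro tendsto_sum lim)
  then have "(\<lambda>k. \<Sum>a\<in>E - {T}. \<integral>\<omega>. indicat_real (B a) \<omega> * (W (p k a) \<omega> - W a \<omega>) \<partial>P) \<longlonglongrightarrow> 0" by simp
  from eventually_happens'[OF trivial_limit_sequentially order_tendstoD(2)[OF this e]]
  obtain k where k: "(\<Sum>a\<in>E - {T}. \<integral>\<omega>. indicat_real (B a) \<omega> * (W (p k a) \<omega> - W a \<omega>) \<partial>P) < e" by blast
  define A' where "A' = (\<Union>a\<in>E - {T}. {p k a<..nxt E a} \<times> B a)"
  \<comment> \<open>The same cells with their cut points added: closed intervals, hence compact, and
    still inside \<open>A\<close> because the cut points lie in the interior of the original
    cells.\<close>
  define \<kappa> where "\<kappa> \<omega> = (\<Union>a\<in>{a\<in>E - {T}. \<omega> \<in> B a}. {p k a..nxt E a})" for \<omega>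
  interpret R: ring_of_sets "{0..T} \<times> space P" rects by (rule ring_rects)
  have A'ER: "A' \<in> rects"
    unfolding A'_def
  proof (rule R.finite_UN[OF fin])
    fix a assume a: "a \<in> E - {T}"
    have "B a \<in> sets (F (p k a))"
      using BF[OF a] F_mono[of a "p k a"] p[OF a, of k] n[OF a] by auto
    then show "{p k a<..nxt E a} \<times> B a \<in> rects"
      using p[OF a, of k] n[OF a] by (intro rects_rectangle) auto
  qed
  have inA: "(t, \<omega>) \<in> A" if "a \<in> E - {T}" "\<omega> \<in> B a" "a < t" "t \<le> nxt E a" for a t \<omega>
    using cell_iff[OF E that(1,3,4)] that(2) cell_subset[of E A a] unfolding B_def by blast
  have sub: "A' \<subseteq> A"
  proof
    fix x assume "x \<in> A'"
    then obtain a where a: "a \<in> E - {T}" "x \<in> {p k a<..nxt E a} \<times> B a" unfolding A'_def by (rule UN_E)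
    then have "(fst x, snd x) \<in> A" using inA[OF a(1), of "snd x" "fst x"] p(1)[OF a(1), of k] by auto
    then show "x \<in> A" by simp
  qed
  have gle: "vol (A - A') \<le> e"
  proof -
    \<comment> \<open>The part of \<open>A\<close> at time zero is dropped from \<open>A'\<close> as
      well; it has volume zero by \<open>vol_initial\<close>.\<close>
    define B0 where "B0 = {\<omega>\<in>space P. (0, \<omega>) \<in> A}"
    have B0: "B0 \<in> sets (F 0)"
    proof -
      have "ind_of A 0 -` {1} \<inter> space (F 0) \<in> sets (F 0)" by (rule measurable_sets[OF simple_zero[OF E]]) simp
      moreover have "ind_of A 0 -` {1} \<inter> space (F 0) = B0"
        using space_F[of 0] T_pos by (auto simp: ind_of_def indicator_def B0_def split: if_splits)
      ultimately show ?thesis by simp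
    qed
    define U where "U = (\<Union>a\<in>E - {T}. {a<..p k a} \<times> B a)"
    have rect: "{a<..p k a} \<times> B a \<in> rects" if "a \<in> E - {T}" for a
      using BF[OF that] p[OF that, of k] n[OF that] by (intro rects_rectangle) auto
    have U: "U \<in> rects" unfolding U_def by (rule R.finite_UN[OF fin rect])
    have cover: "A - A' \<subseteq> {0} \<times> B0 \<union> U"
    proof
      fix x assume x: "x \<in> A - A'"
      obtain t \<omega> where x': "x = (t, \<omega>)" by (cases x)
      have t: "0 \<le> t" "t \<le> T" "\<omega> \<in> space P" using x A by (auto simp: rects_def x')
      show "x \<in> {0} \<times> B0 \<union> U"
      proof (cases "t = 0")
        case True
        then show ?thesis using x t by (auto simp: x' B0_def)
      next
        case False
        then obtain a where a: "a \<in> E - {T}" "a < t" "t \<le> nxt E a" using grid_cell[OF gE, of t] t by auto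
        have "\<omega> \<in> B a" using cell_iff[OF E a t(3)] x by (simp add: B_def x')
        moreover from this have "t \<le> p k a" using x a by (auto simp: x' A'_def not_less)
        ultimately show ?thesis using a by (auto simp: x' U_def)
      qed
    qed
    have "evol (A - A') \<le> evol ({0} \<times> B0 \<union> U)"
      using R.additive_increasing[OF evol_positive evol_additive] cover rects_Diff[OF A A'ER] rects_Un[OF rects_initial[OF B0] U]
      unfolding increasing_def by blast
    also have "\<dots> \<le> evol ({0} \<times> B0) + evol U"
      using R.subadditive[OF evol_positive evol_additive, of "\<lambda>b. if b then {0} \<times> B0 else U" UNIV] rects_initial[OF B0] U
      by (auto simp: UNIV_bool Un_commute add.commute)
    also have "evol ({0} \<times> B0) = 0" by (simp add: evol_def vol_initial[OF B0])
    also have "evol U \<le> (\<Sum>a\<in>E - {T}. evol ({a<..p k a} \<times> B a))"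
      unfolding U_def using rect by (intro R.subadditive[OF evol_positive evol_additive _ fin]) auto
    also have "\<dots> = ennreal (\<Sum>a\<in>E - {T}. vol ({a<..p k a} \<times> B a))"
      unfolding evol_def using rect vol_nonneg by (intro sum_ennreal) auto
    also have "(\<Sum>a\<in>E - {T}. vol ({a<..p k a} \<times> B a)) =
        (\<Sum>a\<in>E - {T}. \<integral>\<omega>. indicat_real (B a) \<omega> * (W (p k a) \<omega> - W a \<omega>) \<partial>P)"
    proof (intro sum.cong refl)
      fix a assume a: "a \<in> E - {T}"
      show "vol ({a<..p k a} \<times> B a) = (\<integral>\<omega>. indicat_real (B a) \<omega> * (W (p k a) \<omega> - W a \<omega>) \<partial>P)"
        using p[OF a, of k] n[OF a] by (intro vol_rectangle BF[OF a]) auto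
    qed
    finally have "ennreal (vol (A - A')) \<le>
        ennreal (\<Sum>a\<in>E - {T}. \<integral>\<omega>. indicat_real (B a) \<omega> * (W (p k a) \<omega> - W a \<omega>) \<partial>P)"
      by (simp add: evol_def)
    also have "\<dots> \<le> ennreal e" using k by (intro ennreal_leI) simp
    finally show ?thesis using e by (simp add: ennreal_le_iff)
  qed
  show ?thesis
  proof (rule that[OF A'ER sub gle])
    show "compact (\<kappa> \<omega>)" for \<omega> unfolding \<kappa>_def using fin by (intro compact_UN) auto
    show "t \<in> \<kappa> \<omega>" if "(t, \<omega>) \<in> A'" for t \<omega>
      using that unfolding A'_def \<kappa>_def by fastforce
    show "(t, \<omega>) \<in> A" if t: "t \<in> \<kappa> \<omega>" "\<omega> \<in> space P" for t \<omega>
    proof -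
      obtain a where a: "a \<in> E - {T}" "\<omega> \<in> B a" "p k a \<le> t" "t \<le> nxt E a" using t(1) by (auto simp: \<kappa>_def)
      then show ?thesis using inA[OF a(1,2)] p(1)[OF a(1), of k] by auto
    qed
    show "0 < t" if tA: "(t, \<omega>) \<in> A'" for t \<omega>
    proof -
      from tA obtain a where a: "a \<in> E - {T}" "(t, \<omega>) \<in> {p k a<..nxt E a} \<times> B a" unfolding A'_def by (rule UN_E)
      then have "p k a < t" by auto
      then show ?thesis using p(1)[OF a(1), of k] n(1)[OF a(1)] by linarith
    qed
  qed
qed

text \<open>Inner approximation combined with compactness: the shrunken sets have finite
  intersections \<open>C n\<close> whose projections \<open>D n\<close> decrease. A path in all of
  them would, by compactness of its time sections, yield a point in every \<open>A k\<close>. Hence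
  \<open>prob (D n)\<close> tends to zero, and \<open>vol_le_prob\<close> controls
  \<open>vol (C n)\<close>.\<close>

lemma evol_continuous:
  assumes A: "range A \<subseteq> rects" and dec: "decseq A" and empty: "(\<Inter>i. A i) = {}"
  shows "(\<lambda>i. evol (A i)) \<longlonglongrightarrow> 0"
proof -
  interpret R: ring_of_sets "{0..T} \<times> space P" rects by (rule ring_rects)
  have AER: "A i \<in> rects" for i using A by auto
  have c0: "0 \<le> c" using W_bounded[of 0] not_empty T_pos by fastforce
  have "(\<lambda>i. vol (A i)) \<longlonglongrightarrow> 0"
  proof (rule order_tendstoI)
    fix r :: real assume "r < 0"
    then show "\<forall>\<^sub>F i in sequentially. r < vol (A i)"
      using vol_nonneg[OF AER] by (intro always_eventually allI) (rule less_le_trans)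
  next
    fix r :: real assume r: "0 < r"
    let ?Q = "\<lambda>k A' \<kappa>. A' \<in> rects \<and> A' \<subseteq> A k \<and> vol (A k - A') \<le> (r / 4) * (1/2) ^ k \<and> (\<forall>\<omega>. compact (\<kappa> \<omega> :: real set)) \<and>
      (\<forall>t \<omega>. (t, \<omega>) \<in> A' \<longrightarrow> t \<in> \<kappa> \<omega>) \<and> (\<forall>t \<omega>. t \<in> \<kappa> \<omega> \<longrightarrow> \<omega> \<in> space P \<longrightarrow> (t, \<omega>) \<in> A k) \<and>
      (\<forall>t \<omega>. (t, \<omega>) \<in> A' \<longrightarrow> 0 < t)"
    have "\<forall>k. \<exists>A' \<kappa>. ?Q k A' \<kappa>"
    proof
      fix k
      \<comment> \<open>The errors \<open>(r / 4) * (1/2) ^ k\<close> add up to at most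
        \<open>r / 2\<close>; together with \<open>vol (C n) < r / 4\<close> this stays below
        \<open>r\<close>.\<close>
      have pos: "0 < (r / 4) * (1/2) ^ k" using r by simp
      obtain A' \<kappa> where sh: "A' \<in> rects" "A' \<subseteq> A k" "vol (A k - A') \<le> (r / 4) * (1/2) ^ k" "\<And>\<omega>. compact (\<kappa> \<omega> :: real set)"
        "\<And>t \<omega>. (t, \<omega>) \<in> A' \<Longrightarrow> t \<in> \<kappa> \<omega>" "\<And>t \<omega>. t \<in> \<kappa> \<omega> \<Longrightarrow> \<omega> \<in> space P \<Longrightarrow> (t, \<omega>) \<in> A k"
        "\<And>t \<omega>. (t, \<omega>) \<in> A' \<Longrightarrow> 0 < t"
        by (rule shrink[OF AER pos]) blast
      show "\<exists>A' \<kappa>. ?Q k A' \<kappa>"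
        by (rule exI[of _ A'], rule exI[of _ \<kappa>]) (use sh in blast)
    qed
    from choice[OF this] obtain A' where "\<forall>k. \<exists>\<kappa>. ?Q k (A' k) \<kappa>" by blast
    from choice[OF this] obtain \<kappa> where Q: "\<And>k. ?Q k (A' k) (\<kappa> k)" by blast
    have A'ER: "A' k \<in> rects" for k using Q by blast
    define C where "C n = (\<Inter>k\<in>{..n}. A' k)" for n
    have CER: "C n \<in> rects" for n
    proof (induction n)
      case 0
      show ?case using A'ER by (simp add: C_def)
    next
      case (Suc n)
      have "C (Suc n) = C n \<inter> A' (Suc n)" by (auto simp: C_def atMost_Suc)
      then show ?case using rects_Int[OF Suc A'ER] by simp
    qed
    define D where "D n = {\<omega>\<in>space P. \<exists>t. (t, \<omega>) \<in> C n}" for n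
    have D: "D n \<in> sets P" "vol (C n) \<le> 2 * c * prob (D n)" for n
    proof -
      obtain E where E: "simple E (ind_of (C n))" using rects_simple[OF CER] by blast
      note gE = simple_grid[OF E]
      have "D n = (\<Union>a\<in>E - {T}. cell E (C n) a)"
      proof (intro set_eqI iffI)
        fix \<omega> assume "\<omega> \<in> D n"
        then obtain t where t: "\<omega> \<in> space P" "(t, \<omega>) \<in> C n" by (auto simp: D_def)
        \<comment> \<open>Shrunken sets contain no point at time zero, so every point of
          \<open>C n\<close> lies over a cell, and \<open>D n\<close> is a finite union of
          cells.\<close>
        have "(t, \<omega>) \<in> A' 0" using t(2) by (auto simp: C_def)
        then have "0 < t" using Q by blast
        moreover have "t \<le> T" using t(2) CER[of n] by (auto simp: rects_def)
        ultimately obtain a where a: "a \<in> E - {T}" "a < t" "t \<le> nxt E a" using grid_cell[OF gE, of t] by auto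
        then show "\<omega> \<in> (\<Union>a\<in>E - {T}. cell E (C n) a)" using cell_iff[OF E a t(1)] t(2) by blast
      next
        fix \<omega> assume "\<omega> \<in> (\<Union>a\<in>E - {T}. cell E (C n) a)"
        then show "\<omega> \<in> D n" by (auto simp: D_def cell_def)
      qed
      moreover have "(\<Union>a\<in>E - {T}. cell E (C n) a) \<in> sets P"
      proof (rule sets.finite_UN)
        show "finite (E - {T})" using gE by (simp add: grid_def)
        show "cell E (C n) a \<in> sets P" if "a \<in> E - {T}" for a
          using cell_sets[OF E that] sets_F[of a] nxt(4,6)[OF gE that] by auto
      qed
      ultimately show "D n \<in> sets P" "vol (C n) \<le> 2 * c * prob (D n)" using vol_le_prob[OF CER E] by simp_all
    qed
    have decD: "decseq D"
    proof (rule antimonoI)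
      fix m n :: nat assume "m \<le> n"
      then have "C n \<subseteq> C m" unfolding C_def by (intro INT_anti_mono) auto
      then show "D n \<subseteq> D m" by (auto simp: D_def)
    qed
    have emptyD: "(\<Inter>n. D n) = {}"
    proof (rule ccontr)
      assume "(\<Inter>n. D n) \<noteq> {}"
      then obtain \<omega> where \<omega>: "\<And>n. \<omega> \<in> D n" by blast
      then have sp: "\<omega> \<in> space P" by (auto simp: D_def)
      \<comment> \<open>Time sections along the fixed path, taken with the compact
        \<open>\<kappa>\<close> because the half-open sections of \<open>A'\<close> need not be
        closed.\<close>
      define K where "K n = (\<Inter>k\<in>{..n}. \<kappa> k \<omega>)" for n
      have "\<Inter>(range K) \<noteq> {}"
      proof (rule compact_nest)
        show "compact (K n)" for n
          unfolding K_def using Q by (intro compact_Inter) auto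
        show "K n \<noteq> {}" for n
        proof -
          obtain t where "(t, \<omega>) \<in> C n" using \<omega>[of n] by (auto simp: D_def)
          then have "(t, \<omega>) \<in> A' k" if "k \<le> n" for k using that by (auto simp: C_def)
          then have "t \<in> K n" unfolding K_def using Q by blast
          then show ?thesis by blast
        qed
        show "K n \<subseteq> K m" if "m \<le> n" for m n unfolding K_def using that by (intro INT_anti_mono) auto
      qed
      then obtain t where t: "\<And>n. t \<in> K n" by blast
      have "t \<in> \<kappa> k \<omega>" for k using t[of k] by (auto simp: K_def)
      then have "(t, \<omega>) \<in> A k" for k using Q sp by blast
      then show False using empty by blast
    qed
    have "(\<lambda>n. prob (D n)) \<longlonglongrightarrow> prob (\<Inter>n. D n)"
      using D(1) decD by (intro finite_Lim_measure_decseq) auto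
    then have "(\<lambda>n. 2 * c * prob (D n)) \<longlonglongrightarrow> 2 * c * 0" unfolding emptyD by (intro tendsto_mult tendsto_const) simp
    then have "(\<lambda>n. 2 * c * prob (D n)) \<longlonglongrightarrow> 0" by simp
    moreover have "0 < r / 4" using r by simp
    ultimately have ev: "\<forall>\<^sub>F n in sequentially. 2 * c * prob (D n) < r / 4" by (rule order_tendstoD(2))
    show "\<forall>\<^sub>F n in sequentially. vol (A n) < r"
      using ev
    proof eventually_elim
      case (elim n)
      have sub: "A n \<subseteq> C n \<union> (\<Union>k\<in>{..n}. A k - A' k)"
      proof
        fix x assume x: "x \<in> A n"
        then have "x \<in> A k" if "k \<le> n" for k using decseqD[OF dec that] by blast
        then show "x \<in> C n \<union> (\<Union>k\<in>{..n}. A k - A' k)" unfolding C_def by blast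
      qed
      have V: "(\<Union>k\<in>{..n}. A k - A' k) \<in> rects" by (rule R.finite_UN) (auto intro: rects_Diff AER A'ER)
      have "evol (A n) \<le> evol (C n \<union> (\<Union>k\<in>{..n}. A k - A' k))"
        using R.additive_increasing[OF evol_positive evol_additive] sub AER rects_Un[OF CER V]
        unfolding increasing_def by blast
      also have "\<dots> \<le> evol (C n) + evol (\<Union>k\<in>{..n}. A k - A' k)"
        using R.subadditive[OF evol_positive evol_additive, of "\<lambda>b. if b then C n else (\<Union>k\<in>{..n}. A k - A' k)" UNIV] CER V
        by (auto simp: UNIV_bool Un_commute add.commute)
      also have "evol (\<Union>k\<in>{..n}. A k - A' k) \<le> (\<Sum>k\<in>{..n}. evol (A k - A' k))"
        by (rule R.subadditive[OF evol_positive evol_additive]) (auto intro: rects_Diff AER A'ER)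
      also have "\<dots> = ennreal (\<Sum>k\<in>{..n}. vol (A k - A' k))"
        unfolding evol_def by (intro sum_ennreal vol_nonneg rects_Diff AER A'ER)
      also have "evol (C n) + \<dots> = ennreal (vol (C n) + (\<Sum>k\<in>{..n}. vol (A k - A' k)))"
        unfolding evol_def by (intro ennreal_plus[symmetric] vol_nonneg CER sum_nonneg rects_Diff AER A'ER)
      finally have "ennreal (vol (A n)) \<le> ennreal (vol (C n) + (\<Sum>k\<in>{..n}. vol (A k - A' k)))"
        by (simp add: evol_def add_left_mono)
      then have "vol (A n) \<le> vol (C n) + (\<Sum>k\<in>{..n}. vol (A k - A' k))"
        by (subst (asm) ennreal_le_iff) (intro add_nonneg_nonneg vol_nonneg CER sum_nonneg rects_Diff AER A'ER)
      also have "(\<Sum>k\<in>{..n}. vol (A k - A' k)) \<le> (\<Sum>k\<in>{..n}. (r / 4) * (1/2) ^ k)"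
        using Q by (intro sum_mono) blast
      also have "\<dots> \<le> (r / 4) * 2"
      proof -
        have "(\<Sum>k\<in>{..n}. (1/2::real) ^ k) \<le> 2" by (simp add: sum_gp0 power_Suc[symmetric] del: power_Suc)
        then show ?thesis unfolding sum_distrib_left[symmetric] using r by (intro mult_left_mono) auto
      qed
      finally show ?case using D(2)[of n] elim r by linarith
    qed
  qed
  then show ?thesis unfolding evol_def using tendsto_ennrealI by fastforce
qed

text \<open>Caratheodory's extension of the content \<open>evol\<close> from the ring
  \<open>rects\<close>, with \<open>evol_continuous\<close> as continuity at the empty set.\<close>

theorem Doleans_measure:
  obtains D where "sets D = sets PA" "finite_measure D"
    "\<And>a b B. 0 \<le> a \<Longrightarrow> a < b \<Longrightarrow> b \<le> T \<Longrightarrow> B \<in> sets (F a) \<Longrightarrow>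
      emeasure D ({a<..b} \<times> B) = ennreal (\<integral>\<omega>. indicat_real B \<omega> * (W b \<omega> - W a \<omega>) \<partial>P)"
proof -
  interpret R: ring_of_sets "{0..T} \<times> space P" rects by (rule ring_rects)
  have "\<exists>\<mu> :: (real \<times> 'a) set \<Rightarrow> ennreal. (\<forall>A\<in>rects. \<mu> A = evol A) \<and>
      measure_space ({0..T} \<times> space P) (sigma_sets ({0..T} \<times> space P) rects) \<mu>"
    by (rule R.caratheodory_empty_continuous[OF evol_positive evol_additive _ evol_continuous]) (simp add: evol_def)
  then obtain \<mu> :: "(real \<times> 'a) set \<Rightarrow> ennreal" where \<mu>: "\<And>A. A \<in> rects \<Longrightarrow> \<mu> A = evol A"
    "measure_space ({0..T} \<times> space P) (sets PA) \<mu>" unfolding sigma_rects by blast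
  define D where "D = measure_of ({0..T} \<times> space P) (sets PA) \<mu>"
  have pow: "sets PA \<subseteq> Pow ({0..T} \<times> space P)" using sets.space_closed[of PA] by (simp add: space_PA)
  have sig: "sigma_sets ({0..T} \<times> space P) (sets PA) = sets PA"
    using sets.sigma_sets_eq[of PA] by (simp add: space_PA)
  have sets: "sets D = sets PA" unfolding D_def using pow by (simp add: sig)
  have em: "emeasure D A = \<mu> A" if "A \<in> sets PA" for A
    unfolding D_def
    by (rule emeasure_measure_of_sigma) (use \<mu>(2) that in \<open>auto simp: measure_space_def\<close>)
  have rects: "A \<in> sets PA" if "A \<in> rects" for A using that sigma_rects by (metis sigma_sets.Basic)
  show ?thesis
  proof (rule that[OF sets])
    show "emeasure D ({a<..b} \<times> B) = ennreal (\<integral>\<omega>. indicat_real B \<omega> * (W b \<omega> - W a \<omega>) \<partial>P)"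
      if "0 \<le> a" "a < b" "b \<le> T" "B \<in> sets (F a)" for a b B
      using em[OF rects[OF rects_rectangle[OF that]]] \<mu>(1)[OF rects_rectangle[OF that]] vol_rectangle[OF that] by (simp add: evol_def)
    show "finite_measure D"
    proof (rule finite_measureI)
      have "{0} \<times> space P \<union> {0<..T} \<times> space P \<in> rects"
        using sets.top[of "F 0"] space_F[of 0] T_pos by (intro rects_Un rects_initial rects_rectangle) auto
      moreover have "{0} \<times> space P \<union> {0<..T} \<times> space P = {0..T} \<times> space P" using T_pos by auto
      moreover have "space D = {0..T} \<times> space P" using sets_eq_imp_space_eq[OF sets] space_PA by simp
      ultimately show "emeasure D (space D) \<noteq> \<infinity>" using em[OF rects] \<mu>(1) by (simp add: evol_def)
    qed
  qed
qed

end

context filtered_space begin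

section \<open>Local martingales admit a control\<close>

text \<open>Boundedness is required at every point and not just almost surely, so that the squared
  norm fits the locale \<open>increments\<close>.\<close>

definition bdd_mart :: "('a, 'c::euclidean_space) process \<Rightarrow> real \<Rightarrow> bool" where
  "bdd_mart N c \<longleftrightarrow> (\<forall>t\<in>{0..T}. N t \<in> borel_measurable (F t)) \<and>
     (\<forall>t\<in>{0..T}. \<forall>\<omega>\<in>space P. norm (N t \<omega>) \<le> c) \<and> (AE \<omega> in P. cadlag_on T (\<lambda>t. N t \<omega>)) \<and>
     (\<forall>i\<in>Basis. mart (\<lambda>t \<omega>. N t \<omega> \<bullet> i))"

lemma bdd_mart_measurable: "bdd_mart N c \<Longrightarrow> t \<in> {0..T} \<Longrightarrow> N t \<in> borel_measurable (F t)"
  and bdd_mart_bounded: "bdd_mart N c \<Longrightarrow> t \<in> {0..T} \<Longrightarrow> \<omega> \<in> space P \<Longrightarrow> norm (N t \<omega>) \<le> c"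
  and bdd_mart_cadlag: "bdd_mart N c \<Longrightarrow> AE \<omega> in P. cadlag_on T (\<lambda>t. N t \<omega>)"
  and bdd_mart_mart: "bdd_mart N c \<Longrightarrow> i \<in> Basis \<Longrightarrow> mart (\<lambda>t \<omega>. N t \<omega> \<bullet> i)"
  unfolding bdd_mart_def by blast+

lemma integrable_bounded:
  fixes f :: "'a \<Rightarrow> real"
  assumes "f \<in> borel_measurable P" "\<And>\<omega>. \<omega> \<in> space P \<Longrightarrow> \<bar>f \<omega>\<bar> \<le> c"
  shows "integrable P f"
  using assms by (intro integrable_const_bound[where B=c]) (auto intro!: AE_I2)

text \<open>Componentwise \<open>mart_eq\<close>, with the coordinates of \<open>h\<close> as test
  factors.\<close>

lemma bdd_mart_orthogonal:
  fixes N :: "('a, 'c::euclidean_space) process"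
  assumes N: "bdd_mart N c" and ab: "0 \<le> a" "a \<le> b" "b \<le> T"
    and h: "h \<in> borel_measurable (F a)" "\<And>\<omega>. \<omega> \<in> space P \<Longrightarrow> norm (h \<omega>) \<le> d"
  shows "(\<integral>\<omega>. h \<omega> \<bullet> (N b \<omega> - N a \<omega>) \<partial>P) = 0"
proof -
  have abT: "a \<in> {0..T}" "b \<in> {0..T}" using ab by auto
  have hi: "(\<lambda>\<omega>. h \<omega> \<bullet> i) \<in> borel_measurable (F a)" for i using h(1) by measurable
  have hiP: "(\<lambda>\<omega>. h \<omega> \<bullet> i) \<in> borel_measurable P" for i by (rule measurable_F_P[OF hi abT(1)])
  have hb: "\<bar>h \<omega> \<bullet> i\<bar> \<le> d" if "i \<in> Basis" "\<omega> \<in> space P" for i \<omega>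
    using Basis_le_norm[OF that(1), of "h \<omega>"] h(2)[OF that(2)] by linarith
  have int: "integrable P (\<lambda>\<omega>. (h \<omega> \<bullet> i) * (N s \<omega> \<bullet> i))" if "i \<in> Basis" "s \<in> {0..T}" for i s
    by (rule integrable_bounded_mult[OF hiP hb[OF that(1)] mart_integrable[OF bdd_mart_mart[OF N that(1)] that(2)]])
  have "(\<integral>\<omega>. h \<omega> \<bullet> (N b \<omega> - N a \<omega>) \<partial>P) =
      (\<integral>\<omega>. (\<Sum>i\<in>Basis. (h \<omega> \<bullet> i) * (N b \<omega> \<bullet> i) - (h \<omega> \<bullet> i) * (N a \<omega> \<bullet> i)) \<partial>P)"
    by (intro Bochner_Integration.integral_cong refl, subst euclidean_inner) (simp add: inner_diff_left algebra_simps)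
  also have "\<dots> = (\<Sum>i\<in>Basis. \<integral>\<omega>. (h \<omega> \<bullet> i) * (N b \<omega> \<bullet> i) - (h \<omega> \<bullet> i) * (N a \<omega> \<bullet> i) \<partial>P)"
    using int abT by (intro Bochner_Integration.integral_sum Bochner_Integration.integrable_diff) auto
  also have "\<dots> = 0"
  proof (rule sum.neutral, rule ballI)
    fix i :: 'c assume i: "i \<in> Basis"
    have "(\<integral>\<omega>. (h \<omega> \<bullet> i) * (N b \<omega> \<bullet> i) \<partial>P) = (\<integral>\<omega>. (h \<omega> \<bullet> i) * (N a \<omega> \<bullet> i) \<partial>P)"
      by (rule mart_eq[OF bdd_mart_mart[OF N i] ab hi hb[OF i]])
    then show "(\<integral>\<omega>. (h \<omega> \<bullet> i) * (N b \<omega> \<bullet> i) - (h \<omega> \<bullet> i) * (N a \<omega> \<bullet> i) \<partial>P) = 0"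
      using int[OF i] abT by simp
  qed
  finally show ?thesis .
qed

text \<open>Expanding the squared norm leaves a cross term whose factor is known at \<open>a\<close>
  and which has mean zero by \<open>bdd_mart_orthogonal\<close>. In particular the squared norm has
  non-negative expected increments.\<close>

lemma bdd_mart_square_increment:
  fixes N :: "('a, 'c::euclidean_space) process"
  assumes N: "bdd_mart N c" and ab: "0 \<le> a" "a \<le> b" "b \<le> T" and B: "B \<in> sets (F a)"
  shows "(\<integral>\<omega>. indicat_real B \<omega> * ((norm (N b \<omega>))\<^sup>2 - (norm (N a \<omega>))\<^sup>2) \<partial>P) =
    (\<integral>\<omega>. indicat_real B \<omega> * (norm (N b \<omega> - N a \<omega>))\<^sup>2 \<partial>P)"
proof -
  have abT: "a \<in> {0..T}" "b \<in> {0..T}" using ab by auto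
  have NP: "N a \<in> borel_measurable P" "N b \<in> borel_measurable P"
    by (rule measurable_F_P[OF bdd_mart_measurable[OF N abT(1)] abT(1)], rule measurable_F_P[OF bdd_mart_measurable[OF N abT(2)] abT(2)])
  have BP: "B \<in> sets P" using B sets_F[OF abT(1)] by auto
  define h where "h \<omega> = indicat_real B \<omega> *\<^sub>R 2 *\<^sub>R N a \<omega>" for \<omega>
  have hm: "h \<in> borel_measurable (F a)" unfolding h_def[abs_def] using bdd_mart_measurable[OF N abT(1)] B by measurable
  have c0: "0 \<le> c" using bdd_mart_bounded[OF N abT(1)] not_empty order_trans[OF norm_ge_zero] by blast
  have hb: "norm (h \<omega>) \<le> 2 * c" if "\<omega> \<in> space P" for \<omega>
    using bdd_mart_bounded[OF N abT(1) that] c0 by (auto simp: h_def indicator_def)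
  have diff: "norm (N b \<omega> - N a \<omega>) \<le> 2 * c" if "\<omega> \<in> space P" for \<omega>
    using norm_triangle_ineq4[of "N b \<omega>" "N a \<omega>"] bdd_mart_bounded[OF N abT(1) that] bdd_mart_bounded[OF N abT(2) that] by linarith
  have i1: "integrable P (\<lambda>\<omega>. indicat_real B \<omega> * (norm (N b \<omega> - N a \<omega>))\<^sup>2)"
  proof (rule integrable_bounded[where c="(2 * c)\<^sup>2"])
    show "(\<lambda>\<omega>. indicat_real B \<omega> * (norm (N b \<omega> - N a \<omega>))\<^sup>2) \<in> borel_measurable P" using NP BP by measurable
    fix \<omega> assume "\<omega> \<in> space P"
    then have "(norm (N b \<omega> - N a \<omega>))\<^sup>2 \<le> (2 * c)\<^sup>2" by (intro power_mono diff) auto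
    then show "\<bar>indicat_real B \<omega> * (norm (N b \<omega> - N a \<omega>))\<^sup>2\<bar> \<le> (2 * c)\<^sup>2" by (auto simp: indicator_def)
  qed
  have i2: "integrable P (\<lambda>\<omega>. h \<omega> \<bullet> (N b \<omega> - N a \<omega>))"
  proof (rule integrable_bounded[where c="(2 * c) * (2 * c)"])
    show "(\<lambda>\<omega>. h \<omega> \<bullet> (N b \<omega> - N a \<omega>)) \<in> borel_measurable P"
      using NP measurable_F_P[OF hm abT(1)] by measurable
    fix \<omega> assume w: "\<omega> \<in> space P"
    have "\<bar>h \<omega> \<bullet> (N b \<omega> - N a \<omega>)\<bar> \<le> norm (h \<omega>) * norm (N b \<omega> - N a \<omega>)" by (rule Cauchy_Schwarz_ineq2)
    also have "\<dots> \<le> (2 * c) * (2 * c)" using hb[OF w] diff[OF w] c0 by (intro mult_mono) auto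
    finally show "\<bar>h \<omega> \<bullet> (N b \<omega> - N a \<omega>)\<bar> \<le> (2 * c) * (2 * c)" .
  qed
  have "(\<integral>\<omega>. indicat_real B \<omega> * ((norm (N b \<omega>))\<^sup>2 - (norm (N a \<omega>))\<^sup>2) \<partial>P) =
      (\<integral>\<omega>. indicat_real B \<omega> * (norm (N b \<omega> - N a \<omega>))\<^sup>2 + h \<omega> \<bullet> (N b \<omega> - N a \<omega>) \<partial>P)"
    by (intro Bochner_Integration.integral_cong refl)
      (auto simp: h_def indicator_def power2_norm_eq_inner inner_diff_left inner_diff_right inner_commute)
  also have "\<dots> = (\<integral>\<omega>. indicat_real B \<omega> * (norm (N b \<omega> - N a \<omega>))\<^sup>2 \<partial>P) + (\<integral>\<omega>. h \<omega> \<bullet> (N b \<omega> - N a \<omega>) \<partial>P)"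
    using i1 i2 by simp
  finally show ?thesis using bdd_mart_orthogonal[OF N ab hm hb] by simp
qed

text \<open>The Ito isometry in the form of an inequality: terms from different cells are
  orthogonal, and the square of a single term is bounded by Cauchy-Schwarz, since \<open>K\<close>
  and \<open>N\<close> are vector-valued while the Doleans measure records only the norm of
  \<open>N\<close>.\<close>

lemma bdd_mart_control:
  fixes N :: "('a, 'c::euclidean_space) process"
  assumes N: "bdd_mart N c"
  obtains D where "sets D = sets PA" "finite_measure D"
    "\<And>K. elem K \<Longrightarrow> (\<integral>\<^sup>+\<omega>. ennreal ((eint K N T \<omega>)\<^sup>2) \<partial>P) \<le> (\<integral>\<^sup>+p. ennreal ((norm (K (fst p) (snd p)))\<^sup>2) \<partial>D)"
proof -
  have c0: "0 \<le> c"
  proof -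
    obtain \<omega> where "\<omega> \<in> space P" using not_empty by blast
    moreover have "0 \<in> {0..T}" using T_pos by simp
    ultimately show ?thesis using order_trans[OF norm_ge_zero bdd_mart_bounded[OF N]] by blast
  qed
  interpret increments P F T "\<lambda>t \<omega>. (norm (N t \<omega>))\<^sup>2" "c\<^sup>2"
  proof unfold_locales
    show "(\<lambda>\<omega>. (norm (N t \<omega>))\<^sup>2) \<in> borel_measurable (F t)" if "t \<in> {0..T}" for t
      using bdd_mart_measurable[OF N that] by measurable
    show "\<bar>(norm (N t \<omega>))\<^sup>2\<bar> \<le> c\<^sup>2" if "t \<in> {0..T}" "\<omega> \<in> space P" for t \<omega>
      using power_mono[OF bdd_mart_bounded[OF N that] norm_ge_zero, of 2] by simp
    show "AE \<omega> in P. cadlag_on T (\<lambda>t. (norm (N t \<omega>))\<^sup>2)"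
      using bdd_mart_cadlag[OF N]
    proof eventually_elim
      case (elim \<omega>)
      show ?case
      proof (rule cadlag_onI)
        show "((\<lambda>t. (norm (N t \<omega>))\<^sup>2) \<longlongrightarrow> (norm (N t \<omega>))\<^sup>2) (at_right t)" if "0 \<le> t" "t < T" for t
          by (intro tendsto_power tendsto_norm cadlag_right[OF elim that])
        fix t assume t: "0 < t" "t \<le> T"
        obtain l where "((\<lambda>t. N t \<omega>) \<longlongrightarrow> l) (at_left t)" by (rule cadlag_left[OF elim t])
        then have "((\<lambda>t. (norm (N t \<omega>))\<^sup>2) \<longlongrightarrow> (norm l)\<^sup>2) (at_left t)" by (intro tendsto_power tendsto_norm)
        then show "\<exists>l. ((\<lambda>t. (norm (N t \<omega>))\<^sup>2) \<longlongrightarrow> l) (at_left t)" by blast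
      qed
    qed
    show "0 \<le> (\<integral>\<omega>. indicat_real B \<omega> * ((norm (N b \<omega>))\<^sup>2 - (norm (N a \<omega>))\<^sup>2) \<partial>P)"
      if "0 \<le> a" "a \<le> b" "b \<le> T" "B \<in> sets (F a)" for a b B
      unfolding bdd_mart_square_increment[OF N that] by (intro integral_nonneg_AE) auto
  qed
  obtain D where D: "sets D = sets PA" "finite_measure D"
    "\<And>a b B. 0 \<le> a \<Longrightarrow> a < b \<Longrightarrow> b \<le> T \<Longrightarrow> B \<in> sets (F a) \<Longrightarrow>
      emeasure D ({a<..b} \<times> B) = ennreal (\<integral>\<omega>. indicat_real B \<omega> * ((norm (N b \<omega>))\<^sup>2 - (norm (N a \<omega>))\<^sup>2) \<partial>P)"
    by (rule Doleans_measure, rule that)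
  have spD: "space D = {0..T} \<times> space P" using sets_eq_imp_space_eq[OF D(1)] space_PA by simp
  \<comment> \<open>For \<open>u\<close> the indicator of an event of \<open>F a\<close> this is the
    defining property of \<open>D\<close>. Both sides are integrals of \<open>u\<close> against
    measures on \<open>F a\<close>, one an image of a density of \<open>P\<close>, the other an
    image of \<open>D\<close> restricted to the strip; equal measures give equal integrals.\<close>
  have transfer: "(\<integral>\<^sup>+\<omega>. ennreal ((norm (N b \<omega> - N a \<omega>))\<^sup>2) * u \<omega> \<partial>P) = (\<integral>\<^sup>+p. u (snd p) * indicator ({a<..b} \<times> space P) p \<partial>D)"
    if ab: "0 \<le> a" "a < b" "b \<le> T" and u: "u \<in> borel_measurable (F a)" for a b and u :: "'a \<Rightarrow> ennreal"
  proof -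
    have abT: "a \<in> {0..T}" "b \<in> {0..T}" using ab by auto
    note spa = space_F[OF abT(1)]
    have NP: "N a \<in> borel_measurable P" "N b \<in> borel_measurable P"
      by (rule measurable_F_P[OF bdd_mart_measurable[OF N abT(1)] abT(1)], rule measurable_F_P[OF bdd_mart_measurable[OF N abT(2)] abT(2)])
    define w where "w \<omega> = ennreal ((norm (N b \<omega> - N a \<omega>))\<^sup>2)" for \<omega>
    have w: "w \<in> borel_measurable P" unfolding w_def[abs_def] using NP by measurable
    let ?R = "{a<..b} \<times> space P"
    have rect: "{a<..b} \<times> B \<in> sets D" if "B \<in> sets (F a)" for B
      unfolding D(1) using that ab by (intro pred_gen_in_PA) (unfold pred_gen_def, blast)
    have R: "?R \<in> sets D" using rect[OF sets.top[of "F a"]] spa by simp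
    have idm: "(\<lambda>x. x) \<in> measurable (density P w) (F a)"
      using sets_F[OF abT(1)] spa by (auto intro!: measurableI)
    have snm: "snd \<in> measurable (restrict_space D ?R) (F a)"
    proof (rule measurableI)
      fix x assume "x \<in> space (restrict_space D ?R)"
      then show "snd x \<in> space (F a)" by (auto simp: space_restrict_space spa)
    next
      fix B assume B: "B \<in> sets (F a)"
      then have "B \<subseteq> space P" using sets.sets_into_space[OF B] spa by simp
      then have "snd -` B \<inter> space (restrict_space D ?R) = ?R \<inter> ({a<..b} \<times> B)"
        using ab by (auto simp: space_restrict_space spD)
      then show "snd -` B \<inter> space (restrict_space D ?R) \<in> sets (restrict_space D ?R)"
        using rect[OF B] by (auto simp: sets_restrict_space)
    qed
    have eq: "distr (density P w) (F a) (\<lambda>x. x) = distr (restrict_space D ?R) (F a) snd"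
    proof (rule measure_eqI)
      fix B assume "B \<in> sets (distr (density P w) (F a) (\<lambda>x. x))"
      then have B: "B \<in> sets (F a)" by simp
      then have BP: "B \<in> sets P" "B \<subseteq> space P" using sets_F[OF abT(1)] sets.sets_into_space[OF B] spa by auto
      have "emeasure (distr (density P w) (F a) (\<lambda>x. x)) B = (\<integral>\<^sup>+\<omega>. w \<omega> * indicator B \<omega> \<partial>P)"
        using B BP idm w by (simp add: emeasure_distr emeasure_density Int_absorb2)
      also have "\<dots> = (\<integral>\<^sup>+\<omega>. ennreal (indicat_real B \<omega> * (norm (N b \<omega> - N a \<omega>))\<^sup>2) \<partial>P)"
        by (intro nn_integral_cong) (simp add: w_def indicator_def)
      also have "\<dots> = ennreal (\<integral>\<omega>. indicat_real B \<omega> * (norm (N b \<omega> - N a \<omega>))\<^sup>2 \<partial>P)"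
      proof (rule nn_integral_eq_integral)
        show "integrable P (\<lambda>\<omega>. indicat_real B \<omega> * (norm (N b \<omega> - N a \<omega>))\<^sup>2)"
        proof (rule integrable_bounded[where c="(2 * c)\<^sup>2"])
          show "(\<lambda>\<omega>. indicat_real B \<omega> * (norm (N b \<omega> - N a \<omega>))\<^sup>2) \<in> borel_measurable P" using NP BP(1) by measurable
          fix \<omega> assume om: "\<omega> \<in> space P"
          have "norm (N b \<omega> - N a \<omega>) \<le> 2 * c"
            using norm_triangle_ineq4[of "N b \<omega>" "N a \<omega>"] bdd_mart_bounded[OF N abT(1) om] bdd_mart_bounded[OF N abT(2) om] by linarith
          then have "(norm (N b \<omega> - N a \<omega>))\<^sup>2 \<le> (2 * c)\<^sup>2" by (intro power_mono) auto
          then show "\<bar>indicat_real B \<omega> * (norm (N b \<omega> - N a \<omega>))\<^sup>2\<bar> \<le> (2 * c)\<^sup>2" by (auto simp: indicator_def)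
        qed
      qed auto
      also have "\<dots> = emeasure D ({a<..b} \<times> B)"
        using D(3)[OF ab B] bdd_mart_square_increment[OF N ab(1) less_imp_le[OF ab(2)] ab(3) B] by simp
      also have "\<dots> = emeasure (distr (restrict_space D ?R) (F a) snd) B"
      proof -
        have "snd -` B \<inter> space (restrict_space D ?R) = {a<..b} \<times> B"
          using ab BP(2) by (auto simp: space_restrict_space spD)
        moreover have "emeasure (restrict_space D ?R) ({a<..b} \<times> B) = emeasure D ({a<..b} \<times> B)"
          using sets.Int_space_eq2[OF R] R BP(2) by (intro emeasure_restrict_space) (auto simp: Int_commute)
        ultimately show ?thesis using emeasure_distr[OF snm B] by simp
      qed
      finally show "emeasure (distr (density P w) (F a) (\<lambda>x. x)) B = emeasure (distr (restrict_space D ?R) (F a) snd) B" .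
    qed simp
    have "(\<integral>\<^sup>+\<omega>. w \<omega> * u \<omega> \<partial>P) = (\<integral>\<^sup>+\<omega>. u \<omega> \<partial>density P w)"
      by (rule nn_integral_density[OF w measurable_F_P[OF u abT(1)], symmetric])
    also have "\<dots> = (\<integral>\<^sup>+\<omega>. u \<omega> \<partial>distr (density P w) (F a) (\<lambda>x. x))" by (rule nn_integral_distr[OF idm, symmetric]) (simp add: u)
    also have "\<dots> = (\<integral>\<^sup>+p. u (snd p) \<partial>restrict_space D ?R)" unfolding eq by (rule nn_integral_distr[OF snm]) (simp add: u)
    also have "\<dots> = (\<integral>\<^sup>+p. u (snd p) * indicator ?R p \<partial>D)" using R by (intro nn_integral_restrict_space) (simp add: sets.Int_space_eq2)
    finally show ?thesis by (simp add: w_def)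
  qed
  show ?thesis
  proof (rule that[OF D(1,2)])
    fix K :: "('a, 'c) process" assume K: "elem K"
    obtain E where E: "simple E K" using K by (auto simp: elem_def)
    note gE = simple_grid[OF E]
    have fin: "finite (E - {T})" using gE by (simp add: grid_def)
    obtain k where k: "0 \<le> k" "\<And>t \<omega>. t \<in> {0..T} \<Longrightarrow> \<omega> \<in> space P \<Longrightarrow> norm (K t \<omega>) \<le> k"
      using simple_bounded[OF E] by blast
    define x where "x a \<omega> = K (nxt E a) \<omega> \<bullet> (N (nxt E a) \<omega> - N a \<omega>)" for a \<omega>
    have n: "0 \<le> a" "a \<in> {0..T}" "nxt E a \<in> {0..T}" "a < nxt E a" "nxt E a \<le> T" if "a \<in> E - {T}" for a
      using nxt[OF gE that] by auto
    have KP: "K (nxt E a) \<in> borel_measurable P" if "a \<in> E - {T}" for a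
      by (rule measurable_F_P[OF simple_measurable[OF E that] n(2)[OF that]])
    have NP: "N t \<in> borel_measurable P" if "t \<in> {0..T}" for t by (rule measurable_F_P[OF bdd_mart_measurable[OF N that] that])
    have xm: "x a \<in> borel_measurable P" if "a \<in> E - {T}" for a
      unfolding x_def[abs_def] using KP[OF that] NP[OF n(2)[OF that]] NP[OF n(3)[OF that]] by measurable
    have dN: "norm (N (nxt E a) \<omega> - N a \<omega>) \<le> 2 * c" if "a \<in> E - {T}" "\<omega> \<in> space P" for a \<omega>
      using norm_triangle_ineq4[of "N (nxt E a) \<omega>" "N a \<omega>"] bdd_mart_bounded[OF N n(2)[OF that(1)] that(2)]
        bdd_mart_bounded[OF N n(3)[OF that(1)] that(2)] by linarith
    have xb: "\<bar>x a \<omega>\<bar> \<le> k * (2 * c)" if "a \<in> E - {T}" "\<omega> \<in> space P" for a \<omega>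
    proof -
      have "\<bar>x a \<omega>\<bar> \<le> norm (K (nxt E a) \<omega>) * norm (N (nxt E a) \<omega> - N a \<omega>)" unfolding x_def by (rule Cauchy_Schwarz_ineq2)
      also have "\<dots> \<le> k * (2 * c)" using k(1) k(2)[OF n(3)[OF that(1)] that(2)] dN[OF that] by (intro mult_mono) auto
      finally show ?thesis .
    qed
    have xx: "integrable P (\<lambda>\<omega>. x a \<omega> * x b \<omega>)" if "a \<in> E - {T}" "b \<in> E - {T}" for a b
    proof (rule integrable_bounded[where c="(k * (2 * c)) * (k * (2 * c))"])
      show "(\<lambda>\<omega>. x a \<omega> * x b \<omega>) \<in> borel_measurable P" using xm[OF that(1)] xm[OF that(2)] by measurable
      show "\<bar>x a \<omega> * x b \<omega>\<bar> \<le> (k * (2 * c)) * (k * (2 * c))" if "\<omega> \<in> space P" for \<omega>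
        unfolding abs_mult using xb \<open>a \<in> E - {T}\<close> \<open>b \<in> E - {T}\<close> that k(1) c0 by (intro mult_mono) auto
    qed
    \<comment> \<open>The earlier factor \<open>x a\<close> is known at time \<open>b\<close>, so it
      can be moved into the integrand of the later increment.\<close>
    have orth: "(\<integral>\<omega>. x a \<omega> * x b \<omega> \<partial>P) = 0" if a: "a \<in> E - {T}" and b: "b \<in> E - {T}" and ab: "a < b" for a b
    proof -
      have nab: "nxt E a \<le> b" using nxt(7)[OF gE a] b ab by auto
      have xF: "x a \<in> borel_measurable (F b)"
      proof -
        have "K (nxt E a) \<in> borel_measurable (F b)"
          by (rule measurable_F_mono[OF simple_measurable[OF E a]]) (use ab n[OF a] n[OF b] in auto)
        moreover have "N (nxt E a) \<in> borel_measurable (F b)"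
          by (rule measurable_F_mono[OF bdd_mart_measurable[OF N n(3)[OF a]]]) (use nab n[OF a] n[OF b] in auto)
        moreover have "N a \<in> borel_measurable (F b)"
          by (rule measurable_F_mono[OF bdd_mart_measurable[OF N n(2)[OF a]]]) (use ab n[OF a] n[OF b] in auto)
        ultimately show ?thesis unfolding x_def[abs_def] by measurable
      qed
      have "(\<integral>\<omega>. (x a \<omega> *\<^sub>R K (nxt E b) \<omega>) \<bullet> (N (nxt E b) \<omega> - N b \<omega>) \<partial>P) = 0"
      proof (rule bdd_mart_orthogonal[OF N n(1)[OF b] less_imp_le[OF n(4)[OF b]] n(5)[OF b], where d="(k * (2 * c)) * k"])
        show "(\<lambda>\<omega>. x a \<omega> *\<^sub>R K (nxt E b) \<omega>) \<in> borel_measurable (F b)" using xF simple_measurable[OF E b] by measurable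
        show "norm (x a \<omega> *\<^sub>R K (nxt E b) \<omega>) \<le> (k * (2 * c)) * k" if "\<omega> \<in> space P" for \<omega>
          unfolding norm_scaleR using xb[OF a that] k(1) k(2)[OF n(3)[OF b] that] c0 by (intro mult_mono) auto
      qed
      then show ?thesis by (simp add: x_def)
    qed
    have eint: "eint K N T \<omega> = (\<Sum>a\<in>E - {T}. x a \<omega>)" if "\<omega> \<in> space P" for \<omega>
      unfolding eint_eq[OF E that] grid_integral_def x_def
    proof (intro sum.cong refl)
      fix a assume a: "a \<in> E - {T}"
      have "min (nxt E a) T = nxt E a" "min a T = a" using n[OF a] by auto
      then show "K (nxt E a) \<omega> \<bullet> (N (min (nxt E a) T) \<omega> - N (min a T) \<omega>) = K (nxt E a) \<omega> \<bullet> (N (nxt E a) \<omega> - N a \<omega>)" by simp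
    qed
    have "(\<integral>\<^sup>+\<omega>. ennreal ((eint K N T \<omega>)\<^sup>2) \<partial>P) = (\<integral>\<^sup>+\<omega>. ennreal (\<Sum>a\<in>E - {T}. \<Sum>b\<in>E - {T}. x a \<omega> * x b \<omega>) \<partial>P)"
      by (intro nn_integral_cong) (simp add: eint power2_eq_square sum_product)
    also have "\<dots> = ennreal (\<integral>\<omega>. (\<Sum>a\<in>E - {T}. \<Sum>b\<in>E - {T}. x a \<omega> * x b \<omega>) \<partial>P)"
      by (intro nn_integral_eq_integral Bochner_Integration.integrable_sum xx AE_I2)
        (simp_all add: sum_product[symmetric])
    also have "(\<integral>\<omega>. (\<Sum>a\<in>E - {T}. \<Sum>b\<in>E - {T}. x a \<omega> * x b \<omega>) \<partial>P) = (\<Sum>a\<in>E - {T}. \<Sum>b\<in>E - {T}. \<integral>\<omega>. x a \<omega> * x b \<omega> \<partial>P)"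
      using xx by (subst Bochner_Integration.integral_sum, intro Bochner_Integration.integrable_sum, assumption+)
        (intro sum.cong refl Bochner_Integration.integral_sum, auto)
    also have "\<dots> = (\<Sum>a\<in>E - {T}. \<integral>\<omega>. x a \<omega> * x a \<omega> \<partial>P)"
    proof (intro sum.cong refl)
      fix a assume a: "a \<in> E - {T}"
      have "(\<Sum>b\<in>E - {T}. \<integral>\<omega>. x a \<omega> * x b \<omega> \<partial>P) = (\<Sum>b\<in>{a}. \<integral>\<omega>. x a \<omega> * x b \<omega> \<partial>P)"
      proof (rule sum.mono_neutral_right[OF fin])
        show "{a} \<subseteq> E - {T}" using a by simp
        show "\<forall>b\<in>E - {T} - {a}. (\<integral>\<omega>. x a \<omega> * x b \<omega> \<partial>P) = 0"
        proof
          fix b assume b: "b \<in> E - {T} - {a}"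
          then consider "a < b" | "b < a" by force
          then show "(\<integral>\<omega>. x a \<omega> * x b \<omega> \<partial>P) = 0"
          proof cases
            case 1
            then show ?thesis using orth[OF a] b by blast
          next
            case 2
            then show ?thesis using orth[of b a] a b by (simp add: mult.commute)
          qed
        qed
      qed
      then show "(\<Sum>b\<in>E - {T}. \<integral>\<omega>. x a \<omega> * x b \<omega> \<partial>P) = (\<integral>\<omega>. x a \<omega> * x a \<omega> \<partial>P)" by simp
    qed
    also have "ennreal \<dots> = (\<Sum>a\<in>E - {T}. ennreal (\<integral>\<omega>. x a \<omega> * x a \<omega> \<partial>P))"
      by (intro sum_ennreal[symmetric] integral_nonneg_AE) auto
    also have "\<dots> \<le> (\<Sum>a\<in>E - {T}. \<integral>\<^sup>+p. ennreal ((norm (K (fst p) (snd p)))\<^sup>2) * indicator ({a<..nxt E a} \<times> space P) p \<partial>D)"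
    proof (rule sum_mono)
      fix a assume a: "a \<in> E - {T}"
      have "ennreal (\<integral>\<omega>. x a \<omega> * x a \<omega> \<partial>P) = (\<integral>\<^sup>+\<omega>. ennreal (x a \<omega> * x a \<omega>) \<partial>P)"
        by (rule nn_integral_eq_integral[OF xx[OF a a], symmetric]) auto
      also have "\<dots> \<le> (\<integral>\<^sup>+\<omega>. ennreal ((norm (N (nxt E a) \<omega> - N a \<omega>))\<^sup>2) * ennreal ((norm (K (nxt E a) \<omega>))\<^sup>2) \<partial>P)"
      proof (rule nn_integral_mono)
        fix \<omega>
        have "x a \<omega> * x a \<omega> \<le> (norm (N (nxt E a) \<omega> - N a \<omega>))\<^sup>2 * (norm (K (nxt E a) \<omega>))\<^sup>2"
        proof -
          have "\<bar>x a \<omega>\<bar>\<^sup>2 \<le> (norm (K (nxt E a) \<omega>) * norm (N (nxt E a) \<omega> - N a \<omega>))\<^sup>2"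
            unfolding x_def by (intro power_mono Cauchy_Schwarz_ineq2) auto
          then show ?thesis by (simp add: power_mult_distrib power2_eq_square ac_simps)
        qed
        then show "ennreal (x a \<omega> * x a \<omega>) \<le> ennreal ((norm (N (nxt E a) \<omega> - N a \<omega>))\<^sup>2) * ennreal ((norm (K (nxt E a) \<omega>))\<^sup>2)"
          by (simp add: ennreal_mult[symmetric] ennreal_leI)
      qed
      also have "\<dots> = (\<integral>\<^sup>+p. ennreal ((norm (K (nxt E a) (snd p)))\<^sup>2) * indicator ({a<..nxt E a} \<times> space P) p \<partial>D)"
      proof (rule transfer[OF n(1)[OF a] n(4)[OF a] n(5)[OF a]])
        show "(\<lambda>\<omega>. ennreal ((norm (K (nxt E a) \<omega>))\<^sup>2)) \<in> borel_measurable (F a)"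
          using simple_measurable[OF E a] by measurable
      qed
      also have "\<dots> = (\<integral>\<^sup>+p. ennreal ((norm (K (fst p) (snd p)))\<^sup>2) * indicator ({a<..nxt E a} \<times> space P) p \<partial>D)"
      proof (rule nn_integral_cong)
        fix p
        show "ennreal ((norm (K (nxt E a) (snd p)))\<^sup>2) * indicator ({a<..nxt E a} \<times> space P) p =
            ennreal ((norm (K (fst p) (snd p)))\<^sup>2) * indicator ({a<..nxt E a} \<times> space P) p"
        proof (cases "p \<in> {a<..nxt E a} \<times> space P")
          case True
          then have "fst p \<in> {a<..nxt E a}" "snd p \<in> space P" by (auto simp: mem_Times_iff)
          then show ?thesis using simple_cell[OF E a, of "fst p" "snd p"] by simp
        qed simp
      qed
      finally show "ennreal (\<integral>\<omega>. x a \<omega> * x a \<omega> \<partial>P) \<le>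
        (\<integral>\<^sup>+p. ennreal ((norm (K (fst p) (snd p)))\<^sup>2) * indicator ({a<..nxt E a} \<times> space P) p \<partial>D)" .
    qed
    also have "\<dots> = (\<integral>\<^sup>+p. (\<Sum>a\<in>E - {T}. ennreal ((norm (K (fst p) (snd p)))\<^sup>2) * indicator ({a<..nxt E a} \<times> space P) p) \<partial>D)"
    proof (rule nn_integral_sum[symmetric])
      fix a assume a: "a \<in> E - {T}"
      have "{a<..nxt E a} \<times> space P \<in> sets D"
        unfolding D(1) using n[OF a] sets.top[of "F a"] space_F[OF n(2)[OF a]]
        by (intro pred_gen_in_PA) (unfold pred_gen_def, auto)
      moreover have "(\<lambda>p. K (fst p) (snd p)) \<in> borel_measurable D"
        using elem_predictable[OF K] by (simp add: measurable_cong_sets[OF D(1) refl])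
      ultimately show "(\<lambda>p. ennreal ((norm (K (fst p) (snd p)))\<^sup>2) * indicator ({a<..nxt E a} \<times> space P) p) \<in> borel_measurable D"
        by measurable
    qed
    \<comment> \<open>The cells are disjoint and leave out time zero, hence an inequality.\<close>
    also have "\<dots> \<le> (\<integral>\<^sup>+p. ennreal ((norm (K (fst p) (snd p)))\<^sup>2) \<partial>D)"
    proof (rule nn_integral_mono)
      fix p
      have "(\<Sum>a\<in>E - {T}. indicator ({a<..nxt E a} \<times> space P) p :: ennreal) =
          indicator (\<Union>a\<in>E - {T}. {a<..nxt E a} \<times> space P) p"
      proof (rule indicator_UN_disjoint[OF fin, symmetric])
        show "disjoint_family_on (\<lambda>a. {a<..nxt E a} \<times> space P) (E - {T})"
          unfolding disjoint_family_on_def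
        proof (intro ballI impI)
          fix a b assume ab: "a \<in> E - {T}" "b \<in> E - {T}" "a \<noteq> b"
          then have "nxt E a \<le> b \<or> nxt E b \<le> a" using nxt(7)[OF gE, of a b] nxt(7)[OF gE, of b a] by force
          then show "({a<..nxt E a} \<times> space P) \<inter> ({b<..nxt E b} \<times> space P) = {}" by auto
        qed
      qed
      also have "\<dots> \<le> 1" by (simp add: indicator_def)
      finally have "ennreal ((norm (K (fst p) (snd p)))\<^sup>2) * (\<Sum>a\<in>E - {T}. indicator ({a<..nxt E a} \<times> space P) p) \<le>
          ennreal ((norm (K (fst p) (snd p)))\<^sup>2) * 1" by (rule mult_left_mono) simp
      then show "(\<Sum>a\<in>E - {T}. ennreal ((norm (K (fst p) (snd p)))\<^sup>2) * indicator ({a<..nxt E a} \<times> space P) p) \<le>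
        ennreal ((norm (K (fst p) (snd p)))\<^sup>2)" by (simp add: sum_distrib_left)
    qed
    finally show "(\<integral>\<^sup>+\<omega>. ennreal ((eint K N T \<omega>)\<^sup>2) \<partial>P) \<le> (\<integral>\<^sup>+p. ennreal ((norm (K (fst p) (snd p)))\<^sup>2) \<partial>D)" .
  qed
qed

text \<open>A control of the integral at the final time only. Localization and the change from
  \<open>Q\<close> to \<open>P\<close> are carried out in this form;
  \<open>terminal_control_controlled\<close> recovers the supremum over time.\<close>

definition terminal_control :: "(real \<times> 'a) measure \<Rightarrow> ('a, 'c::euclidean_space) process \<Rightarrow> bool" where
  "terminal_control \<mu> S \<longleftrightarrow> sets \<mu> = sets PA \<and> finite_measure \<mu> \<and>
     (\<forall>e>0. \<exists>d>0. \<forall>K. elem K \<longrightarrow>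
        (\<integral>\<^sup>+p. ennreal ((norm (K (fst p) (snd p)))\<^sup>2) \<partial>\<mu>) < ennreal d \<longrightarrow>
        prob {\<omega>\<in>space P. e < \<bar>eint K S T \<omega>\<bar>} < e)"

text \<open>Each localized martingale has its own Doleans measure. A mixture with strictly positive
  weights dominates a multiple of each of them, so smallness under the mixture gives smallness under
  the one whose \<open>G k\<close> misses less than \<open>e / 2\<close> of the probability.\<close>

lemma local_terminal_control:
  fixes N :: "nat \<Rightarrow> ('a, 'c::euclidean_space) process"
  assumes N: "\<And>k. bdd_mart (N k) (c k)" and S: "adc S"
    and G: "\<And>k. G k \<in> sets P" "\<And>k. AE \<omega> in P. \<omega> \<in> G k \<longrightarrow> (\<forall>t\<in>{0..T}. N k t \<omega> = S t \<omega> - S 0 \<omega>)"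
    and lim: "(\<lambda>k. prob (G k)) \<longlonglongrightarrow> 1"
  obtains \<mu> where "terminal_control \<mu> S"
proof -
  define good where "good k D \<longleftrightarrow> sets D = sets PA \<and> finite_measure D \<and>
    (\<forall>K. elem K \<longrightarrow> (\<integral>\<^sup>+\<omega>. ennreal ((eint K (N k) T \<omega>)\<^sup>2) \<partial>P) \<le> (\<integral>\<^sup>+p. ennreal ((norm (K (fst p) (snd p)))\<^sup>2) \<partial>D))"
    for k D
  have "\<exists>D. good k D" for k
    by (rule bdd_mart_control[OF N[of k]]) (auto simp: good_def)
  then obtain D where D: "\<And>k. good k (D k)" by metis
  have sD: "sets (D k) = sets PA" and fD: "finite_measure (D k)" for k using D[of k] by (auto simp: good_def)
  have cD: "(\<integral>\<^sup>+\<omega>. ennreal ((eint K (N k) T \<omega>)\<^sup>2) \<partial>P) \<le> (\<integral>\<^sup>+p. ennreal ((norm (K (fst p) (snd p)))\<^sup>2) \<partial>D k)"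
    if "elem K" for k K using D[of k] that by (auto simp: good_def)
  \<comment> \<open>Scales \<open>D k\<close> to total mass at most one, so that the mixture can be
    formed as a bind of subprobability measures.\<close>
  define r where "r k = 1 / (1 + measure (D k) (space (D k)))" for k
  have r: "0 < r k" "r k * measure (D k) (space (D k)) \<le> 1" for k
    by (auto simp: r_def divide_simps add_pos_nonneg)
  define M where "M k = scale_measure (ennreal (r k)) (D k)" for k
  have ssM: "M k \<in> space (subprob_algebra PA)" for k
  proof -
    have "emeasure (M k) (space (M k)) = ennreal (r k * measure (D k) (space (D k)))"
      using r(1)[of k] by (simp add: M_def space_scale_measure finite_measure.emeasure_eq_measure[OF fD] ennreal_mult)
    then have "emeasure (M k) (space (M k)) \<le> 1" using r(2)[of k] by (simp add: ennreal_le_1)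
    moreover have "space (M k) \<noteq> {}"
      using sets_eq_imp_space_eq[OF sD[of k]] space_PA T_pos not_empty by (simp add: M_def space_scale_measure)
    ultimately have "subprob_space (M k)" by (intro subprob_spaceI)
    then show ?thesis by (simp add: space_subprob_algebra M_def sD)
  qed
  \<comment> \<open>The geometric distribution is chosen for its positive mass at every
    index.\<close>
  define p :: "nat pmf" where "p = geometric_pmf (1/2)"
  have p: "0 < pmf p k" for k by (simp add: p_def pmf_geometric)
  have Mm: "M \<in> measurable (measure_pmf p) (subprob_algebra PA)" using ssM by simp
  define \<mu> where "\<mu> = measure_pmf p \<bind> M"
  have s\<mu>: "sets \<mu> = sets PA" unfolding \<mu>_def by (rule sets_bind) (auto simp: M_def sD)
  have int_\<mu>: "(\<integral>\<^sup>+x. g x \<partial>\<mu>) = (\<integral>\<^sup>+k. (\<integral>\<^sup>+x. g x \<partial>M k) \<partial>measure_pmf p)" if "g \<in> borel_measurable PA" for g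
    unfolding \<mu>_def by (rule nn_integral_bind[OF that Mm])
  have fin: "finite_measure \<mu>"
  proof
    have "emeasure \<mu> (space \<mu>) = (\<integral>\<^sup>+k. emeasure (M k) (space (M k)) \<partial>measure_pmf p)"
      using int_\<mu>[of "\<lambda>_. 1"] by simp
    also have "\<dots> \<le> (\<integral>\<^sup>+k. 1 \<partial>measure_pmf p)"
    proof (rule nn_integral_mono)
      fix k
      interpret subprob_space "M k" using ssM[of k] by (simp add: space_subprob_algebra)
      show "emeasure (M k) (space (M k)) \<le> 1" by (rule emeasure_space_le_1)
    qed
    finally show "emeasure \<mu> (space \<mu>) \<noteq> \<infinity>" by (auto simp: measure_pmf.emeasure_space_1 top_unique)
  qed
  have low: "ennreal (pmf p k * r k) * (\<integral>\<^sup>+x. g x \<partial>D k) \<le> (\<integral>\<^sup>+x. g x \<partial>\<mu>)" if g: "g \<in> borel_measurable PA" for g k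
  proof -
    have gD: "g \<in> borel_measurable (D k)" using g by (simp add: measurable_cong_sets[OF sD refl])
    have "ennreal (pmf p k * r k) * (\<integral>\<^sup>+x. g x \<partial>D k) = ennreal (pmf p k) * (\<integral>\<^sup>+x. g x \<partial>M k)"
      using r(1)[of k] gD by (simp add: M_def nn_integral_scale_measure ennreal_mult mult.assoc)
    also have "\<dots> \<le> (\<integral>\<^sup>+k. ennreal (pmf p k) * (\<integral>\<^sup>+x. g x \<partial>M k) \<partial>count_space UNIV)"
      by (rule nn_integral_ge_point) simp
    also have "\<dots> = (\<integral>\<^sup>+x. g x \<partial>\<mu>)" unfolding int_\<mu>[OF g] by (rule nn_integral_measure_pmf[symmetric])
    finally show ?thesis .
  qed
  have "terminal_control \<mu> S"
    unfolding terminal_control_def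
  proof (intro conjI allI impI s\<mu> fin)
    fix e :: real assume e: "0 < e"
    have "\<forall>\<^sub>F k in sequentially. 1 - e / 2 < prob (G k)" using order_tendstoD(1)[OF lim] e by simp
    then obtain k where k: "1 - e / 2 < prob (G k)" using eventually_happens'[OF trivial_limit_sequentially] by blast
    define A where "A = pmf p k * r k"
    have A: "0 < A" using p r by (simp add: A_def)
    \<comment> \<open>From Chebyshev's inequality: \<open>e\<^sup>2 * prob B\<close> is at most the
      second moment \<open>I\<close>, and \<open>I\<close> will be below
      \<open>d / A\<close>.\<close>
    define d where "d = A * (e\<^sup>2 * (e / 2))"
    show "\<exists>d>0. \<forall>K. elem K \<longrightarrow>
        (\<integral>\<^sup>+p. ennreal ((norm (K (fst p) (snd p)))\<^sup>2) \<partial>\<mu>) < ennreal d \<longrightarrow>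
        prob {\<omega>\<in>space P. e < \<bar>eint K S T \<omega>\<bar>} < e"
    proof (intro exI[of _ d] conjI allI impI)
      show "0 < d" using A e by (simp add: d_def)
      fix K :: "('a, 'c) process" assume K: "elem K"
        and small: "(\<integral>\<^sup>+p. ennreal ((norm (K (fst p) (snd p)))\<^sup>2) \<partial>\<mu>) < ennreal d"
      define I where "I = (\<integral>\<^sup>+\<omega>. ennreal ((eint K (N k) T \<omega>)\<^sup>2) \<partial>P)"
      define B where "B = {\<omega>\<in>space P. e < \<bar>eint K (N k) T \<omega>\<bar>}"
      have TT: "T \<in> {0..T}" using T_pos by simp
      have Nadc: "adc (N k)"
        unfolding adapted_cadlag_def adapted_def using bdd_mart_measurable[OF N[of k]] bdd_mart_cadlag[OF N[of k]] by blast
      have em: "eint K (N k) T \<in> borel_measurable P" "eint K S T \<in> borel_measurable P"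
        using meas_proc_def[of "eint K (N k)"] meas_proc_def[of "eint K S"] adc_meas_proc[OF adc_eint[OF Nadc K]] adc_meas_proc[OF adc_eint[OF S K]] TT by blast+
      have B: "B \<in> sets P" unfolding B_def using em(1) by measurable
      have Km: "(\<lambda>p. ennreal ((norm (K (fst p) (snd p)))\<^sup>2)) \<in> borel_measurable PA"
        using elem_predictable[OF K] by measurable
      have "ennreal A * I \<le> ennreal A * (\<integral>\<^sup>+p. ennreal ((norm (K (fst p) (snd p)))\<^sup>2) \<partial>D k)"
        unfolding I_def by (rule mult_left_mono[OF cD[OF K]]) simp
      also have "\<dots> \<le> (\<integral>\<^sup>+p. ennreal ((norm (K (fst p) (snd p)))\<^sup>2) \<partial>\<mu>)" unfolding A_def by (rule low[OF Km])
      finally have AI: "ennreal A * I < ennreal d" using small by (rule order_le_less_trans)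
      have "ennreal (e\<^sup>2) * emeasure P B = (\<integral>\<^sup>+\<omega>. ennreal (e\<^sup>2) * indicator B \<omega> \<partial>P)"
        by (rule nn_integral_cmult_indicator[OF B, symmetric])
      also have "\<dots> \<le> I" unfolding I_def
      proof (rule nn_integral_mono)
        fix \<omega>
        show "ennreal (e\<^sup>2) * indicator B \<omega> \<le> ennreal ((eint K (N k) T \<omega>)\<^sup>2)"
        proof (cases "\<omega> \<in> B")
          case True
          then have "e\<^sup>2 \<le> \<bar>eint K (N k) T \<omega>\<bar>\<^sup>2" using e by (intro power_mono) (auto simp: B_def)
          then show ?thesis using True by (simp add: ennreal_leI)
        qed simp
      qed
      finally have "ennreal A * (ennreal (e\<^sup>2) * emeasure P B) < ennreal d"
        using AI mult_left_mono[of "ennreal (e\<^sup>2) * emeasure P B" I "ennreal A"] by (meson order_le_less_trans zero_le)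
      then have "ennreal (A * (e\<^sup>2 * prob B)) < ennreal d"
        using A e by (simp add: emeasure_eq_measure ennreal_mult)
      then have "A * (e\<^sup>2 * prob B) < d" using A e by (simp add: ennreal_less_iff)
      then have B2: "prob B < e / 2" using A e by (simp add: d_def)
      have GS: "space P - G k \<in> sets P" using G(1) by auto
      have "prob {\<omega>\<in>space P. e < \<bar>eint K S T \<omega>\<bar>} \<le> prob (B \<union> (space P - G k))"
      proof (rule finite_measure_mono_AE)
        show "B \<union> (space P - G k) \<in> sets P" using B GS by (rule sets.Un)
        show "AE \<omega> in P. \<omega> \<in> {\<omega>\<in>space P. e < \<bar>eint K S T \<omega>\<bar>} \<longrightarrow> \<omega> \<in> B \<union> (space P - G k)"
          using G(2)[of k]
        proof eventually_elim
          case (elim \<omega>)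
          show ?case
          proof
            assume w: "\<omega> \<in> {\<omega>\<in>space P. e < \<bar>eint K S T \<omega>\<bar>}"
            show "\<omega> \<in> B \<union> (space P - G k)"
            proof (cases "\<omega> \<in> G k")
              case True
              have "eint K (N k) T \<omega> = eint K (\<lambda>t \<omega>. S t \<omega> - S 0 \<omega>) T \<omega>"
                using w True elim TT by (intro eint_cong_right[OF K]) auto
              \<comment> \<open>Only increments of the integrator enter, so that \<open>S 0\<close>
                cancels.\<close>
              also have "\<dots> = eint K S T \<omega>" by (simp add: eint_def grid_integral_def)
              finally show ?thesis using w by (simp add: B_def)
            next
              case False
              then show ?thesis using w by simp
            qed
          qed
        qed
      qed
      also have "\<dots> \<le> prob B + prob (space P - G k)" by (rule measure_Un_le[OF B GS])
      also have "\<dots> < e" using B2 k prob_compl[OF G(1)] by simp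
      finally show "prob {\<omega>\<in>space P. e < \<bar>eint K S T \<omega>\<bar>} < e" .
    qed
  qed
  then show ?thesis by (rule that)
qed

text \<open>Stopping the integrand when the integral first exceeds \<open>e\<close> on the grid keeps it there, so that a
  bound at time \<open>T\<close> bounds the maximum.\<close>

lemma simple_until:
  fixes K :: "('a, 'c::euclidean_space) process" and S :: "('a, 'c) process" and e :: real
  assumes E: "simple E K" and S: "adc S"
  defines "K' \<equiv> \<lambda>t \<omega>. if \<forall>a\<in>E. a < t \<longrightarrow> \<bar>eint K S a \<omega>\<bar> \<le> e then K t \<omega> else 0"
  shows "simple E K'"
    and "\<omega> \<in> space P \<Longrightarrow> a \<in> E \<Longrightarrow> e < \<bar>eint K S a \<omega>\<bar> \<Longrightarrow> e < \<bar>eint K' S T \<omega>\<bar>"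
proof -
  note gE = simple_grid[OF E]
  have K: "elem K" using E by (auto simp: elem_def)
  note X = adc_eint[OF S K]
  have fin: "finite E" "E \<subseteq> {0..T}" using gE by (auto simp: grid_def)
  have less_nxt: "a' < nxt E a \<longleftrightarrow> a' \<le> a" if "a \<in> E - {T}" "a' \<in> E" for a a'
    using nxt[OF gE that(1)] that(2) by force
  have cell: "(a' < t) = (a' < nxt E a)" if "a \<in> E - {T}" "a' \<in> E" "a < t" "t \<le> nxt E a" for a a' t
    using nxt(7)[OF gE that(1,2)] that by force
  obtain c where c: "0 \<le> c" "\<And>t \<omega>. t \<in> {0..T} \<Longrightarrow> \<omega> \<in> space P \<Longrightarrow> norm (K t \<omega>) \<le> c"
    using simple_bounded[OF E] by blast
  show simple: "simple E K'"
  proof (rule simpleI[OF gE, where c=c])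
    have "K' 0 = K 0" using fin by (auto simp: K'_def fun_eq_iff subset_eq)
    then show "K' 0 \<in> borel_measurable (F 0)" using simple_zero[OF E] by simp
    show "norm (K' t \<omega>) \<le> c" if "t \<in> {0..T}" "\<omega> \<in> space P" for t \<omega>
      using c(1) c(2)[OF that] by (simp add: K'_def)
    show "K' t \<omega> = K' (nxt E a) \<omega>" if "a \<in> E - {T}" "a < t" "t \<le> nxt E a" "\<omega> \<in> space P" for a t \<omega>
    proof -
      have "(\<forall>a'\<in>E. a' < t \<longrightarrow> \<bar>eint K S a' \<omega>\<bar> \<le> e) = (\<forall>a'\<in>E. a' < nxt E a \<longrightarrow> \<bar>eint K S a' \<omega>\<bar> \<le> e)"
        using cell[OF that(1) _ that(2,3)] by blast
      then show ?thesis using simple_cell[OF E that] by (simp only: K'_def)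
    qed
    fix a assume a: "a \<in> E - {T}"
    have aT: "a \<in> {0..T}" using a fin by blast
    define A where "A = {\<omega>\<in>space (F a). \<forall>a'\<in>{a'\<in>E. a' \<le> a}. \<bar>eint K S a' \<omega>\<bar> \<le> e}"
    have A: "A \<in> sets (F a)" unfolding A_def
    proof (rule sets.sets_Collect_finite_All)
      show "finite {a'\<in>E. a' \<le> a}" using fin by simp
      fix a' assume a': "a' \<in> {a'\<in>E. a' \<le> a}"
      have "eint K S a' \<in> borel_measurable (F a')" by (rule adc_measurable[OF X]) (use a' fin in blast)
      then have "eint K S a' \<in> borel_measurable (F a)"
        by (rule measurable_F_mono) (use a' aT fin in auto)
      then show "{\<omega>\<in>space (F a). \<bar>eint K S a' \<omega>\<bar> \<le> e} \<in> sets (F a)" by measurable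
    qed
    have "K' (nxt E a) \<omega> = indicat_real A \<omega> *\<^sub>R K (nxt E a) \<omega>" if "\<omega> \<in> space (F a)" for \<omega>
      using that less_nxt[OF a] by (auto simp: K'_def A_def indicator_def)
    moreover have "(\<lambda>\<omega>. indicat_real A \<omega> *\<^sub>R K (nxt E a) \<omega>) \<in> borel_measurable (F a)"
      using A simple_measurable[OF E a] by measurable
    ultimately show "K' (nxt E a) \<in> borel_measurable (F a)"
      by (subst measurable_cong[of "F a" _ "\<lambda>\<omega>. indicat_real A \<omega> *\<^sub>R K (nxt E a) \<omega>"])
  qed
  assume w: "\<omega> \<in> space P" and a: "a \<in> E" "e < \<bar>eint K S a \<omega>\<bar>"
  define B where "B = {a\<in>E. e < \<bar>eint K S a \<omega>\<bar>}"
  \<comment> \<open>The first grid point at which the integral exceeds \<open>e\<close>. The stopped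
    integrand agrees with \<open>K\<close> on the cells up to \<open>b\<close> and vanishes
    afterwards, so its integral at \<open>T\<close> is the value of the original integral at
    \<open>b\<close>.\<close>
  define b where "b = Min B"
  have B: "finite B" "B \<noteq> {}" using fin a by (auto simp: B_def)
  have b: "b \<in> E" "e < \<bar>eint K S b \<omega>\<bar>" using Min_in[OF B] by (auto simp: b_def B_def)
  have before: "\<bar>eint K S a' \<omega>\<bar> \<le> e" if "a' \<in> E" "a' < b" for a'
    using Min_le[OF B(1), of a'] that unfolding b_def B_def by force
  have "eint K' S T \<omega> = eint K S b \<omega>"
    unfolding eint_eq[OF E w] eint_eq[OF simple w] grid_integral_def
  proof (rule sum.cong[OF refl])
    fix a assume a: "a \<in> E - {T}"
    note n = nxt[OF gE a]
    have bT: "b \<le> T" using b fin by auto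
    show "K' (nxt E a) \<omega> \<bullet> (S (min (nxt E a) T) \<omega> - S (min a T) \<omega>) =
      K (nxt E a) \<omega> \<bullet> (S (min (nxt E a) b) \<omega> - S (min a b) \<omega>)"
    proof (cases "a < b")
      case True
      then have "nxt E a \<le> b" using n(7)[OF b(1)] by simp
      moreover have "K' (nxt E a) \<omega> = K (nxt E a) \<omega>"
        using before less_nxt[OF a] True by (auto simp: K'_def)
      ultimately show ?thesis using True n bT by (simp add: min_def)
    next
      case False
      then have "b < nxt E a" using n by simp
      then have "K' (nxt E a) \<omega> = 0" using b by (auto simp: K'_def not_le)
      then show ?thesis using False \<open>b < nxt E a\<close> by (simp add: min_def)
    qed
  qed
  then show "e < \<bar>eint K' S T \<omega>\<bar>" using b(2) by simp
qed

text \<open>For finitely many times, added to the grid of \<open>K\<close>,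
  \<open>simple_until\<close> reduces the maximum to the final time, and the stopped integrand is no
  larger in norm. Finite sets increasing to \<open>dtimes\<close> then give the supremum.\<close>

lemma terminal_control_controlled:
  fixes S :: "('a, 'c::euclidean_space) process"
  assumes S: "adc S" and \<mu>: "terminal_control \<mu> S"
  shows "controlled P F T S \<mu>"
proof (intro controlled.intro filtered_space_axioms controlled_axioms.intro)
  have s\<mu>: "sets \<mu> = sets PA" and f\<mu>: "finite_measure \<mu>" using \<mu> by (simp_all add: terminal_control_def)
  interpret \<mu>: finite_measure \<mu> by (rule f\<mu>)
  show "adc S" "sets \<mu> = sets PA" "finite_measure \<mu>" by (fact S, fact s\<mu>, fact f\<mu>)
  fix e :: real assume e: "0 < e"
  \<comment> \<open>The estimate ends with \<open>ucp_norm (eint K S) \<le> e' + e'\<close>; the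
    third share makes it strict.\<close>
  define e' where "e' = e / 3"
  have e': "0 < e'" using e by (simp add: e'_def)
  obtain d where d: "0 < d" "\<And>K :: ('a, 'c) process. elem K \<Longrightarrow> (\<integral>\<^sup>+p. ennreal ((norm (K (fst p) (snd p)))\<^sup>2) \<partial>\<mu>) < ennreal d \<Longrightarrow>
        prob {\<omega>\<in>space P. e' < \<bar>eint K S T \<omega>\<bar>} < e'"
    using \<mu> e' unfolding terminal_control_def by blast
  show "\<exists>d>0. \<forall>K. elem K \<longrightarrow> (\<integral>p. (norm (K (fst p) (snd p)))\<^sup>2 \<partial>\<mu>) < d \<longrightarrow> ucp_norm (eint K S) < e"
  proof (intro exI[of _ d] conjI d(1) allI impI)
    fix K :: "('a, 'c) process"
    assume K: "elem K" and small: "(\<integral>p. (norm (K (fst p) (snd p)))\<^sup>2 \<partial>\<mu>) < d"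
    obtain E where E: "simple E K" using K by (auto simp: elem_def)
    obtain c where c: "0 \<le> c" "\<And>t \<omega>. t \<in> {0..T} \<Longrightarrow> \<omega> \<in> space P \<Longrightarrow> norm (K t \<omega>) \<le> c"
      using simple_bounded[OF E] by blast
    note X = adc_eint[OF S K]
    have sp: "space \<mu> = {0..T} \<times> space P" using sets_eq_imp_space_eq[OF s\<mu>] space_PA by simp
    have int: "integrable \<mu> (\<lambda>p. (norm (K (fst p) (snd p)))\<^sup>2)"
    proof (rule \<mu>.integrable_const_bound[where B="c\<^sup>2"])
      show "(\<lambda>p. (norm (K (fst p) (snd p)))\<^sup>2) \<in> borel_measurable \<mu>"
        unfolding measurable_cong_sets[OF s\<mu> refl] using elem_predictable[OF K] by measurable
      show "AE p in \<mu>. norm ((norm (K (fst p) (snd p)))\<^sup>2) \<le> c\<^sup>2"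
      proof (rule AE_I2)
        fix p assume "p \<in> space \<mu>"
        then have "norm (K (fst p) (snd p)) \<le> c" by (intro c(2)) (auto simp: sp)
        then show "norm ((norm (K (fst p) (snd p)))\<^sup>2) \<le> c\<^sup>2" by (simp add: power_mono)
      qed
    qed
    have small': "(\<integral>\<^sup>+p. ennreal ((norm (K (fst p) (snd p)))\<^sup>2) \<partial>\<mu>) < ennreal d"
      using small d(1) by (subst nn_integral_eq_integral[OF int]) (auto simp: ennreal_less_iff)
    have fin: "prob {\<omega>\<in>space P. \<exists>t\<in>E0. e' < \<bar>eint K S t \<omega>\<bar>} \<le> e'" if E0: "finite E0" "E0 \<subseteq> {0..T}" for E0
    proof -
      define E1 where "E1 = E \<union> E0"
      have "grid E1" using simple_grid[OF E] E0 by (auto simp: E1_def grid_def)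
      then have E1: "simple E1 K" by (rule simple_refine(1)[OF E]) (simp add: E1_def)
      define K' where "K' t \<omega> = (if \<forall>a\<in>E1. a < t \<longrightarrow> \<bar>eint K S a \<omega>\<bar> \<le> e' then K t \<omega> else 0)" for t \<omega>
      note until = simple_until[OF E1 S, where e=e', folded K'_def[abs_def]]
      have K': "elem K'" using until(1) by (auto simp: elem_def)
      have "(\<integral>\<^sup>+p. ennreal ((norm (K' (fst p) (snd p)))\<^sup>2) \<partial>\<mu>) \<le> (\<integral>\<^sup>+p. ennreal ((norm (K (fst p) (snd p)))\<^sup>2) \<partial>\<mu>)"
        by (rule nn_integral_mono) (simp add: K'_def)
      then have "prob {\<omega>\<in>space P. e' < \<bar>eint K' S T \<omega>\<bar>} < e'"
        using small' by (intro d(2)[OF K']) (rule order_le_less_trans)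
      moreover have "prob {\<omega>\<in>space P. \<exists>t\<in>E0. e' < \<bar>eint K S t \<omega>\<bar>} \<le> prob {\<omega>\<in>space P. e' < \<bar>eint K' S T \<omega>\<bar>}"
      proof (rule finite_measure_mono)
        show "{\<omega>\<in>space P. \<exists>t\<in>E0. e' < \<bar>eint K S t \<omega>\<bar>} \<subseteq> {\<omega>\<in>space P. e' < \<bar>eint K' S T \<omega>\<bar>}"
          using until(2) unfolding E1_def by blast
        have "eint K' S T \<in> borel_measurable P"
          by (rule measurable_F_P[OF adc_measurable[OF adc_eint[OF S K']]]) (use T_pos in auto)
        then show "{\<omega>\<in>space P. e' < \<bar>eint K' S T \<omega>\<bar>} \<in> sets P" by measurable
      qed
      ultimately show ?thesis by linarith
    qed
    define E where "E n = from_nat_into dtimes ` {..n}" for n :: nat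
    define A where "A n = {\<omega>\<in>space P. \<exists>t\<in>E n. e' < \<bar>eint K S t \<omega>\<bar>}" for n
    have ED: "E n \<subseteq> {0..T}" "finite (E n)" for n
      using from_nat_into[OF dtimes(5)] dtimes(2) by (auto simp: E_def)
    have Xm: "eint K S t \<in> borel_measurable P" if "t \<in> {0..T}" for t
      by (rule measurable_F_P[OF adc_measurable[OF X that] that])
    have "A n \<in> sets P" for n
      unfolding A_def
    proof (rule sets.sets_Collect_finite_Ex)
      fix t assume "t \<in> E n"
      then have "eint K S t \<in> borel_measurable P" using ED(1) by (intro Xm) blast
      then show "{\<omega>\<in>space P. e' < \<bar>eint K S t \<omega>\<bar>} \<in> sets P" by measurable
    qed (rule ED)
    then have "range A \<subseteq> sets P" by blast
    moreover have "incseq A" unfolding incseq_def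
    proof (intro allI impI)
      fix m n :: nat assume "m \<le> n"
      then have "E m \<subseteq> E n" unfolding E_def by (intro image_mono) simp
      then show "A m \<subseteq> A n" unfolding A_def by blast
    qed
    ultimately have "(\<lambda>n. prob (A n)) \<longlonglongrightarrow> prob (\<Union>n. A n)" by (rule finite_Lim_measure_incseq)
    moreover have "prob (A n) \<le> e'" for n unfolding A_def by (rule fin[OF ED(2,1)])
    ultimately have "prob (\<Union>n. A n) \<le> e'" using LIMSEQ_le_const2 by blast
    moreover have "(\<Union>n. A n) = {\<omega>\<in>space P. \<exists>t\<in>dtimes. e' < \<bar>eint K S t \<omega>\<bar>}"
    proof -
      have "(\<Union>n. E n) = range (from_nat_into dtimes)" by (auto simp: E_def)
      also have "\<dots> = dtimes" by (rule range_from_nat_into[OF dtimes(5,1)])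
      finally show ?thesis by (force simp: A_def)
    qed
    ultimately have "ucp_norm (eint K S) \<le> e' + e'" using ucp_norm_le_prob[OF adc_meas_proc[OF X] less_imp_le[OF e']] by simp
    then show "ucp_norm (eint K S) < e" using e by (simp add: e'_def)
  qed
qed

end

lemma (in prob_space) prob_tendsto_1:
  assumes "\<And>n. G n \<in> events" "AE \<omega> in M. \<forall>\<^sub>F n in sequentially. \<omega> \<in> G n"
  shows "(\<lambda>n. prob (G n)) \<longlonglongrightarrow> 1"
proof -
  have "(\<lambda>n. \<integral>\<omega>. indicat_real (G n) \<omega> \<partial>M) \<longlonglongrightarrow> (\<integral>\<omega>. 1 \<partial>M)"
  proof (rule integral_dominated_convergence[where w="\<lambda>_. 1"])
    show "AE \<omega> in M. (\<lambda>n. indicat_real (G n) \<omega>) \<longlonglongrightarrow> 1"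
      using assms(2)
    proof eventually_elim
      case (elim \<omega>)
      then have "\<forall>\<^sub>F n in sequentially. indicat_real (G n) \<omega> = 1" by eventually_elim simp
      then show ?case by (rule tendsto_eventually)
    qed
  qed (use assms(1) in \<open>auto simp: indicator_def\<close>)
  then show ?thesis using assms(1) by (simp add: prob_space)
qed

text \<open>Otherwise there are sets of \<open>Q\<close>-measure below \<open>(1/2)^n\<close> and
  \<open>P\<close>-measure at least \<open>e\<close>. By Borel-Cantelli almost every point lies in
  only finitely many of them, under \<open>Q\<close> and hence under \<open>P\<close>, so that their
  \<open>P\<close>-measures would tend to zero.\<close>

lemma absolutely_continuous_delta:
  fixes e :: real
  assumes Q: "prob_space Q" and P: "prob_space P" and s: "sets Q = sets P"
    and ac: "absolutely_continuous Q P" and e: "0 < e"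
  obtains d where "0 < d" "\<And>A. A \<in> sets P \<Longrightarrow> measure Q A < d \<Longrightarrow> measure P A < e"
proof (rule ccontr)
  interpret Q: prob_space Q by (rule Q)
  interpret P: prob_space P by (rule P)
  assume "\<not> thesis"
  with that have "\<exists>A. A \<in> sets P \<and> measure Q A < d \<and> e \<le> measure P A" if "0 < d" for d
    using \<open>0 < d\<close> by (meson not_le)
  then have "\<forall>n. \<exists>A. A \<in> sets P \<and> measure Q A < (1/2)^n \<and> e \<le> measure P A" by simp
  from choice[OF this] obtain A where A: "\<And>n. A n \<in> sets P" "\<And>n. measure Q (A n) < (1/2::real)^n" "\<And>n. e \<le> measure P (A n)"
    by blast
  have AQ: "A n \<in> sets Q" for n using A(1) s by simp
  have "AE x in Q. eventually (\<lambda>n. x \<in> space Q - A n) sequentially"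
  proof (rule borel_cantelli_AE1[OF AQ])
    show "emeasure Q (A n) < \<infinity>" for n by (simp add: Q.emeasure_eq_measure)
    show "summable (\<lambda>n. measure Q (A n))"
      by (rule summable_comparison_test'[of "\<lambda>n. (1/2::real)^n" 0])
        (use A(2) in \<open>auto simp: summable_geometric intro: less_imp_le\<close>)
  qed
  then have "AE x in P. eventually (\<lambda>n. x \<in> space Q - A n) sequentially"
    by (rule absolutely_continuous_AE[OF s[symmetric] ac])
  then have "AE x in P. eventually (\<lambda>n. x \<in> space P - A n) sequentially"
    using sets_eq_imp_space_eq[OF s] by simp
  then have "(\<lambda>n. measure P (space P - A n)) \<longlonglongrightarrow> 1"
    using A(1) by (intro P.prob_tendsto_1) auto
  then have "(\<lambda>n. 1 - measure P (A n)) \<longlonglongrightarrow> 1" using A(1) by (simp add: P.prob_compl)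
  then have "\<forall>\<^sub>F n in sequentially. 1 - e < 1 - measure P (A n)" by (rule order_tendstoD(1)) (use e in linarith)
  then obtain n where "1 - e < 1 - measure P (A n)" using eventually_happens'[OF trivial_limit_sequentially] by blast
  then show False using A(3)[of n] by simp
qed

lemma cadlag_on_vec:
  fixes x :: "real \<Rightarrow> real^'d"
  assumes "\<And>i. cadlag_on T (\<lambda>t. x t $ i)"
  shows "cadlag_on T x"
proof (rule cadlag_onI)
  fix t assume t: "0 \<le> t" "t < T"
  show "(x \<longlongrightarrow> x t) (at_right t)" by (rule vec_tendstoI) (rule cadlag_right[OF assms t])
next
  fix t assume t: "0 < t" "t \<le> T"
  have "\<forall>i. \<exists>l. ((\<lambda>t. x t $ i) \<longlongrightarrow> l) (at_left t)"
  proof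
    fix i
    show "\<exists>l. ((\<lambda>t. x t $ i) \<longlongrightarrow> l) (at_left t)" by (rule cadlag_left[OF assms[of i] t]) blast
  qed
  from choice[OF this] obtain l where l: "\<And>i. ((\<lambda>t. x t $ i) \<longlongrightarrow> l i) (at_left t)" by blast
  have "(x \<longlongrightarrow> (\<chi> i. l i)) (at_left t)" by (rule vec_tendstoI) (simp add: l)
  then show "\<exists>l. (x \<longlongrightarrow> l) (at_left t)" by blast
qed

lemma borel_measurable_vec:
  fixes f :: "'a \<Rightarrow> real^'d"
  assumes "\<And>i. (\<lambda>x. f x $ i) \<in> borel_measurable M"
  shows "f \<in> borel_measurable M"
proof (subst borel_measurable_euclidean_space, rule ballI)
  fix b :: "real^'d" assume "b \<in> Basis"
  then obtain i where "b = axis i 1" by (auto simp: Basis_vec_def)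
  then show "(\<lambda>x. f x \<bullet> b) \<in> borel_measurable M" using assms by (simp add: inner_axis)
qed

section \<open>Localization and change of measure\<close>

context filtered_space begin

lemma adc_vec:
  fixes S :: "('a, real^'d) process"
  assumes "\<And>i. adc (\<lambda>t \<omega>. S t \<omega> $ i)"
  shows "adc S"
  unfolding adapted_cadlag_def adapted_def
proof (intro conjI ballI)
  show "S t \<in> borel_measurable (F t)" if "t \<in> {0..T}" for t
    by (rule borel_measurable_vec) (rule adc_measurable[OF assms that])
  have "AE \<omega> in P. \<forall>i\<in>UNIV. cadlag_on T (\<lambda>t. S t \<omega> $ i)"
    by (rule AE_finite_allI) (use adc_cadlag[OF assms] in auto)
  then show "AE \<omega> in P. cadlag_on T (\<lambda>t. S t \<omega>)"
    by eventually_elim (rule cadlag_on_vec, simp)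
qed

lemma stop_time_Min:
  assumes I: "finite I" "I \<noteq> {}" and st: "\<And>i. i \<in> I \<Longrightarrow> stop_time (\<sigma> i)"
  shows "stop_time (\<lambda>\<omega>. Min ((\<lambda>i. \<sigma> i \<omega>) ` I))"
  unfolding stop_time_def
proof (intro conjI ballI)
  show "(\<lambda>\<omega>. Min ((\<lambda>i. \<sigma> i \<omega>) ` I)) \<in> space P \<rightarrow> {0..T}"
  proof
    fix \<omega> assume w: "\<omega> \<in> space P"
    have "Min ((\<lambda>i. \<sigma> i \<omega>) ` I) \<in> (\<lambda>i. \<sigma> i \<omega>) ` I" using I by (intro Min_in) auto
    then show "Min ((\<lambda>i. \<sigma> i \<omega>) ` I) \<in> {0..T}" using stop_time_bounds[OF st w] by force
  qed
  fix t assume t: "t \<in> {0..T}"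
  have "{\<omega>\<in>space P. Min ((\<lambda>i. \<sigma> i \<omega>) ` I) \<le> t} = (\<Union>i\<in>I. {\<omega>\<in>space P. \<sigma> i \<omega> \<le> t})"
    using I by (auto simp: Min_le_iff)
  also have "\<dots> \<in> sets (F t)"
    using I(1) st t by (intro sets.finite_UN) (auto simp: stop_time_def)
  finally show "{\<omega>\<in>space P. Min ((\<lambda>i. \<sigma> i \<omega>) ` I) \<le> t} \<in> sets (F t)" .
qed

lemma stop_time_measurable:
  assumes "stop_time \<sigma>" shows "\<sigma> \<in> borel_measurable P"
proof (subst borel_measurable_iff_le, rule allI)
  fix a
  consider "a < 0" | "a \<in> {0..T}" | "T < a" by force
  then show "{\<omega>\<in>space P. \<sigma> \<omega> \<le> a} \<in> sets P"
  proof cases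
    case 1
    then have e: "{\<omega>\<in>space P. \<sigma> \<omega> \<le> a} = {}" using stop_time_bounds(1)[OF assms] by force
    show ?thesis unfolding e by simp
  next
    case 2
    then show ?thesis using assms sets_F unfolding stop_time_def by blast
  next
    case 3
    then have e: "{\<omega>\<in>space P. \<sigma> \<omega> \<le> a} = space P" using stop_time_bounds(2)[OF assms] by force
    show ?thesis unfolding e by simp
  qed
qed

lemma mart_cong_AE:
  assumes X: "mart X" and Y: "\<And>t. t \<in> {0..T} \<Longrightarrow> Y t \<in> borel_measurable (F t)"
    and eq: "AE \<omega> in P. \<forall>t\<in>{0..T}. X t \<omega> = Y t \<omega>"
  shows "mart Y"
  unfolding mart_def
proof (intro conjI ballI allI impI)
  have e: "AE \<omega> in P. X t \<omega> = Y t \<omega>" if "t \<in> {0..T}" for t using eq by eventually_elim (use that in simp)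
  note YP = measurable_F_P[OF Y] and XP = measurable_F_P[OF mart_measurable[OF X]]
  show "Y t \<in> borel_measurable (F t)" if "t \<in> {0..T}" for t by (rule Y[OF that])
  show "integrable P (Y t)" if "t \<in> {0..T}" for t
    using integrable_cong_AE[OF XP[OF that that] YP[OF that that] e[OF that]] mart_integrable[OF X that] by simp
  fix a b c :: real and h :: "'a \<Rightarrow> real"
  assume ab: "0 \<le> a" "a \<le> b" "b \<le> T" and h: "h \<in> borel_measurable (F a)" "\<forall>\<omega>\<in>space P. \<bar>h \<omega>\<bar> \<le> c"
  have abT: "a \<in> {0..T}" "b \<in> {0..T}" using ab by auto
  note hP = measurable_F_P[OF h(1) abT(1)]
  have tr: "(\<integral>\<omega>. h \<omega> * Y t \<omega> \<partial>P) = (\<integral>\<omega>. h \<omega> * X t \<omega> \<partial>P)" if t: "t \<in> {0..T}" for t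
  proof (rule integral_cong_AE)
    show "(\<lambda>\<omega>. h \<omega> * Y t \<omega>) \<in> borel_measurable P" using hP YP[OF t t] by measurable
    show "(\<lambda>\<omega>. h \<omega> * X t \<omega>) \<in> borel_measurable P" using hP XP[OF t t] by measurable
    show "AE \<omega> in P. h \<omega> * Y t \<omega> = h \<omega> * X t \<omega>" using e[OF t] by eventually_elim simp
  qed
  show "(\<integral>\<omega>. h \<omega> * Y b \<omega> \<partial>P) = (\<integral>\<omega>. h \<omega> * Y a \<omega> \<partial>P)"
    unfolding tr[OF abT(1)] tr[OF abT(2)] using mart_eq[OF X ab h(1)] h(2) by blast
qed

text \<open>The minimum of the localizing times of all components and of those for boundedness stops
  \<open>S\<close> at a bounded process; \<open>optional_stopping\<close> shows that stopping
  earlier than the localizing time of a component keeps the martingale property.\<close>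

lemma local_martingale_localize:
  fixes S :: "('a, real^'d) process"
  assumes L: "\<And>i. local_martingale P F T (\<lambda>t \<omega>. S t \<omega> $ i)" and B: "locally_bounded P F T S"
  obtains N c G where "\<And>k. bdd_mart (N k) (c k)" "\<And>k. G k \<in> sets P"
    "\<And>k. AE \<omega> in P. \<omega> \<in> G k \<longrightarrow> (\<forall>t\<in>{0..T}. N k t \<omega> = S t \<omega> - S 0 \<omega>)"
    "(\<lambda>k. prob (G k)) \<longlonglongrightarrow> 1"
proof -
  have Sadc: "adc S" by (rule adc_vec) (use L in \<open>auto simp: local_martingale_def\<close>)
  have "\<forall>i. \<exists>\<tau>. localizing P F T \<tau> \<and> (\<forall>n. martingale P F T (\<lambda>t \<omega>. S (min t (\<tau> n \<omega>)) \<omega> $ i - S 0 \<omega> $ i))"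
    using L unfolding local_martingale_def by blast
  from choice[OF this] obtain \<tau> where \<tau>: "\<And>i. localizing P F T (\<tau> i)"
    "\<And>i n. martingale P F T (\<lambda>t \<omega>. S (min t (\<tau> i n \<omega>)) \<omega> $ i - S 0 \<omega> $ i)" by blast
  obtain \<rho> where \<rho>: "localizing P F T \<rho>"
    and "\<forall>n. \<exists>c. AE \<omega> in P. \<forall>t\<in>{0..T}. norm (S (min t (\<rho> n \<omega>)) \<omega> - S 0 \<omega>) \<le> c"
    using B unfolding locally_bounded_def by blast
  from choice[OF this(2)] obtain c where c: "\<And>n. AE \<omega> in P. \<forall>t\<in>{0..T}. norm (S (min t (\<rho> n \<omega>)) \<omega> - S 0 \<omega>) \<le> c n" by blast
  have st: "stop_time (s n)" if "localizing P F T s" for s n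
    using that unfolding localizing_def by (intro stopping_time_stop_time) blast+
  have ev: "AE \<omega> in P. \<forall>\<^sub>F n in sequentially. s n \<omega> = T" if "localizing P F T s" for s
    using that unfolding localizing_def by auto
  define \<sigma> where "\<sigma> n \<omega> = min (\<rho> n \<omega>) (Min (range (\<lambda>i. \<tau> i n \<omega>)))" for n \<omega>
  have \<sigma>: "stop_time (\<sigma> n)" for n
    unfolding \<sigma>_def[abs_def] by (intro stop_time_min stop_time_Min st \<rho> \<tau>(1)) auto
  have le: "\<sigma> n \<omega> \<le> \<rho> n \<omega>" "\<sigma> n \<omega> \<le> \<tau> i n \<omega>" for n \<omega> i
  proof -
    show "\<sigma> n \<omega> \<le> \<rho> n \<omega>" by (simp add: \<sigma>_def)
    have "Min (range (\<lambda>i. \<tau> i n \<omega>)) \<le> \<tau> i n \<omega>" by (rule Min_le) auto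
    then show "\<sigma> n \<omega> \<le> \<tau> i n \<omega>" unfolding \<sigma>_def by (rule min.coboundedI2)
  qed
  define W where "W n t \<omega> = S (min t (\<sigma> n \<omega>)) \<omega> - S 0 \<omega>" for n t \<omega>
  have Wb: "AE \<omega> in P. \<forall>t\<in>{0..T}. norm (W n t \<omega>) \<le> c n" for n
    using c[of n] AE_space
  proof eventually_elim
    case (elim \<omega>)
    show ?case
    proof
      fix t assume t: "t \<in> {0..T}"
      have "min t (\<sigma> n \<omega>) \<in> {0..T}" using t stop_time_bounds[OF \<sigma> elim(2), of n] by auto
      moreover have "min (min t (\<sigma> n \<omega>)) (\<rho> n \<omega>) = min t (\<sigma> n \<omega>)" using le(1)[of n \<omega>] by auto
      ultimately show "norm (W n t \<omega>) \<le> c n" using elim(1) unfolding W_def by metis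
    qed
  qed
  have Wc: "AE \<omega> in P. cadlag_on T (\<lambda>t. W n t \<omega>)" for n
    using adc_cadlag[OF Sadc] AE_space
  proof eventually_elim
    case (elim \<omega>)
    have "cadlag_on T (\<lambda>t. S (min (\<sigma> n \<omega>) t) \<omega>)" by (rule cadlag_on_stop[OF elim(1) stop_time_bounds[OF \<sigma> elim(2)]])
    then show ?case unfolding W_def by (intro cadlag_on_diff cadlag_on_const) (simp add: min.commute)
  qed
  have Wm: "mart (\<lambda>t \<omega>. W n t \<omega> $ i)" for n i
  proof -
    define M where "M t \<omega> = S (min t (\<tau> i n \<omega>)) \<omega> $ i - S 0 \<omega> $ i" for t \<omega>
    have eq: "M (min t (\<sigma> n \<omega>)) \<omega> = W n t \<omega> $ i" for t \<omega>
    proof -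
      have "min (min t (\<sigma> n \<omega>)) (\<tau> i n \<omega>) = min t (\<sigma> n \<omega>)" using le(2)[of n \<omega> i] by auto
      then show ?thesis by (simp add: M_def W_def)
    qed
    have "mart (\<lambda>t \<omega>. M (min t (\<sigma> n \<omega>)) \<omega>)"
    proof (rule optional_stopping)
      show "mart M" unfolding M_def[abs_def] by (rule martingale_mart[OF \<tau>(2)])
      show "stop_time (\<sigma> n)" by (rule \<sigma>)
      show "AE \<omega> in P. cadlag_on T (\<lambda>t. M t \<omega>)"
      proof -
        have "AE \<omega> in P. cadlag_on T (\<lambda>t. S t \<omega> $ i)"
          using L[of i] unfolding local_martingale_def adapted_cadlag_def by blast
        then show ?thesis using AE_space
        proof eventually_elim
        case (elim \<omega>)
        then have "cadlag_on T (\<lambda>t. S (min (\<tau> i n \<omega>) t) \<omega> $ i)"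
          by (intro cadlag_on_stop[where x="\<lambda>t. S t \<omega> $ i"] stop_time_bounds[OF st[OF \<tau>(1)] elim(2)])
        then show ?case unfolding M_def by (intro cadlag_on_diff cadlag_on_const) (simp add: min.commute)
        qed
      qed
      show "AE \<omega> in P. \<forall>t\<in>{0..T}. \<bar>M (min t (\<sigma> n \<omega>)) \<omega>\<bar> \<le> c n"
        unfolding eq using Wb[of n]
      proof eventually_elim
        case (elim \<omega>)
        then show ?case using component_le_norm_cart order_trans by blast
      qed
    qed
    then show ?thesis unfolding eq .
  qed
  have WF: "W n t \<in> borel_measurable (F t)" if "t \<in> {0..T}" for n t
    by (rule borel_measurable_vec) (rule mart_measurable[OF Wm that])
  \<comment> \<open>The stopped process is bounded only almost surely; setting it to zero where the
    bound fails gives a version bounded at every point, as \<open>bdd_mart\<close> demands.\<close>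
  define N where "N n t \<omega> = (if norm (W n t \<omega>) \<le> c n then W n t \<omega> else 0)" for n t \<omega>
  have c0: "0 \<le> c n" for n
  proof -
    have "AE \<omega> in P. 0 \<le> c n" using Wb[of n]
    proof eventually_elim
      case (elim \<omega>)
      moreover have "0 \<in> {0..T}" using T_pos by simp
      ultimately show ?case using norm_ge_zero order_trans by blast
    qed
    then show ?thesis by simp
  qed
  have NW: "AE \<omega> in P. \<forall>t\<in>{0..T}. W n t \<omega> = N n t \<omega>" for n
    using Wb[of n] by eventually_elim (simp add: N_def)
  have NF: "N n t \<in> borel_measurable (F t)" if "t \<in> {0..T}" for n t
    unfolding N_def[abs_def] using WF[OF that] by measurable
  have bm: "bdd_mart (N n) (c n)" for n
    unfolding bdd_mart_def
  proof (intro conjI ballI)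
    show "N n t \<in> borel_measurable (F t)" if "t \<in> {0..T}" for t by (rule NF[OF that])
    show "norm (N n t \<omega>) \<le> c n" for t \<omega> using c0[of n] by (simp add: N_def)
    show "AE \<omega> in P. cadlag_on T (\<lambda>t. N n t \<omega>)"
      using Wc[of n] NW[of n] by eventually_elim (erule cadlag_on_cong, simp)
    fix b :: "real^'d" assume "b \<in> Basis"
    then obtain i where b: "b = axis i 1" by (auto simp: Basis_vec_def)
    have "mart (\<lambda>t \<omega>. N n t \<omega> $ i)"
    proof (rule mart_cong_AE[OF Wm[of n i]])
      show "(\<lambda>\<omega>. N n t \<omega> $ i) \<in> borel_measurable (F t)" if "t \<in> {0..T}" for t
      proof -
        have "(\<lambda>\<omega>. N n t \<omega> \<bullet> axis i 1) \<in> borel_measurable (F t)" using NF[OF that] by measurable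
        then show ?thesis by (simp add: inner_axis)
      qed
      show "AE \<omega> in P. \<forall>t\<in>{0..T}. W n t \<omega> $ i = N n t \<omega> $ i" using NW[of n] by eventually_elim simp
    qed
    then show "mart (\<lambda>t \<omega>. N n t \<omega> \<bullet> b)" by (simp add: b inner_axis)
  qed
  \<comment> \<open>The event that nothing has been stopped before \<open>T\<close>. Almost surely
    all the localizing times are eventually equal to \<open>T\<close>, so the probabilities tend to
    one.\<close>
  define G where "G n = {\<omega>\<in>space P. \<sigma> n \<omega> = T}" for n
  have G: "G n \<in> sets P" for n unfolding G_def using stop_time_measurable[OF \<sigma>[of n]] by measurable
  have GN: "AE \<omega> in P. \<omega> \<in> G n \<longrightarrow> (\<forall>t\<in>{0..T}. N n t \<omega> = S t \<omega> - S 0 \<omega>)" for n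
    using NW[of n] by eventually_elim (auto simp: G_def W_def)
  have lim: "(\<lambda>n. prob (G n)) \<longlonglongrightarrow> 1"
  proof (rule prob_tendsto_1[OF G])
    have "AE \<omega> in P. \<forall>i\<in>UNIV. \<forall>\<^sub>F n in sequentially. \<tau> i n \<omega> = T"
      by (rule AE_finite_allI) (use ev[OF \<tau>(1)] in auto)
    then show "AE \<omega> in P. \<forall>\<^sub>F n in sequentially. \<omega> \<in> G n"
      using ev[OF \<rho>] AE_space
    proof eventually_elim
      case (elim \<omega>)
      have "\<forall>\<^sub>F n in sequentially. \<forall>i\<in>UNIV. \<tau> i n \<omega> = T" using elim(1) by (intro eventually_ball_finite) auto
      with elim(2) show ?case
      proof eventually_elim
        case (elim n)
        then have "range (\<lambda>i. \<tau> i n \<omega>) = {T}" by auto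
        then show ?case using elim \<open>\<omega> \<in> space P\<close> by (simp add: G_def \<sigma>_def)
      qed
    qed
  qed
  show ?thesis by (rule that[OF bm G GN lim])
qed

text \<open>Simple integrands, their integrals and the predictable sets involve only the filtration
  and the underlying space, so they are the same under \<open>Q\<close> and \<open>P\<close>. Only
  the probabilities have to be translated, which \<open>absolutely_continuous_delta\<close>
  does.\<close>

theorem controlled_exists:
  fixes S :: "('a, real^'d) process"
  assumes S: "locally_bounded_semimartingale P F T S"
    and M: "equivalent_local_martingale_measures P F T S \<noteq> {}"
  obtains \<mu> where "controlled P F T S \<mu>"
proof -
  obtain Q where Q: "prob_space Q" "sets Q = sets P" "absolutely_continuous P Q" "absolutely_continuous Q P"
      "\<And>i. local_martingale Q F T (\<lambda>t \<omega>. S t \<omega> $ i)"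
    using M unfolding equivalent_local_martingale_measures_def by blast
  have sp: "space Q = space P" by (rule sets_eq_imp_space_eq[OF Q(2)])
  have nul: "null_sets Q = null_sets P" using Q(3,4) unfolding absolutely_continuous_def by blast
  have AE: "AE \<omega> in Q. R \<omega>" if "AE \<omega> in P. R \<omega>" for R by (rule absolutely_continuous_AE[OF Q(2,3) that])
  \<comment> \<open>The usual conditions depend on the measure only through its measurable sets and
    its null sets, which \<open>P\<close> and \<open>Q\<close> share.\<close>
  have usualQ: "usual_conditions Q F T"
  proof -
    have "complete_measure P" using usual by (simp add: usual_conditions_def)
    then have "complete_measure Q"
      unfolding complete_measure_def nul Q(2) .
    moreover have "subalgebra Q (F t) \<longleftrightarrow> subalgebra P (F t)" for t by (simp add: subalgebra_def sp Q(2))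
    ultimately show ?thesis using usual by (simp add: usual_conditions_def sp nul)
  qed
  interpret Q: filtered_space Q F T
    using Q(1) usualQ T_pos by (simp add: filtered_space_def filtered_space_axioms_def)
  have simple_eq: "Q.simple E K = simple E K" for E and K :: "('a, real^'d) process"
    unfolding Q.simple_def simple_def sp ..
  have elem_eq: "Q.elem K = elem K" for K :: "('a, real^'d) process"
    unfolding Q.elem_def elem_def simple_eq ..
  have eint_eq: "Q.eint K S = eint K S" for K unfolding Q.eint_def eint_def simple_eq ..
  have PA_eq: "predictable_algebra Q F T = PA" unfolding predictable_algebra_def sp ..
  have loc: "localizing Q F T \<tau>" if "localizing P F T \<tau>" for \<tau>
    using that AE unfolding localizing_def sp by blast
  have "locally_bounded P F T S" using S unfolding locally_bounded_semimartingale_def by blast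
  then have B: "locally_bounded Q F T S"
  proof -
    obtain \<tau> where \<tau>: "localizing P F T \<tau>" "\<forall>n. \<exists>c. AE \<omega> in P. \<forall>t\<in>{0..T}. norm (S (min t (\<tau> n \<omega>)) \<omega> - S 0 \<omega>) \<le> c"
      using \<open>locally_bounded P F T S\<close> unfolding locally_bounded_def by (elim exE conjE)
    show ?thesis unfolding locally_bounded_def
    proof (intro exI[of _ \<tau>] conjI allI)
      show "localizing Q F T \<tau>" by (rule loc[OF \<tau>(1)])
      fix n
      from \<tau>(2) obtain c where "AE \<omega> in P. \<forall>t\<in>{0..T}. norm (S (min t (\<tau> n \<omega>)) \<omega> - S 0 \<omega>) \<le> c" by (elim allE exE)
      then show "\<exists>c. AE \<omega> in Q. \<forall>t\<in>{0..T}. norm (S (min t (\<tau> n \<omega>)) \<omega> - S 0 \<omega>) \<le> c" by (intro exI[of _ c] AE)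
    qed
  qed
  obtain N c G where N: "\<And>k. Q.bdd_mart (N k) (c k)" "\<And>k. G k \<in> sets Q"
    "\<And>k. AE \<omega> in Q. \<omega> \<in> G k \<longrightarrow> (\<forall>t\<in>{0..T}. N k t \<omega> = S t \<omega> - S 0 \<omega>)"
    "(\<lambda>k. measure Q (G k)) \<longlonglongrightarrow> 1"
    by (rule Q.local_martingale_localize[OF Q(5) B], rule that)
  have SQ: "adapted_cadlag Q F T S" by (rule Q.adc_vec) (use Q(5) in \<open>auto simp: local_martingale_def\<close>)
  obtain \<mu> where \<mu>: "Q.terminal_control \<mu> S" by (rule Q.local_terminal_control[OF N(1) SQ N(2-4)])
  have Sadc: "adc S"
    by (rule adc_vec) (use S in \<open>auto simp: locally_bounded_semimartingale_def semimartingale_def\<close>)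
  have "terminal_control \<mu> S"
    unfolding terminal_control_def
  proof (intro conjI allI impI)
    show "sets \<mu> = sets PA" "finite_measure \<mu>" using \<mu> by (simp_all add: Q.terminal_control_def PA_eq)
    fix e :: real assume e: "0 < e"
    obtain d' where d': "0 < d'" "\<And>A. A \<in> sets P \<Longrightarrow> measure Q A < d' \<Longrightarrow> prob A < e"
      by (rule absolutely_continuous_delta[OF Q(1) prob_space_axioms Q(2) Q(4) e]) blast
    \<comment> \<open>One number serves both as threshold, being at most \<open>e\<close>, and as
      probability, being at most the \<open>d'\<close> below which \<open>Q\<close>-smallness forces
      \<open>P\<close>-smallness.\<close>
    define e' where "e' = min e d'"
    have e': "0 < e'" "e' \<le> e" "e' \<le> d'" using e d'(1) by (auto simp: e'_def)
    obtain d where d: "0 < d" "\<And>K :: ('a, real^'d) process. elem K \<Longrightarrow>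
        (\<integral>\<^sup>+p. ennreal ((norm (K (fst p) (snd p)))\<^sup>2) \<partial>\<mu>) < ennreal d \<Longrightarrow>
        measure Q {\<omega>\<in>space P. e' < \<bar>eint K S T \<omega>\<bar>} < e'"
      using \<mu> e'(1) unfolding Q.terminal_control_def elem_eq eint_eq sp by blast
    show "\<exists>d>0. \<forall>K :: ('a, real^'d) process. elem K \<longrightarrow>
        (\<integral>\<^sup>+p. ennreal ((norm (K (fst p) (snd p)))\<^sup>2) \<partial>\<mu>) < ennreal d \<longrightarrow>
        prob {\<omega>\<in>space P. e < \<bar>eint K S T \<omega>\<bar>} < e"
    proof (intro exI[of _ d] conjI d(1) allI impI)
      fix K :: "('a, real^'d) process"
      assume K: "elem K" and small: "(\<integral>\<^sup>+p. ennreal ((norm (K (fst p) (snd p)))\<^sup>2) \<partial>\<mu>) < ennreal d"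
      have m: "eint K S T \<in> borel_measurable P"
        by (rule measurable_F_P[OF adc_measurable[OF adc_eint[OF Sadc K]]]) (use T_pos in auto)
      have s: "{\<omega>\<in>space P. r < \<bar>eint K S T \<omega>\<bar>} \<in> sets P" for r using m by measurable
      have "measure Q {\<omega>\<in>space P. e < \<bar>eint K S T \<omega>\<bar>} \<le> measure Q {\<omega>\<in>space P. e' < \<bar>eint K S T \<omega>\<bar>}"
        using e'(2) s[of e'] by (intro Q.finite_measure_mono) (auto simp: Q(2))
      also have "\<dots> < d'" using d(2)[OF K small] e'(3) by simp
      finally show "prob {\<omega>\<in>space P. e < \<bar>eint K S T \<omega>\<bar>} < e" by (rule d'(2)[OF s])
    qed
  qed
  then have "controlled P F T S \<mu>" by (rule terminal_control_controlled[OF Sadc])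
  then show ?thesis by (rule that)
qed

end

section \<open>Wealth processes\<close>

locale market = controlled P F T S \<mu>
  for P :: "'a measure" and F :: "real \<Rightarrow> 'a measure" and T :: real
    and S :: "('a, real^'d) process" and \<mu> :: "(real \<times> 'a) measure"
begin

abbreviation wealth :: "real \<Rightarrow> ('a, real) process \<Rightarrow> bool" where
  "wealth \<equiv> wealth_from P F T S"

lemma wealth_linear:
  assumes "wealth x X" "wealth y Y"
  shows "wealth (a * x + b * y) (\<lambda>t \<omega>. a * X t \<omega> + b * Y t \<omega>)"
proof -
  obtain H Z where X: "stochastic_integral P F T S H Z" "AE \<omega> in P. \<forall>t\<in>{0..T}. X t \<omega> = x + Z t \<omega>"
    using assms(1) unfolding wealth_from_def by blast
  obtain G W where Y: "stochastic_integral P F T S G W" "AE \<omega> in P. \<forall>t\<in>{0..T}. Y t \<omega> = y + W t \<omega>"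
    using assms(2) unfolding wealth_from_def by blast
  have "AE \<omega> in P. \<forall>t\<in>{0..T}. a * X t \<omega> + b * Y t \<omega> = (a * x + b * y) + (a * Z t \<omega> + b * W t \<omega>)"
    using X(2) Y(2) by eventually_elim (simp add: algebra_simps)
  then show ?thesis
    using stochastic_integral_linear[OF X(1) Y(1), of a b] unfolding wealth_from_def by blast
qed

lemma wealth_add: "wealth x X \<Longrightarrow> wealth y Y \<Longrightarrow> wealth (x + y) (\<lambda>t \<omega>. X t \<omega> + Y t \<omega>)"
  using wealth_linear[of x X y Y 1 1] by simp

lemma wealth_diff: "wealth x X \<Longrightarrow> wealth y Y \<Longrightarrow> wealth (x - y) (\<lambda>t \<omega>. X t \<omega> - Y t \<omega>)"
  using wealth_linear[of x X y Y 1 "-1"] by simp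

lemma wealth_cmult: "wealth x X \<Longrightarrow> wealth (a * x) (\<lambda>t \<omega>. a * X t \<omega>)"
  using wealth_linear[of x X x X a 0] by simp

lemma wealth_shift:
  assumes "wealth x X" shows "wealth (x + c) (\<lambda>t \<omega>. X t \<omega> + c)"
proof -
  obtain H Z where X: "stochastic_integral P F T S H Z" "AE \<omega> in P. \<forall>t\<in>{0..T}. X t \<omega> = x + Z t \<omega>"
    using assms(1) unfolding wealth_from_def by blast
  have "AE \<omega> in P. \<forall>t\<in>{0..T}. X t \<omega> + c = (x + c) + Z t \<omega>" using X(2) by eventually_elim simp
  then show ?thesis using X(1) unfolding wealth_from_def by blast
qed

lemma wealth_start:
  assumes "wealth x X" shows "AE \<omega> in P. X 0 \<omega> = x"
proof -
  obtain H Z where X: "stochastic_integral P F T S H Z" "AE \<omega> in P. \<forall>t\<in>{0..T}. X t \<omega> = x + Z t \<omega>"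
    using assms(1) unfolding wealth_from_def by blast
  show ?thesis using X(2) stochastic_integral_zero_start[OF X(1)]
  proof eventually_elim
    case (elim \<omega>)
    moreover have "0 \<in> {0..T}" using T_pos by simp
    ultimately show ?case by force
  qed
qed

lemma wealth_adc:
  assumes "wealth x X" shows "adc X"
proof -
  obtain H Z where X: "stochastic_integral P F T S H Z" "AE \<omega> in P. \<forall>t\<in>{0..T}. X t \<omega> = x + Z t \<omega>"
    using assms(1) unfolding wealth_from_def by blast
  have Z: "adc Z" using X(1) unfolding stochastic_integral_def by blast
  have "adc (\<lambda>t \<omega>. x + Z t \<omega>)"
    unfolding adapted_cadlag_def adapted_def
  proof (intro conjI ballI)
    show "(\<lambda>\<omega>. x + Z t \<omega>) \<in> borel_measurable (F t)" if "t \<in> {0..T}" for t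
      using adc_measurable[OF Z that] by measurable
    show "AE \<omega> in P. cadlag_on T (\<lambda>t. x + Z t \<omega>)"
      using adc_cadlag[OF Z] by eventually_elim (intro cadlag_on_add cadlag_on_const)
  qed
  moreover have "AE \<omega> in P. \<forall>t\<in>{0..T}. x + Z t \<omega> = X t \<omega>" using X(2) by eventually_elim simp
  ultimately show ?thesis by (rule adc_cong_AE)
qed

lemma wealth_measurable: "wealth x X \<Longrightarrow> t \<in> {0..T} \<Longrightarrow> X t \<in> borel_measurable P"
  by (rule measurable_F_P[OF adc_measurable[OF wealth_adc]])

text \<open>The gains after time \<open>t\<close> on the event \<open>A\<close> come from
  multiplying the strategy by the indicator of \<open>{t<..T} \<times> A\<close>, an elementary
  integrand with values zero and one.\<close>

lemma wealth_switch:
  assumes X: "wealth x X" and t: "0 \<le> t" "t < T" and A: "A \<in> sets (F t)"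
  shows "wealth 0 (\<lambda>s \<omega>. indicat_real A \<omega> * (X s \<omega> - X (min s t) \<omega>))"
proof -
  obtain H Z where X: "stochastic_integral P F T S H Z" "AE \<omega> in P. \<forall>t\<in>{0..T}. X t \<omega> = x + Z t \<omega>"
    using assms(1) unfolding wealth_from_def by blast
  let ?k = "\<lambda>s \<omega>. indicat_real {t<..T} s * indicat_real A \<omega>"
  have SI: "stochastic_integral P F T S (\<lambda>s \<omega>. ?k s \<omega> *\<^sub>R H s \<omega>) (eint ?k Z)"
    by (rule stochastic_integral_elem_mult[OF X(1) elem_rectangle[OF t order_refl A]]) (auto simp: indicator_def)
  have "AE \<omega> in P. \<forall>s\<in>{0..T}. indicat_real A \<omega> * (X s \<omega> - X (min s t) \<omega>) = 0 + eint ?k Z s \<omega>"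
    using X(2) AE_space
  proof eventually_elim
    case (elim \<omega>)
    show ?case
    proof
      fix s assume s: "s \<in> {0..T}"
      have "min T s = s" "min t s = min s t" "min s t \<in> {0..T}" using s t by (auto simp: min_def)
      then show "indicat_real A \<omega> * (X s \<omega> - X (min s t) \<omega>) = 0 + eint ?k Z s \<omega>"
        using elim(1) s by (simp add: eint_rectangle[OF t order_refl A s elim(2)])
    qed
  qed
  then show ?thesis using SI unfolding wealth_from_def by blast
qed

section \<open>Non-negative, maximal and acceptable wealth processes\<close>

lemma nonneg_wealthI: "wealth x X \<Longrightarrow> (AE \<omega> in P. \<forall>t\<in>{0..T}. 0 \<le> X t \<omega>) \<Longrightarrow> X \<in> nonneg_wealth P F T S x"
  and nonneg_wealthD: "X \<in> nonneg_wealth P F T S x \<Longrightarrow> wealth x X"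
    "X \<in> nonneg_wealth P F T S x \<Longrightarrow> AE \<omega> in P. \<forall>t\<in>{0..T}. 0 \<le> X t \<omega>"
  unfolding nonneg_wealth_def nonneg_process_def by blast+

lemma nonneg_wealth_initial:
  assumes "X \<in> nonneg_wealth P F T S x" shows "0 \<le> x"
proof -
  have "AE \<omega> in P. 0 \<le> x"
    using nonneg_wealthD(2)[OF assms] wealth_start[OF nonneg_wealthD(1)[OF assms]]
  proof eventually_elim
    case (elim \<omega>)
    moreover have "0 \<in> {0..T}" using T_pos by simp
    ultimately show ?case by force
  qed
  then show ?thesis by simp
qed

lemma nonneg_wealth_add:
  assumes "X \<in> nonneg_wealth P F T S x" "Y \<in> nonneg_wealth P F T S y"
  shows "(\<lambda>t \<omega>. X t \<omega> + Y t \<omega>) \<in> nonneg_wealth P F T S (x + y)"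
proof (rule nonneg_wealthI)
  show "wealth (x + y) (\<lambda>t \<omega>. X t \<omega> + Y t \<omega>)" by (intro wealth_add nonneg_wealthD(1) assms)
  show "AE \<omega> in P. \<forall>t\<in>{0..T}. 0 \<le> X t \<omega> + Y t \<omega>"
    using nonneg_wealthD(2)[OF assms(1)] nonneg_wealthD(2)[OF assms(2)] by eventually_elim simp
qed

lemma nonneg_wealth_cmult:
  assumes "X \<in> nonneg_wealth P F T S x" "0 \<le> a"
  shows "(\<lambda>t \<omega>. a * X t \<omega>) \<in> nonneg_wealth P F T S (a * x)"
proof (rule nonneg_wealthI)
  show "wealth (a * x) (\<lambda>t \<omega>. a * X t \<omega>)" by (intro wealth_cmult nonneg_wealthD(1) assms)
  show "AE \<omega> in P. \<forall>t\<in>{0..T}. 0 \<le> a * X t \<omega>"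
    using nonneg_wealthD(2)[OF assms(1)] by eventually_elim (use assms(2) in simp)
qed

lemma maximal_wealthI:
  assumes "X \<in> nonneg_wealth P F T S x"
    "\<And>X'. X' \<in> nonneg_wealth P F T S x \<Longrightarrow> AE \<omega> in P. X T \<omega> \<le> X' T \<omega> \<Longrightarrow> AE \<omega> in P. X' T \<omega> = X T \<omega>"
  shows "maximal_wealth P F T S X"
  unfolding maximal_wealth_def using assms nonneg_wealth_initial by blast

lemma maximal_wealthE:
  assumes "maximal_wealth P F T S X"
  obtains x where "X \<in> nonneg_wealth P F T S x"
    "\<And>X'. X' \<in> nonneg_wealth P F T S x \<Longrightarrow> AE \<omega> in P. X T \<omega> \<le> X' T \<omega> \<Longrightarrow> AE \<omega> in P. X' T \<omega> = X T \<omega>"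
  using assms unfolding maximal_wealth_def by blast

text \<open>If \<open>Y\<close> fell below \<open>X\<close> on \<open>A \<in> F t\<close>, then switching from \<open>X\<close> to \<open>Y\<close> at time \<open>t\<close> on \<open>A\<close> while
  keeping the difference as cash would dominate \<open>X\<close>.\<close>

lemma maximal_wealth_dominated:
  assumes X: "maximal_wealth P F T S X" and Y: "Y \<in> nonneg_wealth P F T S y"
    and le: "AE \<omega> in P. X T \<omega> \<le> Y T \<omega>"
  shows "AE \<omega> in P. \<forall>t\<in>{0..T}. X t \<omega> \<le> Y t \<omega>"
proof -
  obtain x where Xx: "X \<in> nonneg_wealth P F T S x" and
    max: "\<And>X'. X' \<in> nonneg_wealth P F T S x \<Longrightarrow> AE \<omega> in P. X T \<omega> \<le> X' T \<omega> \<Longrightarrow> AE \<omega> in P. X' T \<omega> = X T \<omega>"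
    by (rule maximal_wealthE[OF X], rule that)
  note Xw = nonneg_wealthD[OF Xx] and Yw = nonneg_wealthD[OF Y]
  have adD: "adc (\<lambda>t \<omega>. Y t \<omega> - X t \<omega>)" by (rule wealth_adc[OF wealth_diff[OF Yw(1) Xw(1)]])
  have TT: "T \<in> {0..T}" using T_pos by simp
  have pt: "AE \<omega> in P. X t \<omega> \<le> Y t \<omega>" if t: "t \<in> {0..T}" for t
  proof (cases "t = T")
    case True
    then show ?thesis using le by simp
  next
    case False
    then have tT: "0 \<le> t" "t < T" using t by auto
    define A where "A = {\<omega>\<in>space (F t). Y t \<omega> < X t \<omega>}"
    have A: "A \<in> sets (F t)"
      unfolding A_def using adc_measurable[OF wealth_adc[OF Xw(1)] t] adc_measurable[OF wealth_adc[OF Yw(1)] t] by measurable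
    \<comment> \<open>On \<open>A\<close> after time \<open>t\<close> this is
      \<open>Y s \<omega> + (X t \<omega> - Y t \<omega>)\<close>, that is \<open>Y\<close> plus the
      positive amount saved; everywhere else it is \<open>X\<close>.\<close>
    define V where "V s \<omega> = X s \<omega> + indicat_real A \<omega> * ((Y s \<omega> - X s \<omega>) - (Y (min s t) \<omega> - X (min s t) \<omega>))" for s \<omega>
    have VT: "V T \<omega> = X T \<omega> + indicat_real A \<omega> * ((Y T \<omega> - X T \<omega>) + (X t \<omega> - Y t \<omega>))" for \<omega>
      using tT by (simp add: V_def min_def)
    have "V \<in> nonneg_wealth P F T S x"
    proof (rule nonneg_wealthI)
      show "wealth x V"
        unfolding V_def[abs_def] using wealth_add[OF Xw(1) wealth_switch[OF wealth_diff[OF Yw(1) Xw(1)] tT A]] by simp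
      show "AE \<omega> in P. \<forall>s\<in>{0..T}. 0 \<le> V s \<omega>"
        using Xw(2) Yw(2)
      proof eventually_elim
        case (elim \<omega>)
        show ?case
        proof
          fix s assume s: "s \<in> {0..T}"
          show "0 \<le> V s \<omega>"
          proof (cases "\<omega> \<in> A \<and> t < s")
            case True
            then have "V s \<omega> = Y s \<omega> + (X t \<omega> - Y t \<omega>)" by (simp add: V_def)
            then show ?thesis using True elim s by (auto simp: A_def)
          next
            case False
            then have "V s \<omega> = X s \<omega>" by (auto simp: V_def indicator_def min_def)
            then show ?thesis using elim s by simp
          qed
        qed
      qed
    qed
    moreover have "AE \<omega> in P. X T \<omega> \<le> V T \<omega>"
      using le by eventually_elim (auto simp: VT indicator_def A_def)
    ultimately have "AE \<omega> in P. V T \<omega> = X T \<omega>" by (rule max)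
    then show ?thesis using le AE_space
    proof eventually_elim
      case (elim \<omega>)
      show ?case
      proof (rule ccontr)
        assume n: "\<not> X t \<omega> \<le> Y t \<omega>"
        then have "\<omega> \<in> A" using elim(3) by (simp add: A_def space_F[OF t])
        then show False using elim(1,2) n by (simp add: VT)
      qed
    qed
  qed
  \<comment> \<open>The null set in \<open>pt\<close> depends on \<open>t\<close>; countably many
    times are combined, and the cadlag paths fill in the others.\<close>
  have "AE \<omega> in P. \<forall>t\<in>dtimes. X t \<omega> \<le> Y t \<omega>"
    using dtimes(2) pt by (subst AE_ball_countable[OF dtimes(1)]) blast
  then show ?thesis using adc_cadlag[OF adD]
  proof eventually_elim
    case (elim \<omega>)
    show ?case
    proof
      fix t assume t: "t \<in> {0..T}"
      have "Y t \<omega> - X t \<omega> \<in> {0..}"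
        by (rule cadlag_on_closed[OF elim(2) closed_atLeast _ t]) (use elim(1) in \<open>auto simp: dtimes_def\<close>)
      then show "X t \<omega> \<le> Y t \<omega>" by simp
    qed
  qed
qed

text \<open>A competitor \<open>V\<close> of the sum dominates \<open>Y\<close> at \<open>T\<close>,
  hence at all times by \<open>maximal_wealth_dominated\<close>. So \<open>V - Y\<close> is a
  non-negative competitor of \<open>X\<close>, and maximality of \<open>X\<close> concludes.\<close>

lemma maximal_wealth_add:
  assumes X: "maximal_wealth P F T S X" and Y: "maximal_wealth P F T S Y"
  shows "maximal_wealth P F T S (\<lambda>t \<omega>. X t \<omega> + Y t \<omega>)"
proof -
  obtain x where Xx: "X \<in> nonneg_wealth P F T S x" and
    max: "\<And>X'. X' \<in> nonneg_wealth P F T S x \<Longrightarrow> AE \<omega> in P. X T \<omega> \<le> X' T \<omega> \<Longrightarrow> AE \<omega> in P. X' T \<omega> = X T \<omega>"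
    by (rule maximal_wealthE[OF X], rule that)
  obtain y where Yy: "Y \<in> nonneg_wealth P F T S y" by (rule maximal_wealthE[OF Y])
  have TT: "T \<in> {0..T}" using T_pos by simp
  show ?thesis
  proof (rule maximal_wealthI[OF nonneg_wealth_add[OF Xx Yy]])
    fix V assume V: "V \<in> nonneg_wealth P F T S (x + y)" and le: "AE \<omega> in P. X T \<omega> + Y T \<omega> \<le> V T \<omega>"
    have "AE \<omega> in P. Y T \<omega> \<le> V T \<omega>"
      using le nonneg_wealthD(2)[OF Xx]
    proof eventually_elim
      case (elim \<omega>)
      then show ?case using TT by force
    qed
    note dom = maximal_wealth_dominated[OF Y V this]
    have "(\<lambda>t \<omega>. V t \<omega> - Y t \<omega>) \<in> nonneg_wealth P F T S x"
    proof (rule nonneg_wealthI)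
      show "wealth x (\<lambda>t \<omega>. V t \<omega> - Y t \<omega>)"
        using wealth_diff[OF nonneg_wealthD(1)[OF V] nonneg_wealthD(1)[OF Yy]] by simp
      show "AE \<omega> in P. \<forall>t\<in>{0..T}. 0 \<le> V t \<omega> - Y t \<omega>" using dom by eventually_elim simp
    qed
    moreover have "AE \<omega> in P. X T \<omega> \<le> V T \<omega> - Y T \<omega>" using le by eventually_elim simp
    ultimately have "AE \<omega> in P. V T \<omega> - Y T \<omega> = X T \<omega>" by (rule max)
    then show "AE \<omega> in P. V T \<omega> = X T \<omega> + Y T \<omega>" by eventually_elim simp
  qed
qed

lemma maximal_wealth_cmult:
  assumes X: "maximal_wealth P F T S X" and a: "0 < a"
  shows "maximal_wealth P F T S (\<lambda>t \<omega>. a * X t \<omega>)"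
proof -
  obtain x where Xx: "X \<in> nonneg_wealth P F T S x" and
    max: "\<And>X'. X' \<in> nonneg_wealth P F T S x \<Longrightarrow> AE \<omega> in P. X T \<omega> \<le> X' T \<omega> \<Longrightarrow> AE \<omega> in P. X' T \<omega> = X T \<omega>"
    by (rule maximal_wealthE[OF X], rule that)
  show ?thesis
  proof (rule maximal_wealthI[OF nonneg_wealth_cmult[OF Xx less_imp_le[OF a]]])
    fix V assume V: "V \<in> nonneg_wealth P F T S (a * x)" and le: "AE \<omega> in P. a * X T \<omega> \<le> V T \<omega>"
    have "(\<lambda>t \<omega>. (1 / a) * V t \<omega>) \<in> nonneg_wealth P F T S x"
      using nonneg_wealth_cmult[OF V, of "1 / a"] a by simp
    moreover have "AE \<omega> in P. X T \<omega> \<le> (1 / a) * V T \<omega>" using le by eventually_elim (use a in \<open>simp add: field_simps\<close>)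
    ultimately have "AE \<omega> in P. (1 / a) * V T \<omega> = X T \<omega>" by (rule max)
    then show "AE \<omega> in P. V T \<omega> = a * X T \<omega>" by eventually_elim (use a in \<open>simp add: field_simps\<close>)
  qed
qed

text \<open>A non-zero gain from zero initial wealth could be added to the maximal \<open>X\<close>
  and would improve on it. The existence of some maximal process thus expresses absence of
  arbitrage.\<close>

lemma maximal_wealth_zero:
  assumes X: "maximal_wealth P F T S X"
  shows "maximal_wealth P F T S (\<lambda>t \<omega>. 0)"
proof -
  obtain x where Xx: "X \<in> nonneg_wealth P F T S x" and
    max: "\<And>X'. X' \<in> nonneg_wealth P F T S x \<Longrightarrow> AE \<omega> in P. X T \<omega> \<le> X' T \<omega> \<Longrightarrow> AE \<omega> in P. X' T \<omega> = X T \<omega>"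
    by (rule maximal_wealthE[OF X], rule that)
  have "(\<lambda>t \<omega>. 0) \<in> nonneg_wealth P F T S 0" using nonneg_wealth_cmult[OF Xx, of 0] by simp
  then show ?thesis
  proof (rule maximal_wealthI)
    fix V assume V: "V \<in> nonneg_wealth P F T S 0" and le: "AE \<omega> in P. 0 \<le> V T \<omega>"
    have "(\<lambda>t \<omega>. X t \<omega> + V t \<omega>) \<in> nonneg_wealth P F T S x" using nonneg_wealth_add[OF Xx V] by simp
    moreover have "AE \<omega> in P. X T \<omega> \<le> X T \<omega> + V T \<omega>" using le by eventually_elim simp
    ultimately have "AE \<omega> in P. X T \<omega> + V T \<omega> = X T \<omega>" by (rule max)
    then show "AE \<omega> in P. V T \<omega> = 0" by eventually_elim simp
  qed
qed

lemma acceptableI: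
  assumes "X' \<in> nonneg_wealth P F T S x" "maximal_wealth P F T S X''"
    "\<And>t \<omega>. X t \<omega> = X' t \<omega> - X'' t \<omega>"
  shows "acceptable P F T S X"
proof -
  obtain y where Y: "X'' \<in> nonneg_wealth P F T S y" by (rule maximal_wealthE[OF assms(2)])
  have "X = (\<lambda>t \<omega>. X' t \<omega> - X'' t \<omega>)" using assms(3) by blast
  then have "wealth (x - y) X" using wealth_diff[OF nonneg_wealthD(1)[OF assms(1)] nonneg_wealthD(1)[OF Y]] by simp
  moreover have "nonneg_process P T X'" "wealth x X'"
    using assms(1) unfolding nonneg_wealth_def by blast+
  ultimately show ?thesis
    unfolding acceptable_def wealth_process_def using assms(2,3) by (intro conjI exI) auto
qed

lemma acceptableE:
  assumes "acceptable P F T S X"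
  obtains x w X' X'' where "wealth w X" "X' \<in> nonneg_wealth P F T S x" "maximal_wealth P F T S X''"
    "AE \<omega> in P. \<forall>t\<in>{0..T}. X t \<omega> = X' t \<omega> - X'' t \<omega>"
  using assms unfolding acceptable_def wealth_process_def nonneg_wealth_def by blast

lemma acceptable_measurable:
  assumes "acceptable P F T S X" shows "X T \<in> borel_measurable P"
  using assms T_pos by (elim acceptableE) (auto intro: wealth_measurable)

lemma acceptable_linear:
  assumes X: "acceptable P F T S X" and Y: "acceptable P F T S Y" and ab: "0 < a" "0 < b"
  shows "acceptable P F T S (\<lambda>t \<omega>. a * X t \<omega> + b * Y t \<omega>)"
proof -
  obtain x w X1 X2 where X: "wealth w X" "X1 \<in> nonneg_wealth P F T S x" "maximal_wealth P F T S X2"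
    "AE \<omega> in P. \<forall>t\<in>{0..T}. X t \<omega> = X1 t \<omega> - X2 t \<omega>" by (rule acceptableE[OF X])
  obtain y v Y1 Y2 where Y: "wealth v Y" "Y1 \<in> nonneg_wealth P F T S y" "maximal_wealth P F T S Y2"
    "AE \<omega> in P. \<forall>t\<in>{0..T}. Y t \<omega> = Y1 t \<omega> - Y2 t \<omega>" by (rule acceptableE[OF Y])
  let ?A = "\<lambda>t \<omega>. a * X1 t \<omega> + b * Y1 t \<omega>" and ?B = "\<lambda>t \<omega>. a * X2 t \<omega> + b * Y2 t \<omega>"
  have A: "?A \<in> nonneg_wealth P F T S (a * x + b * y)"
    using ab by (intro nonneg_wealth_add nonneg_wealth_cmult X Y) auto
  have B: "maximal_wealth P F T S ?B" using ab by (intro maximal_wealth_add maximal_wealth_cmult X Y)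
  have "AE \<omega> in P. \<forall>t\<in>{0..T}. a * X t \<omega> + b * Y t \<omega> = ?A t \<omega> - ?B t \<omega>"
    using X(4) Y(4) by eventually_elim (simp add: right_diff_distrib)
  moreover have "nonneg_process P T ?A" "wealth (a * x + b * y) ?A" using A unfolding nonneg_wealth_def by blast+
  ultimately show ?thesis
    unfolding acceptable_def wealth_process_def using B wealth_linear[OF X(1) Y(1), of a b] by blast
qed

lemma acceptable_shift:
  assumes X: "acceptable P F T S X" and c: "0 \<le> c"
  shows "acceptable P F T S (\<lambda>t \<omega>. X t \<omega> + c)"
proof -
  obtain x w X1 X2 where X: "wealth w X" "X1 \<in> nonneg_wealth P F T S x" "maximal_wealth P F T S X2"
    "AE \<omega> in P. \<forall>t\<in>{0..T}. X t \<omega> = X1 t \<omega> - X2 t \<omega>" by (rule acceptableE[OF X])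
  let ?A = "\<lambda>t \<omega>. X1 t \<omega> + c"
  have "wealth (x + c) ?A" by (rule wealth_shift[OF nonneg_wealthD(1)[OF X(2)]])
  moreover have "nonneg_process P T ?A"
    unfolding nonneg_process_def using nonneg_wealthD(2)[OF X(2)] by eventually_elim (use c in simp)
  moreover have "AE \<omega> in P. \<forall>t\<in>{0..T}. X t \<omega> + c = ?A t \<omega> - X2 t \<omega>"
    using X(4) by eventually_elim simp
  ultimately show ?thesis
    unfolding acceptable_def wealth_process_def using X(3) wealth_shift[OF X(1), of c] by blast
qed

end

section \<open>Expected utility\<close>

lemma utility_mono_on: "utility_function U \<Longrightarrow> 0 < x \<Longrightarrow> x \<le> y \<Longrightarrow> U x \<le> U y"
  unfolding utility_function_def by (metis strict_mono_on_leD greaterThan_iff order_less_le_trans)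

text \<open>By monotonicity the right limit at zero is an infimum, so that the \<open>Lim\<close> in
  the definition is a genuine limit, possibly \<open>-\<infinity>\<close>.\<close>

lemma extended_utility_zero:
  assumes U: "utility_function U"
  shows "extended_utility U 0 = (INF z\<in>{0<..}. ereal (U z))"
proof -
  have "((\<lambda>z. ereal (U z)) \<longlongrightarrow> (INF z\<in>{0<..}. ereal (U z))) (at_right 0)"
  proof (rule order_tendstoI)
    fix a assume a: "a < (INF z\<in>{0<..}. ereal (U z))"
    have "\<forall>\<^sub>F z in at_right (0::real). 0 < z" by (rule eventually_at_right_less)
    then show "\<forall>\<^sub>F z in at_right 0. a < ereal (U z)"
      by eventually_elim (use a in \<open>auto intro: order_less_le_trans INF_lower\<close>)
  next
    fix a assume "(INF z\<in>{0<..}. ereal (U z)) < a"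
    then obtain y where y: "0 < y" "ereal (U y) < a" by (auto simp: INF_less_iff)
    have "\<forall>\<^sub>F z in at_right (0::real). 0 < z \<and> z < y"
      unfolding eventually_at_right_field using y(1) by (intro exI[of _ y]) auto
    then show "\<forall>\<^sub>F z in at_right 0. ereal (U z) < a"
    proof eventually_elim
      case (elim z)
      then have "ereal (U z) \<le> ereal (U y)" using utility_mono_on[OF U, of z y] by simp
      then show ?case using y(2) by (rule order_le_less_trans)
    qed
  qed
  then have "Lim (at_right 0) (\<lambda>z. ereal (U z)) = (INF z\<in>{0<..}. ereal (U z))"
    by (rule tendsto_Lim[OF trivial_limit_at_right_real])
  then show ?thesis by (simp add: extended_utility_def)
qed

lemma extended_utility_mono:
  assumes U: "utility_function U" and le: "x \<le> y"
  shows "extended_utility U x \<le> extended_utility U y"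
proof -
  consider "0 < x" | "x = 0" "0 < y" | "x = 0" "y = 0" | "x < 0" using le by linarith
  then show ?thesis
  proof cases
    case 1
    then show ?thesis using le utility_mono_on[OF U 1 le] by (simp add: extended_utility_def)
  next
    case 2
    then have "extended_utility U x \<le> ereal (U y)"
      using extended_utility_zero[OF U] by (auto intro: INF_lower)
    then show ?thesis using 2 by (simp add: extended_utility_def)
  qed (auto simp: extended_utility_def)
qed

lemma extended_expectation_mono:
  assumes "AE \<omega> in P. g \<omega> \<le> h \<omega>"
  shows "extended_expectation P g \<le> extended_expectation P h"
proof -
  have neg: "(\<integral>\<^sup>+\<omega>. e2ennreal (- h \<omega>) \<partial>P) \<le> (\<integral>\<^sup>+\<omega>. e2ennreal (- g \<omega>) \<partial>P)"
    using assms by (intro nn_integral_mono_AE) (auto elim!: eventually_mono intro!: e2ennreal_mono)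
  have pos: "(\<integral>\<^sup>+\<omega>. e2ennreal (g \<omega>) \<partial>P) \<le> (\<integral>\<^sup>+\<omega>. e2ennreal (h \<omega>) \<partial>P)"
    using assms by (intro nn_integral_mono_AE) (auto elim!: eventually_mono intro!: e2ennreal_mono)
  show ?thesis
  proof (cases "(\<integral>\<^sup>+\<omega>. e2ennreal (- g \<omega>) \<partial>P) = \<infinity>")
    case True
    then show ?thesis by (simp add: extended_expectation_def)
  next
    case False
    then have "(\<integral>\<^sup>+\<omega>. e2ennreal (- h \<omega>) \<partial>P) \<noteq> \<infinity>" using neg by (auto simp: top_unique)
    then show ?thesis
      using False neg pos by (simp add: extended_expectation_def ereal_minus_mono less_eq_ennreal.rep_eq)
  qed
qed

text \<open>Where \<open>Z\<close> is negative the utility is \<open>-\<infinity>\<close>; on an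
  event of positive probability this would make the integral of the negative part infinite.\<close>

lemma (in prob_space) extended_expectation_utility_nonneg:
  assumes Z: "Z \<in> borel_measurable M"
    and fin: "extended_expectation M (\<lambda>\<omega>. extended_utility U (Z \<omega>)) > -\<infinity>"
  shows "AE \<omega> in M. 0 \<le> Z \<omega>"
proof -
  define A where "A = {\<omega>\<in>space M. Z \<omega> < 0}"
  have A: "A \<in> events" unfolding A_def using Z by measurable
  have "emeasure M A = 0"
  proof (rule ccontr)
    assume "emeasure M A \<noteq> 0"
    then have "\<infinity> = (\<infinity> :: ennreal) * emeasure M A" by (simp add: ennreal_top_mult)
    also have "\<dots> = (\<integral>\<^sup>+\<omega>. \<infinity> * indicator A \<omega> \<partial>M)" by (rule nn_integral_cmult_indicator[OF A, symmetric])
    also have "\<dots> \<le> (\<integral>\<^sup>+\<omega>. e2ennreal (- extended_utility U (Z \<omega>)) \<partial>M)"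
      by (intro nn_integral_mono) (auto simp: A_def indicator_def extended_utility_def)
    finally have "(\<integral>\<^sup>+\<omega>. e2ennreal (- extended_utility U (Z \<omega>)) \<partial>M) = \<infinity>" by (simp add: top_unique)
    then show False using fin by (simp add: extended_expectation_def)
  qed
  then have "AE \<omega> in M. \<omega> \<notin> A" using A by (intro AE_not_in) (auto simp: null_sets_def)
  then show ?thesis using AE_space by eventually_elim (auto simp: A_def)
qed

text \<open>The negative part is at most that of the constant \<open>U e\<close>, so its integral is
  finite, and an infinite positive part does no harm.\<close>

lemma (in prob_space) extended_expectation_utility_finite:
  assumes U: "utility_function U" and e: "0 < e" and Z: "AE \<omega> in M. e \<le> Z \<omega>"
  shows "extended_expectation M (\<lambda>\<omega>. extended_utility U (Z \<omega>)) > -\<infinity>"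
proof -
  have "(\<integral>\<^sup>+\<omega>. e2ennreal (- extended_utility U (Z \<omega>)) \<partial>M) \<le> (\<integral>\<^sup>+\<omega>. ennreal (- U e) \<partial>M)"
  proof (rule nn_integral_mono_AE)
    show "AE \<omega> in M. e2ennreal (- extended_utility U (Z \<omega>)) \<le> ennreal (- U e)"
      using Z
    proof eventually_elim
      case (elim \<omega>)
      have "- extended_utility U (Z \<omega>) \<le> ereal (- U e)"
        using extended_utility_mono[OF U elim] e by (simp add: extended_utility_def ereal_uminus_le_reorder)
      then show ?case by (metis e2ennreal_mono e2ennreal_ereal)
    qed
  qed
  also have "\<dots> < \<infinity>" by (simp add: emeasure_space_1)
  finally have n: "(\<integral>\<^sup>+\<omega>. e2ennreal (- extended_utility U (Z \<omega>)) \<partial>M) < \<infinity>" .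
  then have "enn2ereal (\<integral>\<^sup>+\<omega>. e2ennreal (- extended_utility U (Z \<omega>)) \<partial>M) < \<infinity>"
    by (simp add: less_ennreal.rep_eq)
  moreover have "0 \<le> enn2ereal (\<integral>\<^sup>+\<omega>. e2ennreal (extended_utility U (Z \<omega>)) \<partial>M)" by simp
  ultimately show ?thesis using n
    by (cases "enn2ereal (\<integral>\<^sup>+\<omega>. e2ennreal (extended_utility U (Z \<omega>)) \<partial>M)";
      cases "enn2ereal (\<integral>\<^sup>+\<omega>. e2ennreal (- extended_utility U (Z \<omega>)) \<partial>M)")
      (auto simp: extended_expectation_def)
qed

section \<open>Prices at the boundary\<close>

locale claims_market = market P F T S \<mu>
  for P :: "'a measure" and F :: "real \<Rightarrow> 'a measure" and T :: real
    and S :: "('a, real^'d) process" and \<mu> :: "(real \<times> 'a) measure" +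
  fixes f :: "'a \<Rightarrow> real^'n" and U :: "real \<Rightarrow> real"
  assumes f_measurable: "f \<in> borel_measurable (F T)" and utility: "utility_function U"
    and claims_dominated: "\<exists>X'. wealth_process P F T S X' \<and> nonneg_process P T X' \<and> (AE \<omega> in P. norm (f \<omega>) \<le> X' T \<omega>)"
begin

text \<open>The cone \<open>K\<close> of the overview.\<close>

definition superhedgeable :: "(real \<times> (real^'n)) set" where
  "superhedgeable = {(x, q). superhedging_wealth P F T S f x q \<noteq> {}}"

abbreviation max_utility :: "real \<Rightarrow> real^'n \<Rightarrow> ereal" where
  "max_utility \<equiv> value_function P F T S f U"

lemma superhedgeableI:
  "acceptable P F T S X \<Longrightarrow> AE \<omega> in P. X 0 \<omega> = x \<Longrightarrow> AE \<omega> in P. 0 \<le> X T \<omega> + q \<bullet> f \<omega> \<Longrightarrow> (x, q) \<in> superhedgeable"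
  unfolding superhedgeable_def superhedging_wealth_def by blast

lemma superhedgeableE:
  assumes "(x, q) \<in> superhedgeable"
  obtains X where "acceptable P F T S X" "AE \<omega> in P. X 0 \<omega> = x" "AE \<omega> in P. 0 \<le> X T \<omega> + q \<bullet> f \<omega>"
  using assms unfolding superhedgeable_def superhedging_wealth_def by blast

lemma superhedgeable_linear:
  assumes "(x, q) \<in> superhedgeable" "(y, r) \<in> superhedgeable" "0 < a" "0 < b"
  shows "(a * x + b * y, a *\<^sub>R q + b *\<^sub>R r) \<in> superhedgeable"
proof -
  obtain X where X: "acceptable P F T S X" "AE \<omega> in P. X 0 \<omega> = x" "AE \<omega> in P. 0 \<le> X T \<omega> + q \<bullet> f \<omega>"
    by (rule superhedgeableE[OF assms(1)])
  obtain Y where Y: "acceptable P F T S Y" "AE \<omega> in P. Y 0 \<omega> = y" "AE \<omega> in P. 0 \<le> Y T \<omega> + r \<bullet> f \<omega>"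
    by (rule superhedgeableE[OF assms(2)])
  show ?thesis
  proof (rule superhedgeableI[OF acceptable_linear[OF X(1) Y(1) assms(3,4)]])
    show "AE \<omega> in P. a * X 0 \<omega> + b * Y 0 \<omega> = a * x + b * y" using X(2) Y(2) by eventually_elim simp
    show "AE \<omega> in P. 0 \<le> a * X T \<omega> + b * Y T \<omega> + (a *\<^sub>R q + b *\<^sub>R r) \<bullet> f \<omega>"
      using X(3) Y(3)
    proof eventually_elim
      case (elim \<omega>)
      have "0 \<le> a * (X T \<omega> + q \<bullet> f \<omega>) + b * (Y T \<omega> + r \<bullet> f \<omega>)" using elim assms(3,4) by simp
      then show ?case by (simp add: inner_add_left algebra_simps)
    qed
  qed
qed

lemma superhedgeable_scale: "z \<in> superhedgeable \<Longrightarrow> 0 < a \<Longrightarrow> a *\<^sub>R z \<in> superhedgeable"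
  using superhedgeable_linear[of "fst z" "snd z" "fst z" "snd z" "a / 2" "a / 2"]
  by (cases z) (simp add: scaleR_left_distrib[symmetric] mult.commute)

lemma convex_superhedgeable: "convex superhedgeable"
proof (rule convexI)
  fix z w :: "real \<times> (real^'n)" and u v :: real
  assume zw: "z \<in> superhedgeable" "w \<in> superhedgeable" and uv: "0 \<le> u" "0 \<le> v" "u + v = 1"
  show "u *\<^sub>R z + v *\<^sub>R w \<in> superhedgeable"
  \<comment> \<open>\<open>superhedgeable_linear\<close> is stated for positive weights, like the
    scaling of maximal processes, so the end points of the segment are treated apart.\<close>
  proof (cases "u = 0 \<or> v = 0")
    case True
    then show ?thesis using zw uv by auto
  next
    case False
    then show ?thesis
      using superhedgeable_linear[of "fst z" "snd z" "fst w" "snd w" u v] zw uv by (cases z; cases w) simp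
  qed
qed

lemma acceptable_terminal_measurable:
  assumes "acceptable P F T S X" shows "(\<lambda>\<omega>. X T \<omega> + q \<bullet> f \<omega>) \<in> borel_measurable P"
proof -
  have "f \<in> borel_measurable P" by (rule measurable_F_P[OF f_measurable]) (use T_pos in simp)
  then show ?thesis using acceptable_measurable[OF assms] by measurable
qed

lemma value_domain_superhedgeable: "value_domain P F T S f U \<subseteq> superhedgeable"
proof
  fix z assume "z \<in> value_domain P F T S f U"
  then obtain x q where z: "z = (x, q)" and "-\<infinity> < max_utility x q" by (auto simp: value_domain_def)
  then obtain X where X: "acceptable P F T S X" "AE \<omega> in P. X 0 \<omega> = x"
      "-\<infinity> < extended_expectation P (\<lambda>\<omega>. extended_utility U (X T \<omega> + q \<bullet> f \<omega>))"
    unfolding value_function_def less_SUP_iff by blast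
  then show "z \<in> superhedgeable"
    unfolding z by (intro superhedgeableI[OF X(1,2)] extended_expectation_utility_nonneg[OF acceptable_terminal_measurable[OF X(1)] X(3)])
qed

lemma superhedgeable_shift_value_domain:
  assumes "(x, q) \<in> superhedgeable" "0 < e"
  shows "(x + e, q) \<in> value_domain P F T S f U"
proof -
  obtain X where X: "acceptable P F T S X" "AE \<omega> in P. X 0 \<omega> = x" "AE \<omega> in P. 0 \<le> X T \<omega> + q \<bullet> f \<omega>"
    by (rule superhedgeableE[OF assms(1)])
  have "AE \<omega> in P. e \<le> X T \<omega> + e + q \<bullet> f \<omega>" using X(3) by eventually_elim simp
  then have "-\<infinity> < extended_expectation P (\<lambda>\<omega>. extended_utility U (X T \<omega> + e + q \<bullet> f \<omega>))"
    by (rule extended_expectation_utility_finite[OF utility assms(2)])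
  also have "\<dots> \<le> max_utility (x + e) q"
    unfolding value_function_def
  proof (rule SUP_upper2[where i="\<lambda>t \<omega>. X t \<omega> + e"])
    have "AE \<omega> in P. X 0 \<omega> + e = x + e" using X(2) by eventually_elim simp
    then show "(\<lambda>t \<omega>. X t \<omega> + e) \<in> {X. acceptable P F T S X \<and> (AE \<omega> in P. X 0 \<omega> = x + e)}"
      using acceptable_shift[OF X(1), of e] assms(2) by simp
  qed simp
  finally show ?thesis by (simp add: value_domain_def)
qed

lemma max_utility_mono:
  assumes "x \<le> y" shows "max_utility x q \<le> max_utility y q"
  unfolding value_function_def
proof (rule SUP_mono)
  fix X assume "X \<in> {X. acceptable P F T S X \<and> (AE \<omega> in P. X 0 \<omega> = x)}"
  then have X: "acceptable P F T S X" "AE \<omega> in P. X 0 \<omega> = x" by auto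
  let ?X = "\<lambda>t \<omega>. X t \<omega> + (y - x)"
  have "AE \<omega> in P. ?X 0 \<omega> = y" using X(2) by eventually_elim simp
  then have "?X \<in> {X. acceptable P F T S X \<and> (AE \<omega> in P. X 0 \<omega> = y)}"
    using acceptable_shift[OF X(1), of "y - x"] assms by simp
  then show "\<exists>Y\<in>{X. acceptable P F T S X \<and> (AE \<omega> in P. X 0 \<omega> = y)}.
      extended_expectation P (\<lambda>\<omega>. extended_utility U (X T \<omega> + q \<bullet> f \<omega>)) \<le>
      extended_expectation P (\<lambda>\<omega>. extended_utility U (Y T \<omega> + q \<bullet> f \<omega>))"
  proof (rule bexI[rotated])
    show "extended_expectation P (\<lambda>\<omega>. extended_utility U (X T \<omega> + q \<bullet> f \<omega>)) \<le>
        extended_expectation P (\<lambda>\<omega>. extended_utility U (?X T \<omega> + q \<bullet> f \<omega>))"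
      using assms by (intro extended_expectation_mono AE_I2 extended_utility_mono[OF utility]) simp
  qed
qed

lemma supporting_price:
  assumes D: "(x, q) \<in> value_domain P F T S f U" and bd: "(x, q) \<in> frontier (value_domain P F T S f U)"
  obtains p where "\<And>x' q'. (x', q') \<in> superhedgeable \<Longrightarrow> 0 \<le> x' + p \<bullet> q'" "x = - (p \<bullet> q)"
proof -
  have K: "(x, q) \<in> superhedgeable" using D value_domain_superhedgeable by blast
  obtain X where "acceptable P F T S X" by (rule superhedgeableE[OF K])
  then obtain M where "maximal_wealth P F T S M" by (rule acceptableE)
  then have zero: "maximal_wealth P F T S (\<lambda>t \<omega>. 0)" by (rule maximal_wealth_zero)
  obtain X' x1 where X': "X' \<in> nonneg_wealth P F T S x1" "AE \<omega> in P. norm (f \<omega>) \<le> X' T \<omega>"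
    using claims_dominated unfolding wealth_process_def nonneg_wealth_def by blast
  have x1: "0 \<le> x1" by (rule nonneg_wealth_initial[OF X'(1)])
  \<comment> \<open>A multiple of the dominating wealth process, less the maximal process zero,
    makes up for the worst case of \<open>r \<bullet> f\<close> by Cauchy-Schwarz. The spare cash
    \<open>c\<close> yields an open set inside the cone.\<close>
  have dom: "(norm r * x1 + c, r) \<in> superhedgeable" if c: "0 \<le> c" for r :: "real^'n" and c
  proof (rule superhedgeableI)
    have Y: "(\<lambda>t \<omega>. norm r * X' t \<omega>) \<in> nonneg_wealth P F T S (norm r * x1)"
      by (rule nonneg_wealth_cmult[OF X'(1)]) simp
    show "acceptable P F T S (\<lambda>t \<omega>. norm r * X' t \<omega> + c)"
      by (rule acceptable_shift[OF acceptableI[OF Y zero] c]) simp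
    show "AE \<omega> in P. norm r * X' 0 \<omega> + c = norm r * x1 + c"
      using wealth_start[OF nonneg_wealthD(1)[OF Y]] by eventually_elim simp
    show "AE \<omega> in P. 0 \<le> norm r * X' T \<omega> + c + r \<bullet> f \<omega>"
      using X'(2)
    proof eventually_elim
      case (elim \<omega>)
      have "- (r \<bullet> f \<omega>) \<le> norm r * norm (f \<omega>)" using Cauchy_Schwarz_ineq2[of r "f \<omega>"] by linarith
      also have "\<dots> \<le> norm r * X' T \<omega>" using elim by (intro mult_left_mono) auto
      finally show ?case using c by simp
    qed
  qed
  have one: "(1, 0) \<in> superhedgeable" using dom[of 1 0] by simp
  have "interior superhedgeable \<noteq> {}"
  proof -
    have "open {z :: real \<times> (real^'n). norm (snd z) * x1 < fst z}"
      by (intro open_Collect_less continuous_intros)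
    moreover have "{z :: real \<times> (real^'n). norm (snd z) * x1 < fst z} \<subseteq> superhedgeable"
    proof
      fix z :: "real \<times> (real^'n)" assume "z \<in> {z. norm (snd z) * x1 < fst z}"
      then show "z \<in> superhedgeable" using dom[of "fst z - norm (snd z) * x1" "snd z"] by (cases z) simp
    qed
    ultimately have "{z :: real \<times> (real^'n). norm (snd z) * x1 < fst z} \<subseteq> interior superhedgeable"
      by (rule interior_maximal[rotated])
    moreover have "(1, 0) \<in> {z :: real \<times> (real^'n). norm (snd z) * x1 < fst z}" by simp
    ultimately show ?thesis by blast
  qed
  \<comment> \<open>With interior points at hand, the relative frontier of the separation theorem is
    the ordinary one.\<close>
  then have rel: "rel_interior superhedgeable = interior superhedgeable" by (rule rel_interior_nonempty_interior)
  \<comment> \<open>If a ball of radius \<open>e\<close> lay in the cone, then each point of the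
    concentric ball of radius \<open>e / 2\<close> would be a superhedgeable point plus the cash
    amount \<open>e / 2\<close>, and so would belong to the domain of the value function.\<close>
  have "(x, q) \<notin> interior superhedgeable"
  proof
    assume "(x, q) \<in> interior superhedgeable"
    then obtain e where e: "0 < e" "ball (x, q) e \<subseteq> superhedgeable" unfolding mem_interior by blast
    have "ball (x, q) (e / 2) \<subseteq> value_domain P F T S f U"
    proof
      fix z assume z: "z \<in> ball (x, q) (e / 2)"
      have "dist (x, q) (fst z - e / 2, snd z) \<le> dist (x, q) z + dist z (fst z - e / 2, snd z)" by (rule dist_triangle)
      also have "dist z (fst z - e / 2, snd z) = e / 2"
        using e(1) by (cases z) (simp add: dist_Pair_Pair dist_real_def)
      finally have "(fst z - e / 2, snd z) \<in> superhedgeable" using z e(2) by (intro set_mp[OF e(2)]) simp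
      then show "z \<in> value_domain P F T S f U"
        using superhedgeable_shift_value_domain[of "fst z - e / 2" "snd z" "e / 2"] e(1) by simp
    qed
    then have "(x, q) \<in> interior (value_domain P F T S f U)" using e(1) unfolding mem_interior by (intro exI[of _ "e / 2"]) simp
    then show False using bd by (simp add: frontier_def)
  qed
  then obtain v where v: "v \<noteq> 0" "\<And>y. y \<in> closure superhedgeable \<Longrightarrow> v \<bullet> (x, q) \<le> v \<bullet> y"
    using supporting_hyperplane_relative_frontier[OF convex_superhedgeable, of "(x, q)"] K closure_subset
    unfolding rel by (metis subsetD)
  obtain a b where ab: "v = (a, b)" by (cases v)
  have le: "a * x + b \<bullet> q \<le> a * x' + b \<bullet> q'" if "(x', q') \<in> superhedgeable" for x' q'
    using v(2)[OF subsetD[OF closure_subset that]] by (simp add: ab inner_Pair)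
  \<comment> \<open>Scaling the touching point by two and by one half stays in the cone, so the
    minimum of the functional over the cone can only be zero.\<close>
  define s where "s = a * x + b \<bullet> q"
  have "s \<le> 2 * s" "s \<le> (1/2) * s"
    unfolding s_def
    using le[of "2 * x" "2 *\<^sub>R q"] le[of "(1/2) * x" "(1/2) *\<^sub>R q"]
      superhedgeable_scale[OF K, of 2] superhedgeable_scale[OF K, of "1/2"] by (simp_all add: algebra_simps)
  then have "s = 0" by linarith
  then have zero: "a * x + b \<bullet> q = 0" by (simp add: s_def)
  have nn: "0 \<le> a * x' + b \<bullet> q'" if "(x', q') \<in> superhedgeable" for x' q'
    using le[OF that] zero by simp
  have a0: "0 \<le> a" using nn[OF one] by simp
  \<comment> \<open>If \<open>a\<close> vanished, the position \<open>- b\<close>, superhedgeable by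
    \<open>dom\<close>, would give \<open>b \<bullet> b \<le> 0\<close> and thus a zero functional.
    The cash coefficient is therefore positive and can be normalized to one.\<close>
  have "a \<noteq> 0"
  proof
    assume a: "a = 0"
    have "0 \<le> b \<bullet> (- b)" using nn[OF dom[of 0 "- b"]] a by simp
    then have "b \<bullet> b \<le> 0" by simp
    then have "b = 0" using inner_gt_zero_iff[of b] by linarith
    then show False using v(1) a ab by (simp add: zero_prod_def)
  qed
  with a0 have a: "0 < a" by simp
  show ?thesis
  proof (rule that[of "(1 / a) *\<^sub>R b"])
    fix x' q' assume "(x', q') \<in> superhedgeable"
    then have "0 \<le> (a * x' + b \<bullet> q') / a" using nn a by simp
    then show "0 \<le> x' + ((1 / a) *\<^sub>R b) \<bullet> q'" using a by (simp add: field_simps)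
  next
    show "x = - (((1 / a) *\<^sub>R b) \<bullet> q)" using zero a by (simp add: field_simps)
  qed
qed

lemma marginal_price_segment:
  assumes p: "\<And>x' q'. (x', q') \<in> superhedgeable \<Longrightarrow> 0 \<le> x' + p \<bullet> q'" and x: "x = - (p \<bullet> q)"
    and p0: "p0 \<in> marginal_prices P F T S f U x q"
  shows "closed_segment p0 p - {p} \<subseteq> marginal_prices P F T S f U x q"
proof
  fix r assume r: "r \<in> closed_segment p0 p - {p}"
  then obtain t where t: "0 \<le> t" "t \<le> 1" "r = (1 - t) *\<^sub>R p0 + t *\<^sub>R p" by (auto simp: in_segment)
  then have t1: "t < 1" using r by (cases "t = 1") auto
  have fin: "\<bar>max_utility x q\<bar> \<noteq> \<infinity>" and m: "\<And>q'. max_utility (x - q' \<bullet> p0) (q + q') \<le> max_utility x q"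
    using p0 by (auto simp: marginal_prices_def)
  have "max_utility (x - q' \<bullet> r) (q + q') \<le> max_utility x q" for q'
  \<comment> \<open>A trade that leads out of the domain satisfies the inequality trivially; one
    that stays inside is restricted by the supporting functional.\<close>
  proof (cases "max_utility (x - q' \<bullet> r) (q + q') = -\<infinity>")
    case False
    then have "(x - q' \<bullet> r, q + q') \<in> value_domain P F T S f U" by (simp add: value_domain_def)
    then have "0 \<le> x - q' \<bullet> r + p \<bullet> (q + q')" using value_domain_superhedgeable by (intro p) blast
    then have "0 \<le> q' \<bullet> (p - r)" by (simp add: x inner_diff_right inner_add_right inner_commute)
    \<comment> \<open>Because \<open>t < 1\<close>, the sign of \<open>q' \<bullet> (p - r)\<close>
      passes to \<open>q' \<bullet> (p - p0)\<close>. This is where the end point \<open>p\<close>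
      has to be excluded.\<close>
    also have "p - r = (1 - t) *\<^sub>R (p - p0)" by (simp add: t(3) algebra_simps)
    finally have "0 \<le> q' \<bullet> (p - p0)" using t1 by (simp add: zero_le_mult_iff)
    then have "0 \<le> t * (q' \<bullet> (p - p0))" using t(1) by simp
    then have "q' \<bullet> p0 \<le> q' \<bullet> r" by (simp add: t(3) inner_diff_right inner_add_right algebra_simps)
    then have "max_utility (x - q' \<bullet> r) (q + q') \<le> max_utility (x - q' \<bullet> p0) (q + q')" by (intro max_utility_mono) simp
    then show ?thesis using m[of q'] by (rule order_trans)
  qed simp
  with fin show "r \<in> marginal_prices P F T S f U x q" by (simp add: marginal_prices_def)
qed

text \<open>Any competitor \<open>V\<close> of \<open>X1\<close> yields the superhedge
  \<open>V - X2\<close>, whose terminal value must equal that of \<open>X\<close>, so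
  \<open>V\<close> and \<open>X1\<close> agree at \<open>T\<close>. Once \<open>X1\<close> and
  \<open>X2\<close> are both maximal, they can exchange roles, and \<open>- X\<close> is acceptable
  as well as \<open>X\<close>.\<close>

lemma superhedging_equality_replicable:
  assumes X: "X \<in> superhedging_wealth P F T S f x q"
    and eq: "\<And>X. X \<in> superhedging_wealth P F T S f x q \<Longrightarrow> AE \<omega> in P. X T \<omega> = - (q \<bullet> f \<omega>)"
  shows "replicable P F T S (\<lambda>\<omega>. q \<bullet> f \<omega>)"
proof -
  have TT: "T \<in> {0..T}" "0 \<in> {0..T}" using T_pos by auto
  have Xa: "acceptable P F T S X" "AE \<omega> in P. X 0 \<omega> = x" "AE \<omega> in P. 0 \<le> X T \<omega> + q \<bullet> f \<omega>"
    using X by (auto simp: superhedging_wealth_def)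
  obtain y w X1 X2 where XX: "wealth w X" "X1 \<in> nonneg_wealth P F T S y" "maximal_wealth P F T S X2"
    "AE \<omega> in P. \<forall>t\<in>{0..T}. X t \<omega> = X1 t \<omega> - X2 t \<omega>" by (rule acceptableE[OF Xa(1)])
  have X1: "maximal_wealth P F T S X1"
  proof (rule maximal_wealthI[OF XX(2)])
    fix V assume V: "V \<in> nonneg_wealth P F T S y" and le: "AE \<omega> in P. X1 T \<omega> \<le> V T \<omega>"
    have "(\<lambda>t \<omega>. V t \<omega> - X2 t \<omega>) \<in> superhedging_wealth P F T S f x q"
      unfolding superhedging_wealth_def
    proof (rule CollectI, intro conjI)
      show "acceptable P F T S (\<lambda>t \<omega>. V t \<omega> - X2 t \<omega>)" by (rule acceptableI[OF V XX(3)]) simp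
      show "AE \<omega> in P. V 0 \<omega> - X2 0 \<omega> = x"
        using Xa(2) XX(4) wealth_start[OF nonneg_wealthD(1)[OF V]] wealth_start[OF nonneg_wealthD(1)[OF XX(2)]]
        by eventually_elim (use TT in force)
      show "AE \<omega> in P. 0 \<le> V T \<omega> - X2 T \<omega> + q \<bullet> f \<omega>"
        using Xa(3) XX(4) le by eventually_elim (use TT in force)
    qed
    from eq[OF this] eq[OF X] XX(4) show "AE \<omega> in P. V T \<omega> = X1 T \<omega>"
      by eventually_elim (use TT in force)
  qed
  obtain z where X2: "X2 \<in> nonneg_wealth P F T S z" by (rule maximal_wealthE[OF XX(3)])
  have "acceptable P F T S (\<lambda>t \<omega>. - X t \<omega>)"
    unfolding acceptable_def
  proof (rule conjI[OF _ exI[of _ X2, OF exI[of _ X1, OF conjI[OF _ conjI[OF _ conjI]]]]])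
    show "wealth_process P F T S (\<lambda>t \<omega>. - X t \<omega>)"
      using wealth_cmult[OF XX(1), of "-1"] unfolding wealth_process_def by auto
    show "wealth_process P F T S X2" "nonneg_process P T X2"
      using X2 unfolding nonneg_wealth_def wealth_process_def by blast+
    show "maximal_wealth P F T S X1" by (rule X1)
    show "AE \<omega> in P. \<forall>t\<in>{0..T}. - X t \<omega> = X2 t \<omega> - X1 t \<omega>" using XX(4) by eventually_elim simp
  qed
  then have "workable P F T S (\<lambda>t \<omega>. - X t \<omega>)" using Xa(1) by (simp add: workable_def)
  moreover have "AE \<omega> in P. q \<bullet> f \<omega> = - X T \<omega>" using eq[OF X] by eventually_elim simp
  ultimately show ?thesis unfolding replicable_def by blast
qed

end

theorem theorem3p2:
  fixes P :: "'a measure" and F :: "real \<Rightarrow> 'a measure" and T :: real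
    and S :: "real \<Rightarrow> 'a \<Rightarrow> real^'d" and f :: "'a \<Rightarrow> real^'n"
    and U :: "real \<Rightarrow> real" and x :: real and q p0 :: "real^'n"
  assumes "0 < T" and "prob_space P" and "usual_conditions P F T"
    and "locally_bounded_semimartingale P F T S"
    and "f \<in> borel_measurable (F T)"
    and "utility_function U"
    and "equivalent_local_martingale_measures P F T S \<noteq> {}"
    and "inada U"
    and "\<exists>X'. wealth_process P F T S X' \<and> nonneg_process P T X' \<and> (AE \<omega> in P. norm (f \<omega>) \<le> X' T \<omega>)"
    and "\<forall>r. r \<noteq> 0 \<longrightarrow> \<not> replicable P F T S (\<lambda>\<omega>. r \<bullet> f \<omega>)"
    and "\<forall>y>0. dual_value_function P F T S U y < \<infinity>"
    and "(x, q) \<in> value_domain P F T S f U" and "(x, q) \<noteq> 0"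
    and "(x, q) \<in> frontier (value_domain P F T S f U)"
    and "p0 \<in> marginal_prices P F T S f U x q"
  shows "\<exists>p. p \<notin> arbitrage_free_prices P F T S f \<and>
             closed_segment p0 p - {p} \<subseteq> marginal_prices P F T S f U x q"
proof -
  interpret filtered_space P F T
    using assms(1-3) by (simp add: filtered_space_def filtered_space_axioms_def)
  obtain \<mu> where "controlled P F T S \<mu>" by (rule controlled_exists[OF assms(4,7)])
  then interpret claims_market P F T S \<mu> f U
    using assms(5,6,9) by (simp add: claims_market_def claims_market_axioms_def market_def)
  obtain p where p: "\<And>x' q'. (x', q') \<in> superhedgeable \<Longrightarrow> 0 \<le> x' + p \<bullet> q'" "x = - (p \<bullet> q)"
    using supporting_price[OF assms(12,14)] by blast
  have "p \<notin> arbitrage_free_prices P F T S f"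
  proof
    assume "p \<in> arbitrage_free_prices P F T S f"
    \<comment> \<open>Because \<open>x = - (p \<bullet> q)\<close>, the condition on arbitrage-free
      prices in the direction \<open>q\<close> speaks of exactly the superhedges at
      \<open>(x, q)\<close>.\<close>
    then have af: "AE \<omega> in P. X T \<omega> = - (q \<bullet> f \<omega>)" if "X \<in> superhedging_wealth P F T S f x q" for X
      using that by (simp add: arbitrage_free_prices_def p(2))
    obtain X where "X \<in> superhedging_wealth P F T S f x q"
      using assms(12) value_domain_superhedgeable by (auto simp: superhedgeable_def)
    then have "replicable P F T S (\<lambda>\<omega>. q \<bullet> f \<omega>)" using af by (rule superhedging_equality_replicable)
    then have "q = 0" using assms(10) by blast
    then show False using assms(13) p(2) by (simp add: zero_prod_def)
  qed
  then show ?thesis using marginal_price_segment[OF p assms(15)] by blast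
qed

end
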